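(* Let $\Omega\subset\mathbb{R}^3$ be a bounded weak Lipschitz domain with boundary $\Gamma$, let $\Gamma_t\subset\Gamma$ be a relatively open weak Lipschitz boundary part, and let $\Gamma_n:=\Gamma\setminus\overline{\Gamma_t}$. Let $(E_n)$ and $(H_n)$ be two sequences of vector fields bounded in $L^2(\Omega)$ such that $(\operatorname{curl}E_n)$ and $(\operatorname{div}H_n)$ are also bounded in $L^2(\Omega)$ and such that $\nu\times E_n=0$ on $\Gamma_t$ and $\nu\cdot H_n=0$ on $\Gamma_n$ for all $n$ (in the generalized sense, i.e. $E_n\in\mathring{R}_{\Gamma_t}(\Omega)$ and $H_n\in\mathring{D}_{\Gamma_n}(\Omega)$). Then there exist $E,H\in L^2(\Omega)$ with $\operatorname{curl}E\in L^2(\Omega)$ and $\operatorname{div}H\in L^2(\Omega)$, and subsequences, again denoted by $(E_n)$ and $(H_n)$, such that $E_n\rightharpoonup E$, $\operatorname{curl}E_n\rightharpoonup\operatorname{curl}E$, $H_n\rightharpoonup H$, $\operatorname{div}H_n\rightharpoonup\operatorname{div}H$ weakly in $L^2(\Omega)$, and $$\int_\Omega E_n\cdot H_n\to\int_\Omega E\cdot H .$$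
   Context: A bounded domain $\Omega\subset\mathbb{R}^3$ with boundary $\Gamma=\partial\Omega$ is weak Lipschitz if $\Gamma$ is a Lipschitz submanifold: every $x\in\Gamma$ has an open neighbourhood $U\subset\mathbb{R}^3$ and a bi-Lipschitz bijection $\phi:U\to(-1,1)^3$ with $\phi(x)=0$, $\phi(U\cap\Omega)=\{y_3<0\}$, $\phi(U\cap\Gamma)=\{y_3=0\}$, $\phi(U\setminus\overline\Omega)=\{y_3>0\}$. A relatively open subset $\Gamma_t\subset\Gamma$ is weak Lipschitz if every $x$ in the relative boundary of $\Gamma_t$ in $\Gamma$ has a relatively open neighbourhood $V\subset\Gamma$ and a bi-Lipschitz bijection $\psi:V\to(-1,1)^2$ with $\psi(x)=0$ mapping $V\cap\Gamma_t$, $V\cap\partial\Gamma_t$ and $V\setminus\overline{\Gamma_t}$ onto $\{y_1<0\}$, $\{y_1=0\}$ and $\{y_1>0\}$, respectively. $R(\Omega):=\{E\in L^2(\Omega;\mathbb{R}^3):\operatorname{curl}E\in L^2(\Omega;\mathbb{R}^3)\}$ and $D(\Omega):=\{H\in L^2(\Omega;\mathbb{R}^3):\operatorname{div}H\in L^2(\Omega)\}$ (weak derivatives), with graph norms. For $\Sigma\in\{\Gamma_t,\Gamma_n\}$ let $\mathring{C}^\infty_\Sigma(\Omega):=\{\varphi|_\Omega:\varphi\in C_c^\infty(\mathbb{R}^3),\ \operatorname{dist}(\operatorname{supp}\varphi,\Sigma)>0\}$ (vector valued). $\mathring{R}_{\Gamma_t}(\Omega)$ is the closure of $\mathring{C}^\infty_{\Gamma_t}(\Omega)$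 in $R(\Omega)$ and $\mathring{D}_{\Gamma_n}(\Omega)$ is the closure of $\mathring{C}^\infty_{\Gamma_n}(\Omega)$ in $D(\Omega)$; these encode the homogeneous tangential trace on $\Gamma_t$ and normal trace on $\Gamma_n$. *)

theory Defs
  imports "HOL-Analysis.Analysis"
begin

section \<open>Weak Lipschitz domains and boundary parts\<close>

definition open_cube :: "(real ^ 'n) set" where
  "open_cube = {y. \<forall>i. -1 < y $ i \<and> y $ i < 1}"

definition bi_lipschitz_bij :: "('a::metric_space \<Rightarrow> 'b::metric_space) \<Rightarrow> 'a set \<Rightarrow> 'b set \<Rightarrow> bool" where
  "bi_lipschitz_bij f U V \<longleftrightarrow>
     bij_betw f U V \<and> (\<exists>L. L-lipschitz_on U f) \<and> (\<exists>L. L-lipschitz_on V (inv_into U f))"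

definition bounded_domain :: "(real ^ 3) set \<Rightarrow> bool" where
  "bounded_domain \<Omega> \<longleftrightarrow> open \<Omega> \<and> connected \<Omega> \<and> \<Omega> \<noteq> {} \<and> bounded \<Omega>"

definition weak_lipschitz_domain :: "(real ^ 3) set \<Rightarrow> bool" where
  "weak_lipschitz_domain \<Omega> \<longleftrightarrow>
     bounded_domain \<Omega> \<and>
     (\<forall>x \<in> frontier \<Omega>. \<exists>U (\<phi> :: real ^ 3 \<Rightarrow> real ^ 3).
        open U \<and> x \<in> U \<and> bi_lipschitz_bij \<phi> U open_cube \<and> \<phi> x = 0 \<and>
        \<phi> ` (U \<inter> \<Omega>) = {y \<in> open_cube. y $ 3 < 0} \<and>
        \<phi> ` (U \<inter> frontier \<Omega>) = {y \<in> open_cube. y $ 3 = 0} \<and>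
        \<phi> ` (U - closure \<Omega>) = {y \<in> open_cube. y $ 3 > 0})"

text \<open>
  Below, \<open>\<Gamma>\<close> is the (closed) boundary of a domain. Relative openness and the relative boundary
  refer to the subspace topology of \<open>\<Gamma>\<close>; the closure of a subset of \<open>\<Gamma>\<close> is the same in \<open>\<Gamma>\<close> and
  in the whole space. The empty set and \<open>\<Gamma>\<close> itself have empty relative boundary and are admissible.
\<close>

definition weak_lipschitz_part :: "(real ^ 3) set \<Rightarrow> (real ^ 3) set \<Rightarrow> bool" where
  "weak_lipschitz_part \<Gamma> \<Gamma>t \<longleftrightarrow>
     openin (top_of_set \<Gamma>) \<Gamma>t \<and>
     (\<forall>x \<in> top_of_set \<Gamma> frontier_of \<Gamma>t. \<exists>V (\<psi> :: real ^ 3 \<Rightarrow> real ^ 2).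
        openin (top_of_set \<Gamma>) V \<and> x \<in> V \<and> bi_lipschitz_bij \<psi> V open_cube \<and> \<psi> x = 0 \<and>
        \<psi> ` (V \<inter> \<Gamma>t) = {y \<in> open_cube. y $ 1 < 0} \<and>
        \<psi> ` (V \<inter> (top_of_set \<Gamma> frontier_of \<Gamma>t)) = {y \<in> open_cube. y $ 1 = 0} \<and>
        \<psi> ` (V - closure \<Gamma>t) = {y \<in> open_cube. y $ 1 > 0})"


section \<open>Smooth functions and classical differential operators\<close>

primrec Ck :: "nat \<Rightarrow> ('a::real_normed_vector \<Rightarrow> 'b::real_normed_vector) \<Rightarrow> bool" where
  "Ck 0 f \<longleftrightarrow> continuous_on UNIV f"
| "Ck (Suc k) f \<longleftrightarrow>
     (\<forall>x. f differentiable (at x)) \<and> (\<forall>v. Ck k (\<lambda>x. frechet_derivative f (at x) v))"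

definition smooth :: "('a::real_normed_vector \<Rightarrow> 'b::real_normed_vector) \<Rightarrow> bool" where
  "smooth f \<longleftrightarrow> (\<forall>k. Ck k f)"

definition supp :: "('a::topological_space \<Rightarrow> 'b::zero) \<Rightarrow> 'a set" where
  "supp f = closure {x. f x \<noteq> 0}"

text \<open>Elements of \<open>C_c_inf \<Omega>\<close> are represented by their extension by zero to the whole space.\<close>

definition C_c_inf :: "(real ^ 3) set \<Rightarrow> (real ^ 3 \<Rightarrow> 'b::real_normed_vector) set" where
  "C_c_inf \<Omega> = {\<phi>. smooth \<phi> \<and> compact (supp \<phi>) \<and> supp \<phi> \<subseteq> \<Omega>}"

definition partial :: "3 \<Rightarrow> (real ^ 3 \<Rightarrow> real) \<Rightarrow> real ^ 3 \<Rightarrow> real" where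
  "partial i f x = frechet_derivative f (at x) (axis i 1)"

definition grad :: "(real ^ 3 \<Rightarrow> real) \<Rightarrow> real ^ 3 \<Rightarrow> real ^ 3" where
  "grad f x = (\<chi> i. partial i f x)"

definition curl :: "(real ^ 3 \<Rightarrow> real ^ 3) \<Rightarrow> real ^ 3 \<Rightarrow> real ^ 3" where
  "curl F x = vector
     [partial 2 (\<lambda>y. F y $ 3) x - partial 3 (\<lambda>y. F y $ 2) x,
      partial 3 (\<lambda>y. F y $ 1) x - partial 1 (\<lambda>y. F y $ 3) x,
      partial 1 (\<lambda>y. F y $ 2) x - partial 2 (\<lambda>y. F y $ 1) x]"


section \<open>Square integrable fields\<close>

text \<open>
  Elements of \<open>L\<^sup>2(\<Omega>)\<close> are represented by functions on the whole space of which only the values on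
  \<open>\<Omega>\<close> matter; no passage to almost-everywhere classes is made, so \<open>L2_norm\<close> is a seminorm and
  weak limits, weak curls and weak divergences are determined only almost everywhere on \<open>\<Omega>\<close>.
\<close>

definition L2 :: "(real ^ 3) set \<Rightarrow> (real ^ 3 \<Rightarrow> 'b::euclidean_space) set" where
  "L2 \<Omega> = {f. f \<in> borel_measurable (lebesgue_on \<Omega>) \<and> integrable (lebesgue_on \<Omega>) (\<lambda>x. (norm (f x))\<^sup>2)}"

definition L2_inner ::
  "(real ^ 3) set \<Rightarrow> (real ^ 3 \<Rightarrow> 'b::euclidean_space) \<Rightarrow> (real ^ 3 \<Rightarrow> 'b) \<Rightarrow> real" where
  "L2_inner \<Omega> f g = (LINT x|lebesgue_on \<Omega>. f x \<bullet> g x)"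

definition L2_norm :: "(real ^ 3) set \<Rightarrow> (real ^ 3 \<Rightarrow> 'b::euclidean_space) \<Rightarrow> real" where
  "L2_norm \<Omega> f = sqrt (LINT x|lebesgue_on \<Omega>. (norm (f x))\<^sup>2)"

definition L2_weakly_converges ::
  "(real ^ 3) set \<Rightarrow> (nat \<Rightarrow> real ^ 3 \<Rightarrow> 'b::euclidean_space) \<Rightarrow> (real ^ 3 \<Rightarrow> 'b) \<Rightarrow> bool" where
  "L2_weakly_converges \<Omega> f g \<longleftrightarrow>
     (\<forall>n. f n \<in> L2 \<Omega>) \<and> g \<in> L2 \<Omega> \<and>
     (\<forall>h \<in> L2 \<Omega>. (\<lambda>n. L2_inner \<Omega> (f n) h) \<longlonglongrightarrow> L2_inner \<Omega> g h)"


section \<open>Weak curl and weak divergence\<close>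

definition is_weak_curl :: "(real ^ 3) set \<Rightarrow> (real ^ 3 \<Rightarrow> real ^ 3) \<Rightarrow> (real ^ 3 \<Rightarrow> real ^ 3) \<Rightarrow> bool" where
  "is_weak_curl \<Omega> E G \<longleftrightarrow>
     G \<in> L2 \<Omega> \<and> (\<forall>\<phi> \<in> C_c_inf \<Omega>. L2_inner \<Omega> E (curl \<phi>) = L2_inner \<Omega> G \<phi>)"

definition is_weak_div :: "(real ^ 3) set \<Rightarrow> (real ^ 3 \<Rightarrow> real ^ 3) \<Rightarrow> (real ^ 3 \<Rightarrow> real) \<Rightarrow> bool" where
  "is_weak_div \<Omega> H g \<longleftrightarrow>
     g \<in> L2 \<Omega> \<and> (\<forall>\<phi> \<in> C_c_inf \<Omega>. L2_inner \<Omega> H (grad \<phi>) = - L2_inner \<Omega> g \<phi>)"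

text \<open>
  Some representative; meaningful for elements of \<open>R_space \<Omega>\<close> and \<open>D_space \<Omega>\<close>, respectively.
\<close>

definition weak_curl :: "(real ^ 3) set \<Rightarrow> (real ^ 3 \<Rightarrow> real ^ 3) \<Rightarrow> real ^ 3 \<Rightarrow> real ^ 3" where
  "weak_curl \<Omega> E = (SOME G. is_weak_curl \<Omega> E G)"

definition weak_div :: "(real ^ 3) set \<Rightarrow> (real ^ 3 \<Rightarrow> real ^ 3) \<Rightarrow> real ^ 3 \<Rightarrow> real" where
  "weak_div \<Omega> H = (SOME g. is_weak_div \<Omega> H g)"

definition R_space :: "(real ^ 3) set \<Rightarrow> (real ^ 3 \<Rightarrow> real ^ 3) set" where
  "R_space \<Omega> = {E \<in> L2 \<Omega>. \<exists>G. is_weak_curl \<Omega> E G}"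

definition D_space :: "(real ^ 3) set \<Rightarrow> (real ^ 3 \<Rightarrow> real ^ 3) set" where
  "D_space \<Omega> = {H \<in> L2 \<Omega>. \<exists>g. is_weak_div \<Omega> H g}"

definition R_norm :: "(real ^ 3) set \<Rightarrow> (real ^ 3 \<Rightarrow> real ^ 3) \<Rightarrow> real" where
  "R_norm \<Omega> E = sqrt ((L2_norm \<Omega> E)\<^sup>2 + (L2_norm \<Omega> (weak_curl \<Omega> E))\<^sup>2)"

definition D_norm :: "(real ^ 3) set \<Rightarrow> (real ^ 3 \<Rightarrow> real ^ 3) \<Rightarrow> real" where
  "D_norm \<Omega> H = sqrt ((L2_norm \<Omega> H)\<^sup>2 + (L2_norm \<Omega> (weak_div \<Omega> H))\<^sup>2)"


section \<open>Homogeneous boundary conditions\<close>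

text \<open>
  The condition \<open>dist (supp \<phi>, \<Sigma>) > 0\<close> is spelled out because \<open>setdist\<close> returns 0 when one of the
  sets is empty, whereas here the distance to (or from) the empty set has to count as infinite.
  The restriction to \<open>\<Omega>\<close> is implicit, since the spaces over \<open>\<Omega>\<close> only see the values there.
\<close>

definition C_inf_bd :: "(real ^ 3) set \<Rightarrow> (real ^ 3 \<Rightarrow> real ^ 3) set" where
  "C_inf_bd \<Sigma> = {\<phi> \<in> C_c_inf UNIV. \<exists>\<delta>>0. \<forall>x \<in> supp \<phi>. \<forall>y \<in> \<Sigma>. \<delta> \<le> dist x y}"

definition R_bd :: "(real ^ 3) set \<Rightarrow> (real ^ 3) set \<Rightarrow> (real ^ 3 \<Rightarrow> real ^ 3) set" where
  "R_bd \<Omega> \<Sigma> = {E \<in> R_space \<Omega>. \<forall>\<epsilon>>0. \<exists>\<phi> \<in> C_inf_bd \<Sigma>. R_norm \<Omega> (\<lambda>x. E x - \<phi> x) < \<epsilon>}"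

definition D_bd :: "(real ^ 3) set \<Rightarrow> (real ^ 3) set \<Rightarrow> (real ^ 3 \<Rightarrow> real ^ 3) set" where
  "D_bd \<Omega> \<Sigma> = {H \<in> D_space \<Omega>. \<forall>\<epsilon>>0. \<exists>\<phi> \<in> C_inf_bd \<Sigma>. D_norm \<Omega> (\<lambda>x. H x - \<phi> x) < \<epsilon>}"

end

theory Submission
  imports Defs "HOL-Complex_Analysis.Great_Picard"
begin

text \<open>By density, \<open>E\<^sub>n\<close> and \<open>H\<^sub>n\<close> may be replaced by \<open>C\<^sup>1\<close> fields \<open>\<phi>\<^sub>n\<close> and \<open>\<eta>\<^sub>n\<close> whose supports
  avoid \<open>\<Gamma>t\<close> and \<open>\<Gamma>n\<close>. Near a point of \<open>closure \<Omega>\<close> there is a bi-Lipschitz chart \<open>\<alpha>\<close> with inverse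
  \<open>\<beta>\<close> that maps \<open>\<Omega>\<close> to a wedge \<open>{y\<^sub>1 < a, y\<^sub>3 < b}\<close> such that the face \<open>y\<^sub>1 = a\<close> comes from \<open>\<Gamma>t\<close> and the
  face \<open>y\<^sub>3 = b\<close> from \<open>\<Gamma>n\<close>. For \<open>t\<^sub>1 \<ge> 0 \<ge> t\<^sub>3\<close> the map \<open>x \<mapsto> \<beta> (\<alpha> x + t)\<close> leaves \<open>\<Omega>\<close> only through the first
  face, where \<open>\<phi>\<close> extends by zero, and enters \<open>\<Omega>\<close> only through the second one, where \<open>\<eta>\<close> extends by
  zero. Along the homotopy \<open>s \<mapsto> \<beta> (\<alpha> x + s t)\<close> the pullback of the 1-form \<open>\<phi>\<close> changes by an exact form
  plus a contraction of \<open>curl \<phi>\<close>, so that integration by parts against \<open>\<eta>\<close> shows that replacing \<open>\<phi>\<close> by an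
  average of its pullbacks over small \<open>t\<close> costs at most a small multiple of
  \<open>(\<parallel>\<phi>\<parallel> + \<parallel>curl \<phi>\<parallel>) (\<parallel>\<eta>\<parallel> + \<parallel>div \<eta>\<parallel>)\<close>. Averaging turns weak into strong convergence, hence \<open>\<phi>\<^sub>n\<close> is a Cauchy
  sequence in the dual of the space normed by \<open>\<parallel>\<eta>\<parallel> + \<parallel>div \<eta>\<parallel>\<close>, first locally and then, by cutoffs,
  globally. That Lipschitz maps are differentiable almost everywhere is not needed: \<open>\<alpha>\<close> and \<open>\<beta>\<close> are
  mollified, and a weak \<open>L\<^sup>2\<close> limit of the Jacobians of the mollified \<open>\<beta>\<close> takes the place of the
  derivative of \<open>\<beta>\<close>.\<close>

section \<open>The space of square integrable fields\<close>

text \<open>Two obstacles shape the estimate. A bi-Lipschitz chart has no second derivatives, so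
  neither field is transported to the chart: both stay in \<Omega>, and only the values of
  \<open>\<phi>\<close> are moved along the homotopy. In the derivative of the pullback along the
  homotopy the second derivatives of the mollified \<open>\<beta>\<close> combine, by their
  symmetry, into the differential of one scalar function, and the bounds contain nothing but the
  Lipschitz constant. The other obstacle is that the average contains the derivative of
  \<open>\<beta>\<close>, which is known only as a weak limit. The substitution
  \<open>z = \<alpha> x + t\<close> moves the dependence on \<open>x\<close> into the continuous
  weight, so the derivative enters as a fixed square integrable matrix. At each point the average is
  then a bounded linear functional of \<open>\<phi>\<close>, with a bound uniform in the point: a
  weakly convergent sequence gives pointwise convergent, uniformly bounded averages, and dominated
  convergence applies. The displacements are made short first, according to the error allowed; only
  then is the sequence index taken large.\<close>

lemma L2_measurable: "f \<in> L2 \<Omega> \<Longrightarrow> f \<in> borel_measurable (lebesgue_on \<Omega>)"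
  by (simp add: L2_def)

lemma L2_integrable_norm_square: "f \<in> L2 \<Omega> \<Longrightarrow> integrable (lebesgue_on \<Omega>) (\<lambda>x. (norm (f x))\<^sup>2)"
  by (simp add: L2_def)

lemma L2_integrable_inner:
  assumes f: "f \<in> L2 \<Omega>" and g: "g \<in> L2 \<Omega>"
  shows "integrable (lebesgue_on \<Omega>) (\<lambda>x. f x \<bullet> g x)"
proof (rule Bochner_Integration.integrable_bound)
  show "integrable (lebesgue_on \<Omega>) (\<lambda>x. (norm (f x))\<^sup>2 + (norm (g x))\<^sup>2)"
    using f g by (intro Bochner_Integration.integrable_add L2_integrable_norm_square)
  show "(\<lambda>x. f x \<bullet> g x) \<in> borel_measurable (lebesgue_on \<Omega>)"
    using f g by (intro borel_measurable_inner L2_measurable)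
  have "norm (a \<bullet> b) \<le> norm ((norm a)\<^sup>2 + (norm b)\<^sup>2)" for a b :: 'a
  proof -
    have "\<bar>a \<bullet> b\<bar> \<le> norm a * norm b" by (rule Cauchy_Schwarz_ineq2)
    also have "\<dots> \<le> (norm a)\<^sup>2 + (norm b)\<^sup>2"
      using sum_squares_bound[of "norm a" "norm b"] mult_nonneg_nonneg[OF norm_ge_zero norm_ge_zero, of a b]
      by linarith
    finally show ?thesis by simp
  qed
  then show "AE x in lebesgue_on \<Omega>. norm (f x \<bullet> g x) \<le> norm ((norm (f x))\<^sup>2 + (norm (g x))\<^sup>2)"
    by simp
qed

lemma L2_zero: "(\<lambda>x. 0) \<in> L2 \<Omega>"
  by (simp add: L2_def)

lemma L2_scaleR:
  assumes "f \<in> L2 \<Omega>" shows "(\<lambda>x. c *\<^sub>R f x) \<in> L2 \<Omega>"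
  using assms unfolding L2_def by (auto simp: power_mult_distrib)

lemma L2_add:
  assumes f: "f \<in> L2 \<Omega>" and g: "g \<in> L2 \<Omega>"
  shows "(\<lambda>x. f x + g x) \<in> L2 \<Omega>"
proof -
  have "integrable (lebesgue_on \<Omega>) (\<lambda>x. (norm (f x))\<^sup>2 + (norm (g x))\<^sup>2 + 2 * (f x \<bullet> g x))"
    using f g by (intro Bochner_Integration.integrable_add L2_integrable_norm_square
        integrable_mult_right L2_integrable_inner)
  then have "integrable (lebesgue_on \<Omega>) (\<lambda>x. (norm (f x + g x))\<^sup>2)"
    by (rule Bochner_Integration.integrable_cong[THEN iffD1, rotated 2])
       (simp_all add: power2_norm_eq_inner inner_simps inner_commute)
  then show ?thesis
    using f g unfolding L2_def by auto
qed

lemma L2_minus: "f \<in> L2 \<Omega> \<Longrightarrow> (\<lambda>x. - f x) \<in> L2 \<Omega>"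
  using L2_scaleR[of f \<Omega> "-1"] by simp

lemma L2_diff: "f \<in> L2 \<Omega> \<Longrightarrow> g \<in> L2 \<Omega> \<Longrightarrow> (\<lambda>x. f x - g x) \<in> L2 \<Omega>"
  using L2_add[OF _ L2_minus, of f \<Omega> g] by simp

lemma L2_inner_commute: "L2_inner \<Omega> f g = L2_inner \<Omega> g f"
  by (simp add: L2_inner_def inner_commute)

lemma L2_inner_add_left:
  "f \<in> L2 \<Omega> \<Longrightarrow> g \<in> L2 \<Omega> \<Longrightarrow> h \<in> L2 \<Omega> \<Longrightarrow>
    L2_inner \<Omega> (\<lambda>x. f x + g x) h = L2_inner \<Omega> f h + L2_inner \<Omega> g h"
  unfolding L2_inner_def inner_add_left
  by (rule Bochner_Integration.integral_add; rule L2_integrable_inner)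

lemma L2_inner_diff_left:
  "f \<in> L2 \<Omega> \<Longrightarrow> g \<in> L2 \<Omega> \<Longrightarrow> h \<in> L2 \<Omega> \<Longrightarrow>
    L2_inner \<Omega> (\<lambda>x. f x - g x) h = L2_inner \<Omega> f h - L2_inner \<Omega> g h"
  unfolding L2_inner_def inner_diff_left
  by (rule Bochner_Integration.integral_diff; rule L2_integrable_inner)

lemma L2_inner_scaleR_left: "L2_inner \<Omega> (\<lambda>x. c *\<^sub>R f x) h = c * L2_inner \<Omega> f h"
  unfolding L2_inner_def by simp

lemma L2_inner_add_right:
  "f \<in> L2 \<Omega> \<Longrightarrow> g \<in> L2 \<Omega> \<Longrightarrow> h \<in> L2 \<Omega> \<Longrightarrow>
    L2_inner \<Omega> h (\<lambda>x. f x + g x) = L2_inner \<Omega> h f + L2_inner \<Omega> h g"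
  using L2_inner_add_left[of f \<Omega> g h] by (simp add: L2_inner_commute)

lemma L2_inner_diff_right:
  "f \<in> L2 \<Omega> \<Longrightarrow> g \<in> L2 \<Omega> \<Longrightarrow> h \<in> L2 \<Omega> \<Longrightarrow>
    L2_inner \<Omega> h (\<lambda>x. f x - g x) = L2_inner \<Omega> h f - L2_inner \<Omega> h g"
  using L2_inner_diff_left[of f \<Omega> g h] by (simp add: L2_inner_commute)

lemma L2_inner_scaleR_right: "L2_inner \<Omega> h (\<lambda>x. c *\<^sub>R f x) = c * L2_inner \<Omega> h f"
  unfolding L2_inner_def by simp

lemma L2_norm_nonneg [simp]: "0 \<le> L2_norm \<Omega> f"
  by (simp add: L2_norm_def)

lemma L2_norm_square: "(L2_norm \<Omega> f)\<^sup>2 = L2_inner \<Omega> f f"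
  by (simp add: L2_norm_def L2_inner_def power2_norm_eq_inner)

lemma L2_norm_scaleR: "L2_norm \<Omega> (\<lambda>x. c *\<^sub>R f x) = \<bar>c\<bar> * L2_norm \<Omega> f"
  by (simp add: L2_norm_def power_mult_distrib real_sqrt_mult)

lemma L2_norm_minus_commute: "L2_norm \<Omega> (\<lambda>x. f x - g x) = L2_norm \<Omega> (\<lambda>x. g x - f x)"
  by (simp add: L2_norm_def norm_minus_commute)

lemma L2_inner_add_square:
  assumes "f \<in> L2 \<Omega>" "g \<in> L2 \<Omega>"
  shows "(L2_norm \<Omega> (\<lambda>x. f x + t *\<^sub>R g x))\<^sup>2
    = (L2_norm \<Omega> f)\<^sup>2 + 2 * t * L2_inner \<Omega> f g + t\<^sup>2 * (L2_norm \<Omega> g)\<^sup>2"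
  unfolding L2_norm_square
  using assms L2_inner_commute[of \<Omega> f g]
  by (simp add: L2_inner_add_left L2_inner_add_right L2_add L2_scaleR L2_inner_scaleR_left
      L2_inner_scaleR_right power2_eq_square algebra_simps)

lemma quadratic_nonneg_imp_zero:
  fixes a d :: real
  assumes "\<And>t. 0 \<le> 2 * t * d + t\<^sup>2 * a"
  shows "d = 0"
proof (rule ccontr)
  assume "d \<noteq> 0"
  \<comment> \<open>The minimiser of the quadratic with \<open>a\<close> enlarged to
    \<open>\<bar>a\<bar> + 1\<close>, which is never zero.\<close>
  define t where "t = - d / (\<bar>a\<bar> + 1)"
  have "2 * t * d + t\<^sup>2 * a \<le> 2 * t * d + t\<^sup>2 * (\<bar>a\<bar> + 1)"
    by (intro add_left_mono mult_left_mono) auto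
  also have "\<dots> = - d\<^sup>2 / (\<bar>a\<bar> + 1)"
    by (simp add: t_def power2_eq_square divide_simps add_nonneg_eq_0_iff)
  also have "\<dots> < 0" using \<open>d \<noteq> 0\<close> by (simp add: divide_neg_pos)
  finally show False using assms[of t] by simp
qed

lemma L2_Cauchy_Schwarz:
  assumes f: "f \<in> L2 \<Omega>" and g: "g \<in> L2 \<Omega>"
  shows "\<bar>L2_inner \<Omega> f g\<bar> \<le> L2_norm \<Omega> f * L2_norm \<Omega> g"
proof -
  have pos: "0 \<le> (L2_norm \<Omega> f)\<^sup>2 + 2 * t * L2_inner \<Omega> f g + t\<^sup>2 * (L2_norm \<Omega> g)\<^sup>2" for t
    using L2_inner_add_square[OF f g, of t] by (metis zero_le_power2)
  show ?thesis
  proof (cases "L2_norm \<Omega> g = 0")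
    case True
    have "L2_inner \<Omega> f g = 0"
    proof (rule ccontr)
      assume n: "L2_inner \<Omega> f g \<noteq> 0"
      \<comment> \<open>At this value of the parameter the expression in \<open>pos\<close>, linear
        because the norm of \<open>g\<close> is 0, equals -1.\<close>
      show False
        using pos[of "- ((L2_norm \<Omega> f)\<^sup>2 + 1) / (2 * L2_inner \<Omega> f g)"] True n by (simp add: field_simps)
    qed
    then show ?thesis using True by simp
  next
    case False
    then have g0: "(L2_norm \<Omega> g)\<^sup>2 > 0" by simp
    have "(L2_inner \<Omega> f g)\<^sup>2 \<le> (L2_norm \<Omega> f)\<^sup>2 * (L2_norm \<Omega> g)\<^sup>2"
    proof -
      define G where "G = (L2_norm \<Omega> g)\<^sup>2"
      define I where "I = L2_inner \<Omega> f g"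
      have "0 \<le> (L2_norm \<Omega> f)\<^sup>2 + 2 * (- I / G) * I + (- I / G)\<^sup>2 * G"
        using pos[of "- I / G"] unfolding G_def I_def .
      also have "\<dots> = (L2_norm \<Omega> f)\<^sup>2 - I\<^sup>2 / G"
        using g0 unfolding G_def[symmetric] by (simp add: field_simps power2_eq_square)
      finally show ?thesis using g0 unfolding G_def[symmetric] I_def[symmetric]
        by (simp add: field_simps)
    qed
    then have "(L2_inner \<Omega> f g)\<^sup>2 \<le> (L2_norm \<Omega> f * L2_norm \<Omega> g)\<^sup>2"
      by (simp add: power_mult_distrib)
    then show ?thesis
      by (metis L2_norm_nonneg abs_le_square_iff abs_of_nonneg mult_nonneg_nonneg)
  qed
qed

lemma L2_norm_triangle:
  assumes f: "f \<in> L2 \<Omega>" and g: "g \<in> L2 \<Omega>"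
  shows "L2_norm \<Omega> (\<lambda>x. f x + g x) \<le> L2_norm \<Omega> f + L2_norm \<Omega> g"
proof (rule power2_le_imp_le)
  have "(L2_norm \<Omega> (\<lambda>x. f x + g x))\<^sup>2 = (L2_norm \<Omega> f)\<^sup>2 + 2 * L2_inner \<Omega> f g + (L2_norm \<Omega> g)\<^sup>2"
    using L2_inner_add_square[OF f g, of 1] by simp
  also have "\<dots> \<le> (L2_norm \<Omega> f)\<^sup>2 + 2 * (L2_norm \<Omega> f * L2_norm \<Omega> g) + (L2_norm \<Omega> g)\<^sup>2"
    using L2_Cauchy_Schwarz[OF f g] by simp
  finally show "(L2_norm \<Omega> (\<lambda>x. f x + g x))\<^sup>2 \<le> (L2_norm \<Omega> f + L2_norm \<Omega> g)\<^sup>2"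
    by (simp add: power2_sum)
qed (simp add: add_nonneg_nonneg)

lemma L2_norm_triangle_diff:
  assumes "f \<in> L2 \<Omega>" "g \<in> L2 \<Omega>"
  shows "L2_norm \<Omega> (\<lambda>x. f x - g x) \<le> L2_norm \<Omega> f + L2_norm \<Omega> g"
  using L2_norm_triangle[OF assms(1) L2_minus[OF assms(2)]] L2_norm_scaleR[of \<Omega> "-1" g] by simp

lemma L2_norm_triangle_between:
  assumes "f \<in> L2 \<Omega>" "g \<in> L2 \<Omega>" "h \<in> L2 \<Omega>"
  shows "L2_norm \<Omega> (\<lambda>x. f x - h x) \<le> L2_norm \<Omega> (\<lambda>x. f x - g x) + L2_norm \<Omega> (\<lambda>x. g x - h x)"
  using L2_norm_triangle[OF L2_diff[OF assms(1,2)] L2_diff[OF assms(2,3)]] by simp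

lemma L2_inner_cong_AE:
  assumes "f \<in> L2 \<Omega>" "f' \<in> L2 \<Omega>" "g \<in> L2 \<Omega>" "AE x in lebesgue_on \<Omega>. f x = f' x"
  shows "L2_inner \<Omega> f g = L2_inner \<Omega> f' g"
  unfolding L2_inner_def
  using assms by (intro integral_cong_AE borel_measurable_inner L2_measurable) auto

lemma L2_norm_cong_AE:
  assumes "f \<in> L2 \<Omega>" "f' \<in> L2 \<Omega>" "AE x in lebesgue_on \<Omega>. f x = f' x"
  shows "L2_norm \<Omega> f = L2_norm \<Omega> f'"
  unfolding L2_norm_def
  using assms
  by (intro arg_cong[where f=sqrt] integral_cong_AE borel_measurable_power borel_measurable_norm
      L2_measurable[THEN measurable_compose, OF _ borel_measurable_norm] L2_measurable) auto

lemma L2_integrable_norm: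
  assumes \<Omega>: "\<Omega> \<in> lmeasurable" and f: "f \<in> L2 \<Omega>"
  shows "integrable (lebesgue_on \<Omega>) (\<lambda>x. norm (f x))"
    and "(LINT x|lebesgue_on \<Omega>. norm (f x)) \<le> sqrt (measure lebesgue \<Omega>) * L2_norm \<Omega> f"
proof -
  interpret finite_measure "lebesgue_on \<Omega>"
    using \<Omega> by (rule finite_measure_lebesgue_on)
  have S: "\<Omega> \<in> sets lebesgue" using \<Omega> by (rule fmeasurableD)
  have one: "(\<lambda>x. 1::real) \<in> L2 \<Omega>" by (simp add: L2_def)
  have nf: "(\<lambda>x. norm (f x)) \<in> L2 \<Omega>"
    using f by (auto simp: L2_def)
  show "integrable (lebesgue_on \<Omega>) (\<lambda>x. norm (f x))"
    using L2_integrable_inner[OF nf one] by simp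
  have "(LINT x|lebesgue_on \<Omega>. norm (f x)) = L2_inner \<Omega> (\<lambda>x. 1) (\<lambda>x. norm (f x))"
    by (simp add: L2_inner_def)
  also have "\<dots> \<le> L2_norm \<Omega> (\<lambda>x. 1::real) * L2_norm \<Omega> (\<lambda>x. norm (f x))"
    using L2_Cauchy_Schwarz[OF one nf] by simp
  also have "L2_norm \<Omega> (\<lambda>x. 1::real) = sqrt (measure lebesgue \<Omega>)"
    using S by (simp add: L2_norm_def measure_restrict_space)
  also have "L2_norm \<Omega> (\<lambda>x. norm (f x)) = L2_norm \<Omega> f"
    by (simp add: L2_norm_def)
  finally show "(LINT x|lebesgue_on \<Omega>. norm (f x)) \<le> sqrt (measure lebesgue \<Omega>) * L2_norm \<Omega> f" .
qed

lemma L2_norm_nn_integral: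
  assumes "f \<in> L2 \<Omega>"
  shows "(\<integral>\<^sup>+x. ennreal ((norm (f x))\<^sup>2) \<partial>lebesgue_on \<Omega>) = ennreal ((L2_norm \<Omega> f)\<^sup>2)"
  by (subst nn_integral_eq_integral)
     (use assms in \<open>auto simp: L2_norm_def L2_integrable_norm_square\<close>)

lemma L2_Fatou:
  assumes meas: "g \<in> borel_measurable (lebesgue_on \<Omega>)"
    and f: "\<And>n. f n \<in> L2 \<Omega>" and lim: "AE x in lebesgue_on \<Omega>. (\<lambda>n. f n x) \<longlonglongrightarrow> g x"
    and bd: "\<And>n. L2_norm \<Omega> (f n) \<le> C"
  shows "g \<in> L2 \<Omega>" "L2_norm \<Omega> g \<le> C"
proof -
  have C: "0 \<le> C" using bd[of 0] L2_norm_nonneg[of \<Omega> "f 0"] by linarith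
  have "(\<integral>\<^sup>+x. ennreal ((norm (g x))\<^sup>2) \<partial>lebesgue_on \<Omega>)
      = (\<integral>\<^sup>+x. liminf (\<lambda>n. ennreal ((norm (f n x))\<^sup>2)) \<partial>lebesgue_on \<Omega>)"
  proof (rule nn_integral_cong_AE, use lim in eventually_elim)
    case (elim x)
    then have "(\<lambda>n. ennreal ((norm (f n x))\<^sup>2)) \<longlonglongrightarrow> ennreal ((norm (g x))\<^sup>2)"
      by (intro tendsto_intros)
    from lim_imp_Liminf[OF sequentially_bot this] show ?case by simp
  qed
  also have "\<dots> \<le> liminf (\<lambda>n. \<integral>\<^sup>+x. ennreal ((norm (f n x))\<^sup>2) \<partial>lebesgue_on \<Omega>)"
    using L2_measurable[OF f] by (intro nn_integral_liminf) measurable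
  also have "\<dots> \<le> liminf (\<lambda>n. ennreal (C\<^sup>2))"
    using bd by (intro Liminf_mono always_eventually allI)
      (auto simp: L2_norm_nn_integral[OF f] intro!: ennreal_leI power_mono)
  finally have le: "(\<integral>\<^sup>+x. ennreal ((norm (g x))\<^sup>2) \<partial>lebesgue_on \<Omega>) \<le> ennreal (C\<^sup>2)"
    by (simp add: Liminf_const)
  have "integrable (lebesgue_on \<Omega>) (\<lambda>x. (norm (g x))\<^sup>2)"
    using meas le by (intro integrableI_bounded) (auto simp: less_top[symmetric] top_unique)
  then show g: "g \<in> L2 \<Omega>" using meas by (simp add: L2_def)
  have "(L2_norm \<Omega> g)\<^sup>2 \<le> C\<^sup>2"
    using le L2_norm_nn_integral[OF g] by (simp add: ennreal_le_iff)
  then show "L2_norm \<Omega> g \<le> C" using C by (rule power2_le_imp_le)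
qed

text \<open>On a set of finite measure a Cauchy sequence in the L^2 norm is also Cauchy in the L^1
  norm, so a subsequence converges almost everywhere. Fatou's lemma then carries the L^2 Cauchy
  bounds to the pointwise limit.\<close>

lemma L2_complete:
  fixes f :: "nat \<Rightarrow> real ^ 3 \<Rightarrow> 'b::euclidean_space"
  assumes \<Omega>: "\<Omega> \<in> lmeasurable" and f: "\<And>n. f n \<in> L2 \<Omega>"
    and cauchy: "\<And>e. 0 < e \<Longrightarrow> \<exists>N. \<forall>i\<ge>N. \<forall>j\<ge>N. L2_norm \<Omega> (\<lambda>x. f i x - f j x) < e"
  obtains g where "g \<in> L2 \<Omega>" "(\<lambda>n. L2_norm \<Omega> (\<lambda>x. f n x - g x)) \<longlonglongrightarrow> 0"
proof -
  interpret finite_measure "lebesgue_on \<Omega>"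
    using \<Omega> by (rule finite_measure_lebesgue_on)
  have i: "integrable (lebesgue_on \<Omega>) (f n)" for n
    using L2_integrable_norm(1)[OF \<Omega> f[of n]] L2_measurable[OF f[of n]] by (simp add: integrable_norm_iff)
  have "\<exists>N. \<forall>i\<ge>N. \<forall>j\<ge>N. (LINT x|lebesgue_on \<Omega>. norm (f i x - f j x)) < e" if "0 < e" for e
  proof -
    define c where "c = sqrt (measure lebesgue \<Omega>) + 1"
    have c: "0 < c" by (simp add: c_def add_nonneg_pos)
    obtain N where N: "\<And>i j. N \<le> i \<Longrightarrow> N \<le> j \<Longrightarrow> L2_norm \<Omega> (\<lambda>x. f i x - f j x) < e / c"
      using cauchy[of "e / c"] \<open>0 < e\<close> c by auto
    have "(LINT x|lebesgue_on \<Omega>. norm (f i x - f j x)) < e" if "N \<le> i" "N \<le> j" for i j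
    proof -
      have "(LINT x|lebesgue_on \<Omega>. norm (f i x - f j x))
          \<le> sqrt (measure lebesgue \<Omega>) * L2_norm \<Omega> (\<lambda>x. f i x - f j x)"
        by (rule L2_integrable_norm(2)[OF \<Omega> L2_diff[OF f f]])
      also have "\<dots> \<le> c * L2_norm \<Omega> (\<lambda>x. f i x - f j x)"
        by (intro mult_right_mono) (auto simp: c_def)
      also have "\<dots> < c * (e / c)"
        using N[OF that] c by (intro mult_strict_left_mono)
      finally show ?thesis using c by simp
    qed
    then show ?thesis by blast
  qed
  then obtain r where r: "strict_mono r" "AE x in lebesgue_on \<Omega>. Cauchy (\<lambda>i. f (r i) x)"
    using cauchy_L1_AE_cauchy_subseq[of "lebesgue_on \<Omega>" f, OF i] by blast
  define g where "g x = lim (\<lambda>i. f (r i) x)" for x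
  have gm: "g \<in> borel_measurable (lebesgue_on \<Omega>)"
    unfolding g_def using L2_measurable[OF f] by (intro borel_measurable_lim_metric)
  have lim: "AE x in lebesgue_on \<Omega>. (\<lambda>i. f (r i) x) \<longlonglongrightarrow> g x"
    using r(2) by eventually_elim (auto simp: g_def convergent_LIMSEQ_iff[symmetric] Cauchy_convergent_iff)
  \<comment> \<open>With \<open>n\<close> fixed, Fatou's lemma is applied to the differences of
    \<open>f n\<close> and the tail of the subsequence.\<close>
  have key: "(\<lambda>x. f n x - g x) \<in> L2 \<Omega> \<and> L2_norm \<Omega> (\<lambda>x. f n x - g x) \<le> e"
    if N: "\<And>i j. N \<le> i \<Longrightarrow> N \<le> j \<Longrightarrow> L2_norm \<Omega> (\<lambda>x. f i x - f j x) < e" and n: "N \<le> n" for N n e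
  proof -
    have *: "N \<le> r (i + N)" for i
      using seq_suble[OF r(1), of "i + N"] by simp
    have L: "AE x in lebesgue_on \<Omega>. (\<lambda>i. f n x - f (r (i + N)) x) \<longlonglongrightarrow> f n x - g x"
      using lim
    proof eventually_elim
      case (elim x)
      show ?case by (intro tendsto_intros LIMSEQ_ignore_initial_segment elim)
    qed
    have m: "(\<lambda>x. f n x - g x) \<in> borel_measurable (lebesgue_on \<Omega>)"
      using gm L2_measurable[OF f] by simp
    have "L2_norm \<Omega> (\<lambda>x. f n x - f (r (i + N)) x) \<le> e" for i
      using N[OF n *] by (simp add: less_imp_le)
    then show ?thesis
      using L2_Fatou[OF m L2_diff[OF f f] L] by blast
  qed
  have g: "g \<in> L2 \<Omega>"
  proof -
    obtain N where "\<And>i j. N \<le> i \<Longrightarrow> N \<le> j \<Longrightarrow> L2_norm \<Omega> (\<lambda>x. f i x - f j x) < 1"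
      using cauchy[of 1] by auto
    then have "(\<lambda>x. f N x - g x) \<in> L2 \<Omega>" using key[of N 1 N] by simp
    from L2_diff[OF f[of N] this] show ?thesis by simp
  qed
  have "(\<lambda>n. L2_norm \<Omega> (\<lambda>x. f n x - g x)) \<longlonglongrightarrow> 0"
  proof (rule LIMSEQ_I)
    fix e :: real assume "0 < e"
    then obtain N where N: "\<And>i j. N \<le> i \<Longrightarrow> N \<le> j \<Longrightarrow> L2_norm \<Omega> (\<lambda>x. f i x - f j x) < e / 2"
      using cauchy[of "e / 2"] by auto
    then have "\<forall>n\<ge>N. L2_norm \<Omega> (\<lambda>x. f n x - g x) \<le> e / 2"
      using key[of N "e / 2"] by blast
    then show "\<exists>N. \<forall>n\<ge>N. norm (L2_norm \<Omega> (\<lambda>x. f n x - g x) - 0) < e"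
      using \<open>0 < e\<close> by (intro exI[of _ N]) auto
  qed
  with g show ?thesis by (rule that)
qed

section \<open>Riesz representation and weak sequential compactness\<close>

definition L2_subspace :: "(real ^ 3) set \<Rightarrow> (real ^ 3 \<Rightarrow> 'b::euclidean_space) set \<Rightarrow> bool" where
  "L2_subspace \<Omega> S \<longleftrightarrow> S \<subseteq> L2 \<Omega> \<and> (\<lambda>x. 0) \<in> S \<and>
    (\<forall>f\<in>S. \<forall>g\<in>S. (\<lambda>x. f x + g x) \<in> S) \<and> (\<forall>c. \<forall>f\<in>S. (\<lambda>x. c *\<^sub>R f x) \<in> S)"

text \<open>The representing element minimises the energy \<open>J\<close> over \<open>S\<close>.
  Since \<open>S\<close> need not be closed, the minimum may be attained only in its closure; the
  conclusion therefore also provides the minimising sequence \<open>s\<close> in \<open>S\<close>.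
  Later uses are the linear span of a sequence, where \<open>g\<close> is an orthogonal projection,
  and \<open>C1_away\<close>.\<close>

lemma L2_Riesz:
  fixes F :: "(real ^ 3 \<Rightarrow> 'b::euclidean_space) \<Rightarrow> real"
  assumes \<Omega>: "\<Omega> \<in> lmeasurable" and S: "L2_subspace \<Omega> S"
    and add: "\<And>f g. f \<in> S \<Longrightarrow> g \<in> S \<Longrightarrow> F (\<lambda>x. f x + g x) = F f + F g"
    and scale: "\<And>c f. f \<in> S \<Longrightarrow> F (\<lambda>x. c *\<^sub>R f x) = c * F f"
    and bd: "\<And>f. f \<in> S \<Longrightarrow> \<bar>F f\<bar> \<le> C * L2_norm \<Omega> f"
  obtains g s where "g \<in> L2 \<Omega>" "\<And>f. f \<in> S \<Longrightarrow> F f = L2_inner \<Omega> g f"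
    "\<And>n. s n \<in> S" "(\<lambda>n. L2_norm \<Omega> (\<lambda>x. s n x - g x)) \<longlonglongrightarrow> 0"
proof -
  have sub: "S \<subseteq> L2 \<Omega>" and z: "(\<lambda>x. 0) \<in> S"
    and Sadd: "\<And>f g. f \<in> S \<Longrightarrow> g \<in> S \<Longrightarrow> (\<lambda>x. f x + g x) \<in> S"
    and Sscale: "\<And>c f. f \<in> S \<Longrightarrow> (\<lambda>x. c *\<^sub>R f x) \<in> S"
    using S by (auto simp: L2_subspace_def)
  define J where "J f = (L2_norm \<Omega> f)\<^sup>2 - 2 * F f" for f
  have J_lower: "- C\<^sup>2 \<le> J f" if "f \<in> S" for f
  proof -
    have "2 * F f \<le> 2 * C * L2_norm \<Omega> f" using bd[OF that] by linarith
    also have "\<dots> \<le> (L2_norm \<Omega> f)\<^sup>2 + C\<^sup>2"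
      using sum_squares_bound[of "L2_norm \<Omega> f" C] by (simp add: mult.commute mult.left_commute)
    finally show ?thesis by (simp add: J_def)
  qed
  define m where "m = Inf (J ` S)"
  have bb: "bdd_below (J ` S)" using J_lower by (intro bdd_belowI2[of _ "- C\<^sup>2"])
  have m_le: "m \<le> J f" if "f \<in> S" for f
    unfolding m_def using that bb by (intro cInf_lower) auto
  have "\<exists>f\<in>S. J f < m + 1 / real (Suc n)" for n
  proof -
    have "\<exists>y\<in>J ` S. y < m + 1 / real (Suc n)"
      unfolding m_def by (rule cInf_lessD) (use z in auto)
    then show ?thesis by auto
  qed
  then obtain s where s: "\<And>n. s n \<in> S" and sJ: "\<And>n. J (s n) < m + 1 / real (Suc n)"
    by metis
  have sL: "s n \<in> L2 \<Omega>" for n using s sub by blast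
  have quad: "J (\<lambda>x. f x + t *\<^sub>R g x) = J f + 2 * t * (L2_inner \<Omega> f g - F g) + t\<^sup>2 * (L2_norm \<Omega> g)\<^sup>2"
    if "f \<in> S" "g \<in> S" for f g t
    using that sub by (simp add: J_def L2_inner_add_square[of f \<Omega> g t] subset_iff add[OF that(1) Sscale[OF that(2)]]
        scale[OF that(2)] algebra_simps)
  have par: "(L2_norm \<Omega> (\<lambda>x. s i x - s j x))\<^sup>2 \<le> 2 / real (Suc i) + 2 / real (Suc j)" for i j
  proof -
    define d where "d = (\<lambda>x. s j x + (-1) *\<^sub>R s i x)"
    have d: "d \<in> S" unfolding d_def by (intro Sadd Sscale s)
    have 1: "J (\<lambda>x. s i x + 1 *\<^sub>R d x) = J (s i) + 2 * (L2_inner \<Omega> (s i) d - F d) + (L2_norm \<Omega> d)\<^sup>2"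
      using quad[OF s d, of i 1] by simp
    \<comment> \<open>The midpoint of \<open>s i\<close> and \<open>s j\<close> has energy at least
      \<open>m\<close>; compared with the two almost minimal end points this bounds their distance,
      as in the parallelogram law.\<close>
    have 2: "J (\<lambda>x. s i x + (1/2) *\<^sub>R d x) = J (s i) + (L2_inner \<Omega> (s i) d - F d) + (L2_norm \<Omega> d)\<^sup>2 / 4"
      using quad[OF s d, of i "1/2"] by (simp add: power2_eq_square)
    have "(\<lambda>x. s i x + 1 *\<^sub>R d x) = s j" by (auto simp: d_def)
    then have 3: "J (s j) = J (s i) + 2 * (L2_inner \<Omega> (s i) d - F d) + (L2_norm \<Omega> d)\<^sup>2" using 1 by simp
    have "m \<le> J (\<lambda>x. s i x + (1/2) *\<^sub>R d x)" by (intro m_le Sadd Sscale s d)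
    then have "m \<le> J (s i) + (L2_inner \<Omega> (s i) d - F d) + (L2_norm \<Omega> d)\<^sup>2 / 4" using 2 by metis
    then have "(L2_norm \<Omega> d)\<^sup>2 / 2 \<le> J (s i) + J (s j) - 2 * m" using 3 by argo
    also have "\<dots> \<le> 1 / real (Suc i) + 1 / real (Suc j)" using sJ[of i] sJ[of j] by linarith
    finally have "(L2_norm \<Omega> d)\<^sup>2 \<le> 2 / real (Suc i) + 2 / real (Suc j)" by simp
    moreover have "L2_norm \<Omega> d = L2_norm \<Omega> (\<lambda>x. s i x - s j x)"
      by (subst L2_norm_minus_commute) (simp add: d_def)
    ultimately show ?thesis by simp
  qed
  obtain g where g: "g \<in> L2 \<Omega>" "(\<lambda>n. L2_norm \<Omega> (\<lambda>x. s n x - g x)) \<longlonglongrightarrow> 0"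
  proof (rule L2_complete[OF \<Omega> sL])
    fix e :: real assume e: "0 < e"
    obtain N where N: "4 / e\<^sup>2 < real N" using reals_Archimedean2 by blast
    have "L2_norm \<Omega> (\<lambda>x. s i x - s j x) < e" if ij: "N \<le> i" "N \<le> j" for i j
    proof (rule power2_less_imp_less)
      have *: "2 / real (Suc k) < e\<^sup>2 / 2" if "N \<le> k" for k
      proof -
        have "4 / e\<^sup>2 < real (Suc k)" using N that by linarith
        then show ?thesis using e by (simp add: field_simps)
      qed
      show "(L2_norm \<Omega> (\<lambda>x. s i x - s j x))\<^sup>2 < e\<^sup>2"
        using par[of i j] *[OF ij(1)] *[OF ij(2)] by linarith
    qed (use e in simp)
    then show "\<exists>N. \<forall>i\<ge>N. \<forall>j\<ge>N. L2_norm \<Omega> (\<lambda>x. s i x - s j x) < e" by blast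
  qed
  have "F f = L2_inner \<Omega> g f" if f: "f \<in> S" for f
  proof -
    have fL: "f \<in> L2 \<Omega>" using f sub by blast
    have lim: "(\<lambda>n. L2_inner \<Omega> (s n) f) \<longlonglongrightarrow> L2_inner \<Omega> g f"
    proof (rule LIM_zero_cancel, rule Lim_null_comparison)
      show "\<forall>\<^sub>F n in sequentially. norm (L2_inner \<Omega> (s n) f - L2_inner \<Omega> g f)
          \<le> L2_norm \<Omega> (\<lambda>x. s n x - g x) * L2_norm \<Omega> f"
        using L2_Cauchy_Schwarz[OF L2_diff[OF sL g(1)] fL] L2_inner_diff_left[OF sL g(1) fL]
        by (intro always_eventually allI) (metis real_norm_def)
      show "(\<lambda>n. L2_norm \<Omega> (\<lambda>x. s n x - g x) * L2_norm \<Omega> f) \<longlonglongrightarrow> 0"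
        using tendsto_mult_left_zero[OF g(2)] by simp
    qed
    \<comment> \<open>The first variation at the limit. Each \<open>s n\<close> misses the infimum
      by at most \<open>1 / Suc n\<close>, so the inequality holds up to this error before the limit
      is taken.\<close>
    have "0 \<le> 2 * t * (L2_inner \<Omega> g f - F f) + t\<^sup>2 * (L2_norm \<Omega> f)\<^sup>2" for t
    proof (rule LIMSEQ_le)
      show "(\<lambda>n. - (1 / real (Suc n))) \<longlonglongrightarrow> 0"
        using tendsto_minus[OF LIMSEQ_Suc[OF lim_1_over_n]] by simp
      show "(\<lambda>n. 2 * t * (L2_inner \<Omega> (s n) f - F f) + t\<^sup>2 * (L2_norm \<Omega> f)\<^sup>2)
          \<longlonglongrightarrow> 2 * t * (L2_inner \<Omega> g f - F f) + t\<^sup>2 * (L2_norm \<Omega> f)\<^sup>2"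
        by (intro tendsto_intros lim)
      have "- (1 / real (Suc n)) \<le> 2 * t * (L2_inner \<Omega> (s n) f - F f) + t\<^sup>2 * (L2_norm \<Omega> f)\<^sup>2" for n
        using m_le[OF Sadd[OF s[of n] Sscale[OF f, of t]]] quad[OF s[of n] f, of t] sJ[of n] by linarith
      then show "\<exists>N. \<forall>n\<ge>N. - (1 / real (Suc n)) \<le> 2 * t * (L2_inner \<Omega> (s n) f - F f) + t\<^sup>2 * (L2_norm \<Omega> f)\<^sup>2"
        by blast
    qed
    then show ?thesis using quadratic_nonneg_imp_zero by fastforce
  qed
  with g s show ?thesis by (intro that)
qed

text \<open>Built up one multiple at a time, so that convergence of inner products with the members
  of the sequence spreads to the span by rule induction.\<close>

inductive_set lin_span :: "(nat \<Rightarrow> real ^ 3 \<Rightarrow> 'b::euclidean_space) \<Rightarrow> (real ^ 3 \<Rightarrow> 'b) set"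
  for f :: "nat \<Rightarrow> real ^ 3 \<Rightarrow> 'b::euclidean_space" where
  zero: "(\<lambda>x. 0) \<in> lin_span f"
| step: "g \<in> lin_span f \<Longrightarrow> (\<lambda>x. g x + c *\<^sub>R f n x) \<in> lin_span f"

lemma lin_span_subspace:
  assumes f: "\<And>n. f n \<in> L2 \<Omega>"
  shows "L2_subspace \<Omega> (lin_span f)"
proof -
  have 1: "g \<in> lin_span f \<Longrightarrow> g \<in> L2 \<Omega>" for g
    by (induction rule: lin_span.induct) (use f in \<open>auto intro!: L2_zero L2_add L2_scaleR\<close>)
  have 2: "(\<lambda>x. g x + h x) \<in> lin_span f" if "h \<in> lin_span f" "g \<in> lin_span f" for g h
    using that
  proof (induction rule: lin_span.induct)
    case (step h c n)
    then show ?case using lin_span.step[of "\<lambda>x. g x + h x" f c n] by (simp add: add.assoc)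
  qed simp
  have 3: "(\<lambda>x. c *\<^sub>R g x) \<in> lin_span f" if "g \<in> lin_span f" for g c
    using that
  proof (induction rule: lin_span.induct)
    case (step g d n)
    then show ?case using lin_span.step[of "\<lambda>x. c *\<^sub>R g x" f "c * d" n] by (simp add: scaleR_add_right)
  qed (simp add: lin_span.zero)
  show ?thesis unfolding L2_subspace_def using 1 2 3 lin_span.zero[of f] by blast
qed

text \<open>The diagonal argument is needed only for the inner products with the members of the
  sequence itself. Any other test field may be replaced by its projection to the closure of their
  span, because the difference is orthogonal to every \<open>f n\<close>.\<close>

lemma L2_weakly_compact:
  fixes f :: "nat \<Rightarrow> real ^ 3 \<Rightarrow> 'b::euclidean_space"
  assumes \<Omega>: "\<Omega> \<in> lmeasurable" and f: "\<And>n. f n \<in> L2 \<Omega>"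
    and bd: "\<And>n. L2_norm \<Omega> (f n) \<le> M"
  obtains r g where "strict_mono (r :: nat \<Rightarrow> nat)" "L2_weakly_converges \<Omega> (\<lambda>n. f (r n)) g"
proof -
  have M: "0 \<le> M" using bd[of 0] L2_norm_nonneg[of \<Omega> "f 0"] by linarith
  have CS: "\<bar>L2_inner \<Omega> (f n) h\<bar> \<le> M * L2_norm \<Omega> h" if "h \<in> L2 \<Omega>" for n h
    using L2_Cauchy_Schwarz[OF f that, of n] bd[of n] mult_right_mono[OF bd[of n], of "L2_norm \<Omega> h"] by simp
  \<comment> \<open>The diagonal extraction, with the index \<open>m\<close> in the role of the
    point at which a sequence of functions is to converge.\<close>
  obtain r where r: "strict_mono (r :: nat \<Rightarrow> nat)"
    and conv: "\<And>m. m \<in> UNIV \<Longrightarrow> \<exists>l. (\<lambda>n. L2_inner \<Omega> (f (r n)) (f m)) \<longlonglongrightarrow> l"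
  proof (rule function_convergent_subsequence[of UNIV "\<lambda>n m. L2_inner \<Omega> (f n) (f m)" "M * M"])
    show "norm (L2_inner \<Omega> (f n) (f m)) \<le> M * M" for n m
      using CS[OF f[of m], of n] mult_left_mono[OF bd[of m] M] by simp
  qed auto
  have conv_span: "convergent (\<lambda>n. L2_inner \<Omega> (f (r n)) h)" if "h \<in> lin_span f" for h
    using that
  proof (induction rule: lin_span.induct)
    case zero
    then show ?case by (simp add: L2_inner_def convergent_const)
  next
    case (step g c m)
    have g: "g \<in> L2 \<Omega>" using step lin_span_subspace[of f \<Omega>, OF f] by (auto simp: L2_subspace_def)
    have "(\<lambda>n. L2_inner \<Omega> (f (r n)) (\<lambda>x. g x + c *\<^sub>R f m x))
        = (\<lambda>n. L2_inner \<Omega> (f (r n)) g + c * L2_inner \<Omega> (f (r n)) (f m))"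
      using f g by (simp add: L2_inner_add_right L2_scaleR L2_inner_scaleR_right)
    moreover have "convergent (\<lambda>n. L2_inner \<Omega> (f (r n)) (f m))" using conv[of m] by (auto simp: convergent_def)
    ultimately show ?case
      using step.IH by (auto intro!: convergent_add convergent_mult convergent_const)
  qed
  have fspan: "f n \<in> lin_span f" for n using lin_span.step[OF lin_span.zero, where f=f and c=1 and n=n] by simp
  have conv_all: "convergent (\<lambda>n. L2_inner \<Omega> (f (r n)) h)" if h: "h \<in> L2 \<Omega>" for h
  proof -
    have spL: "g \<in> lin_span f \<Longrightarrow> g \<in> L2 \<Omega>" for g
      using lin_span_subspace[of f \<Omega>, OF f] by (auto simp: L2_subspace_def)
    \<comment> \<open>\<open>g\<close> is the orthogonal projection of \<open>h\<close> to the
      closure of the span, and \<open>s\<close> approximates it from within the span.\<close>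
    obtain g s where g: "g \<in> L2 \<Omega>" "\<And>k. k \<in> lin_span f \<Longrightarrow> L2_inner \<Omega> h k = L2_inner \<Omega> g k"
      and s: "\<And>n. s n \<in> lin_span f" "(\<lambda>n. L2_norm \<Omega> (\<lambda>x. s n x - g x)) \<longlonglongrightarrow> 0"
    proof (rule L2_Riesz[OF \<Omega> lin_span_subspace[OF f], where F="L2_inner \<Omega> h" and C="L2_norm \<Omega> h"])
      show "\<bar>L2_inner \<Omega> h k\<bar> \<le> L2_norm \<Omega> h * L2_norm \<Omega> k" if "k \<in> lin_span f" for k
        using h spL[OF that] by (rule L2_Cauchy_Schwarz)
    qed (use spL h in \<open>auto simp: L2_inner_add_right L2_inner_scaleR_right\<close>)
    have "Cauchy (\<lambda>n. L2_inner \<Omega> (f (r n)) g)"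
    proof (rule metric_CauchyI)
      fix e :: real assume e: "0 < e"
      have "0 < e / (3 * (M + 1))" using e M by simp
      then obtain k where k: "L2_norm \<Omega> (\<lambda>x. s k x - g x) < e / (3 * (M + 1))"
        using s(2) by (metis (no_types, lifting) LIMSEQ_D diff_zero dual_order.refl real_norm_def abs_of_nonneg L2_norm_nonneg)
      have near: "\<bar>L2_inner \<Omega> (f n) (s k) - L2_inner \<Omega> (f n) g\<bar> < e / 3" for n
      proof -
        have "\<bar>L2_inner \<Omega> (f n) (s k) - L2_inner \<Omega> (f n) g\<bar> \<le> M * L2_norm \<Omega> (\<lambda>x. s k x - g x)"
          using CS[OF L2_diff[OF spL[OF s(1)[of k]] g(1)], of n] L2_inner_diff_right[OF spL[OF s(1)[of k]] g(1) f[of n]] by simp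
        also have "\<dots> \<le> (M + 1) * L2_norm \<Omega> (\<lambda>x. s k x - g x)" by (intro mult_right_mono) auto
        also have "\<dots> < (M + 1) * (e / (3 * (M + 1)))" using k M by (intro mult_strict_left_mono) auto
        also have "\<dots> = e / 3" using M by (simp add: divide_simps)
        finally show ?thesis .
      qed
      obtain N where N: "\<And>i j. N \<le> i \<Longrightarrow> N \<le> j \<Longrightarrow>
          dist (L2_inner \<Omega> (f (r i)) (s k)) (L2_inner \<Omega> (f (r j)) (s k)) < e / 3"
        using metric_CauchyD[OF convergent_Cauchy[OF conv_span[OF s(1)]], of "e / 3" k] e by auto
      have "dist (L2_inner \<Omega> (f (r i)) g) (L2_inner \<Omega> (f (r j)) g) < e" if "N \<le> i" "N \<le> j" for i j
        using N[OF that] near[of "r i"] near[of "r j"] unfolding dist_real_def by linarith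
      then show "\<exists>N. \<forall>i\<ge>N. \<forall>j\<ge>N. dist (L2_inner \<Omega> (f (r i)) g) (L2_inner \<Omega> (f (r j)) g) < e" by blast
    qed
    moreover have "L2_inner \<Omega> (f n) h = L2_inner \<Omega> (f n) g" for n
      using g(2)[OF fspan[of n]] by (simp add: L2_inner_commute)
    ultimately show ?thesis by (simp add: Cauchy_convergent_iff)
  qed
  \<comment> \<open>The pointwise limit of the functionals is again bounded by \<open>M\<close>, and
    its Riesz representative is the weak limit.\<close>
  define F where "F h = lim (\<lambda>n. L2_inner \<Omega> (f (r n)) h)" for h
  have F: "(\<lambda>n. L2_inner \<Omega> (f (r n)) h) \<longlonglongrightarrow> F h" if "h \<in> L2 \<Omega>" for h
    using conv_all[OF that] by (simp add: F_def convergent_LIMSEQ_iff)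
  have sub: "L2_subspace \<Omega> (L2 \<Omega> :: (real ^ 3 \<Rightarrow> 'b) set)"
    by (auto simp: L2_subspace_def intro: L2_zero L2_add L2_scaleR)
  obtain g where g: "g \<in> L2 \<Omega>" "\<And>h. h \<in> L2 \<Omega> \<Longrightarrow> F h = L2_inner \<Omega> g h"
  proof (rule L2_Riesz[OF \<Omega> sub, where F=F and C=M])
    fix h k :: "real ^ 3 \<Rightarrow> 'b" assume hk: "h \<in> L2 \<Omega>" "k \<in> L2 \<Omega>"
    have "(\<lambda>n. L2_inner \<Omega> (f (r n)) (\<lambda>x. h x + k x)) \<longlonglongrightarrow> F h + F k"
      using tendsto_add[OF F[OF hk(1)] F[OF hk(2)]] by (simp add: L2_inner_add_right hk f)
    then show "F (\<lambda>x. h x + k x) = F h + F k"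
      using F[OF L2_add[OF hk]] LIMSEQ_unique by blast
  next
    fix c and h :: "real ^ 3 \<Rightarrow> 'b" assume h: "h \<in> L2 \<Omega>"
    have "(\<lambda>n. L2_inner \<Omega> (f (r n)) (\<lambda>x. c *\<^sub>R h x)) \<longlonglongrightarrow> c * F h"
      using tendsto_mult_left[OF F[OF h], of c] by (simp add: L2_inner_scaleR_right)
    then show "F (\<lambda>x. c *\<^sub>R h x) = c * F h"
      using F[OF L2_scaleR[OF h]] LIMSEQ_unique by blast
  next
    fix h :: "real ^ 3 \<Rightarrow> 'b" assume h: "h \<in> L2 \<Omega>"
    show "\<bar>F h\<bar> \<le> M * L2_norm \<Omega> h"
      by (rule LIMSEQ_le_const2[OF tendsto_rabs[OF F[OF h]]]) (use CS[OF h] in auto)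
  qed auto
  have "L2_weakly_converges \<Omega> (\<lambda>n. f (r n)) g"
    unfolding L2_weakly_converges_def using f F g by simp
  with r show ?thesis by (rule that)
qed

section \<open>Calculus of continuously differentiable functions\<close>

lemma has_frechet_derivative:
  "f differentiable (at x) \<Longrightarrow> (f has_derivative frechet_derivative f (at x)) (at x)"
  using frechet_derivative_works by blast

lemma Ck_SucI:
  assumes "\<And>x. (f has_derivative f' x) (at x)" "\<And>v. Ck k (\<lambda>x. f' x v)"
  shows "Ck (Suc k) f"
proof -
  have "frechet_derivative f (at x) = f' x" for x
    using frechet_derivative_at[OF assms(1)] by simp
  then show ?thesis using assms by (auto simp: differentiable_def)
qed

lemma Ck_Suc_has_derivative:
  "Ck (Suc k) f \<Longrightarrow> (f has_derivative frechet_derivative f (at x)) (at x)"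
  by (simp add: has_frechet_derivative)

lemma Ck_Suc_derivative: "Ck (Suc k) f \<Longrightarrow> Ck k (\<lambda>x. frechet_derivative f (at x) v)"
  by simp

lemma Ck_imp_continuous: "Ck k f \<Longrightarrow> continuous_on UNIV f"
proof (cases k)
  case (Suc l)
  then show "Ck k f \<Longrightarrow> continuous_on UNIV f"
    by (simp add: continuous_at_imp_continuous_on differentiable_imp_continuous_within)
qed simp

lemma Ck_Suc_imp: "Ck (Suc k) f \<Longrightarrow> Ck k f"
proof (induction k arbitrary: f)
  case 0
  then show ?case using Ck_imp_continuous by (metis Ck.simps(1))
next
  case (Suc k)
  have "Ck k (\<lambda>x. frechet_derivative f (at x) v)" for v
    using Suc.prems by (intro Suc.IH) simp
  then show ?case using Suc.prems by simp
qed

lemma Ck_const: "Ck k (\<lambda>x. c)"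
proof (induction k arbitrary: c)
  case (Suc k)
  show ?case by (rule Ck_SucI[of _ "\<lambda>x v. 0"]) (use Suc in auto)
qed simp

lemma Ck_bounded_linear:
  assumes "bounded_linear f" shows "Ck k f"
proof (cases k)
  case 0
  then show ?thesis using assms by (simp add: linear_continuous_on)
next
  case (Suc l)
  show ?thesis unfolding Suc
    by (rule Ck_SucI[of _ "\<lambda>x. f"]) (use assms in \<open>auto intro: bounded_linear_imp_has_derivative Ck_const\<close>)
qed

lemma Ck_add: "Ck k f \<Longrightarrow> Ck k g \<Longrightarrow> Ck k (\<lambda>x. f x + g x)"
proof (induction k arbitrary: f g)
  case 0
  then show ?case by (simp add: continuous_on_add)
next
  case (Suc k)
  show ?case
    by (rule Ck_SucI[of _ "\<lambda>x v. frechet_derivative f (at x) v + frechet_derivative g (at x) v"])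
       (use Suc in \<open>auto intro!: has_derivative_add has_frechet_derivative\<close>)
qed

lemma Ck_bilinear:
  assumes B: "bounded_bilinear B"
  shows "Ck k f \<Longrightarrow> Ck k g \<Longrightarrow> Ck k (\<lambda>x. B (f x) (g x))"
proof (induction k arbitrary: f g)
  case 0
  then show ?case using bounded_bilinear.continuous_on[OF B] by auto
next
  case (Suc k)
  show ?case
  proof (rule Ck_SucI[of _ "\<lambda>x v. B (f x) (frechet_derivative g (at x) v) + B (frechet_derivative f (at x) v) (g x)"])
    show "((\<lambda>x. B (f x) (g x)) has_derivative
        (\<lambda>v. B (f x) (frechet_derivative g (at x) v) + B (frechet_derivative f (at x) v) (g x))) (at x)" for x
      using Suc.prems by (intro bounded_bilinear.FDERIV[OF B] Ck_Suc_has_derivative)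
    show "Ck k (\<lambda>x. B (f x) (frechet_derivative g (at x) v) + B (frechet_derivative f (at x) v) (g x))" for v
      using Suc.prems by (intro Ck_add Suc.IH Ck_Suc_imp[of k f] Ck_Suc_imp[of k g] Ck_Suc_derivative)
  qed
qed

lemmas Ck_scaleR = Ck_bilinear[OF bounded_bilinear_scaleR]
lemmas Ck_mult = Ck_bilinear[OF bounded_bilinear_mult]
lemmas Ck_inner = Ck_bilinear[OF bounded_bilinear_inner]

lemma Ck_minus: "Ck k f \<Longrightarrow> Ck k (\<lambda>x. - f x)"
  using Ck_scaleR[OF Ck_const, of k f "-1"] by simp

lemma Ck_diff: "Ck k f \<Longrightarrow> Ck k g \<Longrightarrow> Ck k (\<lambda>x. f x - g x)"
  using Ck_add[OF _ Ck_minus, of k f g] by simp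

lemma Ck_sum: "finite A \<Longrightarrow> (\<And>i. i \<in> A \<Longrightarrow> Ck k (f i)) \<Longrightarrow> Ck k (\<lambda>x. \<Sum>i\<in>A. f i x)"
proof (induction A rule: finite_induct)
  case (insert i A)
  then have "Ck k (\<lambda>x. f i x + (\<Sum>i\<in>A. f i x))" by (intro Ck_add) auto
  then show ?case using insert by simp
qed (simp add: Ck_const)

lemma Ck_prod:
  fixes f :: "'i \<Rightarrow> 'a::real_normed_vector \<Rightarrow> real"
  shows "finite A \<Longrightarrow> (\<And>i. i \<in> A \<Longrightarrow> Ck k (f i)) \<Longrightarrow> Ck k (\<lambda>x. \<Prod>i\<in>A. f i x)"
proof (induction A rule: finite_induct)
  case (insert i A)
  then have "Ck k (\<lambda>x. f i x * (\<Prod>i\<in>A. f i x))" by (intro Ck_mult) auto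
  then show ?case using insert by simp
qed (simp add: Ck_const)

text \<open>\<open>Ck\<close> speaks of derivatives in one fixed direction at a time. A direction
  that varies with the point, as in the chain rule, is reduced to fixed ones by this
  expansion.\<close>

lemma frechet_derivative_basis_expansion:
  fixes f :: "'a::euclidean_space \<Rightarrow> 'b::real_normed_vector"
  assumes "f differentiable (at x)"
  shows "frechet_derivative f (at x) v = (\<Sum>b\<in>Basis. (v \<bullet> b) *\<^sub>R frechet_derivative f (at x) b)"
proof -
  have L: "linear (frechet_derivative f (at x))"
    using assms by (rule linear_frechet_derivative)
  have "frechet_derivative f (at x) v = frechet_derivative f (at x) (\<Sum>b\<in>Basis. (v \<bullet> b) *\<^sub>R b)"
    by (simp add: euclidean_representation)
  then show ?thesis using L by (simp add: linear_sum linear_scale)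
qed

lemma Ck_compose:
  fixes f :: "'b::euclidean_space \<Rightarrow> 'c::real_normed_vector" and g :: "'a::real_normed_vector \<Rightarrow> 'b"
  shows "Ck k f \<Longrightarrow> Ck k g \<Longrightarrow> Ck k (\<lambda>x. f (g x))"
proof (induction k arbitrary: f)
  case 0
  then show ?case by (auto intro: continuous_on_compose2)
next
  case (Suc k)
  let ?D = "\<lambda>x v. \<Sum>b\<in>Basis. (frechet_derivative g (at x) v \<bullet> b) *\<^sub>R frechet_derivative f (at (g x)) b"
  show ?case
  proof (rule Ck_SucI[of _ ?D])
    fix x
    have "((\<lambda>x. f (g x)) has_derivative (\<lambda>v. frechet_derivative f (at (g x)) (frechet_derivative g (at x) v))) (at x)"
      using Suc.prems by (intro has_derivative_compose[of g _ x UNIV f] Ck_Suc_has_derivative)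
    also have "(\<lambda>v. frechet_derivative f (at (g x)) (frechet_derivative g (at x) v)) = ?D x"
      using Suc.prems by (intro ext frechet_derivative_basis_expansion) simp
    finally show "((\<lambda>x. f (g x)) has_derivative ?D x) (at x)" .
  next
    fix v
    show "Ck k (\<lambda>x. ?D x v)"
      using Suc.prems Ck_Suc_imp[OF Suc.prems(2)]
      by (intro Ck_sum Ck_scaleR Ck_inner Ck_const Ck_Suc_derivative Suc.IH) auto
  qed
qed

lemma continuous_on_frechet_derivative:
  fixes f :: "'a::euclidean_space \<Rightarrow> 'b::real_normed_vector"
  assumes f: "Ck (Suc 0) f" and a: "continuous_on S a" and b: "continuous_on S b"
  shows "continuous_on S (\<lambda>x. frechet_derivative f (at (a x)) (b x))"
proof -
  have c: "continuous_on S (\<lambda>x. frechet_derivative f (at (a x)) i)" for i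
    using f by (intro continuous_on_compose2[OF _ a, of UNIV "\<lambda>x. frechet_derivative f (at x) i"]) auto
  have "continuous_on S (\<lambda>x. \<Sum>i\<in>Basis. (b x \<bullet> i) *\<^sub>R frechet_derivative f (at (a x)) i)"
    by (intro continuous_intros c b)
  moreover have "(\<Sum>i\<in>Basis. (b x \<bullet> i) *\<^sub>R frechet_derivative f (at (a x)) i) = frechet_derivative f (at (a x)) (b x)" for x
    using f by (intro frechet_derivative_basis_expansion[symmetric]) simp
  ultimately show ?thesis by simp
qed

lemma frechet_derivative_zero_outside_supp:
  assumes "x \<notin> supp f"
  shows "frechet_derivative f (at x) v = 0"
proof -
  have "open (- supp f)" by (simp add: supp_def open_Compl)
  have "((\<lambda>x. 0) has_derivative (\<lambda>v. 0)) (at x)" by simp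
  then have "(f has_derivative (\<lambda>v. 0)) (at x)"
    by (rule has_derivative_transform_within_open[OF _ \<open>open (- supp f)\<close>])
       (use assms in \<open>auto simp: supp_def intro: closure_subset[THEN subsetD]\<close>)
  then show ?thesis using frechet_derivative_at by metis
qed

lemma frechet_derivative_cong_open:
  assumes "open U" "x \<in> U" "\<And>y. y \<in> U \<Longrightarrow> f y = g y" "f differentiable (at x)"
  shows "frechet_derivative g (at x) = frechet_derivative f (at x)"
proof -
  have "(g has_derivative frechet_derivative f (at x)) (at x)"
    using has_derivative_transform_within_open[OF has_frechet_derivative[OF assms(4)] assms(1,2)] assms(3) by auto
  then show ?thesis using frechet_derivative_at by metis
qed

section \<open>Smooth cutoff functions\<close>

text \<open>Up to the extension by 0, the derivatives of \<open>exp (- (1 / x))\<close> are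
  polynomials in \<open>1 / x\<close> times this exponential. The family of all such functions is
  closed under differentiation, so a single induction over all \<open>p\<close> proves
  smoothness.\<close>

definition exp_inv_poly :: "real poly \<Rightarrow> real \<Rightarrow> real" where
  "exp_inv_poly p x = (if 0 < x then poly p (1 / x) * exp (- (1 / x)) else 0)"

lemma poly_exp_minus_tendsto_0: "((\<lambda>y. poly p y * exp (- y)) \<longlongrightarrow> (0::real)) at_top"
proof -
  have "((\<lambda>y. coeff p i * (y ^ i / exp y)) \<longlongrightarrow> 0) at_top" for i
    using tendsto_mult_right_zero[OF tendsto_power_div_exp_0] by blast
  then have "((\<lambda>y. \<Sum>i\<le>degree p. coeff p i * (y ^ i / exp y)) \<longlongrightarrow> (\<Sum>i\<le>degree p. 0)) at_top"
    by (intro tendsto_sum)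
  moreover have "(\<Sum>i\<le>degree p. coeff p i * (y ^ i / exp y)) = poly p y * exp (- y)" for y
    unfolding poly_altdef sum_distrib_right by (rule sum.cong) (auto simp: exp_minus divide_inverse)
  ultimately show ?thesis by simp
qed

lemma exp_inv_poly_tendsto_0: "(exp_inv_poly p \<longlongrightarrow> 0) (at 0)"
proof -
  have "((\<lambda>x. poly p (inverse x) * exp (- (inverse x))) \<longlongrightarrow> 0) (at_right 0)"
    using filterlim_compose[OF poly_exp_minus_tendsto_0 filterlim_inverse_at_top_right] .
  then have "(exp_inv_poly p \<longlongrightarrow> 0) (at_right 0)"
    by (rule Lim_transform_eventually)
       (auto simp: exp_inv_poly_def eventually_at_right_field inverse_eq_divide intro: exI[of _ 1])
  moreover have "(exp_inv_poly p \<longlongrightarrow> 0) (at_left 0)"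
    by (rule Lim_transform_eventually[of "\<lambda>x. 0"])
       (auto simp: exp_inv_poly_def eventually_at_left_field intro: exI[of _ "-1"])
  ultimately show ?thesis by (simp add: filterlim_split_at)
qed

lemma exp_inv_poly_has_derivative:
  "(exp_inv_poly p has_real_derivative exp_inv_poly ([:0, 0, 1:] * (p - pderiv p)) x) (at x)"
proof -
  consider "x > 0" | "x < 0" | "x = 0" by linarith
  then show ?thesis
  proof cases
    case 1
    have d: "((\<lambda>x. 1 / x) has_real_derivative - (1 / x\<^sup>2)) (at x)"
      using 1 by (auto intro!: derivative_eq_intros simp: power2_eq_square)
    have "((\<lambda>x. poly p (1 / x) * exp (- (1 / x))) has_real_derivative
        poly (pderiv p) (1 / x) * (- (1 / x\<^sup>2)) * exp (- (1 / x))
        + exp (- (1 / x)) * - (- (1 / x\<^sup>2)) * poly p (1 / x)) (at x)"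
      by (intro DERIV_mult DERIV_chain2[OF poly_DERIV d] DERIV_chain2[OF DERIV_exp DERIV_minus[OF d]])
    moreover have "poly (pderiv p) (1 / x) * (- (1 / x\<^sup>2)) * exp (- (1 / x))
        + exp (- (1 / x)) * - (- (1 / x\<^sup>2)) * poly p (1 / x) = exp_inv_poly ([:0, 0, 1:] * (p - pderiv p)) x"
      using 1 by (simp add: exp_inv_poly_def field_simps power2_eq_square)
    ultimately have "((\<lambda>x. poly p (1 / x) * exp (- (1 / x))) has_real_derivative
        exp_inv_poly ([:0, 0, 1:] * (p - pderiv p)) x) (at x)" by simp
    then show ?thesis
      by (rule has_field_derivative_transform_within_open[of _ _ _ "{0<..}"])
         (use 1 in \<open>auto simp: exp_inv_poly_def\<close>)
  next
    case 2
    have "((\<lambda>x. 0) has_real_derivative exp_inv_poly ([:0, 0, 1:] * (p - pderiv p)) x) (at x)"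
      using 2 by (auto simp: exp_inv_poly_def)
    then show ?thesis
      by (rule has_field_derivative_transform_within_open[of _ _ _ "{..<0}"])
         (use 2 in \<open>auto simp: exp_inv_poly_def\<close>)
  next
    case 3
    \<comment> \<open>The difference quotient at 0 belongs to the family again, with one more factor
      \<open>1 / h\<close>, so its limit is already known to be 0.\<close>
    have "(\<lambda>h. (exp_inv_poly p (0 + h) - exp_inv_poly p 0) / h) = exp_inv_poly ([:0, 1:] * p)"
      by (auto simp: exp_inv_poly_def fun_eq_iff)
    then show ?thesis
      using exp_inv_poly_tendsto_0[of "[:0, 1:] * p"] unfolding DERIV_def 3
      by (simp add: exp_inv_poly_def)
  qed
qed

lemma Ck_exp_inv_poly: "Ck k (exp_inv_poly p)"
proof (induction k arbitrary: p)
  case 0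
  have "isCont (exp_inv_poly p) x" for x by (rule DERIV_isCont[OF exp_inv_poly_has_derivative])
  then show ?case by (simp add: continuous_at_imp_continuous_on)
next
  case (Suc k)
  show ?case
  proof (rule Ck_SucI[of _ "\<lambda>x v. exp_inv_poly ([:0, 0, 1:] * (p - pderiv p)) x * v"])
    show "(exp_inv_poly p has_derivative (*) (exp_inv_poly ([:0, 0, 1:] * (p - pderiv p)) x)) (at x)" for x
      using exp_inv_poly_has_derivative by (simp add: has_field_derivative_def)
    show "Ck k (\<lambda>x. exp_inv_poly ([:0, 0, 1:] * (p - pderiv p)) x * v)" for v
      by (intro Ck_mult Ck_const Suc)
  qed
qed

definition exp_inv :: "real \<Rightarrow> real" where
  "exp_inv = exp_inv_poly 1"

lemma exp_inv_eq: "exp_inv x = (if 0 < x then exp (- (1 / x)) else 0)"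
  by (simp add: exp_inv_def exp_inv_poly_def)

lemma Ck_exp_inv: "Ck k exp_inv"
  by (simp add: exp_inv_def Ck_exp_inv_poly)

lemma exp_inv_nonneg: "0 \<le> exp_inv x" and exp_inv_le_1: "exp_inv x \<le> 1"
  and exp_inv_pos_iff: "0 < exp_inv x \<longleftrightarrow> 0 < x"
  by (simp_all add: exp_inv_eq)

section \<open>Integrals of continuous functions with bounded support\<close>

lemma supp_zero: "x \<notin> supp f \<Longrightarrow> f x = 0"
  unfolding supp_def using closure_subset[of "{x. f x \<noteq> 0}"] by auto

lemma closed_supp: "closed (supp f)"
  by (simp add: supp_def)

lemma supp_subset: "closed S \<Longrightarrow> (\<And>x. x \<notin> S \<Longrightarrow> f x = 0) \<Longrightarrow> supp f \<subseteq> S"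
  unfolding supp_def by (rule closure_minimal) auto

lemma bounded_subset_cbox_zero:
  fixes S :: "'a::euclidean_space set"
  assumes "bounded S" obtains c where "S \<subseteq> cbox (-c) c"
  using bounded_subset_cbox_symmetric[OF assms] by blast

lemma integral_cbox_eq_UNIV:
  fixes f :: "'a::euclidean_space \<Rightarrow> 'b::banach"
  assumes "\<And>x. x \<notin> S \<Longrightarrow> f x = 0"
  shows "integral S f = integral UNIV f"
proof -
  have "(\<lambda>x. if x \<in> S then f x else 0) = f" using assms by auto
  then show ?thesis using integral_restrict_UNIV[of S f] by simp
qed

lemma integrable_lborel_bounded_support:
  fixes f :: "'a::euclidean_space \<Rightarrow> 'b::euclidean_space"
  assumes "continuous_on UNIV f" "bounded S" "\<And>x. x \<notin> S \<Longrightarrow> f x = 0"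
  shows "integrable lborel f"
proof -
  obtain c where c: "S \<subseteq> cbox (-c) c" using assms(2) by (rule bounded_subset_cbox_zero)
  have "integrable lborel (\<lambda>x. indicator (cbox (-c) c) x *\<^sub>R f x)"
    using assms(1) by (intro borel_integrable_compact) (auto intro: continuous_on_subset)
  moreover have "(\<lambda>x. indicator (cbox (-c) c) x *\<^sub>R f x) = f"
    using c assms(3) by (auto simp: indicator_def fun_eq_iff of_bool_def)
  ultimately show ?thesis by simp
qed

lemma integrable_on_bounded_support:
  fixes f :: "'a::euclidean_space \<Rightarrow> 'b::euclidean_space"
  assumes "continuous_on UNIV f" "bounded S" "\<And>x. x \<notin> S \<Longrightarrow> f x = 0"
  shows "f integrable_on UNIV"
  using integrable_lborel_bounded_support[OF assms] by (rule integrable_on_lborel)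

lemma integral_translation:
  fixes f :: "'a::euclidean_space \<Rightarrow> 'b::euclidean_space"
  assumes f: "continuous_on UNIV f" "bounded S" "\<And>x. x \<notin> S \<Longrightarrow> f x = 0"
  shows "integral UNIV (\<lambda>x. f (x + c)) = integral UNIV f"
proof -
  have i: "integrable lborel f" using f by (rule integrable_lborel_bounded_support)
  have m: "f \<in> borel_measurable borel" using f(1) by (rule borel_measurable_continuous_onI)
  have S: "bounded ((\<lambda>x. x - c) ` S)"
    using bounded_translation[OF f(2), of "-c"] by (simp add: add.commute[of "- c"])
  have i': "integrable lborel (\<lambda>x. f (x + c))"
  proof (rule integrable_lborel_bounded_support[OF _ S])
    show "continuous_on UNIV (\<lambda>x. f (x + c))"
      by (intro continuous_on_compose2[OF f(1)] continuous_intros) auto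
    show "f (x + c) = 0" if "x \<notin> (\<lambda>x. x - c) ` S" for x
    proof (rule f(3))
      show "x + c \<notin> S" using that by (metis add_diff_cancel_right' imageI)
    qed
  qed
  have "integral UNIV f = (LINT x|lborel. f x)" using i by (rule integral_lborel)
  also have "\<dots> = (LINT x|distr lborel borel ((+) c). f x)" by (simp add: lborel_distr_plus)
  also have "\<dots> = (LINT x|lborel. f (c + x))" using m by (intro integral_distr) auto
  also have "\<dots> = integral UNIV (\<lambda>x. f (x + c))" using integral_lborel[OF i'] by (simp add: add.commute)
  finally show ?thesis by simp
qed

text \<open>The integral of \<open>f (x + h *\<^sub>R v)\<close> over \<open>x\<close> does not
  depend on \<open>h\<close>; its derivative at \<open>h = 0\<close> is the integral in
  question.\<close>

lemma integral_derivative_zero: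
  fixes f :: "'a::euclidean_space \<Rightarrow> 'b::euclidean_space"
  assumes f: "Ck (Suc 0) f" and b: "bounded (supp f)"
  shows "integral UNIV (\<lambda>x. frechet_derivative f (at x) v) = 0"
proof -
  obtain R where R: "\<And>x. x \<in> supp f \<Longrightarrow> norm x \<le> R"
    using b by (auto simp: bounded_iff)
  \<comment> \<open>Large enough to contain the supports of all translates by
    \<open>h *\<^sub>R v\<close> with \<open>h\<close> between -1 and 1.\<close>
  obtain c where c: "cball 0 (R + norm v) \<subseteq> cbox (-c) (c :: 'a)"
    using bounded_cball by (rule bounded_subset_cbox_zero)
  let ?B = "cbox (-c) c"
  have cont: "continuous_on UNIV f" using f by (rule Ck_imp_continuous)
  have zero: "f (x + h *\<^sub>R v) = 0" if "x \<notin> ?B" "h \<in> {-1<..<1}" for x h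
  proof (rule supp_zero[of "x + h *\<^sub>R v" f], rule notI)
    assume "x + h *\<^sub>R v \<in> supp f"
    then have "norm (x + h *\<^sub>R v) \<le> R" by (rule R)
    moreover have "norm x \<le> norm (x + h *\<^sub>R v) + norm (h *\<^sub>R v)"
      using norm_triangle_ineq4[of "x + h *\<^sub>R v" "h *\<^sub>R v"] by simp
    moreover have "norm (h *\<^sub>R v) \<le> norm v" using that(2) by (auto simp: mult_left_le_one_le)
    ultimately have "norm x \<le> R + norm v" by linarith
    then have "x \<in> cball 0 (R + norm v)" by simp
    then show False using c that(1) by blast
  qed
  have const: "integral ?B (\<lambda>x. f (x + h *\<^sub>R v)) = integral UNIV f" if "h \<in> {-1<..<1}" for h
    using integral_cbox_eq_UNIV[of ?B "\<lambda>x. f (x + h *\<^sub>R v)"] zero[OF _ that]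
      integral_translation[OF cont b supp_zero[where f=f], of "h *\<^sub>R v"] by simp
  have "((\<lambda>h. integral ?B (\<lambda>x. f (x + h *\<^sub>R v))) has_vector_derivative
      integral ?B (\<lambda>x. frechet_derivative f (at (x + 0 *\<^sub>R v)) v)) (at 0 within {-1<..<1})"
  proof (rule leibniz_rule_vector_derivative)
    fix h x
    have "((\<lambda>h. f (x + h *\<^sub>R v)) has_derivative (\<lambda>k. frechet_derivative f (at (x + h *\<^sub>R v)) (k *\<^sub>R v))) (at h within {-1<..<1})"
      by (rule has_derivative_compose[where g=f, OF _ Ck_Suc_has_derivative[OF f]]) (auto intro!: derivative_eq_intros)
    moreover have "linear (frechet_derivative f (at (x + h *\<^sub>R v)))"
      using f by (intro linear_frechet_derivative) simp
    ultimately show "((\<lambda>h. f (x + h *\<^sub>R v)) has_vector_derivative frechet_derivative f (at (x + h *\<^sub>R v)) v) (at h within {-1<..<1})"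
      by (simp add: has_vector_derivative_def linear_scale)
  next
    show "(\<lambda>x. f (x + h *\<^sub>R v)) integrable_on ?B" for h
      by (intro integrable_continuous continuous_on_compose2[OF cont] continuous_intros) auto
    show "continuous_on ({-1<..<1} \<times> ?B) (\<lambda>(h, x). frechet_derivative f (at (x + h *\<^sub>R v)) v)"
      unfolding split_beta by (intro continuous_on_frechet_derivative[OF f] continuous_intros)
  qed auto
  then have "((\<lambda>h. integral ?B (\<lambda>x. f (x + h *\<^sub>R v))) has_vector_derivative
      integral ?B (\<lambda>x. frechet_derivative f (at x) v)) (at 0)"
    using at_within_open[of 0 "{-1<..<1::real}"] by simp
  moreover have "((\<lambda>h. integral ?B (\<lambda>x. f (x + h *\<^sub>R v))) has_vector_derivative 0) (at 0)"
  proof (rule has_vector_derivative_transform_within_open[where S="{-1<..<1}"])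
    show "((\<lambda>h. integral UNIV f) has_vector_derivative 0) (at 0)" by (rule has_vector_derivative_const)
  qed (simp_all add: const)
  ultimately have "integral ?B (\<lambda>x. frechet_derivative f (at x) v) = 0"
    by (rule vector_derivative_unique_at)
  moreover have "integral ?B (\<lambda>x. frechet_derivative f (at x) v) = integral UNIV (\<lambda>x. frechet_derivative f (at x) v)"
  proof (rule integral_cbox_eq_UNIV)
    fix x assume x: "x \<notin> ?B"
    have "x \<notin> supp f"
    proof
      assume "x \<in> supp f"
      then have "x \<in> cball 0 (R + norm v)" using R[of x] norm_ge_zero[of v] unfolding mem_cball_0 by linarith
      then show False using c x by blast
    qed
    then show "frechet_derivative f (at x) v = 0" by (rule frechet_derivative_zero_outside_supp)
  qed
  ultimately show ?thesis by simp
qed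

section \<open>Classical divergence and curl, integration by parts\<close>

definition divergence :: "(real ^ 3 \<Rightarrow> real ^ 3) \<Rightarrow> real ^ 3 \<Rightarrow> real" where
  "divergence F x = (\<Sum>i\<in>UNIV. frechet_derivative F (at x) (axis i 1) $ i)"

lemma frechet_derivative_component:
  assumes "F differentiable (at x)"
  shows "frechet_derivative (\<lambda>y. F y $ i) (at x) v = frechet_derivative F (at x) v $ i"
proof -
  have "((\<lambda>y. F y $ i) has_derivative (\<lambda>v. frechet_derivative F (at x) v $ i)) (at x)"
    using has_frechet_derivative[OF assms] by (intro bounded_linear.has_derivative[OF bounded_linear_vec_nth])
  from frechet_derivative_at[OF this] show ?thesis by metis
qed

lemma vec3_expansion: "(v :: real ^ 3) = v $ 1 *\<^sub>R axis 1 1 + v $ 2 *\<^sub>R axis 2 1 + v $ 3 *\<^sub>R axis 3 1"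
  by (simp add: vec_eq_iff forall_3 axis_def)

lemma linear_vec3_expansion:
  assumes "linear D"
  shows "D (v :: real ^ 3) = v $ 1 *\<^sub>R D (axis 1 1) + v $ 2 *\<^sub>R D (axis 2 1) + v $ 3 *\<^sub>R D (axis 3 1)"
proof -
  have "D v = D (v $ 1 *\<^sub>R axis 1 1 + v $ 2 *\<^sub>R axis 2 1 + v $ 3 *\<^sub>R axis 3 1)"
    using vec3_expansion[of v] by (rule arg_cong)
  then show ?thesis by (simp add: linear_add[OF assms] linear_scale[OF assms])
qed

text \<open>The right-hand side is the exterior derivative of the 1-form with coefficients
  \<open>F\<close>, evaluated at \<open>a\<close> and \<open>b\<close>. In this coordinate-free form
  the curl appears in the homotopy formula.\<close>

lemma curl_cross3:
  assumes F: "F differentiable (at x)"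
  shows "curl F x \<bullet> cross3 a b = frechet_derivative F (at x) a \<bullet> b - frechet_derivative F (at x) b \<bullet> a"
proof -
  have L: "linear (frechet_derivative F (at x))"
    using F by (rule linear_frechet_derivative)
  show ?thesis
    unfolding curl_def partial_def frechet_derivative_component[OF F]
      linear_vec3_expansion[OF L, of a] linear_vec3_expansion[OF L, of b]
    by (simp add: cross3_def inner_vec_def sum_3 vector_3 algebra_simps)
qed

lemma norm_cross3_le: "norm (cross3 a b) \<le> norm a * norm b"
proof (rule power2_le_imp_le)
  show "(norm (cross3 a b))\<^sup>2 \<le> (norm a * norm b)\<^sup>2"
    by (simp add: norm_cross power_mult_distrib)
qed simp

lemma continuous_on_divergence:
  assumes "Ck (Suc 0) F" shows "continuous_on S (divergence F)"
proof -
  have "continuous_on S (\<lambda>x. \<Sum>i\<in>UNIV. frechet_derivative F (at x) (axis i 1) $ i)"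
    by (intro continuous_intros continuous_on_frechet_derivative[OF assms])
  then show ?thesis by (simp add: divergence_def[abs_def])
qed

lemma continuous_on_vector_3:
  fixes a b c :: "'a::topological_space \<Rightarrow> real"
  assumes "continuous_on S a" "continuous_on S b" "continuous_on S c"
  shows "continuous_on S (\<lambda>x. vector [a x, b x, c x] :: real ^ 3)"
proof -
  have "(\<lambda>x. vector [a x, b x, c x] :: real ^ 3) = (\<lambda>x. a x *\<^sub>R axis 1 1 + b x *\<^sub>R axis 2 1 + c x *\<^sub>R axis 3 1)"
    by (auto simp: fun_eq_iff vec_eq_iff forall_3 axis_def)
  then show ?thesis
    using assms by (simp only:) (intro continuous_on_add continuous_on_scaleR continuous_on_const)
qed

lemma continuous_on_curl:
  assumes "Ck (Suc 0) F" shows "continuous_on S (curl F)"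
proof -
  have F: "F differentiable (at x)" for x using assms by simp
  have "continuous_on S (\<lambda>x. curl F x)"
    unfolding curl_def partial_def frechet_derivative_component[OF F]
    by (intro continuous_on_vector_3 continuous_intros continuous_on_frechet_derivative[OF assms])
  then show ?thesis by simp
qed

lemma divergence_scaleR:
  assumes f: "f differentiable (at x)" and F: "F differentiable (at x)"
  shows "divergence (\<lambda>x. f x *\<^sub>R F x) x = frechet_derivative f (at x) (F x) + f x * divergence F x"
proof -
  have "((\<lambda>x. f x *\<^sub>R F x) has_derivative
      (\<lambda>v. f x *\<^sub>R frechet_derivative F (at x) v + frechet_derivative f (at x) v *\<^sub>R F x)) (at x)"
    by (intro has_derivative_scaleR has_frechet_derivative f F)
  then have "frechet_derivative (\<lambda>x. f x *\<^sub>R F x) (at x)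
      = (\<lambda>v. f x *\<^sub>R frechet_derivative F (at x) v + frechet_derivative f (at x) v *\<^sub>R F x)"
    by (rule frechet_derivative_at[symmetric])
  moreover have "frechet_derivative f (at x) (F x) = (\<Sum>i\<in>UNIV. frechet_derivative f (at x) (axis i 1) * F x $ i)"
    by (subst linear_vec3_expansion[OF linear_frechet_derivative[OF f], of "F x"]) (simp add: sum_3 algebra_simps)
  ultimately show ?thesis
    by (simp add: divergence_def sum.distrib sum_distrib_left algebra_simps)
qed

lemma integral_divergence_zero:
  assumes F: "Ck (Suc 0) F" and b: "bounded (supp F)"
  shows "integral UNIV (divergence F) = 0"
proof -
  have i: "(\<lambda>x. frechet_derivative F (at x) (axis i 1)) integrable_on UNIV" for i
    by (intro integrable_on_bounded_support[OF _ b] continuous_on_frechet_derivative[OF F]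
        continuous_intros frechet_derivative_zero_outside_supp)
  have j: "(\<lambda>x. frechet_derivative F (at x) (axis i 1) $ i) integrable_on UNIV" for i
    using integrable_linear[OF i bounded_linear_vec_nth[of i]] by (simp add: o_def)
  have "integral UNIV (\<lambda>x. frechet_derivative F (at x) (axis i 1) $ i) = 0" for i
    using integral_linear[OF i bounded_linear_vec_nth[of i]] integral_derivative_zero[OF F b]
    by (simp add: o_def)
  then show ?thesis
    unfolding divergence_def[abs_def] by (subst integral_sum) (auto simp: j)
qed

text \<open>The divergence theorem for the product of \<open>f\<close> and \<open>F\<close>. Only
  \<open>F\<close> has bounded support, so \<open>f\<close> may be built from charts defined on the
  whole space.\<close>

lemma integral_divergence_by_parts:
  assumes f: "Ck (Suc 0) f" and F: "Ck (Suc 0) F" and b: "bounded (supp F)"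
  shows "integral UNIV (\<lambda>x. frechet_derivative f (at x) (F x)) = - integral UNIV (\<lambda>x. f x * divergence F x)"
proof -
  have sub: "supp (\<lambda>x. f x *\<^sub>R F x) \<subseteq> supp F"
    by (intro supp_subset closed_supp) (simp add: supp_zero)
  have F0: "divergence F x = 0" if "x \<notin> supp F" for x
    using frechet_derivative_zero_outside_supp[OF that] by (simp add: divergence_def)
  have D0: "frechet_derivative f (at x) 0 = 0" for x
    using f by (intro linear_0 linear_frechet_derivative) simp
  have "0 = integral UNIV (divergence (\<lambda>x. f x *\<^sub>R F x))"
    using integral_divergence_zero[OF Ck_scaleR[OF f F] bounded_subset[OF b sub]] by simp
  also have "divergence (\<lambda>x. f x *\<^sub>R F x) = (\<lambda>x. frechet_derivative f (at x) (F x) + f x * divergence F x)"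
    using f F by (intro ext divergence_scaleR) auto
  also have "integral UNIV \<dots> = integral UNIV (\<lambda>x. frechet_derivative f (at x) (F x)) + integral UNIV (\<lambda>x. f x * divergence F x)"
    by (intro integral_add integrable_on_bounded_support[OF _ b] continuous_on_frechet_derivative[OF f]
        continuous_intros continuous_on_divergence[OF F] Ck_imp_continuous[OF F] Ck_imp_continuous[OF f])
      (simp_all add: F0 D0 supp_zero)
  finally show ?thesis by simp
qed

section \<open>The fundamental lemma of the calculus of variations in L^2\<close>

lemma AE_zero_of_box_integrals:
  fixes f :: "'a::euclidean_space \<Rightarrow> real"
  assumes f: "integrable lebesgue f" and total: "(LINT x|lebesgue. f x) = 0"
    and box: "\<And>a b. (LINT x:box a b|lebesgue. f x) = 0"
  shows "AE x in lebesgue. f x = 0"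
proof -
  have si: "set_integrable lebesgue A f" if "A \<in> sets lebesgue" for A
    unfolding set_integrable_def using f that by (rule integrable_mult_indicator[rotated])
  have bo: "A \<in> sets lebesgue" if "A \<in> sets borel" for A :: "'a set" using that by simp
  let ?E = "range (\<lambda>(a, b). box a b :: 'a set)"
  have borel0: "(LINT x:A|lebesgue. f x) = 0" if A: "A \<in> sets borel" for A
  proof -
    \<comment> \<open>Dynkin's lemma: the open boxes are stable under intersection and generate the
      Borel sets. The case of complements rests on \<open>total\<close>.\<close>
    have st: "Int_stable ?E" by (auto simp: Int_stable_def box_Int_box)
    have borel_eq: "sets (borel :: 'a measure) = sigma_sets UNIV ?E"
      by (subst borel_eq_box) (simp add: sets_measure_of)
    have "?E \<subseteq> Pow UNIV" "A \<in> sigma_sets UNIV ?E" using A borel_eq by auto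
    with st show ?thesis
    proof (induction rule: sigma_sets_induct_disjoint)
      case (basic A)
      then show ?case using box by auto
    next
      case empty
      then show ?case by (simp add: set_lebesgue_integral_def)
    next
      case (compl A)
      have A: "A \<in> sets lebesgue" using compl(1) borel_eq bo by blast
      have "(LINT x:A \<union> (UNIV - A)|lebesgue. f x) = (LINT x:A|lebesgue. f x) + (LINT x:UNIV - A|lebesgue. f x)"
        using A by (intro set_integral_Un si) (auto intro: sets.Diff)
      moreover have "(LINT x:A \<union> (UNIV - A)|lebesgue. f x) = 0"
        using total by (simp add: set_lebesgue_integral_def)
      ultimately show ?case using compl by simp
    next
      case (union A)
      have A: "A i \<in> sets lebesgue" for i using union(2) borel_eq bo by blast
      have "(LINT x:(\<Union>i. A i)|lebesgue. f x) = (\<Sum>i. (LINT x:(A i)|lebesgue. f x))"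
        by (intro lebesgue_integral_countable_add A si sets.countable_UN)
           (use union(1) A in \<open>auto simp: disjoint_family_on_def\<close>)
      then show ?case using union by simp
    qed
  qed
  show ?thesis
  proof (rule sigma_finite_measure.density_zero[OF _ f])
    show "sigma_finite_measure (lebesgue :: 'a measure)"
    proof
      obtain A :: "'a set set" where "countable A" "A \<subseteq> sets lborel" "\<Union>A = space lborel" "\<forall>a\<in>A. emeasure lborel a \<noteq> \<infinity>"
        using lborel.sigma_finite_countable by blast
      then show "\<exists>A::'a set set. countable A \<and> A \<subseteq> sets lebesgue \<and> \<Union>A = space lebesgue \<and> (\<forall>a\<in>A. emeasure lebesgue a \<noteq> \<infinity>)"
        by (intro exI[of _ A]) auto
    qed
    fix A :: "'a set" assume "A \<in> sets lebesgue"
    \<comment> \<open>A Lebesgue set is a Borel set up to a subset of a null set, which does not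
      affect the integral.\<close>
    then obtain S N N' where A: "A = S \<union> N" "N \<subseteq> N'" "N' \<in> null_sets lborel" "S \<in> sets lborel"
      by (rule sets_completionE)
    have S: "S \<in> sets lebesgue" using A(4) by simp
    have "AE x in lebesgue. x \<notin> N'"
      using A(3) by (intro AE_not_in) (simp add: null_sets_completionI)
    then have "AE x in lebesgue. indicator A x *\<^sub>R f x = indicator S x *\<^sub>R f x"
      by eventually_elim (use A in \<open>auto simp: indicator_def\<close>)
    then have "(LINT x:A|lebesgue. f x) = (LINT x:S|lebesgue. f x)"
      unfolding set_lebesgue_integral_def
      using si[OF \<open>A \<in> sets lebesgue\<close>] si[OF S] unfolding set_integrable_def
      by (intro integral_cong_AE) auto
    then show "(LINT x:A|lebesgue. f x) = 0" using borel0 A(4) by simp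
  qed
qed

text \<open>Each factor \<open>exp_inv (real (Suc k) * s)\<close> tends to 1 if \<open>s\<close> is
  positive and vanishes otherwise, so the product is smooth, supported in the closed box, and tends
  to the indicator of the open box. With \<open>k = 0\<close> it is also the unnormalised weight for
  averaging over displacements.\<close>

definition box_cutoff :: "real ^ 3 \<Rightarrow> real ^ 3 \<Rightarrow> nat \<Rightarrow> real ^ 3 \<Rightarrow> real" where
  "box_cutoff a b k x = (\<Prod>i\<in>UNIV. exp_inv (real (Suc k) * (x $ i - a $ i)) * exp_inv (real (Suc k) * (b $ i - x $ i)))"

lemma smooth_box_cutoff: "smooth (box_cutoff a b k)"
proof -
  have "Ck n (\<lambda>x :: real ^ 3. exp_inv (c * (x $ i - d)))" for n c d i
    by (intro Ck_compose[OF Ck_exp_inv] Ck_mult Ck_diff Ck_const Ck_bounded_linear[OF bounded_linear_vec_nth])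
  moreover have "Ck n (\<lambda>x :: real ^ 3. exp_inv (c * (d - x $ i)))" for n c d i
    by (intro Ck_compose[OF Ck_exp_inv] Ck_mult Ck_diff Ck_const Ck_bounded_linear[OF bounded_linear_vec_nth])
  ultimately show ?thesis
    unfolding smooth_def box_cutoff_def[abs_def] by (intro allI Ck_prod Ck_mult) auto
qed

lemma box_cutoff_bounds: "0 \<le> box_cutoff a b k x" "box_cutoff a b k x \<le> 1"
  unfolding box_cutoff_def
  by (auto intro!: prod_nonneg prod_le_1 mult_nonneg_nonneg mult_le_one exp_inv_nonneg exp_inv_le_1)

lemma box_cutoff_outside: "x \<notin> box a b \<Longrightarrow> box_cutoff a b k x = 0"
proof -
  assume "x \<notin> box a b"
  then obtain i where "\<not> (a $ i < x $ i \<and> x $ i < b $ i)" by (auto simp: mem_box_cart)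
  then have "exp_inv (real (Suc k) * (x $ i - a $ i)) * exp_inv (real (Suc k) * (b $ i - x $ i)) = 0"
    by (auto simp: exp_inv_eq zero_less_mult_iff)
  then show ?thesis unfolding box_cutoff_def by (intro prod_zero) auto
qed

lemma box_cutoff_tendsto: "(\<lambda>k. box_cutoff a b k x) \<longlonglongrightarrow> indicator (box a b) x"
proof (cases "x \<in> box a b")
  case True
  have e: "(\<lambda>k. exp_inv (real (Suc k) * c)) \<longlonglongrightarrow> 1" if "0 < c" for c
  proof -
    have "(\<lambda>k. exp (- (inverse (real (Suc k)) * (1 / c)))) \<longlonglongrightarrow> exp (- (0 * (1 / c)))"
      by (intro tendsto_intros LIMSEQ_inverse_real_of_nat)
    moreover have "exp_inv (real (Suc k) * c) = exp (- (inverse (real (Suc k)) * (1 / c)))" for k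
    proof -
      have "0 < real (Suc k) * c" using that by simp
      then show ?thesis by (simp add: exp_inv_eq divide_simps)
    qed
    ultimately show ?thesis by simp
  qed
  have "(\<lambda>k. box_cutoff a b k x) \<longlonglongrightarrow> (\<Prod>i\<in>(UNIV :: 3 set). 1 * 1)"
    unfolding box_cutoff_def using True by (intro tendsto_prod tendsto_mult e) (auto simp: mem_box_cart)
  then show ?thesis using True by simp
qed (simp add: box_cutoff_outside)

lemma smooth_scaleR: "smooth f \<Longrightarrow> smooth g \<Longrightarrow> smooth (\<lambda>x. f x *\<^sub>R g x)"
  by (simp add: smooth_def Ck_scaleR)

text \<open>Testing with \<open>box_cutoff\<close> times a constant vector and passing to the limit
  shows that the integral over every box with closure in \<Omega> vanishes. Countably many closed
  boxes exhaust \<Omega>, and their faces are null sets.\<close>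

lemma L2_fundamental_lemma:
  fixes g :: "real ^ 3 \<Rightarrow> 'b::euclidean_space"
  assumes \<Omega>: "open \<Omega>" "\<Omega> \<in> lmeasurable" and g: "g \<in> L2 \<Omega>"
    and zero: "\<And>\<phi>. \<phi> \<in> C_c_inf \<Omega> \<Longrightarrow> L2_inner \<Omega> g \<phi> = 0"
  shows "AE x in lebesgue_on \<Omega>. g x = 0"
proof -
  have S: "\<Omega> \<in> sets lebesgue" using \<Omega>(2) by (rule fmeasurableD)
  have ig: "integrable (lebesgue_on \<Omega>) (\<lambda>x. g x \<bullet> w)" for w
    using L2_integrable_norm(1)[OF \<Omega>(2) g] L2_measurable[OF g]
    by (simp add: integrable_norm_iff)
  have box0: "(LINT x|lebesgue_on \<Omega>. indicator (box a b) x * (g x \<bullet> w)) = 0" if "cbox a b \<subseteq> \<Omega>" for a b w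
  proof -
    have "(\<lambda>k. LINT x|lebesgue_on \<Omega>. box_cutoff a b k x * (g x \<bullet> w))
        \<longlonglongrightarrow> (LINT x|lebesgue_on \<Omega>. indicator (box a b) x * (g x \<bullet> w))"
    proof (rule integral_dominated_convergence[where w="\<lambda>x. norm (g x \<bullet> w)"])
      have "box_cutoff a b k \<in> borel_measurable (lebesgue_on \<Omega>)" for k
        using smooth_box_cutoff[of a b k] S
        by (intro continuous_imp_measurable_on_sets_lebesgue continuous_on_subset[OF Ck_imp_continuous[of 0]])
           (auto simp: smooth_def)
      then show "(\<lambda>x. box_cutoff a b k x * (g x \<bullet> w)) \<in> borel_measurable (lebesgue_on \<Omega>)" for k
        using borel_measurable_integrable[OF ig] by simp
      have "indicat_real (box a b) \<in> borel_measurable (lebesgue_on \<Omega>)"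
        by (intro measurable_restrict_space1 borel_measurable_indicator) simp
      then show "(\<lambda>x. indicator (box a b) x * (g x \<bullet> w)) \<in> borel_measurable (lebesgue_on \<Omega>)"
        using borel_measurable_integrable[OF ig] by simp
      show "integrable (lebesgue_on \<Omega>) (\<lambda>x. norm (g x \<bullet> w))" using ig by simp
      show "AE x in lebesgue_on \<Omega>. (\<lambda>k. box_cutoff a b k x * (g x \<bullet> w)) \<longlonglongrightarrow> indicator (box a b) x * (g x \<bullet> w)"
        by (intro AE_I2 tendsto_intros box_cutoff_tendsto)
      show "AE x in lebesgue_on \<Omega>. norm (box_cutoff a b k x * (g x \<bullet> w)) \<le> norm (g x \<bullet> w)" for k
        using box_cutoff_bounds[of a b k] by (intro AE_I2) (simp add: abs_mult mult_left_le_one_le)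
    qed
    moreover have "(LINT x|lebesgue_on \<Omega>. box_cutoff a b k x * (g x \<bullet> w)) = 0" for k
    proof -
      have sub: "supp (\<lambda>x. box_cutoff a b k x *\<^sub>R w) \<subseteq> cbox a b"
        by (intro supp_subset closed_cbox) (use box_cutoff_outside box_subset_cbox in fastforce)
      have "(\<lambda>x. box_cutoff a b k x *\<^sub>R w) \<in> C_c_inf \<Omega>"
        unfolding C_c_inf_def using that sub smooth_scaleR[OF smooth_box_cutoff, of "\<lambda>x. w"]
        by (auto simp: smooth_def Ck_const compact_eq_bounded_closed closed_supp intro: bounded_subset[OF bounded_cbox])
      from zero[OF this] show ?thesis by (simp add: L2_inner_def)
    qed
    ultimately show ?thesis by (simp add: LIMSEQ_const_iff)
  qed
  \<comment> \<open>Multiplied by the indicator of one admissible box, the component of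
    \<open>g\<close> becomes a function on the whole space, and its integral over any box is that
    over a smaller box inside \<Omega>.\<close>
  have cb: "AE x in lebesgue. x \<in> box c d \<longrightarrow> g x \<bullet> w = 0" if cd: "cbox c d \<subseteq> \<Omega>" for c d w
  proof -
    let ?f = "\<lambda>x. indicator (box c d) x * (g x \<bullet> w)"
    have bc: "box c d \<subseteq> \<Omega>" using cd box_subset_cbox by blast
    have f_eq: "?f x = indicator \<Omega> x *\<^sub>R ?f x" for x using bc by (auto simp: indicator_def)
    have conv: "(LINT x|lebesgue. indicator (box a b) x * ?f x) = 0"
      "integrable lebesgue (\<lambda>x. indicator (box a b) x * ?f x)" for a b
    proof -
      obtain a' b' where ab: "box a b \<inter> box c d = box a' b'" by (simp add: box_Int_box)
      have *: "indicator (box a b) x * ?f x = indicator \<Omega> x *\<^sub>R (indicator (box a' b') x * (g x \<bullet> w))" for x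
        unfolding ab[symmetric] using bc by (auto simp: indicator_def)
      have "integrable (lebesgue_on \<Omega>) (\<lambda>x. indicator (box a' b') x *\<^sub>R (g x \<bullet> w))"
      proof (rule Bochner_Integration.integrable_bound[OF ig])
        have "indicat_real (box a' b') \<in> borel_measurable (lebesgue_on \<Omega>)"
          by (intro measurable_restrict_space1 borel_measurable_indicator) simp
        then show "(\<lambda>x. indicator (box a' b') x *\<^sub>R (g x \<bullet> w)) \<in> borel_measurable (lebesgue_on \<Omega>)"
          using borel_measurable_integrable[OF ig] by simp
      qed (auto simp: indicator_def)
      then show "integrable lebesgue (\<lambda>x. indicator (box a b) x * ?f x)"
        unfolding * using S by (simp add: integrable_restrict_space)
      have "(LINT x|lebesgue_on \<Omega>. indicator (box a' b') x * (g x \<bullet> w)) = 0"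
      \<comment> \<open>When the intersection is empty, its corners are arbitrary and the closed box
        \<open>cbox a' b'\<close> may leave \<Omega>.\<close>
      proof (cases "box a' b' = {}")
        case False
        then have "cbox a' b' \<subseteq> cbox c d" using ab by (metis Int_lower2 closure_box closure_minimal closed_cbox box_subset_cbox order_trans)
        then show ?thesis using cd by (intro box0) blast
      qed simp
      then show "(LINT x|lebesgue. indicator (box a b) x * ?f x) = 0"
        unfolding * using S by (simp add: integral_restrict_space)
    qed
    have i: "integrable lebesgue ?f" "(LINT x|lebesgue. ?f x) = 0"
    proof -
      have "(\<lambda>x. indicator (box c d) x * ?f x) = ?f" by (auto simp: indicator_def)
      then show "integrable lebesgue ?f" "(LINT x|lebesgue. ?f x) = 0" using conv[of c d] by auto
    qed
    have "AE x in lebesgue. ?f x = 0"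
      by (rule AE_zero_of_box_integrals[OF i]) (use conv in \<open>simp add: set_lebesgue_integral_def\<close>)
    then show ?thesis by eventually_elim (auto simp: indicator_def split: if_splits)
  qed
  obtain \<D> where D: "countable \<D>" "\<D> \<subseteq> Pow \<Omega>" "\<And>X. X \<in> \<D> \<Longrightarrow> \<exists>a b. X = cbox a b" "\<Union>\<D> = \<Omega>"
    using open_countable_Union_open_cbox[OF \<Omega>(1)] by metis
  have "AE x in lebesgue. x \<in> X \<longrightarrow> g x = 0" if "X \<in> \<D>" for X
  proof -
    obtain c d where X: "X = cbox c d" using D(3)[OF \<open>X \<in> \<D>\<close>] by blast
    then have cd: "cbox c d \<subseteq> \<Omega>" using D(2) that by blast
    have "AE x in lebesgue. \<forall>w\<in>Basis. x \<in> box c d \<longrightarrow> g x \<bullet> w = 0"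
      by (intro AE_finite_allI finite_Basis cb cd)
    moreover have "AE x in lebesgue. x \<notin> cbox c d - box c d"
      by (intro AE_not_in) (simp add: negligible_iff_null_sets[symmetric] negligible_frontier_interval)
    ultimately show ?thesis
      by eventually_elim (auto simp: X euclidean_all_zero_iff)
  qed
  then have "AE x in lebesgue. \<forall>X\<in>\<D>. x \<in> X \<longrightarrow> g x = 0"
    by (subst AE_ball_countable[OF D(1)]) blast
  then have "AE x in lebesgue. x \<in> \<Omega> \<longrightarrow> g x = 0"
    by eventually_elim (use D(4) in blast)
  then show ?thesis using S by (simp add: AE_restrict_space_iff)
qed

section \<open>Weak curl and weak divergence\<close>

lemma open_bounded_lmeasurable: "open \<Omega> \<Longrightarrow> bounded \<Omega> \<Longrightarrow> \<Omega> \<in> lmeasurable"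
  by (rule lmeasurable_open)

lemma integral_lebesgue_on_supp:
  fixes f :: "'a::euclidean_space \<Rightarrow> 'b::euclidean_space"
  assumes \<Omega>: "\<Omega> \<in> sets lebesgue" and f: "continuous_on UNIV f" and b: "bounded S"
    and z: "\<And>x. x \<notin> S \<inter> \<Omega> \<Longrightarrow> f x = 0"
  shows "(LINT x|lebesgue_on \<Omega>. f x) = integral UNIV f"
proof -
  have i: "integrable lborel f" by (rule integrable_lborel_bounded_support[OF f b]) (use z in auto)
  have "(\<lambda>x. indicator \<Omega> x *\<^sub>R f x) = f" using z by (auto simp: indicator_def fun_eq_iff)
  then have "(LINT x|lebesgue_on \<Omega>. f x) = (LINT x|lebesgue. f x)"
    using \<Omega> by (simp add: integral_restrict_space)
  also have "\<dots> = (LINT x|lborel. f x)" using i by (intro integral_completion) auto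
  also have "\<dots> = integral UNIV f" using integral_lborel[OF i] by simp
  finally show ?thesis .
qed

lemma continuous_L2:
  fixes f :: "real ^ 3 \<Rightarrow> 'b::euclidean_space"
  assumes \<Omega>: "\<Omega> \<in> lmeasurable" "bounded \<Omega>" and f: "continuous_on UNIV f"
  shows "f \<in> L2 \<Omega>"
proof -
  interpret finite_measure "lebesgue_on \<Omega>"
    using \<Omega>(1) by (rule finite_measure_lebesgue_on)
  have S: "\<Omega> \<in> sets lebesgue" using \<Omega>(1) by (rule fmeasurableD)
  have m: "f \<in> borel_measurable (lebesgue_on \<Omega>)"
    using S by (intro continuous_imp_measurable_on_sets_lebesgue continuous_on_subset[OF f]) auto
  have "compact (f ` closure \<Omega>)"
    using \<Omega>(2) by (intro compact_continuous_image continuous_on_subset[OF f]) auto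
  then have "bounded (f ` closure \<Omega>)" by (rule compact_imp_bounded)
  then obtain C where "\<forall>y\<in>f ` closure \<Omega>. norm y \<le> C" unfolding bounded_iff by blast
  then have C: "norm (f x) \<le> C" if "x \<in> \<Omega>" for x using that closure_subset[of \<Omega>] by blast
  have "integrable (lebesgue_on \<Omega>) (\<lambda>x. (norm (f x))\<^sup>2)"
  proof (rule integrable_const_bound[where B="C\<^sup>2"])
    show "AE x in lebesgue_on \<Omega>. norm ((norm (f x))\<^sup>2) \<le> C\<^sup>2"
      using C by (intro AE_I2) (simp add: power_mono)
    show "(\<lambda>x. (norm (f x))\<^sup>2) \<in> borel_measurable (lebesgue_on \<Omega>)"
      using m by measurable
  qed
  with m show ?thesis by (simp add: L2_def)
qed

lemma divergence_cross3:
  assumes E: "E differentiable (at x)" and F: "F differentiable (at x)"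
  shows "divergence (\<lambda>x. cross3 (E x) (F x)) x = curl E x \<bullet> F x - E x \<bullet> curl F x"
proof -
  have bb: "bounded_bilinear cross3"
    using bilinear_cross by (simp add: bilinear_conv_bounded_bilinear)
  have "frechet_derivative (\<lambda>x. cross3 (E x) (F x)) (at x)
      = (\<lambda>v. cross3 (E x) (frechet_derivative F (at x) v) + cross3 (frechet_derivative E (at x) v) (F x))"
    by (rule frechet_derivative_at[symmetric], rule bounded_bilinear.FDERIV[OF bb])
       (intro has_frechet_derivative E F)+
  then show ?thesis
    unfolding divergence_def curl_def partial_def frechet_derivative_component[OF E] frechet_derivative_component[OF F]
    by (simp add: cross3_def inner_vec_def sum_3 vector_3 algebra_simps)
qed

lemma C_c_inf_Ck: "\<phi> \<in> C_c_inf \<Omega> \<Longrightarrow> Ck k \<phi>"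
  by (simp add: C_c_inf_def smooth_def)

lemma C_c_inf_supp: "\<phi> \<in> C_c_inf \<Omega> \<Longrightarrow> supp \<phi> \<subseteq> \<Omega>" "\<phi> \<in> C_c_inf \<Omega> \<Longrightarrow> bounded (supp \<phi>)"
  by (auto simp: C_c_inf_def compact_imp_bounded)

lemma curl_zero_outside_supp:
  assumes "F differentiable (at x)" "x \<notin> supp F" shows "curl F x = 0"
  unfolding curl_def partial_def frechet_derivative_component[OF assms(1)]
    frechet_derivative_zero_outside_supp[OF assms(2)]
  by (simp add: vec_eq_iff forall_3)

lemma grad_inner:
  assumes "f differentiable (at x)"
  shows "v \<bullet> grad f x = frechet_derivative f (at x) v"
  unfolding grad_def partial_def
  using linear_vec3_expansion[OF linear_frechet_derivative[OF assms], of v]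
  by (simp add: inner_vec_def sum_3)

text \<open>The difference of the two sides is the integral of the divergence of
  \<open>cross3 (F x) (\<phi> x)\<close>, a field with compact support in \<Omega>. It links the
  approximating fields of the boundary spaces to the weak curl.\<close>

lemma is_weak_curl_curl:
  assumes \<Omega>: "open \<Omega>" "bounded \<Omega>" and F: "Ck (Suc 0) F"
  shows "is_weak_curl \<Omega> F (curl F)"
  unfolding is_weak_curl_def
proof (intro conjI ballI)
  have L: "\<Omega> \<in> lmeasurable" using \<Omega> by (rule open_bounded_lmeasurable)
  then have S: "\<Omega> \<in> sets lebesgue" by (rule fmeasurableD)
  show curlL: "curl F \<in> L2 \<Omega>" using continuous_L2[OF L \<Omega>(2) continuous_on_curl[OF F]] .
  fix \<phi> :: "real ^ 3 \<Rightarrow> real ^ 3" assume \<phi>: "\<phi> \<in> C_c_inf \<Omega>"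
  have bb: "bounded_bilinear cross3"
    using bilinear_cross by (simp add: bilinear_conv_bounded_bilinear)
  have P: "Ck (Suc 0) \<phi>" using \<phi> by (rule C_c_inf_Ck)
  have PL: "\<phi> \<in> L2 \<Omega>" "curl \<phi> \<in> L2 \<Omega>" "F \<in> L2 \<Omega>"
    by (intro continuous_L2[OF L \<Omega>(2)] continuous_on_curl Ck_imp_continuous[OF P] Ck_imp_continuous[OF F] P)+
  have sub: "supp (\<lambda>x. cross3 (F x) (\<phi> x)) \<subseteq> supp \<phi>"
    by (intro supp_subset closed_supp) (simp add: supp_zero)
  have "L2_inner \<Omega> (curl F) \<phi> - L2_inner \<Omega> F (curl \<phi>) = (LINT x|lebesgue_on \<Omega>. curl F x \<bullet> \<phi> x - F x \<bullet> curl \<phi> x)"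
    unfolding L2_inner_def by (intro Bochner_Integration.integral_diff[symmetric] L2_integrable_inner curlL PL)
  also have "\<dots> = integral UNIV (\<lambda>x. curl F x \<bullet> \<phi> x - F x \<bullet> curl \<phi> x)"
  proof (rule integral_lebesgue_on_supp[OF S _ C_c_inf_supp(2)[OF \<phi>]])
    show "continuous_on UNIV (\<lambda>x. curl F x \<bullet> \<phi> x - F x \<bullet> curl \<phi> x)"
      by (intro continuous_intros continuous_on_curl Ck_imp_continuous[OF P] Ck_imp_continuous[OF F] P F)
    show "curl F x \<bullet> \<phi> x - F x \<bullet> curl \<phi> x = 0" if "x \<notin> supp \<phi> \<inter> \<Omega>" for x
    proof -
      have "x \<notin> supp \<phi>" using that C_c_inf_supp(1)[OF \<phi>] by blast
      then show ?thesis using curl_zero_outside_supp[of \<phi> x] P by (simp add: supp_zero)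
    qed
  qed
  also have "(\<lambda>x. curl F x \<bullet> \<phi> x - F x \<bullet> curl \<phi> x) = divergence (\<lambda>x. cross3 (F x) (\<phi> x))"
    using F P by (auto simp: divergence_cross3)
  also have "integral UNIV \<dots> = 0"
    by (rule integral_divergence_zero[OF Ck_bilinear[OF bb F P] bounded_subset[OF C_c_inf_supp(2)[OF \<phi>] sub]])
  finally show "L2_inner \<Omega> F (curl \<phi>) = L2_inner \<Omega> (curl F) \<phi>" by simp
qed

lemma is_weak_div_divergence:
  assumes \<Omega>: "open \<Omega>" "bounded \<Omega>" and F: "Ck (Suc 0) F"
  shows "is_weak_div \<Omega> F (divergence F)"
  unfolding is_weak_div_def
proof (intro conjI ballI)
  have L: "\<Omega> \<in> lmeasurable" using \<Omega> by (rule open_bounded_lmeasurable)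
  then have S: "\<Omega> \<in> sets lebesgue" by (rule fmeasurableD)
  show divL: "divergence F \<in> L2 \<Omega>" using continuous_L2[OF L \<Omega>(2) continuous_on_divergence[OF F]] .
  fix \<phi> :: "real ^ 3 \<Rightarrow> real" assume \<phi>: "\<phi> \<in> C_c_inf \<Omega>"
  have P: "Ck (Suc 0) \<phi>" using \<phi> by (rule C_c_inf_Ck)
  have G: "F x \<bullet> grad \<phi> x = frechet_derivative \<phi> (at x) (F x)" for x
    using P by (intro grad_inner) simp
  have out: "x \<notin> supp \<phi>" if "x \<notin> supp \<phi> \<inter> \<Omega>" for x using that C_c_inf_supp(1)[OF \<phi>] by blast
  have sub: "supp (\<lambda>x. \<phi> x *\<^sub>R F x) \<subseteq> supp \<phi>"
    by (intro supp_subset closed_supp) (simp add: supp_zero)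
  have c1: "continuous_on UNIV (\<lambda>x. frechet_derivative \<phi> (at x) (F x))"
    by (intro continuous_on_frechet_derivative[OF P] continuous_intros Ck_imp_continuous[OF F])
  have c2: "continuous_on UNIV (\<lambda>x. \<phi> x * divergence F x)"
    by (intro continuous_intros Ck_imp_continuous[OF P] continuous_on_divergence[OF F])
  have "L2_inner \<Omega> F (grad \<phi>) = integral UNIV (\<lambda>x. frechet_derivative \<phi> (at x) (F x))"
    unfolding L2_inner_def G
    by (rule integral_lebesgue_on_supp[OF S c1 C_c_inf_supp(2)[OF \<phi>]])
       (use out frechet_derivative_zero_outside_supp in blast)
  moreover have "L2_inner \<Omega> (divergence F) \<phi> = integral UNIV (\<lambda>x. \<phi> x * divergence F x)"
    unfolding L2_inner_def inner_real_def mult.commute[of "divergence F _"]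
    by (rule integral_lebesgue_on_supp[OF S c2 C_c_inf_supp(2)[OF \<phi>]])
       (use out supp_zero[of _ \<phi>] in fastforce)
  moreover have "integral UNIV (\<lambda>x. frechet_derivative \<phi> (at x) (F x)) + integral UNIV (\<lambda>x. \<phi> x * divergence F x)
      = integral UNIV (divergence (\<lambda>x. \<phi> x *\<^sub>R F x))"
  proof -
    have "divergence (\<lambda>x. \<phi> x *\<^sub>R F x) = (\<lambda>x. frechet_derivative \<phi> (at x) (F x) + \<phi> x * divergence F x)"
      using P F by (intro ext divergence_scaleR) auto
    moreover have "(\<lambda>x. frechet_derivative \<phi> (at x) (F x)) integrable_on UNIV"
      by (rule integrable_on_bounded_support[OF c1 C_c_inf_supp(2)[OF \<phi>]])
         (rule frechet_derivative_zero_outside_supp)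
    moreover have "(\<lambda>x. \<phi> x * divergence F x) integrable_on UNIV"
      by (rule integrable_on_bounded_support[OF c2 C_c_inf_supp(2)[OF \<phi>]]) (simp add: supp_zero)
    ultimately show ?thesis by (simp add: integral_add)
  qed
  moreover have "integral UNIV (divergence (\<lambda>x. \<phi> x *\<^sub>R F x)) = 0"
    by (rule integral_divergence_zero[OF Ck_scaleR[OF P F] bounded_subset[OF C_c_inf_supp(2)[OF \<phi>] sub]])
  ultimately show "L2_inner \<Omega> F (grad \<phi>) = - L2_inner \<Omega> (divergence F) \<phi>" by linarith
qed

lemma C_c_inf_L2:
  assumes "open \<Omega>" "bounded \<Omega>" "\<phi> \<in> C_c_inf \<Omega>"
  shows "\<phi> \<in> L2 \<Omega>"
  using assms by (intro continuous_L2 open_bounded_lmeasurable Ck_imp_continuous[OF C_c_inf_Ck])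

lemma C_c_inf_curl_L2:
  assumes "open \<Omega>" "bounded \<Omega>" "\<phi> \<in> C_c_inf \<Omega>"
  shows "curl \<phi> \<in> L2 \<Omega>"
  using is_weak_curl_curl[OF assms(1,2) C_c_inf_Ck[OF assms(3)]] by (simp add: is_weak_curl_def)

lemma C_c_inf_grad_L2:
  assumes "open \<Omega>" "bounded \<Omega>" "\<phi> \<in> C_c_inf \<Omega>"
  shows "grad \<phi> \<in> L2 \<Omega>"
proof (rule continuous_L2)
  show "\<Omega> \<in> lmeasurable" "bounded \<Omega>" using assms by (auto intro: lmeasurable_open)
  have "continuous_on UNIV (\<lambda>x. frechet_derivative \<phi> (at x) (axis i 1))" for i
    by (intro continuous_on_frechet_derivative[OF C_c_inf_Ck[OF assms(3)]] continuous_intros)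
  then show "continuous_on UNIV (grad \<phi>)"
    unfolding grad_def[abs_def] partial_def by (intro continuous_on_vec_lambda)
qed

text \<open>\<open>weak_curl\<close> is an arbitrary choice of representative; uniqueness almost
  everywhere is what allows it to be compared with a curl that is computed explicitly.\<close>

lemma is_weak_curl_unique:
  assumes \<Omega>: "open \<Omega>" "bounded \<Omega>" and G: "is_weak_curl \<Omega> E G" and G': "is_weak_curl \<Omega> E G'"
  shows "AE x in lebesgue_on \<Omega>. G x = G' x"
proof -
  have L: "G \<in> L2 \<Omega>" "G' \<in> L2 \<Omega>" using G G' by (auto simp: is_weak_curl_def)
  have "AE x in lebesgue_on \<Omega>. G x - G' x = 0"
  proof (rule L2_fundamental_lemma[OF \<Omega>(1) open_bounded_lmeasurable[OF \<Omega>] L2_diff[OF L]])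
    fix \<phi> :: "real ^ 3 \<Rightarrow> real ^ 3" assume "\<phi> \<in> C_c_inf \<Omega>"
    then show "L2_inner \<Omega> (\<lambda>x. G x - G' x) \<phi> = 0"
      using G G' L2_inner_diff_left[OF L C_c_inf_L2[OF \<Omega>]] by (simp add: is_weak_curl_def)
  qed
  then show ?thesis by simp
qed

lemma is_weak_div_unique:
  assumes \<Omega>: "open \<Omega>" "bounded \<Omega>" and G: "is_weak_div \<Omega> E G" and G': "is_weak_div \<Omega> E G'"
  shows "AE x in lebesgue_on \<Omega>. G x = G' x"
proof -
  have L: "G \<in> L2 \<Omega>" "G' \<in> L2 \<Omega>" using G G' by (auto simp: is_weak_div_def)
  have "AE x in lebesgue_on \<Omega>. G x - G' x = 0"
  proof (rule L2_fundamental_lemma[OF \<Omega>(1) open_bounded_lmeasurable[OF \<Omega>] L2_diff[OF L]])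
    fix \<phi> :: "real ^ 3 \<Rightarrow> real" assume "\<phi> \<in> C_c_inf \<Omega>"
    then show "L2_inner \<Omega> (\<lambda>x. G x - G' x) \<phi> = 0"
      using G G' L2_inner_diff_left[OF L C_c_inf_L2[OF \<Omega>]] by (simp add: is_weak_div_def)
  qed
  then show ?thesis by simp
qed

lemma is_weak_curl_diff:
  assumes \<Omega>: "open \<Omega>" "bounded \<Omega>" and E: "E \<in> L2 \<Omega>" "E' \<in> L2 \<Omega>"
    and G: "is_weak_curl \<Omega> E G" "is_weak_curl \<Omega> E' G'"
  shows "is_weak_curl \<Omega> (\<lambda>x. E x - E' x) (\<lambda>x. G x - G' x)"
  using G E unfolding is_weak_curl_def
  by (auto simp: L2_diff L2_inner_diff_left C_c_inf_L2[OF \<Omega>] C_c_inf_curl_L2[OF \<Omega>])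

lemma is_weak_div_diff:
  assumes \<Omega>: "open \<Omega>" "bounded \<Omega>" and E: "E \<in> L2 \<Omega>" "E' \<in> L2 \<Omega>"
    and G: "is_weak_div \<Omega> E G" "is_weak_div \<Omega> E' G'"
  shows "is_weak_div \<Omega> (\<lambda>x. E x - E' x) (\<lambda>x. G x - G' x)"
  using G E unfolding is_weak_div_def
  by (auto simp: L2_diff L2_inner_diff_left C_c_inf_L2[OF \<Omega>] C_c_inf_grad_L2[OF \<Omega>])

lemma is_weak_curl_weak_curl: "E \<in> R_space \<Omega> \<Longrightarrow> is_weak_curl \<Omega> E (weak_curl \<Omega> E)"
  using someI_ex[of "is_weak_curl \<Omega> E"] by (simp add: R_space_def weak_curl_def)

lemma is_weak_div_weak_div: "E \<in> D_space \<Omega> \<Longrightarrow> is_weak_div \<Omega> E (weak_div \<Omega> E)"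
  using someI_ex[of "is_weak_div \<Omega> E"] by (simp add: D_space_def weak_div_def)

lemma is_weak_curl_limit:
  assumes \<Omega>: "open \<Omega>" "bounded \<Omega>" and E: "L2_weakly_converges \<Omega> E E'" and G: "L2_weakly_converges \<Omega> G G'"
    and c: "\<And>n. is_weak_curl \<Omega> (E n) (G n)"
  shows "is_weak_curl \<Omega> E' G'"
  unfolding is_weak_curl_def
proof (intro conjI ballI)
  show "G' \<in> L2 \<Omega>" using G by (simp add: L2_weakly_converges_def)
  fix \<phi> :: "real ^ 3 \<Rightarrow> real ^ 3" assume p: "\<phi> \<in> C_c_inf \<Omega>"
  have "(\<lambda>n. L2_inner \<Omega> (E n) (curl \<phi>)) \<longlonglongrightarrow> L2_inner \<Omega> E' (curl \<phi>)"
    using E C_c_inf_curl_L2[OF \<Omega> p] by (simp add: L2_weakly_converges_def)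
  moreover have "(\<lambda>n. L2_inner \<Omega> (G n) \<phi>) \<longlonglongrightarrow> L2_inner \<Omega> G' \<phi>"
    using G C_c_inf_L2[OF \<Omega> p] by (simp add: L2_weakly_converges_def)
  ultimately show "L2_inner \<Omega> E' (curl \<phi>) = L2_inner \<Omega> G' \<phi>"
    using c p LIMSEQ_unique by (simp add: is_weak_curl_def)
qed

lemma is_weak_div_limit:
  assumes \<Omega>: "open \<Omega>" "bounded \<Omega>" and E: "L2_weakly_converges \<Omega> E E'" and G: "L2_weakly_converges \<Omega> G G'"
    and c: "\<And>n. is_weak_div \<Omega> (E n) (G n)"
  shows "is_weak_div \<Omega> E' G'"
  unfolding is_weak_div_def
proof (intro conjI ballI)
  show "G' \<in> L2 \<Omega>" using G by (simp add: L2_weakly_converges_def)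
  fix \<phi> :: "real ^ 3 \<Rightarrow> real" assume p: "\<phi> \<in> C_c_inf \<Omega>"
  have "(\<lambda>n. L2_inner \<Omega> (E n) (grad \<phi>)) \<longlonglongrightarrow> L2_inner \<Omega> E' (grad \<phi>)"
    using E C_c_inf_grad_L2[OF \<Omega> p] by (simp add: L2_weakly_converges_def)
  moreover have "(\<lambda>n. - L2_inner \<Omega> (G n) \<phi>) \<longlonglongrightarrow> - L2_inner \<Omega> G' \<phi>"
    using G C_c_inf_L2[OF \<Omega> p] by (intro tendsto_minus) (simp add: L2_weakly_converges_def)
  ultimately show "L2_inner \<Omega> E' (grad \<phi>) = - L2_inner \<Omega> G' \<phi>"
    using c p LIMSEQ_unique by (simp add: is_weak_div_def)
qed

section \<open>Expanding maps and Lebesgue measure\<close>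

text \<open>A replacement for the change of variables formula that involves no Jacobian. The
  preimage of a ball of radius \<open>r\<close> lies in a ball of radius \<open>3 * L * r\<close>
  about one of its own points. Vitali's theorem fills an open set with disjoint balls up to a null
  set, whose preimage is a Lipschitz image of a null set; a Borel set is approximated from outside
  by open ones.\<close>

lemma emeasure_vimage_expanding_le:
  fixes T :: "'a::euclidean_space \<Rightarrow> 'a"
  assumes A: "A \<in> sets lebesgue" and T: "continuous_on A T" and L: "0 < L"
    and exp: "\<And>x y. x \<in> A \<Longrightarrow> y \<in> A \<Longrightarrow> dist x y \<le> L * dist (T x) (T y)"
    and B: "B \<in> sets borel"
  shows "emeasure lebesgue {x \<in> A. T x \<in> B} \<le> ennreal ((3 * L) ^ DIM('a)) * emeasure lborel B"
proof -
  have mT: "T \<in> borel_measurable (lebesgue_on A)"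
    using T A by (rule continuous_imp_measurable_on_sets_lebesgue)
  have meas: "{x \<in> A. T x \<in> X} \<in> sets lebesgue" if "X \<in> sets borel" for X
  proof -
    have "T -` X \<inter> space (lebesgue_on A) \<in> sets (lebesgue_on A)"
      using mT that by (rule measurable_sets)
    moreover have "T -` X \<inter> space (lebesgue_on A) = {x \<in> A. T x \<in> X}"
      using A by auto
    ultimately show ?thesis using A by (simp add: sets_restrict_space_iff)
  qed
  have inj: "inj_on T A"
    using exp by (intro inj_onI) (metis dist_eq_0_iff dist_le_zero_iff mult_zero_right)
  let ?g = "inv_into A T"
  have g: "norm (?g u - ?g v) \<le> L * norm (u - v)" if "u \<in> T ` A" "v \<in> T ` A" for u v
    using exp[of "?g u" "?g v"] that by (simp add: dist_norm f_inv_into_f inv_into_into)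
  have neg: "negligible {x \<in> A. T x \<in> N}" if "negligible N" for N
  proof -
    have "negligible (?g ` (N \<inter> T ` A))"
    proof (rule negligible_locally_Lipschitz_image)
      show "negligible (N \<inter> T ` A)" using that by (rule negligible_subset) auto
      show "\<exists>S B. open S \<and> x \<in> S \<and> (\<forall>y\<in>(N \<inter> T ` A) \<inter> S. norm (?g y - ?g x) \<le> B * norm (y - x))"
        if "x \<in> N \<inter> T ` A" for x
        using that g by (intro exI[of _ UNIV] exI[of _ L]) auto
    qed simp
    moreover have "{x \<in> A. T x \<in> N} \<subseteq> ?g ` (N \<inter> T ` A)"
      using inj by (auto simp: image_iff) (metis IntI imageI inv_into_f_f)
    ultimately show ?thesis by (rule negligible_subset)
  qed
  have ball_le: "emeasure lebesgue {x \<in> A. T x \<in> ball c r}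
      \<le> ennreal ((3 * L) ^ DIM('a)) * emeasure lebesgue (ball c r)" for c r
  proof (cases "{x \<in> A. T x \<in> ball c r} = {}")
    case True
    then show ?thesis by (metis emeasure_empty zero_le)
  next
    case False
    then obtain x0 where x0: "x0 \<in> A" "T x0 \<in> ball c r" by auto
    then have r: "0 < r" by (metis mem_ball zero_le_dist le_less_trans)
    have "{x \<in> A. T x \<in> ball c r} \<subseteq> ball x0 (3 * L * r)"
    proof
      fix x assume x: "x \<in> {x \<in> A. T x \<in> ball c r}"
      have "dist (T x0) (T x) \<le> dist c (T x0) + dist c (T x)" by (metis dist_triangle dist_commute)
      then have "dist (T x0) (T x) < 3 * r" using x x0(2) r by auto
      then have "L * dist (T x0) (T x) < L * (3 * r)" using L by (rule mult_strict_left_mono)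
      then show "x \<in> ball x0 (3 * L * r)" using exp[OF x0(1), of x] x by (simp add: algebra_simps)
    qed
    then have "emeasure lebesgue {x \<in> A. T x \<in> ball c r} \<le> emeasure lebesgue (ball x0 (3 * L * r))"
      by (intro emeasure_mono) auto
    also have "\<dots> = ennreal ((3 * L * r) ^ DIM('a)) * emeasure lebesgue (ball (0::'a) 1)"
      using L r by (intro emeasure_lebesgue_ball_conv_unit_ball) simp
    also have "\<dots> = ennreal ((3 * L) ^ DIM('a)) * emeasure lebesgue (ball c r)"
      using L r by (subst emeasure_lebesgue_ball_conv_unit_ball[of r c])
        (auto simp: power_mult_distrib ennreal_mult' mult.assoc)
    finally show ?thesis .
  qed
  have open_le: "emeasure lebesgue {x \<in> A. T x \<in> S} \<le> ennreal ((3 * L) ^ DIM('a)) * emeasure lebesgue S"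
    if S: "open S" for S
  proof -
    \<comment> \<open>All balls inside \<open>S\<close>, as pairs of centre and radius. Every point
      of \<open>S\<close> is the centre of arbitrarily small ones, as Vitali's theorem
      requires.\<close>
    define K where "K = {(c, r). ball c r \<subseteq> S}"
    have K: "\<exists>i. i \<in> K \<and> x \<in> ball (fst i) (snd i) \<and> snd i < d" if xd: "x \<in> S" "0 < d" for x d
    proof -
      obtain e where e: "0 < e" "ball x e \<subseteq> S" using S xd(1) openE by blast
      have "ball x (min e (d / 2)) \<subseteq> S" using e(2) by (auto simp: subset_eq)
      then show ?thesis using e(1) xd(2) by (intro exI[of _ "(x, min e (d / 2))"]) (auto simp: K_def)
    qed
    obtain C where C: "countable C" "C \<subseteq> K"
      "pairwise (\<lambda>i j. disjnt (ball (fst i) (snd i)) (ball (fst j) (snd j))) C"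
      "negligible (S - (\<Union>i\<in>C. ball (fst i) (snd i)))"
      using Vitali_covering_theorem_balls[of S K fst snd, OF K] by blast
    let ?b = "\<lambda>i. ball (fst i) (snd i)"
    have dis: "disjoint_family_on ?b C"
      using C(3) by (auto simp: disjoint_family_on_def pairwise_def disjnt_def)
    then have dis': "disjoint_family_on (\<lambda>i. {x \<in> A. T x \<in> ?b i}) C"
      unfolding disjoint_family_on_def by blast
    let ?N = "S - (\<Union>i\<in>C. ?b i)"
    have "{x \<in> A. T x \<in> S} \<subseteq> (\<Union>i\<in>C. {x \<in> A. T x \<in> ?b i}) \<union> {x \<in> A. T x \<in> ?N}" by auto
    then have "emeasure lebesgue {x \<in> A. T x \<in> S}
        \<le> emeasure lebesgue ((\<Union>i\<in>C. {x \<in> A. T x \<in> ?b i}) \<union> {x \<in> A. T x \<in> ?N})"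
      using C(1) by (intro emeasure_mono sets.Un sets.countable_UN'' meas negligible_imp_sets neg C(4)) auto
    also have "\<dots> = emeasure lebesgue (\<Union>i\<in>C. {x \<in> A. T x \<in> ?b i})"
    proof (rule emeasure_Un_null_set)
      show "{x \<in> A. T x \<in> ?N} \<in> null_sets lebesgue"
        using neg[OF C(4)] by (simp only: negligible_iff_null_sets)
      show "(\<Union>i\<in>C. {x \<in> A. T x \<in> ?b i}) \<in> sets lebesgue"
        using C(1) by (intro sets.countable_UN'' meas) auto
    qed
    also have "\<dots> = (\<integral>\<^sup>+i. emeasure lebesgue {x \<in> A. T x \<in> ?b i} \<partial>count_space C)"
      using C(1) by (intro emeasure_UN_countable meas dis') auto
    also have "\<dots> \<le> (\<integral>\<^sup>+i. ennreal ((3 * L) ^ DIM('a)) * emeasure lebesgue (?b i) \<partial>count_space C)"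
      by (intro nn_integral_mono ball_le)
    also have "\<dots> = ennreal ((3 * L) ^ DIM('a)) * (\<integral>\<^sup>+i. emeasure lebesgue (?b i) \<partial>count_space C)"
      by (rule nn_integral_cmult) simp
    also have "(\<integral>\<^sup>+i. emeasure lebesgue (?b i) \<partial>count_space C) = emeasure lebesgue (\<Union>i\<in>C. ?b i)"
      using C(1) by (intro emeasure_UN_countable[symmetric] dis) auto
    also have "emeasure lebesgue (\<Union>i\<in>C. ?b i) \<le> emeasure lebesgue S"
      using S C(2) by (intro emeasure_mono UN_least) (auto simp: K_def split_beta dest!: subsetD[of C])
    finally show ?thesis by (simp add: mult_left_mono)
  qed
  show ?thesis
  proof (rule ennreal_le_epsilon)
    fix e :: real assume e: "0 < e"
    define M where "M = (3 * L) ^ DIM('a)"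
    have M: "0 < M" using L by (simp add: M_def)
    have "B \<in> sets lebesgue" using B by simp
    then obtain S where S: "open S" "B \<subseteq> S" "S - B \<in> lmeasurable" "emeasure lebesgue (S - B) < ennreal (e / M)"
      using sets_lebesgue_outer_open[of B "e / M"] e M by auto
    have "emeasure lebesgue {x \<in> A. T x \<in> B} \<le> emeasure lebesgue {x \<in> A. T x \<in> S}"
      using S by (intro emeasure_mono meas) auto
    also have "\<dots> \<le> ennreal M * emeasure lebesgue S" unfolding M_def by (rule open_le[OF S(1)])
    also have "emeasure lebesgue S = emeasure lebesgue (B \<union> (S - B))" using S(2) by (intro arg_cong[where f="emeasure lebesgue"]) auto
    also have "\<dots> \<le> emeasure lebesgue B + emeasure lebesgue (S - B)"
      using B S(1) by (intro emeasure_subadditive) auto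
    also have "\<dots> \<le> emeasure lebesgue B + ennreal (e / M)"
      using S(4) by (intro add_left_mono) simp
    also have "ennreal M * (emeasure lebesgue B + ennreal (e / M)) = ennreal M * emeasure lborel B + ennreal e"
      using M e B by (simp add: distrib_left ennreal_mult'[symmetric])
    finally show "emeasure lebesgue {x \<in> A. T x \<in> B} \<le> ennreal ((3 * L) ^ DIM('a)) * emeasure lborel B + ennreal e"
      unfolding M_def by (simp add: mult_left_mono)
  qed
qed

text \<open>The measure bound says that the pushforward of Lebesgue measure under \<open>T\<close>
  is dominated by a multiple of Lebesgue measure; integrals follow by monotonicity in the
  measure.\<close>

lemma nn_integral_expanding_le:
  fixes T :: "'a::euclidean_space \<Rightarrow> 'a"
  assumes A: "A \<in> sets lebesgue" and T: "continuous_on A T" and L: "0 < L"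
    and exp: "\<And>x y. x \<in> A \<Longrightarrow> y \<in> A \<Longrightarrow> dist x y \<le> L * dist (T x) (T y)"
    and f: "f \<in> borel_measurable borel"
  shows "(\<integral>\<^sup>+x. f (T x) \<partial>lebesgue_on A) \<le> ennreal ((3 * L) ^ DIM('a)) * (\<integral>\<^sup>+x. f x \<partial>lborel)"
proof -
  have mT: "T \<in> borel_measurable (lebesgue_on A)"
    using T A by (rule continuous_imp_measurable_on_sets_lebesgue)
  have "(\<integral>\<^sup>+x. f (T x) \<partial>lebesgue_on A) = (\<integral>\<^sup>+x. f x \<partial>distr (lebesgue_on A) borel T)"
    using mT f by (intro nn_integral_distr[symmetric]) auto
  also have "\<dots> \<le> (\<integral>\<^sup>+x. f x \<partial>scale_measure (ennreal ((3 * L) ^ DIM('a))) lborel)"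
  proof (rule nn_integral_mono_measure)
    show "distr (lebesgue_on A) borel T \<le> scale_measure (ennreal ((3 * L) ^ DIM('a))) lborel"
    proof (subst le_measure)
      show "\<forall>B\<in>sets (distr (lebesgue_on A) borel T).
          emeasure (distr (lebesgue_on A) borel T) B \<le> emeasure (scale_measure (ennreal ((3 * L) ^ DIM('a))) lborel) B"
      proof
        fix B assume "B \<in> sets (distr (lebesgue_on A) borel T)"
        then have B: "B \<in> sets borel" by simp
        have eq: "T -` B \<inter> space (lebesgue_on A) = {x \<in> A. T x \<in> B}" using A by auto
        have "emeasure (distr (lebesgue_on A) borel T) B = emeasure (lebesgue_on A) {x \<in> A. T x \<in> B}"
          using mT B eq by (simp add: emeasure_distr)
        also have "\<dots> = emeasure lebesgue {x \<in> A. T x \<in> B}"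
          using A by (intro emeasure_restrict_space) auto
        also have "\<dots> \<le> ennreal ((3 * L) ^ DIM('a)) * emeasure lborel B"
          by (rule emeasure_vimage_expanding_le[OF A T L exp B])
        finally show "emeasure (distr (lebesgue_on A) borel T) B \<le> emeasure (scale_measure (ennreal ((3 * L) ^ DIM('a))) lborel) B"
          by simp
      qed
    qed simp
  qed simp
  also have "\<dots> = ennreal ((3 * L) ^ DIM('a)) * (\<integral>\<^sup>+x. f x \<partial>lborel)"
    using f by (intro nn_integral_scale_measure) simp
  finally show ?thesis .
qed

section \<open>Mollification of Lipschitz maps\<close>

text \<open>The kernel is evaluated at \<open>y - x\<close>, so a derivative in \<open>x\<close>
  turns it into minus its own derivative. It is not normalised, because these derivatives, whose
  integrals vanish, have to be admissible kernels as well.\<close>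

definition mollify :: "('a::euclidean_space \<Rightarrow> real) \<Rightarrow> ('a \<Rightarrow> 'b::euclidean_space) \<Rightarrow> 'a \<Rightarrow> 'b" where
  "mollify \<kappa> f x = integral UNIV (\<lambda>y. \<kappa> (y - x) *\<^sub>R f y)"

lemma continuous_on_mollify_integrand:
  fixes f :: "'a::euclidean_space \<Rightarrow> 'b::euclidean_space"
  assumes "continuous_on UNIV \<kappa>" "continuous_on UNIV f"
  shows "continuous_on UNIV (\<lambda>y. \<kappa> (y - x) *\<^sub>R f y)"
  by (intro continuous_intros assms(2) continuous_on_compose2[OF assms(1)]) auto

lemma mollify_integrable:
  fixes f :: "'a::euclidean_space \<Rightarrow> 'b::euclidean_space"
  assumes "continuous_on UNIV \<kappa>" "continuous_on UNIV f" "\<And>z. r < norm z \<Longrightarrow> \<kappa> z = 0"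
  shows "(\<lambda>y. \<kappa> (y - x) *\<^sub>R f y) integrable_on UNIV"
  by (rule integrable_on_bounded_support[OF continuous_on_mollify_integrand[OF assms(1,2)] bounded_cball[of x r]])
     (use assms(3) in \<open>auto simp: dist_norm norm_minus_commute\<close>)

lemma mollify_has_derivative:
  fixes f :: "'a::euclidean_space \<Rightarrow> 'b::euclidean_space"
  assumes \<kappa>: "Ck (Suc 0) \<kappa>" and f: "continuous_on UNIV f" and r: "\<And>z. r < norm z \<Longrightarrow> \<kappa> z = 0"
  shows "(mollify \<kappa> f has_derivative (\<lambda>v. mollify (\<lambda>z. - frechet_derivative \<kappa> (at z) v) f x)) (at x)"
proof -
  have \<kappa>c: "continuous_on UNIV \<kappa>" using \<kappa> by (rule Ck_imp_continuous)
  have lin: "linear (frechet_derivative \<kappa> (at z))" for z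
    using \<kappa> by (intro linear_frechet_derivative) simp
  have bl: "bounded_linear (\<lambda>v. - frechet_derivative \<kappa> (at z) v *\<^sub>R w)" for z and w :: 'b
    using lin[of z] by (intro bounded_linear_scaleR_const bounded_linear_minus) (simp add: linear_conv_bounded_linear)
  have r': "frechet_derivative \<kappa> (at z) v = 0" if "r < norm z" for z v
  proof (rule frechet_derivative_zero_outside_supp, rule notI)
    assume "z \<in> supp \<kappa>"
    moreover have "supp \<kappa> \<subseteq> cball 0 r" using r by (intro supp_subset) auto
    ultimately show False using that by auto
  qed
  \<comment> \<open>The extra 1 gives one box of integration for all points of
    \<open>ball x 1\<close>, on which the integral is differentiated.\<close>
  obtain c where c: "cball x (r + 1) \<subseteq> cbox (-c) (c :: 'a)"
    using bounded_cball by (rule bounded_subset_cbox_zero)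
  let ?B = "cbox (-c) c"
  have out: "r < norm (y - x')" if "y \<notin> ?B" "x' \<in> ball x 1" for y x'
  proof -
    have "y \<notin> cball x (r + 1)" using that(1) c by blast
    then have "r + 1 < dist x y" by simp
    also have "\<dots> \<le> dist x x' + dist x' y" by (rule dist_triangle)
    finally show ?thesis using that(2) by (simp add: dist_norm norm_minus_commute)
  qed
  have eq: "integral ?B (\<lambda>y. \<kappa> (y - x') *\<^sub>R f y) = mollify \<kappa> f x'" if "x' \<in> ball x 1" for x'
    unfolding mollify_def by (rule integral_cbox_eq_UNIV) (use out[OF _ that] r in auto)
  let ?fx = "\<lambda>x' y. Blinfun (\<lambda>v. - frechet_derivative \<kappa> (at (y - x')) v *\<^sub>R f y)"
  have app: "blinfun_apply (?fx x' y) v = - frechet_derivative \<kappa> (at (y - x')) v *\<^sub>R f y" for x' y v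
    using bl by (simp add: bounded_linear_Blinfun_apply)
  have cont: "continuous_on S (\<lambda>(x', y). ?fx x' y)" for S
  proof (rule continuous_on_blinfun_componentwise)
    fix v :: 'a
    have "continuous_on S (\<lambda>p. - frechet_derivative \<kappa> (at (snd p - fst p)) v *\<^sub>R f (snd p))"
      by (intro continuous_intros continuous_on_frechet_derivative[OF \<kappa>] continuous_on_compose2[OF f]) auto
    then show "continuous_on S (\<lambda>p. blinfun_apply (case p of (x', y) \<Rightarrow> ?fx x' y) v)"
      by (simp only: split_beta app)
  qed
  have "((\<lambda>x'. integral ?B (\<lambda>y. \<kappa> (y - x') *\<^sub>R f y)) has_derivative
      integral ?B (?fx x)) (at x within ball x 1)"
  proof (rule leibniz_rule[where fx="?fx"])
    fix x' y
    have "((\<lambda>x'. \<kappa> (y - x')) has_derivative (\<lambda>v. frechet_derivative \<kappa> (at (y - x')) (- v))) (at x' within ball x 1)"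
      by (rule has_derivative_compose[where g=\<kappa>, OF _ Ck_Suc_has_derivative[OF \<kappa>]]) (auto intro!: derivative_eq_intros)
    then have "((\<lambda>x'. \<kappa> (y - x') *\<^sub>R f y) has_derivative (\<lambda>v. frechet_derivative \<kappa> (at (y - x')) (- v) *\<^sub>R f y)) (at x' within ball x 1)"
      by (rule has_derivative_scaleR_left)
    then show "((\<lambda>x'. \<kappa> (y - x') *\<^sub>R f y) has_derivative blinfun_apply (?fx x' y)) (at x' within ball x 1)"
      by (simp only: bounded_linear_Blinfun_apply[OF bl] linear_neg[OF lin])
  next
    show "(\<lambda>y. \<kappa> (y - x') *\<^sub>R f y) integrable_on ?B" for x'
      by (intro integrable_continuous continuous_on_subset[OF continuous_on_mollify_integrand[OF \<kappa>c f]]) simp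
  next
    show "continuous_on (ball x 1 \<times> ?B) (\<lambda>(x', y). ?fx x' y)" by (rule cont)
  qed auto
  then have 1: "((\<lambda>x'. integral ?B (\<lambda>y. \<kappa> (y - x') *\<^sub>R f y)) has_derivative integral ?B (?fx x)) (at x)"
    using at_within_open[of x "ball x 1"] by simp
  have "blinfun_apply (integral ?B (?fx x)) v = mollify (\<lambda>z. - frechet_derivative \<kappa> (at z) v) f x" for v
  proof -
    have "continuous_on ?B (\<lambda>y. (\<lambda>(x', y). ?fx x' y) (x, y))"
      by (rule continuous_on_compose2[OF cont[of UNIV]]) (intro continuous_intros, simp)
    then have "continuous_on ?B (?fx x)" by (simp only: prod.case)
    then have int: "?fx x integrable_on ?B" by (rule integrable_continuous)
    have "blinfun_apply (integral ?B (?fx x)) v = integral ?B (\<lambda>y. blinfun_apply (?fx x y) v)"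
      using integral_linear[OF int blinfun.bounded_linear_left[of v]] by (simp add: o_def)
    also have "\<dots> = mollify (\<lambda>z. - frechet_derivative \<kappa> (at z) v) f x"
      unfolding app mollify_def by (rule integral_cbox_eq_UNIV) (use out[of _ x] r' in auto)
    finally show ?thesis .
  qed
  then have "blinfun_apply (integral ?B (?fx x)) = (\<lambda>v. mollify (\<lambda>z. - frechet_derivative \<kappa> (at z) v) f x)" by auto
  with 1 have 2: "((\<lambda>x'. integral ?B (\<lambda>y. \<kappa> (y - x') *\<^sub>R f y)) has_derivative
      (\<lambda>v. mollify (\<lambda>z. - frechet_derivative \<kappa> (at z) v) f x)) (at x)" by simp
  show ?thesis
    by (rule has_derivative_transform_within_open[OF 2 open_ball[of x 1]]) (use eq in auto)
qed

lemma derivative_zero_outside_ball: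
  assumes "\<And>z. r < norm z \<Longrightarrow> \<kappa> z = 0" "r < norm z"
  shows "- frechet_derivative \<kappa> (at z) v = 0"
proof -
  have "supp \<kappa> \<subseteq> cball 0 r" using assms(1) by (intro supp_subset) auto
  then have "z \<notin> supp \<kappa>" using assms(2) by auto
  then show ?thesis using frechet_derivative_zero_outside_supp by simp
qed

text \<open>A directional derivative of a mollification is a mollification with another kernel,
  which gives the induction. It proves the claim for \<open>Suc k\<close>, because the continuity of
  a mollification is read off from its differentiability.\<close>

lemma Ck_mollify:
  fixes f :: "'a::euclidean_space \<Rightarrow> 'b::euclidean_space"
  assumes "smooth \<kappa>" "continuous_on UNIV f" "\<And>z. r < norm z \<Longrightarrow> \<kappa> z = 0"
  shows "Ck k (mollify \<kappa> f)"
proof -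
  have s: "smooth \<kappa> \<Longrightarrow> Ck l \<kappa>" for l \<kappa> by (simp add: smooth_def)
  have suc: "Ck (Suc k) (mollify \<kappa> f)"
    using assms(1,3)
  proof (induction k arbitrary: \<kappa>)
    case 0
    have "continuous_on UNIV (mollify (\<lambda>z. - frechet_derivative \<kappa> (at z) v) f)" for v
    proof -
      have k: "Ck (Suc 0) (\<lambda>z. - frechet_derivative \<kappa> (at z) v)"
        by (intro Ck_minus Ck_Suc_derivative s 0)
      show ?thesis
        using has_derivative_continuous[OF mollify_has_derivative[OF k assms(2) derivative_zero_outside_ball[OF 0(2)]]]
        by (auto intro!: continuous_at_imp_continuous_on)
    qed
    then show ?case
      by (intro Ck_SucI[OF mollify_has_derivative[OF s[OF 0(1)] assms(2) 0(2)]]) auto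
  next
    case (Suc k)
    have "smooth (\<lambda>z. - frechet_derivative \<kappa> (at z) v)" for v
      using Suc.prems(1) unfolding smooth_def by (intro allI Ck_minus Ck_Suc_derivative) auto
    then have "Ck (Suc k) (mollify (\<lambda>z. - frechet_derivative \<kappa> (at z) v) f)" for v
      by (intro Suc.IH derivative_zero_outside_ball[OF Suc.prems(2)])
    then show ?case
      by (intro Ck_SucI[OF mollify_has_derivative[OF s[OF Suc.prems(1)] assms(2) Suc.prems(2)]])
  qed
  then show ?thesis by (rule Ck_Suc_imp)
qed

section \<open>Smoothing a Lipschitz map with a radial kernel\<close>

definition bump :: "real \<Rightarrow> 'a::euclidean_space \<Rightarrow> real" where
  "bump r x = exp_inv (r\<^sup>2 - x \<bullet> x)"

lemma Ck_inner_self: "Ck k (\<lambda>x :: 'a::euclidean_space. x \<bullet> x)"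
  by (intro Ck_inner Ck_bounded_linear bounded_linear_ident)

lemma Ck_bump: "Ck k (bump r)"
  unfolding bump_def[abs_def] by (intro Ck_compose[OF Ck_exp_inv] Ck_diff Ck_const Ck_inner_self)

lemma bump_nonneg: "0 \<le> bump r x"
  by (simp add: bump_def exp_inv_nonneg)

lemma bump_outside: "r < norm x \<Longrightarrow> 0 < r \<Longrightarrow> bump r x = 0"
  by (simp add: bump_def exp_inv_eq dot_square_norm power_strict_mono less_imp_le not_less)

text \<open>The explicit second derivative is a multiple of \<open>v \<bullet> w\<close> plus a
  multiple of \<open>(x \<bullet> v) * (x \<bullet> w)\<close>. Mollifications inherit the symmetry
  from their kernel, and the homotopy formula rests on it.\<close>

lemma bump_second_derivative_symmetric:
  "frechet_derivative (\<lambda>x. frechet_derivative (bump r) (at x) v) (at x) w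
    = frechet_derivative (\<lambda>x. frechet_derivative (bump r) (at x) w) (at x) v"
proof -
  define p where "p = [:0, 0, 1:] * (1 - pderiv (1 :: real poly))"
  define q where "q = [:0, 0, 1:] * (p - pderiv p)"
  have d1: "(bump r has_derivative (\<lambda>v. exp_inv_poly p (r\<^sup>2 - x \<bullet> x) * (- (2 * (x \<bullet> v))))) (at x)" for x :: 'a
  proof -
    have "((\<lambda>x. r\<^sup>2 - x \<bullet> x) has_derivative (\<lambda>v. - (2 * (x \<bullet> v)))) (at x)"
      by (auto intro!: derivative_eq_intros simp: inner_commute)
    from has_derivative_compose[OF this, of "exp_inv_poly 1", OF exp_inv_poly_has_derivative[unfolded has_field_derivative_def]]
    show ?thesis by (simp add: bump_def[abs_def] exp_inv_def p_def)
  qed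
  have e1: "frechet_derivative (bump r) (at x) v = exp_inv_poly p (r\<^sup>2 - x \<bullet> x) * (- (2 * (x \<bullet> v)))" for x v :: 'a
    using frechet_derivative_at[OF d1[of x]] by metis
  have d2: "((\<lambda>x. exp_inv_poly p (r\<^sup>2 - x \<bullet> x) * (- (2 * (x \<bullet> v)))) has_derivative
      (\<lambda>w. exp_inv_poly p (r\<^sup>2 - x \<bullet> x) * (- (2 * (w \<bullet> v)))
        + exp_inv_poly q (r\<^sup>2 - x \<bullet> x) * (- (2 * (x \<bullet> w))) * (- (2 * (x \<bullet> v))))) (at x)" for v x :: 'a
  proof -
    have "((\<lambda>x. r\<^sup>2 - x \<bullet> x) has_derivative (\<lambda>v. - (2 * (x \<bullet> v)))) (at x)"
      by (auto intro!: derivative_eq_intros simp: inner_commute)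
    from has_derivative_compose[OF this, of "exp_inv_poly p", OF exp_inv_poly_has_derivative[unfolded has_field_derivative_def]]
    have "((\<lambda>x. exp_inv_poly p (r\<^sup>2 - x \<bullet> x)) has_derivative (\<lambda>w. exp_inv_poly q (r\<^sup>2 - x \<bullet> x) * (- (2 * (x \<bullet> w))))) (at x)"
      by (simp add: q_def)
    moreover have "((\<lambda>x. - (2 * (x \<bullet> v))) has_derivative (\<lambda>w. - (2 * (w \<bullet> v)))) (at x)"
      by (auto intro!: derivative_eq_intros)
    ultimately show ?thesis by (rule has_derivative_mult)
  qed
  show ?thesis
    unfolding e1 frechet_derivative_at[OF d2, symmetric] by (simp add: inner_commute)
qed

lemma bump_integral_pos:
  assumes r: "0 < r"
  shows "0 < integral UNIV (bump r :: 'a::euclidean_space \<Rightarrow> real)"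
proof -
  have c: "continuous_on UNIV (bump r :: 'a \<Rightarrow> real)" using Ck_imp_continuous[OF Ck_bump[of 0]] .
  have z: "bump r x = 0" if "x \<notin> cball 0 r" for x :: 'a
    using that by (intro bump_outside r) simp
  have i: "(bump r :: 'a \<Rightarrow> real) integrable_on UNIV"
    by (rule integrable_on_bounded_support[OF c bounded_cball z])
  have n: "0 \<le> integral UNIV (bump r :: 'a \<Rightarrow> real)" by (rule integral_nonneg[OF i]) (simp add: bump_nonneg)
  have "integral UNIV (bump r :: 'a \<Rightarrow> real) \<noteq> 0"
  proof
    assume "integral UNIV (bump r :: 'a \<Rightarrow> real) = 0"
    obtain c' where c': "cball 0 r \<subseteq> cbox (-c') (c' :: 'a)"
      using bounded_cball by (rule bounded_subset_cbox_zero)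
    have i0: "integral (cbox (-c') c') (bump r :: 'a \<Rightarrow> real) = 0"
    proof (subst integral_cbox_eq_UNIV)
      fix x :: 'a assume "x \<notin> cbox (-c') c'"
      then have "x \<notin> cball 0 r" using c' by blast
      then show "bump r x = 0" by (rule z)
    qed fact
    have "(bump r :: 'a \<Rightarrow> real) integrable_on cbox (-c') c'"
      using i by (rule integrable_on_subcbox) simp
    from integrable_integral[OF this]
    have hi: "((bump r :: 'a \<Rightarrow> real) has_integral 0) (cbox (-c') c')" unfolding i0 .
    have "0 \<in> cball 0 r" using r by simp
    then have in0: "(0 :: 'a) \<in> cbox (-c') c'" using c' by blast
    have ne: "box (-c') c' \<noteq> {}"
    proof -
      have "c' \<bullet> b \<ge> r" if "b \<in> Basis" for b
      proof -
        have "r *\<^sub>R b \<in> cball 0 r" using r that by simp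
        then have "r *\<^sub>R b \<in> cbox (-c') c'" using c' by blast
        then have "(r *\<^sub>R b) \<bullet> b \<le> c' \<bullet> b" using that unfolding mem_box by blast
        then show ?thesis using that by (simp add: inner_Basis)
      qed
      then have "(-c') \<bullet> b < c' \<bullet> b" if "b \<in> Basis" for b
      proof -
        have "0 < c' \<bullet> b" using \<open>\<And>b. b \<in> Basis \<Longrightarrow> r \<le> c' \<bullet> b\<close>[OF that] r by linarith
        then show ?thesis by simp
      qed
      then show ?thesis unfolding box_ne_empty by blast
    qed
    have "bump r (0 :: 'a) = 0"
      by (rule has_integral_0_cbox_imp_0[OF continuous_on_subset[OF c] _ hi ne in0]) (simp_all add: bump_nonneg)
    moreover have "0 < bump r (0 :: 'a)" using r unfolding bump_def exp_inv_pos_iff by simp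
    ultimately show False by simp
  qed
  with n show ?thesis by simp
qed

lemma derivative_norm_le_of_Lipschitz:
  assumes d: "(f has_derivative f') (at x)" and L: "\<And>y. norm (f y - f x) \<le> L * norm (y - x)"
  shows "norm (f' v) \<le> L * norm v"
proof (rule field_le_epsilon)
  fix e :: real assume e: "0 < e"
  define e' where "e' = e / (norm v + 1)"
  have e': "0 < e'" using e by (simp add: e'_def add_nonneg_pos)
  obtain \<delta> where \<delta>: "0 < \<delta>" "\<And>y. norm (y - x) < \<delta> \<Longrightarrow> norm (f y - f x - f' (y - x)) \<le> e' * norm (y - x)"
    using d e' unfolding has_derivative_at_alt by blast
  \<comment> \<open>The vector is scaled into the range of \<open>\<delta>\<close>; linearity of
    \<open>f'\<close> removes the factor again. As in \<open>e'\<close>, the summand 1 covers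
    \<open>v = 0\<close>.\<close>
  define t where "t = \<delta> / (2 * (norm v + 1))"
  have t: "0 < t" using \<delta>(1) by (simp add: t_def add_nonneg_pos)
  have "t * norm v < \<delta>"
  proof -
    have "t * norm v \<le> t * (norm v + 1)" using t by simp
    also have "\<dots> = \<delta> / 2" using norm_ge_zero[of v] by (simp add: t_def field_simps add_nonneg_eq_0_iff)
    finally show ?thesis using \<delta>(1) by simp
  qed
  then have "norm (f (x + t *\<^sub>R v) - f x - f' (t *\<^sub>R v)) \<le> e' * (t * norm v)"
    using \<delta>(2)[of "x + t *\<^sub>R v"] t by simp
  moreover have "norm (f (x + t *\<^sub>R v) - f x) \<le> L * (t * norm v)"
    using L[of "x + t *\<^sub>R v"] t by simp
  moreover have "norm (f' (t *\<^sub>R v)) \<le> norm (f (x + t *\<^sub>R v) - f x) + norm (f (x + t *\<^sub>R v) - f x - f' (t *\<^sub>R v))"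
    by (metis norm_triangle_sub norm_minus_commute)
  ultimately have "t * norm (f' v) \<le> t * ((L + e') * norm v)"
    using t by (simp add: linear_scale[OF has_derivative_linear[OF d]] algebra_simps)
  then have "norm (f' v) \<le> (L + e') * norm v" using t by simp
  also have "\<dots> \<le> L * norm v + e"
  proof -
    have "e' * norm v \<le> e' * (norm v + 1)" using e' by simp
    also have "\<dots> = e" using norm_ge_zero[of v] by (simp add: e'_def add_nonneg_eq_0_iff)
    finally show ?thesis by (simp add: algebra_simps)
  qed
  finally show "norm (f' v) \<le> L * norm v + e" .
qed

text \<open>\<open>g\<close> averages values of \<open>f\<close> at distance at most
  \<open>r\<close>, hence the error \<open>L * r\<close>. Averaging commutes with translations, so
  \<open>g\<close> has the same Lipschitz constant \<open>L\<close>, which bounds its derivative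
  independently of \<open>r\<close>.\<close>

lemma Lipschitz_smooth_approximation:
  fixes f :: "'a::euclidean_space \<Rightarrow> 'b::euclidean_space"
  assumes L: "\<And>x y. norm (f x - f y) \<le> L * norm (x - y)" and r: "0 < r"
  obtains g where "smooth g" "\<And>x. norm (g x - f x) \<le> L * r"
    "\<And>x v. norm (frechet_derivative g (at x) v) \<le> L * norm v"
    "\<And>x v w. frechet_derivative (\<lambda>x. frechet_derivative g (at x) v) (at x) w
      = frechet_derivative (\<lambda>x. frechet_derivative g (at x) w) (at x) v"
proof -
  have L0: "0 \<le> L"
    using order_trans[OF norm_ge_zero L[of "SOME i. i \<in> Basis" 0]] by (simp add: SOME_Basis)
  have cf: "continuous_on UNIV f"
  proof -
    have "L-lipschitz_on UNIV f" using L L0 by (intro lipschitz_onI) (auto simp: dist_norm)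
    then show ?thesis by (rule lipschitz_on_continuous_on)
  qed
  define I where "I = integral UNIV (bump r :: 'a \<Rightarrow> real)"
  have I: "0 < I" using bump_integral_pos[OF r] by (simp add: I_def)
  have hI: "norm ((1 / I) *\<^sub>R w) \<le> c" if "norm w \<le> c * I" for w :: 'b and c
    using that I by (simp add: divide_le_eq)
  have sb: "smooth (bump r :: 'a \<Rightarrow> real)" by (simp add: smooth_def Ck_bump)
  have cb: "continuous_on UNIV (bump r :: 'a \<Rightarrow> real)" using Ck_imp_continuous[OF Ck_bump[of 0]] .
  have b0: "bump r z = 0" if "r < norm z" for z :: 'a using bump_outside that r by blast
  define g where "g x = (1 / I) *\<^sub>R mollify (bump r) f x" for x
  have one: "integral UNIV (\<lambda>y. bump r (y - x)) = I" for x :: 'a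
  proof -
    have "(bump r z :: real) = 0" if "z \<notin> cball 0 r" for z :: 'a using that by (intro b0) simp
    from integral_translation[of "bump r" "cball 0 r" "-x", OF cb bounded_cball this] show ?thesis by (simp add: I_def)
  qed
  have ib: "(\<lambda>y. bump r (y - x)) integrable_on UNIV" for x :: 'a
    using mollify_integrable[of "bump r" "\<lambda>_. 1::real" r x, OF cb continuous_on_const b0] by simp
  have if': "(\<lambda>y. bump r (y - x) *\<^sub>R h y) integrable_on UNIV" if "continuous_on UNIV h" for h :: "'a \<Rightarrow> 'b" and x :: 'a
    using mollify_integrable[of "bump r" h r x, OF cb that b0] .
  have s: "smooth g"
    unfolding smooth_def g_def[abs_def] by (intro allI Ck_scaleR Ck_const Ck_mollify[OF sb cf b0])
  have near: "norm (g x - f x) \<le> L * r" for x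
  proof -
    have "I *\<^sub>R f x = integral UNIV (\<lambda>y. bump r (y - x) *\<^sub>R f x)"
      using integral_linear[OF ib[of x] bounded_linear_scaleR_left[of "f x"]] by (simp add: o_def one)
    then have "mollify (bump r) f x - I *\<^sub>R f x = integral UNIV (\<lambda>y. bump r (y - x) *\<^sub>R f y - bump r (y - x) *\<^sub>R f x)"
      unfolding mollify_def by (simp add: integral_diff if' cf)
    moreover have "norm \<dots> \<le> integral UNIV (\<lambda>y. (L * r) * bump r (y - x))"
    proof (rule integral_norm_bound_integral)
      show "(\<lambda>y. bump r (y - x) *\<^sub>R f y - bump r (y - x) *\<^sub>R f x) integrable_on UNIV"
        by (intro integrable_diff if' cf continuous_on_const)
      show "(\<lambda>y. (L * r) * bump r (y - x)) integrable_on UNIV"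
        using integrable_cmul[OF ib[of x], of "L * r"] by simp
      fix y
      show "norm (bump r (y - x) *\<^sub>R f y - bump r (y - x) *\<^sub>R f x) \<le> L * r * bump r (y - x)"
      proof (cases "r < norm (y - x)")
        case True
        then show ?thesis by (simp add: b0)
      next
        case False
        have "norm (f y - f x) \<le> L * norm (y - x)" by (rule L)
        also have "\<dots> \<le> L * r" using False L0 by (intro mult_left_mono) auto
        finally show ?thesis
          using bump_nonneg[of r "y - x"] by (simp add: scaleR_diff_right[symmetric] mult.commute[of "bump r (y - x)"] mult_right_mono)
      qed
    qed
    moreover have "integral UNIV (\<lambda>y. (L * r) * bump r (y - x)) = L * r * I" by (simp add: one)
    ultimately have "norm (mollify (bump r) f x - I *\<^sub>R f x) \<le> L * r * I" by (simp only:)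
    moreover have "g x - f x = (1 / I) *\<^sub>R (mollify (bump r) f x - I *\<^sub>R f x)"
      using I by (simp add: g_def scaleR_diff_right)
    ultimately show ?thesis by (simp only: hI)
  qed
  have lip: "norm (g y - g x) \<le> L * norm (y - x)" for x y
  proof -
    \<comment> \<open>Both values are written with the kernel centred at \<open>x\<close>, so that
      their difference is an average of differences of \<open>f\<close> at points
      \<open>y - x\<close> apart.\<close>
    have "mollify (bump r) f y = integral UNIV (\<lambda>z. bump r (z - x) *\<^sub>R f (z + (y - x)))"
    proof -
      have "integral UNIV (\<lambda>z. (\<lambda>z. bump r (z - y) *\<^sub>R f z) (z + (y - x))) = integral UNIV (\<lambda>z. bump r (z - y) *\<^sub>R f z)"
        by (rule integral_translation[OF continuous_on_mollify_integrand[OF cb cf] bounded_cball[of y r]])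
           (use b0 in \<open>auto simp: dist_norm norm_minus_commute\<close>)
      then show ?thesis by (simp add: mollify_def algebra_simps)
    qed
    moreover have cf': "continuous_on UNIV (\<lambda>z. f (z + (y - x)))"
      by (intro continuous_on_compose2[OF cf] continuous_intros) auto
    ultimately have "mollify (bump r) f y - mollify (bump r) f x
        = integral UNIV (\<lambda>z. bump r (z - x) *\<^sub>R f (z + (y - x)) - bump r (z - x) *\<^sub>R f z)"
      unfolding mollify_def by (simp add: integral_diff if' cf)
    moreover have "norm \<dots> \<le> integral UNIV (\<lambda>z. (L * norm (y - x)) * bump r (z - x))"
    proof (rule integral_norm_bound_integral)
      show "(\<lambda>z. bump r (z - x) *\<^sub>R f (z + (y - x)) - bump r (z - x) *\<^sub>R f z) integrable_on UNIV"
        by (intro integrable_diff if' cf cf')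
      show "(\<lambda>z. (L * norm (y - x)) * bump r (z - x)) integrable_on UNIV"
        using integrable_cmul[OF ib[of x], of "L * norm (y - x)"] by simp
      show "norm (bump r (z - x) *\<^sub>R f (z + (y - x)) - bump r (z - x) *\<^sub>R f z) \<le> L * norm (y - x) * bump r (z - x)" for z
        using bump_nonneg[of r "z - x"] mult_right_mono[OF L[of "z + (y - x)" z] bump_nonneg[of r "z - x"]]
        by (simp add: scaleR_diff_right[symmetric] mult.commute[of "bump r (z - x)"])
    qed
    moreover have "integral UNIV (\<lambda>z. (L * norm (y - x)) * bump r (z - x)) = L * norm (y - x) * I" by (simp add: one)
    ultimately have "norm (mollify (bump r) f y - mollify (bump r) f x) \<le> L * norm (y - x) * I" by (simp only:)
    moreover have "g y - g x = (1 / I) *\<^sub>R (mollify (bump r) f y - mollify (bump r) f x)"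
      by (simp add: g_def scaleR_diff_right)
    ultimately show ?thesis by (simp only: hI)
  qed
  have dg: "norm (frechet_derivative g (at x) v) \<le> L * norm v" for x v
    using s by (intro derivative_norm_le_of_Lipschitz[OF Ck_Suc_has_derivative[of 0] lip]) (simp add: smooth_def del: Ck.simps)
  have g1: "frechet_derivative g (at x) v = (1 / I) *\<^sub>R mollify (\<lambda>z. - frechet_derivative (bump r) (at z) v) f x" for x v
  proof -
    have "(g has_derivative (\<lambda>v. (1 / I) *\<^sub>R mollify (\<lambda>z. - frechet_derivative (bump r) (at z) v) f x)) (at x)"
      unfolding g_def[abs_def] by (intro has_derivative_scaleR_right mollify_has_derivative[OF Ck_bump cf b0])
    from frechet_derivative_at[OF this] show ?thesis by metis
  qed
  have g2: "frechet_derivative (\<lambda>x. frechet_derivative g (at x) v) (at x) w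
      = (1 / I) *\<^sub>R mollify (\<lambda>z. frechet_derivative (\<lambda>z. frechet_derivative (bump r) (at z) v) (at z) w) f x" for x v w
  proof -
    let ?k = "\<lambda>z. - frechet_derivative (bump r) (at z) v"
    have k: "Ck (Suc 0) ?k" by (intro Ck_minus Ck_Suc_derivative Ck_bump)
    have "((\<lambda>x. (1 / I) *\<^sub>R mollify ?k f x) has_derivative
        (\<lambda>w. (1 / I) *\<^sub>R mollify (\<lambda>z. - frechet_derivative ?k (at z) w) f x)) (at x)"
      by (intro has_derivative_scaleR_right mollify_has_derivative[OF k cf derivative_zero_outside_ball[OF b0]])
    then have "frechet_derivative (\<lambda>x. frechet_derivative g (at x) v) (at x) w
        = (1 / I) *\<^sub>R mollify (\<lambda>z. - frechet_derivative ?k (at z) w) f x"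
      unfolding g1 using frechet_derivative_at by metis
    moreover have "- frechet_derivative ?k (at z) w
        = frechet_derivative (\<lambda>z. frechet_derivative (bump r) (at z) v) (at z) w" for z
    proof -
      have "(?k has_derivative (\<lambda>w. - frechet_derivative (\<lambda>z. frechet_derivative (bump r) (at z) v) (at z) w)) (at z)"
        by (intro has_derivative_minus Ck_Suc_has_derivative[of 0] Ck_Suc_derivative Ck_bump)
      from frechet_derivative_at[OF this] show ?thesis by (metis minus_minus)
    qed
    ultimately show ?thesis by simp
  qed
  show ?thesis
  proof (rule that[OF s near dg])
    show "frechet_derivative (\<lambda>x. frechet_derivative g (at x) v) (at x) w
        = frechet_derivative (\<lambda>x. frechet_derivative g (at x) w) (at x) v" for x v w
      unfolding g2 by (simp add: bump_second_derivative_symmetric[of r v _ w])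
  qed
qed

section \<open>The homotopy estimate for pulled back fields\<close>

text \<open>Cartan's formula for the pullback of the 1-form \<open>e\<close> along
  \<open>x \<mapsto> \<beta> (\<alpha> x + s *\<^sub>R t)\<close>: its derivative in
  \<open>s\<close> is the differential of the contraction \<open>g\<close> plus the contraction
  \<open>c\<close> of the curl with the velocity. Integration by parts moves the differential from
  \<open>g\<close> to the divergence of \<open>h\<close>. The three factors \<open>L\<close> come
  from the velocity and from the derivatives of \<open>\<beta>\<close> and \<open>\<alpha>\<close>
  applied to \<open>h\<close>; the divergence term has only one of them.\<close>

lemma homotopy_estimate:
  fixes \<alpha> \<beta> e h :: "real ^ 3 \<Rightarrow> real ^ 3"
  assumes \<alpha>: "Ck (Suc 0) \<alpha>" and \<beta>: "Ck (Suc (Suc 0)) \<beta>" and e: "Ck (Suc 0) e" and h: "Ck (Suc 0) h"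
    and L: "1 \<le> L" "\<And>x v. norm (frechet_derivative \<alpha> (at x) v) \<le> L * norm v"
      "\<And>x v. norm (frechet_derivative \<beta> (at x) v) \<le> L * norm v"
    and sym: "\<And>x v w. frechet_derivative (\<lambda>x. frechet_derivative \<beta> (at x) v) (at x) w
      = frechet_derivative (\<lambda>x. frechet_derivative \<beta> (at x) w) (at x) v"
    and supp: "supp h \<subseteq> cbox a b"
    and M: "\<And>s. s \<in> {0..1} \<Longrightarrow> integral (cbox a b) (\<lambda>x. norm (e (\<beta> (\<alpha> x + s *\<^sub>R t))) * \<bar>divergence h x\<bar>
      + norm (curl e (\<beta> (\<alpha> x + s *\<^sub>R t))) * norm (h x)) \<le> M"
  shows "\<bar>integral (cbox a b) (\<lambda>x. e (\<beta> (\<alpha> x + t)) \<bullet> frechet_derivative \<beta> (at (\<alpha> x + t)) (frechet_derivative \<alpha> (at x) (h x)))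
    - integral (cbox a b) (\<lambda>x. e (\<beta> (\<alpha> x)) \<bullet> frechet_derivative \<beta> (at (\<alpha> x)) (frechet_derivative \<alpha> (at x) (h x)))\<bar>
    \<le> L ^ 3 * norm t * M"
proof -
  let ?D = "\<lambda>f x. frechet_derivative f (at x)"
  let ?B = "cbox a b"
  have \<beta>1: "Ck (Suc 0) \<beta>" using \<beta> by (rule Ck_Suc_imp)
  have \<beta>2: "Ck (Suc 0) (\<lambda>z. ?D \<beta> z v)" for v using \<beta> by (rule Ck_Suc_derivative)
  define z where "z s x = \<alpha> x + s *\<^sub>R t" for s x
  define A where "A x = ?D \<alpha> x (h x)" for x
  \<comment> \<open>\<open>g\<close> pairs the form with the velocity of the homotopy,
    \<open>\<iota>\<close> pairs it with the transported field \<open>h\<close>, and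
    \<open>\<iota>'\<close> will be the derivative of \<open>\<iota>\<close> in
    \<open>s\<close>.\<close>
  define g where "g s x = e (\<beta> (z s x)) \<bullet> ?D \<beta> (z s x) t" for s x
  define \<iota> where "\<iota> s x = e (\<beta> (z s x)) \<bullet> ?D \<beta> (z s x) (A x)" for s x
  define \<iota>' where "\<iota>' s x = ?D e (\<beta> (z s x)) (?D \<beta> (z s x) t) \<bullet> ?D \<beta> (z s x) (A x)
    + e (\<beta> (z s x)) \<bullet> ?D (\<lambda>z. ?D \<beta> z t) (z s x) (A x)" for s x
  define c where "c s x = curl e (\<beta> (z s x)) \<bullet> cross3 (?D \<beta> (z s x) t) (?D \<beta> (z s x) (A x))" for s x
  note cont1 = Ck_imp_continuous[OF \<alpha>] Ck_imp_continuous[OF \<beta>] Ck_imp_continuous[OF e] Ck_imp_continuous[OF h]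
  have cz: "continuous_on S (\<lambda>p. z (s p) (x p))" if "continuous_on S s" "continuous_on S x" for S :: "'p::topological_space set" and s x
    unfolding z_def using that by (intro continuous_intros continuous_on_compose2[OF cont1(1)]) auto
  have cA: "continuous_on S (\<lambda>p. A (x p))" if "continuous_on S x" for S :: "'p::topological_space set" and x
    unfolding A_def using that
    by (intro continuous_on_frechet_derivative[OF \<alpha>] continuous_on_compose2[OF cont1(4)]) auto
  have c\<beta>: "continuous_on S (\<lambda>p. \<beta> (y p))" if "continuous_on S y" for S :: "'p::topological_space set" and y
    using that by (intro continuous_on_compose2[OF cont1(2)]) auto
  have ce: "continuous_on S (\<lambda>p. e (y p))" if "continuous_on S y" for S :: "'p::topological_space set" and y
    using that by (intro continuous_on_compose2[OF cont1(3)]) auto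
  have ccurl: "continuous_on S (\<lambda>p. curl e (y p))" if "continuous_on S y" for S :: "'p::topological_space set" and y
    using that by (intro continuous_on_compose2[OF continuous_on_curl[OF e, of UNIV]]) auto
  have c\<iota>: "continuous_on S (\<lambda>p. \<iota> (s p) (x p))" if "continuous_on S s" "continuous_on S x" for S :: "'p::topological_space set" and s x
    unfolding \<iota>_def using that
    by (intro continuous_on_inner ce c\<beta> cz cA continuous_on_frechet_derivative[OF \<beta>1])
  have c\<iota>': "continuous_on S (\<lambda>p. \<iota>' (s p) (x p))" if "continuous_on S s" "continuous_on S x" for S :: "'p::topological_space set" and s x
    unfolding \<iota>'_def using that
    by (intro continuous_on_add continuous_on_inner ce c\<beta> cz cA continuous_on_const
        continuous_on_frechet_derivative[OF \<beta>1] continuous_on_frechet_derivative[OF \<beta>2] continuous_on_frechet_derivative[OF e])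
  have cg: "continuous_on S (g s)" for S s
    unfolding g_def by (intro continuous_on_inner ce c\<beta> cz continuous_on_frechet_derivative[OF \<beta>1] continuous_intros)
  have cc: "continuous_on S (c s)" for S s
    unfolding c_def by (intro continuous_on_inner continuous_on_cross ccurl c\<beta> cz cA continuous_on_frechet_derivative[OF \<beta>1] continuous_intros)
  have dz: "((\<lambda>s. z s x) has_derivative (\<lambda>k. k *\<^sub>R t)) (at s within U)" for s x U
    unfolding z_def by (auto intro!: derivative_eq_intros)
  have lin: "linear (?D \<beta> y)" "linear (?D e y)" "linear (?D (\<lambda>z. ?D \<beta> z w) y)" "linear (?D \<alpha> y)" for y w
    using \<beta>1 e \<beta>2 \<alpha> by (auto intro!: linear_frechet_derivative)
  have d\<iota>: "((\<lambda>s. \<iota> s x) has_vector_derivative \<iota>' s x) (at s)" for s x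
  proof -
    have 1: "((\<lambda>s. e (\<beta> (z s x))) has_derivative (\<lambda>k. ?D e (\<beta> (z s x)) (?D \<beta> (z s x) (k *\<^sub>R t)))) (at s)"
      by (rule has_derivative_compose[where g=e, OF has_derivative_compose[where g=\<beta>, OF dz Ck_Suc_has_derivative[OF \<beta>]] Ck_Suc_has_derivative[OF e]])
    have 2: "((\<lambda>s. ?D \<beta> (z s x) (A x)) has_derivative (\<lambda>k. ?D (\<lambda>z. ?D \<beta> z (A x)) (z s x) (k *\<^sub>R t))) (at s)"
      by (rule has_derivative_compose[where g="\<lambda>z. ?D \<beta> z (A x)", OF dz Ck_Suc_has_derivative[OF \<beta>2]])
    \<comment> \<open>\<open>sym\<close> exchanges the directions \<open>t\<close> and
      \<open>A x\<close>, so that the second derivative of \<open>\<beta>\<close> takes the form in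
      which it occurs in the derivative of \<open>g\<close>.\<close>
    from has_derivative_inner[OF 1 2]
    show ?thesis
      unfolding \<iota>_def[abs_def] \<iota>'_def has_vector_derivative_def
      by (rule has_derivative_eq_rhs) (auto simp: fun_eq_iff linear_scale[OF lin(1)] linear_scale[OF lin(2)] linear_scale[OF lin(3)]
          sym[where v=t and w="A x"] algebra_simps)
  qed
  have dg: "?D (g s) x w = ?D e (\<beta> (z s x)) (?D \<beta> (z s x) (?D \<alpha> x w)) \<bullet> ?D \<beta> (z s x) t
      + e (\<beta> (z s x)) \<bullet> ?D (\<lambda>z. ?D \<beta> z t) (z s x) (?D \<alpha> x w)" for s x w
  proof -
    have 0: "(z s has_derivative ?D \<alpha> x) (at x)"
      unfolding z_def using Ck_Suc_has_derivative[OF \<alpha>] by (auto intro!: derivative_eq_intros)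
    have 1: "((\<lambda>x. e (\<beta> (z s x))) has_derivative (\<lambda>w. ?D e (\<beta> (z s x)) (?D \<beta> (z s x) (?D \<alpha> x w)))) (at x)"
      by (rule has_derivative_compose[where g=e, OF has_derivative_compose[where g=\<beta>, OF 0 Ck_Suc_has_derivative[OF \<beta>]] Ck_Suc_has_derivative[OF e]])
    have 2: "((\<lambda>x. ?D \<beta> (z s x) t) has_derivative (\<lambda>w. ?D (\<lambda>z. ?D \<beta> z t) (z s x) (?D \<alpha> x w))) (at x)"
      by (rule has_derivative_compose[where g="\<lambda>z. ?D \<beta> z t", OF 0 Ck_Suc_has_derivative[OF \<beta>2]])
    have "(g s has_derivative (\<lambda>w. e (\<beta> (z s x)) \<bullet> ?D (\<lambda>z. ?D \<beta> z t) (z s x) (?D \<alpha> x w)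
        + ?D e (\<beta> (z s x)) (?D \<beta> (z s x) (?D \<alpha> x w)) \<bullet> ?D \<beta> (z s x) t)) (at x)"
      unfolding g_def[abs_def] by (rule has_derivative_inner[OF 1 2])
    from fun_cong[OF frechet_derivative_at[OF this], of w] show ?thesis by simp
  qed
  have Ckg: "Ck (Suc 0) (g s)" for s
  proof -
    have z1: "Ck (Suc 0) (z s)" unfolding z_def by (intro Ck_add \<alpha> Ck_const)
    show ?thesis unfolding g_def
      by (intro Ck_inner Ck_compose[OF e] Ck_compose[OF \<beta>1] Ck_compose[OF \<beta>2] z1)
  qed
  \<comment> \<open>The terms with second derivatives of \<open>\<beta>\<close> agree; what remains
    is the antisymmetric part of the derivative of \<open>e\<close>, which
    \<open>curl_cross3\<close> identifies with the curl.\<close>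
  have split: "\<iota>' s x = ?D (g s) x (h x) + c s x" for s x
    unfolding dg \<iota>'_def c_def using curl_cross3[of e "\<beta> (z s x)" "?D \<beta> (z s x) t" "?D \<beta> (z s x) (A x)"] e
    by (simp add: A_def)
  have out: "x \<notin> supp h" if "x \<notin> ?B" for x using that supp by blast
  have div0: "divergence h x = 0" if "x \<notin> ?B" for x
    using frechet_derivative_zero_outside_supp[OF out[OF that]] by (simp add: divergence_def)
  have ibp: "integral ?B (\<lambda>x. ?D (g s) x (h x)) = - integral ?B (\<lambda>x. g s x * divergence h x)" for s
  proof -
    have "linear (?D (g s) x)" for x using Ckg by (intro linear_frechet_derivative) simp
    then have "integral ?B (\<lambda>x. ?D (g s) x (h x)) = integral UNIV (\<lambda>x. ?D (g s) x (h x))"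
      by (intro integral_cbox_eq_UNIV) (simp add: supp_zero[OF out] linear_0)
    also have "\<dots> = - integral UNIV (\<lambda>x. g s x * divergence h x)"
      by (rule integral_divergence_by_parts[OF Ckg h bounded_subset[OF bounded_cbox supp]])
    also have "integral UNIV (\<lambda>x. g s x * divergence h x) = integral ?B (\<lambda>x. g s x * divergence h x)"
      by (rule integral_cbox_eq_UNIV[symmetric]) (simp add: div0)
    finally show ?thesis .
  qed
  have bound: "\<bar>integral ?B (\<iota>' s)\<bar> \<le> L ^ 3 * norm t * M" if s: "s \<in> {0..1}" for s
  proof -
    have "integral ?B (\<iota>' s) = integral ?B (\<lambda>x. ?D (g s) x (h x)) + integral ?B (c s)"
      unfolding split by (intro integral_add integrable_continuous continuous_on_frechet_derivative[OF Ckg]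
          continuous_on_subset[OF cont1(4)] cc continuous_intros) auto
    also have "\<dots> = integral ?B (\<lambda>x. c s x - g s x * divergence h x)"
      unfolding ibp by (subst integral_diff)
        (auto intro!: integrable_continuous continuous_on_mult cc cg continuous_on_divergence[OF h])
    finally have eq: "integral ?B (\<iota>' s) = integral ?B (\<lambda>x. c s x - g s x * divergence h x)" .
    have "norm (integral ?B (\<lambda>x. c s x - g s x * divergence h x))
        \<le> integral ?B (\<lambda>x. (L ^ 3 * norm t) * (norm (e (\<beta> (\<alpha> x + s *\<^sub>R t))) * \<bar>divergence h x\<bar>
          + norm (curl e (\<beta> (\<alpha> x + s *\<^sub>R t))) * norm (h x)))"
    proof (rule integral_norm_bound_integral)
      show "(\<lambda>x. c s x - g s x * divergence h x) integrable_on ?B"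
        by (intro integrable_continuous continuous_on_diff continuous_on_mult cc cg continuous_on_divergence[OF h])
      show "(\<lambda>x. (L ^ 3 * norm t) * (norm (e (\<beta> (\<alpha> x + s *\<^sub>R t))) * \<bar>divergence h x\<bar>
          + norm (curl e (\<beta> (\<alpha> x + s *\<^sub>R t))) * norm (h x))) integrable_on ?B"
        unfolding z_def[symmetric]
        by (intro integrable_continuous continuous_intros ce ccurl c\<beta> cz continuous_on_divergence[OF h]
            continuous_on_subset[OF cont1(4)]) auto
      fix x
      have L3: "L \<le> L ^ 3" using power_increasing[of 1 3 L] L(1) by simp
      have t1: "norm (?D \<beta> (z s x) t) \<le> L * norm t" by (rule L(3))
      have "norm (?D \<beta> (z s x) (A x)) \<le> L * norm (A x)" by (rule L(3))
      also have "\<dots> \<le> L * (L * norm (h x))" using L(1) unfolding A_def by (intro mult_left_mono L(2)) auto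
      finally have t2: "norm (?D \<beta> (z s x) (A x)) \<le> L * (L * norm (h x))" .
      have "\<bar>g s x * divergence h x\<bar> \<le> (norm (e (\<beta> (z s x))) * (L * norm t)) * \<bar>divergence h x\<bar>"
        unfolding g_def abs_mult
        by (intro mult_right_mono order_trans[OF Cauchy_Schwarz_ineq2] mult_left_mono t1) auto
      also have "\<dots> \<le> (norm (e (\<beta> (z s x))) * (L ^ 3 * norm t)) * \<bar>divergence h x\<bar>"
        by (intro mult_right_mono mult_left_mono L3) auto
      finally have b1: "\<bar>g s x * divergence h x\<bar> \<le> (norm (e (\<beta> (z s x))) * (L ^ 3 * norm t)) * \<bar>divergence h x\<bar>" .
      have "\<bar>c s x\<bar> \<le> norm (curl e (\<beta> (z s x))) * norm (cross3 (?D \<beta> (z s x) t) (?D \<beta> (z s x) (A x)))"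
        unfolding c_def by (rule Cauchy_Schwarz_ineq2)
      also have "\<dots> \<le> norm (curl e (\<beta> (z s x))) * ((L * norm t) * (L * (L * norm (h x))))"
        using L(1) by (intro mult_left_mono order_trans[OF norm_cross3_le] mult_mono t1 t2) auto
      finally have b2: "\<bar>c s x\<bar> \<le> norm (curl e (\<beta> (z s x))) * ((L * norm t) * (L * (L * norm (h x))))" .
      show "norm (c s x - g s x * divergence h x) \<le> (L ^ 3 * norm t) * (norm (e (\<beta> (\<alpha> x + s *\<^sub>R t))) * \<bar>divergence h x\<bar>
          + norm (curl e (\<beta> (\<alpha> x + s *\<^sub>R t))) * norm (h x))"
      proof -
        have "norm (c s x - g s x * divergence h x) \<le> \<bar>c s x\<bar> + \<bar>g s x * divergence h x\<bar>" by simp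
        also have "\<dots> \<le> norm (curl e (\<beta> (z s x))) * ((L * norm t) * (L * (L * norm (h x))))
            + (norm (e (\<beta> (z s x))) * (L ^ 3 * norm t)) * \<bar>divergence h x\<bar>"
          using b1 b2 by linarith
        also have "\<dots> = (L ^ 3 * norm t) * (norm (e (\<beta> (z s x))) * \<bar>divergence h x\<bar>
            + norm (curl e (\<beta> (z s x))) * norm (h x))"
          by (simp add: power3_eq_cube algebra_simps)
        finally show ?thesis unfolding z_def .
      qed
    qed
    also have "\<dots> = (L ^ 3 * norm t) * integral ?B (\<lambda>x. norm (e (\<beta> (\<alpha> x + s *\<^sub>R t))) * \<bar>divergence h x\<bar>
          + norm (curl e (\<beta> (\<alpha> x + s *\<^sub>R t))) * norm (h x))"
      by (rule integral_mult_right)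
    also have "\<dots> \<le> (L ^ 3 * norm t) * M"
      using L(1) by (intro mult_left_mono M[OF s]) auto
    finally show ?thesis unfolding eq by simp
  qed
  have "((\<lambda>s. integral ?B (\<iota> s)) has_vector_derivative integral ?B (\<iota>' s)) (at s)" for s
  proof (rule leibniz_rule_vector_derivative[where U=UNIV])
    show "((\<lambda>s. \<iota> s x) has_vector_derivative \<iota>' s x) (at s)" for s x by (rule d\<iota>)
    show "\<iota> s integrable_on ?B" for s
      using c\<iota>[of ?B "\<lambda>_. s" "\<lambda>x. x"] by (intro integrable_continuous) (auto intro: continuous_intros)
    show "continuous_on (UNIV \<times> ?B) (\<lambda>(s, x). \<iota>' s x)"
      unfolding split_beta by (intro c\<iota>' continuous_intros)
  qed auto
  then have "((\<lambda>s. integral ?B (\<iota> s)) has_real_derivative integral ?B (\<iota>' s)) (at s)" for s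
    by (simp add: has_real_derivative_iff_has_vector_derivative)
  \<comment> \<open>The mean value theorem leaves the bound at a single intermediate
    \<open>s\<close>.\<close>
  then obtain s where s: "0 < s" "s < 1"
    "integral ?B (\<iota> 1) - integral ?B (\<iota> 0) = (1 - 0) * integral ?B (\<iota>' s)"
    using MVT2[of 0 1 "\<lambda>s. integral ?B (\<iota> s)" "\<lambda>s. integral ?B (\<iota>' s)"] by auto
  have "\<bar>integral ?B (\<iota> 1) - integral ?B (\<iota> 0)\<bar> \<le> L ^ 3 * norm t * M"
    using s bound[of s] by simp
  then show ?thesis by (simp add: \<iota>_def[abs_def] z_def A_def)
qed

section \<open>Regularized charts and their limits\<close>

lemma uniformly_continuous_bounded_support:
  fixes f :: "'a::euclidean_space \<Rightarrow> 'b::real_normed_vector"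
  assumes f: "continuous_on UNIV f" and b: "bounded (supp f)"
  shows "uniformly_continuous_on UNIV f"
  unfolding uniformly_continuous_on_def
proof (intro allI impI)
  fix \<epsilon> :: real assume \<epsilon>: "0 < \<epsilon>"
  obtain R where R: "\<And>x. x \<in> supp f \<Longrightarrow> norm x \<le> R" using b by (auto simp: bounded_iff)
  have "uniformly_continuous_on (cball 0 (R + 1)) f"
    by (intro compact_uniformly_continuous continuous_on_subset[OF f]) auto
  then obtain \<delta> where \<delta>: "0 < \<delta>"
    "\<And>x y. x \<in> cball 0 (R + 1) \<Longrightarrow> y \<in> cball 0 (R + 1) \<Longrightarrow> dist x y < \<delta> \<Longrightarrow> dist (f x) (f y) < \<epsilon>"
    using \<epsilon> unfolding uniformly_continuous_on_def by (metis dist_commute)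
  have "dist (f x) (f y) < \<epsilon>" if d: "dist x y < min \<delta> 1" for x y
  proof (cases "x \<in> supp f \<or> y \<in> supp f")
    case True
    have "norm x \<le> norm y + dist x y" "norm y \<le> norm x + dist x y"
      using norm_triangle_sub[of x y] norm_triangle_sub[of y x] by (auto simp: dist_norm norm_minus_commute)
    then have "x \<in> cball 0 (R + 1)" "y \<in> cball 0 (R + 1)" using True R[of x] R[of y] d by auto
    then show ?thesis using \<delta>(2) d by simp
  next
    case False
    then show ?thesis using \<epsilon> by (simp add: supp_zero)
  qed
  then show "\<exists>\<delta>>0. \<forall>x\<in>UNIV. \<forall>x'\<in>UNIV. dist x' x < \<delta> \<longrightarrow> dist (f x') (f x) < \<epsilon>"
    using \<delta>(1) by (intro exI[of _ "min \<delta> 1"]) auto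
qed

text \<open>The derivative bounds are uniform in \<open>n\<close>; nothing is assumed about
  convergence of the derivatives. Symmetry of second derivatives concerns \<open>\<beta>s\<close>
  alone, as \<open>\<alpha>s\<close> is differentiated only once in the homotopy formula.\<close>

locale regularized_pair =
  fixes \<alpha> \<beta> :: "real ^ 3 \<Rightarrow> real ^ 3" and L :: real and \<alpha>s \<beta>s :: "nat \<Rightarrow> real ^ 3 \<Rightarrow> real ^ 3"
  assumes L: "1 \<le> L"
    and lip_\<alpha>: "\<And>x y. norm (\<alpha> x - \<alpha> y) \<le> L * norm (x - y)"
    and lip_\<beta>: "\<And>x y. norm (\<beta> x - \<beta> y) \<le> L * norm (x - y)"
    and smooth_\<alpha>s: "\<And>n. smooth (\<alpha>s n)" and smooth_\<beta>s: "\<And>n. smooth (\<beta>s n)"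
    and near_\<alpha>s: "\<And>n x. norm (\<alpha>s n x - \<alpha> x) \<le> L * (1 / real (Suc n))"
    and near_\<beta>s: "\<And>n x. norm (\<beta>s n x - \<beta> x) \<le> L * (1 / real (Suc n))"
    and deriv_\<alpha>s: "\<And>n x v. norm (frechet_derivative (\<alpha>s n) (at x) v) \<le> L * norm v"
    and deriv_\<beta>s: "\<And>n x v. norm (frechet_derivative (\<beta>s n) (at x) v) \<le> L * norm v"
    and sym_\<beta>s: "\<And>n x v w. frechet_derivative (\<lambda>x. frechet_derivative (\<beta>s n) (at x) v) (at x) w
      = frechet_derivative (\<lambda>x. frechet_derivative (\<beta>s n) (at x) w) (at x) v"
begin

lemma Ck_\<alpha>s: "Ck k (\<alpha>s n)" and Ck_\<beta>s: "Ck k (\<beta>s n)"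
  using smooth_\<alpha>s smooth_\<beta>s by (auto simp: smooth_def)

lemma near_composition: "norm (\<beta>s n (\<alpha>s n x + y) - \<beta> (\<alpha> x + y)) \<le> 2 * L\<^sup>2 * (1 / real (Suc n))"
proof -
  have "norm (\<beta>s n (\<alpha>s n x + y) - \<beta> (\<alpha> x + y))
      \<le> norm (\<beta>s n (\<alpha>s n x + y) - \<beta> (\<alpha>s n x + y)) + norm (\<beta> (\<alpha>s n x + y) - \<beta> (\<alpha> x + y))"
    using norm_triangle_ineq[of "\<beta>s n (\<alpha>s n x + y) - \<beta> (\<alpha>s n x + y)" "\<beta> (\<alpha>s n x + y) - \<beta> (\<alpha> x + y)"] by simp
  also have "\<dots> \<le> L * (1 / real (Suc n)) + L * (L * (1 / real (Suc n)))"
    using L lip_\<beta>[of "\<alpha>s n x + y" "\<alpha> x + y"] near_\<alpha>s[of n x]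
    by (intro add_mono near_\<beta>s order_trans[OF lip_\<beta>] mult_left_mono) auto
  also have "\<dots> \<le> 2 * L\<^sup>2 * (1 / real (Suc n))"
  proof -
    have "L \<le> L\<^sup>2" using L by (simp add: power2_eq_square)
    then have "L * (1 / real (Suc n)) \<le> L\<^sup>2 * (1 / real (Suc n))" by (intro mult_right_mono) auto
    then show ?thesis by (simp add: power2_eq_square)
  qed
  finally show ?thesis .
qed

lemma near_composition_eventually:
  assumes "0 < \<delta>"
  shows "\<forall>\<^sub>F n in sequentially. \<forall>x y. norm (\<beta>s n (\<alpha>s n x + y) - \<beta> (\<alpha> x + y)) < \<delta>"
proof -
  have "(\<lambda>n. 2 * L\<^sup>2 * (1 / real (Suc n))) \<longlonglongrightarrow> 2 * L\<^sup>2 * 0"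
    using LIMSEQ_Suc[OF lim_1_over_n] by (intro tendsto_mult tendsto_const) simp
  then have "\<forall>\<^sub>F n in sequentially. 2 * L\<^sup>2 * (1 / real (Suc n)) < \<delta>"
    using assms by (intro order_tendstoD) auto
  then show ?thesis
    by eventually_elim (use near_composition in \<open>auto intro: le_less_trans\<close>)
qed

lemma uniform_composition_eventually:
  fixes f :: "real ^ 3 \<Rightarrow> 'b::real_normed_vector"
  assumes f: "continuous_on UNIV f" "bounded (supp f)" and \<epsilon>: "0 < \<epsilon>"
  shows "\<forall>\<^sub>F n in sequentially. \<forall>x y. norm (f (\<beta>s n (\<alpha>s n x + y)) - f (\<beta> (\<alpha> x + y))) < \<epsilon>"
proof -
  obtain \<delta> where \<delta>: "0 < \<delta>" "\<And>x y. dist x y < \<delta> \<Longrightarrow> dist (f x) (f y) < \<epsilon>"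
    using uniformly_continuous_bounded_support[OF f] \<epsilon> unfolding uniformly_continuous_on_def
    by (metis UNIV_I dist_commute)
  from near_composition_eventually[OF \<delta>(1)] show ?thesis
    by eventually_elim (use \<delta>(2) in \<open>auto simp: dist_norm\<close>)
qed

text \<open>The gradients of the regularized compositions converge to the identity only weakly, hence the
  integration by parts, which moves the derivative to the smooth fields.\<close>

lemma pullback_tendsto:
  assumes e: "Ck (Suc 0) e" "bounded (supp e)" and h: "Ck (Suc 0) h" and supp: "supp h \<subseteq> cbox a b"
    and inv: "\<And>x. x \<in> supp h \<Longrightarrow> \<beta> (\<alpha> x) = x"
  shows "(\<lambda>n. integral (cbox a b) (\<lambda>x. e (\<beta>s n (\<alpha>s n x)) \<bullet> frechet_derivative (\<beta>s n) (at (\<alpha>s n x)) (frechet_derivative (\<alpha>s n) (at x) (h x))))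
    \<longlonglongrightarrow> integral (cbox a b) (\<lambda>x. e x \<bullet> h x)"
proof -
  let ?B = "cbox a b" and ?D = "\<lambda>f x. frechet_derivative f (at x)"
  define G where "G n x = \<beta>s n (\<alpha>s n x)" for n x
  \<comment> \<open>On the support of \<open>h\<close>, where \<open>\<beta>\<close> inverts
    \<open>\<alpha>\<close>, the deviation \<open>P n\<close> tends to 0 uniformly; its derivative
    is merely bounded.\<close>
  define P where "P n x = G n x - x" for n x
  have CkG: "Ck (Suc 0) (G n)" for n unfolding G_def by (intro Ck_compose[OF Ck_\<beta>s] Ck_\<alpha>s)
  have CkP: "Ck (Suc 0) (P n)" for n unfolding P_def by (intro Ck_diff CkG Ck_bounded_linear bounded_linear_ident)
  have DG: "?D (G n) x v = ?D (\<beta>s n) (\<alpha>s n x) (?D (\<alpha>s n) x v)" for n x v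
  proof -
    have "(G n has_derivative (\<lambda>v. ?D (\<beta>s n) (\<alpha>s n x) (?D (\<alpha>s n) x v))) (at x)"
      unfolding G_def by (rule has_derivative_compose[where g="\<beta>s n", OF Ck_Suc_has_derivative[OF Ck_\<alpha>s] Ck_Suc_has_derivative[OF Ck_\<beta>s]])
    from fun_cong[OF frechet_derivative_at[OF this], of v] show ?thesis by simp
  qed
  have DP: "?D (P n) x v = ?D (G n) x v - v" for n x v
  proof -
    have "(P n has_derivative (\<lambda>v. ?D (G n) x v - v)) (at x)"
      unfolding P_def using Ck_Suc_has_derivative[OF CkG] by (auto intro!: derivative_eq_intros)
    from fun_cong[OF frechet_derivative_at[OF this], of v] show ?thesis by simp
  qed
  have boundG: "norm (?D (G n) x v) \<le> L\<^sup>2 * norm v" for n x v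
  proof -
    have "norm (?D (G n) x v) \<le> L * norm (?D (\<alpha>s n) x v)" unfolding DG by (rule deriv_\<beta>s)
    also have "\<dots> \<le> L * (L * norm v)" using L by (intro mult_left_mono deriv_\<alpha>s) auto
    finally show ?thesis by (simp add: power2_eq_square mult.assoc)
  qed
  note cont = Ck_imp_continuous[OF e(1)] Ck_imp_continuous[OF h] Ck_imp_continuous[OF CkG] Ck_imp_continuous[OF CkP]
  have ch: "continuous_on S h" and ce: "continuous_on S e" and cP: "continuous_on S (P n)" for S n
    by (auto intro: continuous_on_subset[OF cont(2)] continuous_on_subset[OF cont(1)] continuous_on_subset[OF cont(4)])
  have ceG: "continuous_on S (\<lambda>x. e (G n x))" for S n
    by (intro continuous_on_compose2[OF cont(1)] continuous_on_subset[OF cont(3)]) auto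
  have out: "x \<notin> supp h" if "x \<notin> ?B" for x using that supp by blast
  have D0: "?D f x 0 = 0" if "Ck (Suc 0) f" for f :: "real ^ 3 \<Rightarrow> 'c::real_normed_vector" and x
    using that by (intro linear_0 linear_frechet_derivative) simp
  have div0: "divergence h x = 0" if "x \<notin> supp h" for x
    using frechet_derivative_zero_outside_supp[OF that] by (simp add: divergence_def)
  have parts: "integral ?B (\<lambda>x. e x \<bullet> ?D (P n) x (h x))
      = - integral ?B (\<lambda>x. (e x \<bullet> P n x) * divergence h x + ?D e x (h x) \<bullet> P n x)" for n
  proof -
    let ?f = "\<lambda>x. e x \<bullet> P n x"
    have f: "Ck (Suc 0) ?f" by (intro Ck_inner e CkP)
    have Df: "?D ?f x v = e x \<bullet> ?D (P n) x v + ?D e x v \<bullet> P n x" for x v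
    proof -
      have "(?f has_derivative (\<lambda>v. e x \<bullet> ?D (P n) x v + ?D e x v \<bullet> P n x)) (at x)"
        by (rule has_derivative_inner[OF Ck_Suc_has_derivative[OF e(1)] Ck_Suc_has_derivative[OF CkP]])
      from fun_cong[OF frechet_derivative_at[OF this], of v] show ?thesis by simp
    qed
    have "integral ?B (\<lambda>x. ?D ?f x (h x)) = integral UNIV (\<lambda>x. ?D ?f x (h x))"
      by (rule integral_cbox_eq_UNIV) (simp add: supp_zero[OF out] D0[OF f])
    also have "\<dots> = - integral UNIV (\<lambda>x. ?f x * divergence h x)"
      by (rule integral_divergence_by_parts[OF f h bounded_subset[OF bounded_cbox supp]])
    also have "integral UNIV (\<lambda>x. ?f x * divergence h x) = integral ?B (\<lambda>x. ?f x * divergence h x)"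
      by (rule integral_cbox_eq_UNIV[symmetric]) (simp add: div0[OF out])
    finally have "integral ?B (\<lambda>x. e x \<bullet> ?D (P n) x (h x) + ?D e x (h x) \<bullet> P n x) = - integral ?B (\<lambda>x. ?f x * divergence h x)"
      unfolding Df .
    moreover have "(\<lambda>x. e x \<bullet> ?D (P n) x (h x)) integrable_on ?B" "(\<lambda>x. ?D e x (h x) \<bullet> P n x) integrable_on ?B"
      "(\<lambda>x. ?f x * divergence h x) integrable_on ?B"
      by (intro integrable_continuous continuous_on_inner continuous_on_mult ce cP ch continuous_on_divergence[OF h]
          continuous_on_frechet_derivative[OF CkP] continuous_on_frechet_derivative[OF e(1)] continuous_intros)+
    ultimately show ?thesis by (simp add: integral_add)
  qed
  define S where "S = integral ?B (\<lambda>x. L\<^sup>2 * norm (h x) + norm (e x) * \<bar>divergence h x\<bar> + norm (?D e x (h x)))"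
  have iS: "(\<lambda>x. L\<^sup>2 * norm (h x) + norm (e x) * \<bar>divergence h x\<bar> + norm (?D e x (h x))) integrable_on ?B"
    by (intro integrable_continuous continuous_intros ce ch continuous_on_divergence[OF h] continuous_on_frechet_derivative[OF e(1)])
  have S: "0 \<le> S" unfolding S_def by (rule integral_nonneg[OF iS]) simp
  show ?thesis
  proof (rule LIMSEQ_I)
    fix \<epsilon> :: real assume \<epsilon>: "0 < \<epsilon>"
    define \<omega> where "\<omega> = \<epsilon> / (S + 1)"
    have \<omega>: "0 < \<omega>" using \<epsilon> S by (simp add: \<omega>_def)
    have ev: "\<forall>\<^sub>F n in sequentially. \<bar>integral ?B (\<lambda>x. e (G n x) \<bullet> ?D (G n) x (h x)) - integral ?B (\<lambda>x. e x \<bullet> h x)\<bar> \<le> \<omega> * S"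
      using uniform_composition_eventually[OF cont(1) e(2) \<omega>] near_composition_eventually[OF \<omega>]
    proof eventually_elim
      case (elim n)
      have near_e: "norm (e (G n x) - e x) \<le> \<omega>" "norm (P n x) \<le> \<omega>" if "x \<in> supp h" for x
        using spec[OF spec[OF elim(1), of x], of 0] spec[OF spec[OF elim(2), of x], of 0] inv[OF that]
        by (auto simp: G_def P_def)
      \<comment> \<open>The first term is small because \<open>e\<close> is uniformly continuous and
        the derivative of \<open>G n\<close> is bounded; the second one is small after the
        integration by parts in \<open>parts\<close>.\<close>
      have "integral ?B (\<lambda>x. e (G n x) \<bullet> ?D (G n) x (h x)) - integral ?B (\<lambda>x. e x \<bullet> h x)
          = integral ?B (\<lambda>x. (e (G n x) - e x) \<bullet> ?D (G n) x (h x)) + integral ?B (\<lambda>x. e x \<bullet> ?D (P n) x (h x))"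
        unfolding DP
        by (subst integral_add[symmetric] integral_diff[symmetric],
            (intro integrable_continuous continuous_intros ce ceG ch continuous_on_frechet_derivative[OF CkG])+)+
          (auto intro!: integral_cong simp: inner_simps)
      also have "\<dots> = integral ?B (\<lambda>x. (e (G n x) - e x) \<bullet> ?D (G n) x (h x)
          - ((e x \<bullet> P n x) * divergence h x + ?D e x (h x) \<bullet> P n x))"
        unfolding parts by (subst integral_diff)
          (auto intro!: integrable_continuous continuous_intros ce ceG ch cP continuous_on_divergence[OF h]
            continuous_on_frechet_derivative[OF CkG] continuous_on_frechet_derivative[OF e(1)])
      finally have eq: "integral ?B (\<lambda>x. e (G n x) \<bullet> ?D (G n) x (h x)) - integral ?B (\<lambda>x. e x \<bullet> h x)
        = integral ?B (\<lambda>x. (e (G n x) - e x) \<bullet> ?D (G n) x (h x)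
          - ((e x \<bullet> P n x) * divergence h x + ?D e x (h x) \<bullet> P n x))" .
      have "norm (integral ?B (\<lambda>x. (e (G n x) - e x) \<bullet> ?D (G n) x (h x)
          - ((e x \<bullet> P n x) * divergence h x + ?D e x (h x) \<bullet> P n x)))
        \<le> integral ?B (\<lambda>x. \<omega> * (L\<^sup>2 * norm (h x) + norm (e x) * \<bar>divergence h x\<bar> + norm (?D e x (h x))))"
      proof (rule integral_norm_bound_integral)
        show "(\<lambda>x. (e (G n x) - e x) \<bullet> ?D (G n) x (h x)
            - ((e x \<bullet> P n x) * divergence h x + ?D e x (h x) \<bullet> P n x)) integrable_on ?B"
          by (intro integrable_continuous continuous_intros ce ceG ch cP continuous_on_divergence[OF h]
            continuous_on_frechet_derivative[OF CkG] continuous_on_frechet_derivative[OF e(1)])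
        show "(\<lambda>x. \<omega> * (L\<^sup>2 * norm (h x) + norm (e x) * \<bar>divergence h x\<bar> + norm (?D e x (h x)))) integrable_on ?B"
          using integrable_cmul[OF iS, of \<omega>] by simp
        fix x
        show "norm ((e (G n x) - e x) \<bullet> ?D (G n) x (h x) - ((e x \<bullet> P n x) * divergence h x + ?D e x (h x) \<bullet> P n x))
            \<le> \<omega> * (L\<^sup>2 * norm (h x) + norm (e x) * \<bar>divergence h x\<bar> + norm (?D e x (h x)))"
        proof (cases "x \<in> supp h")
          case True
          have 1: "\<bar>(e (G n x) - e x) \<bullet> ?D (G n) x (h x)\<bar> \<le> \<omega> * (L\<^sup>2 * norm (h x))"
            using near_e(1)[OF True] \<omega>
            by (intro order_trans[OF Cauchy_Schwarz_ineq2] mult_mono boundG) auto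
          have 2: "\<bar>(e x \<bullet> P n x) * divergence h x\<bar> \<le> \<omega> * (norm (e x) * \<bar>divergence h x\<bar>)"
          proof -
            have "\<bar>e x \<bullet> P n x\<bar> \<le> norm (e x) * norm (P n x)" by (rule Cauchy_Schwarz_ineq2)
            also have "\<dots> \<le> norm (e x) * \<omega>" by (intro mult_left_mono near_e(2)[OF True]) auto
            finally show ?thesis by (simp add: abs_mult mult_right_mono mult.commute[of \<omega>] mult.assoc[symmetric] mult.left_commute)
          qed
          have 3: "\<bar>?D e x (h x) \<bullet> P n x\<bar> \<le> \<omega> * norm (?D e x (h x))"
          proof -
            have "\<bar>?D e x (h x) \<bullet> P n x\<bar> \<le> norm (?D e x (h x)) * norm (P n x)" by (rule Cauchy_Schwarz_ineq2)
            also have "\<dots> \<le> norm (?D e x (h x)) * \<omega>" by (intro mult_left_mono near_e(2)[OF True]) auto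
            finally show ?thesis by (simp add: mult.commute)
          qed
          show ?thesis using 1 2 3 unfolding real_norm_def distrib_left by linarith
        next
          case False
          then show ?thesis using \<omega> by (simp add: supp_zero div0 D0[OF CkG] D0[OF e(1)])
        qed
      qed
      also have "\<dots> = \<omega> * S" unfolding S_def by (rule integral_mult_right)
      finally show ?case unfolding eq by simp
    qed
    have "\<omega> * S < \<epsilon>" using \<epsilon> S by (simp add: \<omega>_def field_simps)
    then obtain N where "\<forall>n\<ge>N. \<bar>integral ?B (\<lambda>x. e (G n x) \<bullet> ?D (G n) x (h x)) - integral ?B (\<lambda>x. e x \<bullet> h x)\<bar> < \<epsilon>"
      using ev unfolding eventually_sequentially by (meson le_less_trans)
    then show "\<exists>N. \<forall>n\<ge>N. norm (integral ?B (\<lambda>x. e (\<beta>s n (\<alpha>s n x)) \<bullet> ?D (\<beta>s n) (\<alpha>s n x) (?D (\<alpha>s n) x (h x)))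
        - integral ?B (\<lambda>x. e x \<bullet> h x)) < \<epsilon>"
      unfolding DG G_def by auto
  qed
qed

end

lemma bounded_support_bound:
  fixes f :: "'a::euclidean_space \<Rightarrow> 'b::real_normed_vector"
  assumes f: "continuous_on UNIV f" and b: "bounded (supp f)"
  obtains M where "0 < M" "\<And>x. norm (f x) \<le> M"
proof -
  have "compact (f ` supp f)"
    using b by (intro compact_continuous_image continuous_on_subset[OF f]) (auto simp: compact_eq_bounded_closed closed_supp)
  then have "bounded (f ` supp f)" by (rule compact_imp_bounded)
  then obtain M where M: "0 < M" "\<forall>y\<in>f ` supp f. norm y \<le> M" unfolding bounded_pos by blast
  have "norm (f x) \<le> M" for x
    using M supp_zero[of x f] by (cases "x \<in> supp f") auto
  with M(1) show ?thesis by (rule that)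
qed

lemma L2_norm_le_bound:
  assumes \<Omega>: "\<Omega> \<in> lmeasurable" and f: "f \<in> L2 \<Omega>" and C: "0 \<le> C" "\<And>x. x \<in> \<Omega> \<Longrightarrow> norm (f x) \<le> C"
  shows "L2_norm \<Omega> f \<le> C * sqrt (measure lebesgue \<Omega>)"
proof -
  interpret finite_measure "lebesgue_on \<Omega>"
    using \<Omega> by (rule finite_measure_lebesgue_on)
  have S: "\<Omega> \<in> sets lebesgue" using \<Omega> by (rule fmeasurableD)
  have "(LINT x|lebesgue_on \<Omega>. (norm (f x))\<^sup>2) \<le> (LINT x|lebesgue_on \<Omega>. C\<^sup>2)"
    using C by (intro integral_mono L2_integrable_norm_square f) (auto intro: power_mono)
  also have "\<dots> = C\<^sup>2 * measure lebesgue \<Omega>" using S by (simp add: measure_restrict_space)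
  finally have "L2_norm \<Omega> f \<le> sqrt (C\<^sup>2 * measure lebesgue \<Omega>)"
    unfolding L2_norm_def by (rule real_sqrt_le_mono)
  then show ?thesis using C by (simp add: real_sqrt_mult)
qed

lemma L2_weakly_converges_subseq:
  assumes "L2_weakly_converges \<Omega> f g" "strict_mono (r :: nat \<Rightarrow> nat)"
  shows "L2_weakly_converges \<Omega> (\<lambda>n. f (r n)) g"
proof -
  have "(\<lambda>n. L2_inner \<Omega> (f (r n)) h) \<longlonglongrightarrow> L2_inner \<Omega> g h" if "h \<in> L2 \<Omega>" for h
    using assms(1) that LIMSEQ_subseq_LIMSEQ[OF _ assms(2), of "\<lambda>n. L2_inner \<Omega> (f n) h"]
    by (simp add: L2_weakly_converges_def o_def)
  then show ?thesis using assms(1) by (simp add: L2_weakly_converges_def)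
qed

lemma L2_inner_tendsto_weak_strong:
  assumes f: "L2_weakly_converges \<Omega> f f'" and bd: "\<And>n. L2_norm \<Omega> (f n) \<le> M"
    and g: "\<And>n. g n \<in> L2 \<Omega>" "g' \<in> L2 \<Omega>" "(\<lambda>n. L2_norm \<Omega> (\<lambda>x. g n x - g' x)) \<longlonglongrightarrow> 0"
  shows "(\<lambda>n. L2_inner \<Omega> (f n) (g n)) \<longlonglongrightarrow> L2_inner \<Omega> f' g'"
proof -
  have fL: "f n \<in> L2 \<Omega>" for n using f by (simp add: L2_weakly_converges_def)
  have "(\<lambda>n. L2_inner \<Omega> (f n) (\<lambda>x. g n x - g' x)) \<longlonglongrightarrow> 0"
  proof (rule Lim_null_comparison)
    show "\<forall>\<^sub>F n in sequentially. norm (L2_inner \<Omega> (f n) (\<lambda>x. g n x - g' x)) \<le> M * L2_norm \<Omega> (\<lambda>x. g n x - g' x)"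
      using order_trans[OF L2_Cauchy_Schwarz[OF fL L2_diff[OF g(1,2)]] mult_right_mono[OF bd L2_norm_nonneg]]
      by (intro always_eventually allI) simp
    show "(\<lambda>n. M * L2_norm \<Omega> (\<lambda>x. g n x - g' x)) \<longlonglongrightarrow> 0"
      using tendsto_mult_left[OF g(3), of M] by simp
  qed
  moreover have "(\<lambda>n. L2_inner \<Omega> (f n) g') \<longlonglongrightarrow> L2_inner \<Omega> f' g'"
    using f g(2) by (simp add: L2_weakly_converges_def)
  ultimately have "(\<lambda>n. L2_inner \<Omega> (f n) (\<lambda>x. g n x - g' x) + L2_inner \<Omega> (f n) g') \<longlonglongrightarrow> 0 + L2_inner \<Omega> f' g'"
    by (rule tendsto_add)
  then show ?thesis by (simp add: L2_inner_diff_right g fL)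
qed

section \<open>Averages of pulled back fields over displacements\<close>

lemma norm_vec_le_sum: "norm (x :: 'a::real_normed_vector ^ 'n) \<le> (\<Sum>i\<in>UNIV. norm (x $ i))"
  unfolding norm_vec_def by (rule L2_set_le_sum) simp

text \<open>Row \<open>j\<close> is the partial derivative in direction \<open>j\<close>, so this is
  the transpose of the usual Jacobian matrix. The form suits \<open>avg\<close>, whose component
  \<open>j\<close> uses exactly this row.\<close>

definition jacobian :: "(real ^ 3 \<Rightarrow> real ^ 3) \<Rightarrow> real ^ 3 \<Rightarrow> real ^ 3 ^ 3" where
  "jacobian f z = (\<chi> j. frechet_derivative f (at z) (axis j 1))"

lemma continuous_on_jacobian: "Ck (Suc 0) f \<Longrightarrow> continuous_on S (jacobian f)"
  unfolding jacobian_def[abs_def]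
  by (intro continuous_on_vec_lambda continuous_on_frechet_derivative continuous_intros)

text \<open>\<open>W\<close> takes the place of the Jacobian of \<open>\<beta>\<close>. The ball of
  radius \<open>R\<close> is to be chosen so large that it contains all points to which the
  displacements lead.\<close>

locale regularized_pair_limit = regularized_pair +
  fixes W :: "real ^ 3 \<Rightarrow> real ^ 3 ^ 3" and R :: real
  assumes weak: "L2_weakly_converges (cball 0 R) (\<lambda>n. jacobian (\<beta>s n)) W"

text \<open>The Jacobians of the mollified maps are bounded by \<open>3 * L\<close> on the ball,
  hence bounded in L^2, and weak compactness yields \<open>W\<close> after passing to a
  subsequence.\<close>

lemma regularization_exists:
  fixes \<alpha> \<beta> :: "real ^ 3 \<Rightarrow> real ^ 3"
  assumes L: "1 \<le> L" and \<alpha>: "\<And>x y. norm (\<alpha> x - \<alpha> y) \<le> L * norm (x - y)"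
    and \<beta>: "\<And>x y. norm (\<beta> x - \<beta> y) \<le> L * norm (x - y)"
  obtains \<alpha>s \<beta>s W where "regularized_pair_limit \<alpha> \<beta> L \<alpha>s \<beta>s W R"
proof -
  have "\<exists>g. smooth g \<and> (\<forall>x. norm (g x - \<alpha> x) \<le> L * (1 / real (Suc n))) \<and>
    (\<forall>x v. norm (frechet_derivative g (at x) v) \<le> L * norm v)" for n
    by (rule Lipschitz_smooth_approximation[OF \<alpha>, of "1 / real (Suc n)"]) auto
  then obtain \<alpha>s where \<alpha>s: "\<And>n. smooth (\<alpha>s n)" "\<And>n x. norm (\<alpha>s n x - \<alpha> x) \<le> L * (1 / real (Suc n))"
    "\<And>n x v. norm (frechet_derivative (\<alpha>s n) (at x) v) \<le> L * norm v"
    by metis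
  have "\<exists>g. smooth g \<and> (\<forall>x. norm (g x - \<beta> x) \<le> L * (1 / real (Suc n))) \<and>
    (\<forall>x v. norm (frechet_derivative g (at x) v) \<le> L * norm v) \<and>
    (\<forall>x v w. frechet_derivative (\<lambda>x. frechet_derivative g (at x) v) (at x) w
      = frechet_derivative (\<lambda>x. frechet_derivative g (at x) w) (at x) v)" for n
    by (rule Lipschitz_smooth_approximation[OF \<beta>, of "1 / real (Suc n)"]) auto
  then obtain \<beta>s where \<beta>s: "\<And>n. smooth (\<beta>s n)" "\<And>n x. norm (\<beta>s n x - \<beta> x) \<le> L * (1 / real (Suc n))"
    "\<And>n x v. norm (frechet_derivative (\<beta>s n) (at x) v) \<le> L * norm v"
    "\<And>n x v w. frechet_derivative (\<lambda>x. frechet_derivative (\<beta>s n) (at x) v) (at x) w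
      = frechet_derivative (\<lambda>x. frechet_derivative (\<beta>s n) (at x) w) (at x) v"
    by metis
  have L2j: "jacobian (\<beta>s n) \<in> L2 (cball 0 R)" for n
    by (intro continuous_L2 continuous_on_jacobian) (use \<beta>s(1) in \<open>auto simp: smooth_def simp del: Ck.simps\<close>)
  have nj: "norm (jacobian (\<beta>s n) z) \<le> 3 * L" for n z
  proof -
    have "norm (jacobian (\<beta>s n) z) \<le> (\<Sum>j\<in>UNIV. norm (jacobian (\<beta>s n) z $ j))" by (rule norm_vec_le_sum)
    also have "\<dots> \<le> (\<Sum>j\<in>(UNIV :: 3 set). L)"
      using \<beta>s(3)[of n z "axis _ 1"] by (intro sum_mono) (simp add: jacobian_def)
    finally show ?thesis by simp
  qed
  obtain r W where r: "strict_mono (r :: nat \<Rightarrow> nat)"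
    and W: "L2_weakly_converges (cball 0 R) (\<lambda>n. jacobian (\<beta>s (r n))) W"
  proof (rule L2_weakly_compact[of "cball 0 R" "\<lambda>n. jacobian (\<beta>s n)"])
    show "L2_norm (cball 0 R) (jacobian (\<beta>s n)) \<le> 3 * L * sqrt (measure lebesgue (cball (0 :: real ^ 3) R))" for n
      using L nj by (intro L2_norm_le_bound L2j) auto
  qed (auto simp: L2j)
  have "regularized_pair_limit \<alpha> \<beta> L \<alpha>s (\<lambda>n. \<beta>s (r n)) W R"
  proof unfold_locales
    \<comment> \<open>Only \<open>\<beta>s\<close> is thinned out; the rate in \<open>n\<close>
      persists because \<open>r n\<close> is at least \<open>n\<close>.\<close>
    show "norm (\<beta>s (r n) x - \<beta> x) \<le> L * (1 / real (Suc n))" for n x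
    proof -
      have "norm (\<beta>s (r n) x - \<beta> x) \<le> L * (1 / real (Suc (r n)))" by (rule \<beta>s(2))
      also have "\<dots> \<le> L * (1 / real (Suc n))"
        using seq_suble[OF r, of n] L by (intro mult_left_mono divide_left_mono) auto
      finally show ?thesis .
    qed
  qed (use assms \<alpha>s \<beta>s W in auto)
  then show ?thesis by (rule that)
qed

context regularized_pair_limit
begin

text \<open>The coefficients of the averaged form in chart coordinates: \<open>e\<close> is pulled
  back by \<open>\<beta>s n\<close> alone. The derivative of \<open>\<alpha>s n\<close> is left out
  and applied to the test field instead, see \<open>inner_avg\<close>.\<close>

definition avg :: "(real ^ 3 \<Rightarrow> real ^ 3) \<Rightarrow> (real ^ 3 \<Rightarrow> real) \<Rightarrow> real ^ 3 \<Rightarrow> real ^ 3 \<Rightarrow> nat \<Rightarrow> real ^ 3 \<Rightarrow> real ^ 3" where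
  "avg e \<rho> c d n x = (\<chi> j. integral (cbox c d)
    (\<lambda>t. \<rho> t * (e (\<beta>s n (\<alpha>s n x + t)) \<bullet> frechet_derivative (\<beta>s n) (at (\<alpha>s n x + t)) (axis j 1))))"

text \<open>The average after the substitution \<open>z = \<alpha> x + t\<close>, which leaves
  \<open>x\<close> only in the argument of the weight.\<close>

definition avg_limit :: "(real ^ 3 \<Rightarrow> real ^ 3) \<Rightarrow> (real ^ 3 \<Rightarrow> real) \<Rightarrow> real ^ 3 \<Rightarrow> real ^ 3" where
  "avg_limit e \<rho> x = (\<chi> j. LINT z|lebesgue_on (cball 0 R). \<rho> (z - \<alpha> x) * (e (\<beta> z) \<bullet> W z $ j))"

lemma continuous_on_avg_integrand:
  assumes e: "continuous_on UNIV e" and \<rho>: "continuous_on UNIV \<rho>"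
    and S: "continuous_on S x" "continuous_on S t" "continuous_on S v"
  shows "continuous_on S (\<lambda>p. \<rho> (t p) * (e (\<beta>s n (\<alpha>s n (x p) + t p)) \<bullet> frechet_derivative (\<beta>s n) (at (\<alpha>s n (x p) + t p)) (v p)))"
proof -
  have c1: "continuous_on S (\<lambda>p. \<alpha>s n (x p) + t p)"
    using S by (intro continuous_on_add continuous_on_compose2[OF Ck_imp_continuous[OF Ck_\<alpha>s[of 0 n]]]) auto
  have c2: "continuous_on S (\<lambda>p. e (\<beta>s n (\<alpha>s n (x p) + t p)))"
    by (intro continuous_on_compose2[OF e] continuous_on_compose2[OF Ck_imp_continuous[OF Ck_\<beta>s[of 0 n]]] c1) auto
  have c3: "continuous_on S (\<lambda>p. \<rho> (t p))" using S(2) by (intro continuous_on_compose2[OF \<rho>]) auto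
  show ?thesis
    by (intro continuous_on_mult continuous_on_inner c2 c3 continuous_on_frechet_derivative[OF Ck_\<beta>s] c1 S(3))
qed

lemma continuous_on_avg:
  assumes e: "continuous_on UNIV e" and \<rho>: "continuous_on UNIV \<rho>"
  shows "continuous_on S (avg e \<rho> c d n)"
  unfolding avg_def[abs_def]
proof (intro continuous_on_vec_lambda integral_continuous_on_param)
  show "continuous_on (S \<times> cbox c d) (\<lambda>(x, t). \<rho> t * (e (\<beta>s n (\<alpha>s n x + t)) \<bullet> frechet_derivative (\<beta>s n) (at (\<alpha>s n x + t)) (axis j 1)))" for j
    unfolding split_beta by (intro continuous_on_avg_integrand e \<rho> continuous_intros)
qed

lemma inner_avg:
  assumes e: "continuous_on UNIV e" and \<rho>: "continuous_on UNIV \<rho>"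
  shows "integral (cbox c d) (\<lambda>t. \<rho> t * (e (\<beta>s n (\<alpha>s n x + t)) \<bullet> frechet_derivative (\<beta>s n) (at (\<alpha>s n x + t)) v))
    = v \<bullet> avg e \<rho> c d n x"
proof -
  let ?f = "\<lambda>v t. \<rho> t * (e (\<beta>s n (\<alpha>s n x + t)) \<bullet> frechet_derivative (\<beta>s n) (at (\<alpha>s n x + t)) v)"
  have i: "?f v integrable_on cbox c d" for v
    by (intro integrable_continuous continuous_on_avg_integrand[OF e \<rho>] continuous_intros)
  have lin: "linear (frechet_derivative (\<beta>s n) (at z))" for z
    using Ck_\<beta>s[of "Suc 0" n] by (intro linear_frechet_derivative) simp
  have "?f v = (\<lambda>t. \<Sum>j\<in>UNIV. v $ j * ?f (axis j 1) t)"
    by (rule ext, subst linear_vec3_expansion[OF lin]) (simp add: sum_3 inner_simps algebra_simps)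
  then have "integral (cbox c d) (?f v) = (\<Sum>j\<in>UNIV. integral (cbox c d) (\<lambda>t. v $ j * ?f (axis j 1) t))"
    using integrable_cmul[OF i] by (simp add: integral_sum)
  also have "\<dots> = v \<bullet> avg e \<rho> c d n x"
    by (simp add: inner_vec_def avg_def)
  finally show ?thesis .
qed

lemma avg_bound:
  assumes e: "continuous_on UNIV e" "\<And>x. norm (e x) \<le> Me" and \<rho>: "continuous_on UNIV \<rho>" "\<And>t. \<bar>\<rho> t\<bar> \<le> M\<rho>"
  shows "norm (avg e \<rho> c d n x) \<le> 3 * (M\<rho> * (Me * L) * measure lborel (cbox c d))"
proof -
  have M: "0 \<le> M\<rho>" "0 \<le> Me" using e(2)[of 0] \<rho>(2)[of 0] norm_ge_zero[of "e 0"] by linarith+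
  have b: "norm (avg e \<rho> c d n x $ j) \<le> M\<rho> * (Me * L) * measure lborel (cbox c d)" for j
    unfolding avg_def vec_lambda_beta
  proof (rule integrable_bound)
    show "0 \<le> M\<rho> * (Me * L)" using M L by simp
    show "(\<lambda>t. \<rho> t * (e (\<beta>s n (\<alpha>s n x + t)) \<bullet> frechet_derivative (\<beta>s n) (at (\<alpha>s n x + t)) (axis j 1))) integrable_on cbox c d"
      by (intro integrable_continuous continuous_on_avg_integrand e(1) \<rho>(1) continuous_intros)
    fix t
    have "\<bar>e (\<beta>s n (\<alpha>s n x + t)) \<bullet> frechet_derivative (\<beta>s n) (at (\<alpha>s n x + t)) (axis j 1)\<bar> \<le> Me * L"
      using M deriv_\<beta>s[of n "\<alpha>s n x + t" "axis j 1"]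
      by (intro order_trans[OF Cauchy_Schwarz_ineq2] mult_mono e(2)) auto
    then show "norm (\<rho> t * (e (\<beta>s n (\<alpha>s n x + t)) \<bullet> frechet_derivative (\<beta>s n) (at (\<alpha>s n x + t)) (axis j 1))) \<le> M\<rho> * (Me * L)"
      unfolding real_norm_def abs_mult using M by (intro mult_mono \<rho>(2)) auto
  qed
  have "norm (avg e \<rho> c d n x) \<le> (\<Sum>j\<in>UNIV. norm (avg e \<rho> c d n x $ j))" by (rule norm_vec_le_sum)
  also have "\<dots> \<le> (\<Sum>j\<in>(UNIV :: 3 set). M\<rho> * (Me * L) * measure lborel (cbox c d))" by (intro sum_mono b)
  finally show ?thesis by simp
qed

text \<open>After the substitution \<open>z = \<alpha>s n x + t\<close> the integrand is the
  Jacobian, which converges weakly, times a factor that converges uniformly and hence strongly in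
  L^2.\<close>

lemma avg_tendsto:
  assumes e: "continuous_on UNIV e" "bounded (supp e)" and \<rho>: "continuous_on UNIV \<rho>" "\<And>t. t \<notin> cbox c d \<Longrightarrow> \<rho> t = 0"
    and range: "\<And>t. t \<in> cbox c d \<Longrightarrow> norm (\<alpha> x + t) + L \<le> R"
  shows "(\<lambda>n. avg e \<rho> c d n x) \<longlonglongrightarrow> avg_limit e \<rho> x"
proof (rule vec_tendstoI)
  fix j :: 3
  let ?B = "cball (0 :: real ^ 3) R"
  have sub\<rho>: "supp \<rho> \<subseteq> cbox c d" using \<rho>(2) by (intro supp_subset) auto
  then have bs\<rho>: "bounded (supp \<rho>)" using bounded_cbox by (rule bounded_subset[rotated])
  obtain Me where Me: "0 < Me" "\<And>x. norm (e x) \<le> Me" using bounded_support_bound[OF e] by blast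
  obtain M\<rho> where M\<rho>: "0 < M\<rho>" "\<And>t. norm (\<rho> t) \<le> M\<rho>" using bounded_support_bound[OF \<rho>(1) bs\<rho>] by blast
  \<comment> \<open>A vector field is placed in row \<open>j\<close> of an otherwise zero matrix, so
    that the inner product of matrix fields picks out row \<open>j\<close> of the Jacobian.\<close>
  define row :: "(real ^ 3 \<Rightarrow> real ^ 3) \<Rightarrow> real ^ 3 \<Rightarrow> real ^ 3 ^ 3" where "row g z = (\<chi> i. if i = j then g z else 0)" for g z
  define G where "G n = row (\<lambda>z. \<rho> (z - \<alpha>s n x) *\<^sub>R e (\<beta>s n z))" for n
  define G' where "G' = row (\<lambda>z. \<rho> (z - \<alpha> x) *\<^sub>R e (\<beta> z))"
  have c\<beta>: "continuous_on UNIV \<beta>"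
    using lip_\<beta> L by (intro lipschitz_on_continuous_on[of L] lipschitz_onI) (auto simp: dist_norm)
  have c\<beta>s: "continuous_on UNIV (\<beta>s n)" for n by (rule Ck_imp_continuous[OF Ck_\<beta>s[of 0]])
  have rowc: "continuous_on UNIV (row g)" if "continuous_on UNIV g" for g
    unfolding row_def[abs_def]
  proof (intro continuous_on_vec_lambda)
    show "continuous_on UNIV (\<lambda>z. if i = j then g z else 0)" for i
      using that by (cases "i = j") auto
  qed
  have cont_prod: "continuous_on UNIV (\<lambda>z. \<rho> (z - y) *\<^sub>R e (b z))" if "continuous_on UNIV b" for b y
    by (intro continuous_on_scaleR continuous_on_compose2[OF \<rho>(1)] continuous_on_compose2[OF e(1)] that continuous_intros) auto
  have GL: "G n \<in> L2 ?B" "G' \<in> L2 ?B" for n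
    unfolding G_def G'_def by (intro continuous_L2 rowc cont_prod c\<beta> c\<beta>s; simp)+
  have rn: "norm (row g z - row g' z) = norm (g z - g' z)" for g g' z
  proof -
    have "row g z - row g' z = axis j (g z - g' z)" by (auto simp: row_def vec_eq_iff axis_def)
    then show ?thesis by (simp add: norm_eq_sqrt_inner inner_axis axis_nth)
  qed
  have ri: "F \<bullet> row g z = F $ j \<bullet> g z" for F g z
  proof -
    have "row g z = axis j (g z)" by (auto simp: row_def vec_eq_iff axis_def)
    then show ?thesis by (simp add: inner_axis)
  qed
  have strong: "(\<lambda>n. L2_norm ?B (\<lambda>z. G n z - G' z)) \<longlonglongrightarrow> 0"
  proof (rule LIMSEQ_I)
    fix \<epsilon> :: real assume \<epsilon>: "0 < \<epsilon>"
    define V where "V = sqrt (measure lebesgue ?B) + 1"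
    have V: "0 < V" by (simp add: V_def add_nonneg_pos)
    define \<omega> where "\<omega> = \<epsilon> / (V * (Me + M\<rho>))"
    have \<omega>: "0 < \<omega>" using \<epsilon> V Me(1) M\<rho>(1) by (simp add: \<omega>_def)
    obtain \<delta>1 where \<delta>1: "0 < \<delta>1" "\<And>x y. dist x y < \<delta>1 \<Longrightarrow> dist (e x) (e y) < \<omega>"
      using uniformly_continuous_bounded_support[OF e] \<omega> unfolding uniformly_continuous_on_def
      by (metis UNIV_I dist_commute)
    obtain \<delta>2 where \<delta>2: "0 < \<delta>2" "\<And>x y. dist x y < \<delta>2 \<Longrightarrow> dist (\<rho> x) (\<rho> y) < \<omega>"
      using uniformly_continuous_bounded_support[OF \<rho>(1) bs\<rho>] \<omega> unfolding uniformly_continuous_on_def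
      by (metis UNIV_I dist_commute)
    have "(\<lambda>n. L * (1 / real (Suc n))) \<longlonglongrightarrow> L * 0"
      using LIMSEQ_Suc[OF lim_1_over_n] by (intro tendsto_mult tendsto_const) simp
    then have "\<forall>\<^sub>F n in sequentially. L * (1 / real (Suc n)) < min \<delta>1 \<delta>2"
      using \<delta>1(1) \<delta>2(1) by (intro order_tendstoD) auto
    then obtain N where N: "\<And>n. N \<le> n \<Longrightarrow> L * (1 / real (Suc n)) < min \<delta>1 \<delta>2"
      unfolding eventually_sequentially by blast
    have "L2_norm ?B (\<lambda>z. G n z - G' z) < \<epsilon>" if n: "N \<le> n" for n
    proof -
      have "norm (G n z - G' z) \<le> \<omega> * (Me + M\<rho>)" for z
      proof -
        have "dist (z - \<alpha>s n x) (z - \<alpha> x) < \<delta>2"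
          using near_\<alpha>s[of n x] N[OF n] by (simp add: dist_norm norm_minus_commute)
        then have d1: "\<bar>\<rho> (z - \<alpha>s n x) - \<rho> (z - \<alpha> x)\<bar> \<le> \<omega>" using \<delta>2(2) by (metis dist_real_def less_imp_le)
        have "dist (\<beta>s n z) (\<beta> z) < \<delta>1"
          using near_\<beta>s[of n z] N[OF n] by (simp add: dist_norm)
        then have d2: "norm (e (\<beta>s n z) - e (\<beta> z)) \<le> \<omega>" using \<delta>1(2) by (metis dist_norm less_imp_le)
        have "\<rho> (z - \<alpha>s n x) *\<^sub>R e (\<beta>s n z) - \<rho> (z - \<alpha> x) *\<^sub>R e (\<beta> z)
            = (\<rho> (z - \<alpha>s n x) - \<rho> (z - \<alpha> x)) *\<^sub>R e (\<beta>s n z) + \<rho> (z - \<alpha> x) *\<^sub>R (e (\<beta>s n z) - e (\<beta> z))"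
          by (simp add: algebra_simps)
        then have "norm (G n z - G' z) \<le> norm ((\<rho> (z - \<alpha>s n x) - \<rho> (z - \<alpha> x)) *\<^sub>R e (\<beta>s n z)) + norm (\<rho> (z - \<alpha> x) *\<^sub>R (e (\<beta>s n z) - e (\<beta> z)))"
          unfolding G_def G'_def rn by (simp only: norm_triangle_ineq)
        also have "\<dots> \<le> \<omega> * Me + M\<rho> * \<omega>"
          unfolding norm_scaleR using d1 d2 Me M\<rho> \<omega>
          by (intro add_mono mult_mono) (simp_all add: less_imp_le)
        finally show ?thesis by (simp add: algebra_simps)
      qed
      then have "L2_norm ?B (\<lambda>z. G n z - G' z) \<le> \<omega> * (Me + M\<rho>) * sqrt (measure lebesgue ?B)"
        using \<omega> Me(1) M\<rho>(1) by (intro L2_norm_le_bound L2_diff GL) auto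
      also have "\<dots> < \<omega> * (Me + M\<rho>) * V"
        using \<omega> Me(1) M\<rho>(1) by (intro mult_strict_left_mono) (auto simp: V_def)
      also have "\<dots> = \<epsilon>" using V Me(1) M\<rho>(1) by (simp add: \<omega>_def)
      finally show ?thesis .
    qed
    then show "\<exists>N. \<forall>n\<ge>N. norm (L2_norm ?B (\<lambda>z. G n z - G' z) - 0) < \<epsilon>"
      by (intro exI[of _ N]) simp
  qed
  have "L2_norm ?B (jacobian (\<beta>s n)) \<le> 3 * L * sqrt (measure lebesgue ?B)" for n
  proof (rule L2_norm_le_bound)
    show "jacobian (\<beta>s n) \<in> L2 ?B" using weak by (simp add: L2_weakly_converges_def)
    show "norm (jacobian (\<beta>s n) z) \<le> 3 * L" for z
    proof -
      have "norm (jacobian (\<beta>s n) z) \<le> (\<Sum>j\<in>UNIV. norm (jacobian (\<beta>s n) z $ j))" by (rule norm_vec_le_sum)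
      also have "\<dots> \<le> (\<Sum>j\<in>(UNIV :: 3 set). L)"
        using deriv_\<beta>s[of n z "axis _ 1"] by (intro sum_mono) (simp add: jacobian_def)
      finally show ?thesis by simp
    qed
  qed (use L in auto)
  from L2_inner_tendsto_weak_strong[OF weak this GL strong]
  have lim: "(\<lambda>n. L2_inner ?B (jacobian (\<beta>s n)) (G n)) \<longlonglongrightarrow> L2_inner ?B W G'" .
  have "L2_inner ?B W G' = avg_limit e \<rho> x $ j"
    unfolding L2_inner_def G'_def ri avg_limit_def by (simp add: inner_commute)
  moreover have "L2_inner ?B (jacobian (\<beta>s n)) (G n) = avg e \<rho> c d n x $ j" for n
  proof -
    let ?f = "\<lambda>z. \<rho> (z - \<alpha>s n x) * (e (\<beta>s n z) \<bullet> frechet_derivative (\<beta>s n) (at z) (axis j 1))"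
    have cf: "continuous_on UNIV ?f"
      by (intro continuous_on_mult continuous_on_inner continuous_on_frechet_derivative[OF Ck_\<beta>s] continuous_intros
          continuous_on_compose2[OF e(1)] continuous_on_compose2[OF \<rho>(1)] c\<beta>s) auto
    \<comment> \<open>The summand \<open>L\<close> in the assumption \<open>range\<close> absorbs
      the distance between \<open>\<alpha>s n x\<close> and \<open>\<alpha> x\<close>.\<close>
    have zero: "?f z = 0" if "z \<notin> ?B" for z
    proof -
      have "z - \<alpha>s n x \<notin> cbox c d"
      proof
        assume "z - \<alpha>s n x \<in> cbox c d"
        then have "norm (\<alpha> x + (z - \<alpha>s n x)) + L \<le> R" by (rule range)
        moreover have "norm (\<alpha>s n x - \<alpha> x) \<le> L"
        proof -
          have "norm (\<alpha>s n x - \<alpha> x) \<le> L * (1 / real (Suc n))" by (rule near_\<alpha>s)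
          also have "\<dots> \<le> L * 1" using L by (intro mult_left_mono) auto
          finally show ?thesis by simp
        qed
        moreover have "norm z \<le> norm (\<alpha> x + (z - \<alpha>s n x)) + norm (\<alpha>s n x - \<alpha> x)"
          using norm_triangle_ineq[of "\<alpha> x + (z - \<alpha>s n x)" "\<alpha>s n x - \<alpha> x"] by simp
        ultimately have "norm z \<le> R" by linarith
        then show False using that by simp
      qed
      then show ?thesis using \<rho>(2) by simp
    qed
    have "L2_inner ?B (jacobian (\<beta>s n)) (G n) = (LINT z|lebesgue_on ?B. ?f z)"
      unfolding L2_inner_def G_def ri by (simp add: jacobian_def inner_commute)
    also have "\<dots> = integral UNIV ?f"
    proof (rule integral_lebesgue_on_supp[OF _ cf bounded_cball[of 0 R]])
      show "?f z = 0" if "z \<notin> ?B \<inter> ?B" for z using that zero by blast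
    qed simp
    also have "\<dots> = integral UNIV (\<lambda>t. ?f (t + \<alpha>s n x))"
      by (rule integral_translation[of ?f ?B, OF cf bounded_cball zero, symmetric])
    also have "\<dots> = integral (cbox c d) (\<lambda>t. ?f (t + \<alpha>s n x))"
      by (rule integral_cbox_eq_UNIV[symmetric]) (simp add: \<rho>(2))
    finally show ?thesis unfolding avg_def by (simp add: add.commute)
  qed
  ultimately show "(\<lambda>n. avg e \<rho> c d n x $ j) \<longlonglongrightarrow> avg_limit e \<rho> x $ j" using lim by simp
qed

text \<open>Since the weight has total mass 1, the undisplaced integral differs from the average of
  the displaced ones by an average of homotopy errors, each of order \<open>\<tau>\<close>.
  Exchanging the integrals turns the average itself into a pairing of \<open>h\<close> with
  \<open>avg\<close>.\<close>

lemma div_curl_estimate: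
  assumes e: "Ck (Suc 0) e" "bounded (supp e)" and h: "Ck (Suc 0) h" and supp: "supp h \<subseteq> cbox a b"
    and inv: "\<And>x. x \<in> supp h \<Longrightarrow> \<beta> (\<alpha> x) = x"
    and \<rho>: "continuous_on UNIV \<rho>" "\<And>t. t \<notin> cbox c d \<Longrightarrow> \<rho> t = 0" "\<And>t. 0 \<le> \<rho> t" "integral (cbox c d) \<rho> = 1"
    and range: "\<And>x t. x \<in> supp h \<Longrightarrow> t \<in> cbox c d \<Longrightarrow> norm (\<alpha> x + t) + L \<le> R"
    and \<tau>: "\<And>t. t \<in> cbox c d \<Longrightarrow> norm t \<le> \<tau>"
    and M: "\<And>s t. s \<in> {0..1} \<Longrightarrow> t \<in> cbox c d \<Longrightarrow>
      integral (cbox a b) (\<lambda>x. norm (e (\<beta> (\<alpha> x + s *\<^sub>R t))) * \<bar>divergence h x\<bar>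
        + norm (curl e (\<beta> (\<alpha> x + s *\<^sub>R t))) * norm (h x)) \<le> M"
  shows "\<bar>integral (cbox a b) (\<lambda>x. e x \<bullet> h x)\<bar>
      \<le> L ^ 3 * \<tau> * M + L * integral (cbox a b) (\<lambda>x. norm (h x) * norm (avg_limit e \<rho> x))"
    and "(\<lambda>x. norm (h x) * norm (avg_limit e \<rho> x)) integrable_on cbox a b"
proof -
  let ?B = "cbox a b" and ?D = "\<lambda>f x. frechet_derivative f (at x)"
  have ce: "continuous_on UNIV e" and ch: "continuous_on UNIV h"
    using Ck_imp_continuous[OF e(1)] Ck_imp_continuous[OF h] .
  have bs\<rho>: "bounded (supp \<rho>)"
    using supp_subset[OF closed_cbox \<rho>(2)] bounded_cbox by (rule bounded_subset[rotated])
  obtain Me where Me: "0 < Me" "\<And>x. norm (e x) \<le> Me" using bounded_support_bound[OF ce e(2)] by blast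
  obtain M\<rho> where M\<rho>: "0 < M\<rho>" "\<And>t. norm (\<rho> t) \<le> M\<rho>" using bounded_support_bound[OF \<rho>(1) bs\<rho>] by blast
  have "cbox c d \<noteq> {}" using \<rho>(4) by auto
  then obtain t0 where t0: "t0 \<in> cbox c d" by blast
  then have \<tau>0: "0 \<le> \<tau>" using \<tau>[of t0] norm_ge_zero[of t0] by linarith
  define I where "I n t = integral ?B (\<lambda>x. e (\<beta>s n (\<alpha>s n x + t)) \<bullet> ?D (\<beta>s n) (\<alpha>s n x + t) (?D (\<alpha>s n) x (h x)))" for n t
  define S where "S = integral ?B (\<lambda>x. \<bar>divergence h x\<bar> + norm (h x))"
  have iS: "(\<lambda>x. \<bar>divergence h x\<bar> + norm (h x)) integrable_on ?B"
    by (intro integrable_continuous continuous_intros continuous_on_divergence[OF h] continuous_on_subset[OF ch]) auto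
  have S: "0 \<le> S" unfolding S_def by (rule integral_nonneg[OF iS]) simp
  have c\<alpha>: "continuous_on U \<alpha>" for U
    using lip_\<alpha> L by (intro lipschitz_on_continuous_on[of L] lipschitz_onI) (auto simp: dist_norm)
  have c\<beta>: "continuous_on UNIV \<beta>"
    using lip_\<beta> L by (intro lipschitz_on_continuous_on[of L] lipschitz_onI) (auto simp: dist_norm)
  have c\<alpha>s: "continuous_on U (\<alpha>s n)" and c\<beta>s: "continuous_on UNIV (\<beta>s n)" for n U
    using continuous_on_subset[OF Ck_imp_continuous[OF Ck_\<alpha>s[of 0]]] Ck_imp_continuous[OF Ck_\<beta>s[of 0]] by auto
  have cDh: "continuous_on ?B (\<lambda>x. ?D (\<alpha>s n) x (h x))" for n
    by (intro continuous_on_frechet_derivative[OF Ck_\<alpha>s] continuous_intros continuous_on_subset[OF ch]) auto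
  \<comment> \<open>The assumption \<open>M\<close> concerns the composition of
    \<open>\<beta>\<close> and \<open>\<alpha>\<close> themselves; \<open>\<eta> * S\<close> pays
    for replacing it by the regularized composition.\<close>
  have main: "\<bar>I n 0\<bar> \<le> L ^ 3 * \<tau> * (M + \<eta> * S) + L * integral ?B (\<lambda>x. norm (h x) * norm (avg e \<rho> c d n x))"
    if \<eta>: "0 < \<eta>" and close_e: "\<And>x y. norm (e (\<beta>s n (\<alpha>s n x + y)) - e (\<beta> (\<alpha> x + y))) < \<eta>"
      and close_c: "\<And>x y. norm (curl e (\<beta>s n (\<alpha>s n x + y)) - curl e (\<beta> (\<alpha> x + y))) < \<eta>" for n \<eta>
  proof -
    have MS: "0 \<le> L ^ 3 * \<tau> * (M + \<eta> * S)"
    proof -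
      have "0 \<le> integral ?B (\<lambda>x. norm (e (\<beta> (\<alpha> x + 0 *\<^sub>R t0))) * \<bar>divergence h x\<bar> + norm (curl e (\<beta> (\<alpha> x + 0 *\<^sub>R t0))) * norm (h x))"
        by (intro integral_nonneg integrable_continuous continuous_intros continuous_on_divergence[OF h] continuous_on_subset[OF ch]
            continuous_on_compose2[OF ce] continuous_on_compose2[OF c\<beta>] continuous_on_compose2[OF continuous_on_curl[OF e(1), of UNIV]] c\<alpha>) auto
      also have "\<dots> \<le> M" using t0 by (intro M) auto
      finally show ?thesis using S \<eta> L \<tau>0 by simp
    qed
    have step: "\<bar>I n t - I n 0\<bar> \<le> L ^ 3 * \<tau> * (M + \<eta> * S)" if t: "t \<in> cbox c d" for t
    proof -
      have "\<bar>I n t - I n 0\<bar> \<le> L ^ 3 * norm t * (M + \<eta> * S)"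
        unfolding I_def add_0_right
      proof (rule homotopy_estimate[OF Ck_\<alpha>s Ck_\<beta>s e(1) h L deriv_\<alpha>s deriv_\<beta>s sym_\<beta>s supp])
        fix s :: real assume s: "s \<in> {0..1}"
        have "integral ?B (\<lambda>x. norm (e (\<beta>s n (\<alpha>s n x + s *\<^sub>R t))) * \<bar>divergence h x\<bar> + norm (curl e (\<beta>s n (\<alpha>s n x + s *\<^sub>R t))) * norm (h x))
          \<le> integral ?B (\<lambda>x. (norm (e (\<beta> (\<alpha> x + s *\<^sub>R t))) * \<bar>divergence h x\<bar> + norm (curl e (\<beta> (\<alpha> x + s *\<^sub>R t))) * norm (h x))
            + \<eta> * (\<bar>divergence h x\<bar> + norm (h x)))"
        proof (rule integral_le)
          show "(\<lambda>x. norm (e (\<beta>s n (\<alpha>s n x + s *\<^sub>R t))) * \<bar>divergence h x\<bar> + norm (curl e (\<beta>s n (\<alpha>s n x + s *\<^sub>R t))) * norm (h x)) integrable_on ?B"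
            by (intro integrable_continuous continuous_intros continuous_on_divergence[OF h] continuous_on_subset[OF ch]
                continuous_on_compose2[OF ce] continuous_on_compose2[OF c\<beta>s] continuous_on_compose2[OF continuous_on_curl[OF e(1), of UNIV]] c\<alpha>s) auto
          show "(\<lambda>x. (norm (e (\<beta> (\<alpha> x + s *\<^sub>R t))) * \<bar>divergence h x\<bar> + norm (curl e (\<beta> (\<alpha> x + s *\<^sub>R t))) * norm (h x))
            + \<eta> * (\<bar>divergence h x\<bar> + norm (h x))) integrable_on ?B"
            by (intro integrable_continuous continuous_intros continuous_on_divergence[OF h] continuous_on_subset[OF ch]
                continuous_on_compose2[OF ce] continuous_on_compose2[OF c\<beta>] continuous_on_compose2[OF continuous_on_curl[OF e(1), of UNIV]] c\<alpha>) auto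
          fix x
          have "norm (e (\<beta>s n (\<alpha>s n x + s *\<^sub>R t))) \<le> norm (e (\<beta> (\<alpha> x + s *\<^sub>R t))) + \<eta>"
            using close_e[of x "s *\<^sub>R t"] norm_triangle_sub[of "e (\<beta>s n (\<alpha>s n x + s *\<^sub>R t))" "e (\<beta> (\<alpha> x + s *\<^sub>R t))"] by linarith
          moreover have "norm (curl e (\<beta>s n (\<alpha>s n x + s *\<^sub>R t))) \<le> norm (curl e (\<beta> (\<alpha> x + s *\<^sub>R t))) + \<eta>"
            using close_c[of x "s *\<^sub>R t"] norm_triangle_sub[of "curl e (\<beta>s n (\<alpha>s n x + s *\<^sub>R t))" "curl e (\<beta> (\<alpha> x + s *\<^sub>R t))"] by linarith
          ultimately have "norm (e (\<beta>s n (\<alpha>s n x + s *\<^sub>R t))) * \<bar>divergence h x\<bar> + norm (curl e (\<beta>s n (\<alpha>s n x + s *\<^sub>R t))) * norm (h x)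
            \<le> (norm (e (\<beta> (\<alpha> x + s *\<^sub>R t))) + \<eta>) * \<bar>divergence h x\<bar> + (norm (curl e (\<beta> (\<alpha> x + s *\<^sub>R t))) + \<eta>) * norm (h x)"
            by (intro add_mono mult_right_mono) auto
          also have "\<dots> = (norm (e (\<beta> (\<alpha> x + s *\<^sub>R t))) * \<bar>divergence h x\<bar> + norm (curl e (\<beta> (\<alpha> x + s *\<^sub>R t))) * norm (h x))
            + \<eta> * (\<bar>divergence h x\<bar> + norm (h x))" by (simp add: algebra_simps)
          finally show "norm (e (\<beta>s n (\<alpha>s n x + s *\<^sub>R t))) * \<bar>divergence h x\<bar> + norm (curl e (\<beta>s n (\<alpha>s n x + s *\<^sub>R t))) * norm (h x)
            \<le> (norm (e (\<beta> (\<alpha> x + s *\<^sub>R t))) * \<bar>divergence h x\<bar> + norm (curl e (\<beta> (\<alpha> x + s *\<^sub>R t))) * norm (h x))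
            + \<eta> * (\<bar>divergence h x\<bar> + norm (h x))" .
        qed
        also have "\<dots> = integral ?B (\<lambda>x. norm (e (\<beta> (\<alpha> x + s *\<^sub>R t))) * \<bar>divergence h x\<bar> + norm (curl e (\<beta> (\<alpha> x + s *\<^sub>R t))) * norm (h x))
            + integral ?B (\<lambda>x. \<eta> * (\<bar>divergence h x\<bar> + norm (h x)))"
          by (intro integral_add integrable_continuous continuous_intros continuous_on_divergence[OF h] continuous_on_subset[OF ch]
                continuous_on_compose2[OF ce] continuous_on_compose2[OF c\<beta>] continuous_on_compose2[OF continuous_on_curl[OF e(1), of UNIV]] c\<alpha>) auto
        also have "\<dots> \<le> M + \<eta> * S"
          unfolding S_def by (intro add_mono M s t) (simp only: integral_mult_right order_refl)
        finally show "integral ?B (\<lambda>x. norm (e (\<beta>s n (\<alpha>s n x + s *\<^sub>R t))) * \<bar>divergence h x\<bar> + norm (curl e (\<beta>s n (\<alpha>s n x + s *\<^sub>R t))) * norm (h x)) \<le> M + \<eta> * S" .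
      qed
      also have "\<dots> \<le> L ^ 3 * \<tau> * (M + \<eta> * S)"
      proof (cases "\<tau> = 0")
        case True
        then have "norm t = 0" using \<tau>[OF t] by simp
        then show ?thesis using MS by simp
      next
        case False
        then have "0 < L ^ 3 * \<tau>" using L \<tau>0 by simp
        then have "0 \<le> M + \<eta> * S" using MS by (simp add: zero_le_mult_iff)
        then show ?thesis using \<tau>[OF t] L by (intro mult_right_mono mult_left_mono) auto
      qed
      finally show ?thesis .
    qed
    have cint: "continuous_on (?B \<times> cbox c d) (\<lambda>(x, t). \<rho> t * (e (\<beta>s n (\<alpha>s n x + t)) \<bullet> ?D (\<beta>s n) (\<alpha>s n x + t) (?D (\<alpha>s n) x (h x))))"
      unfolding split_beta
      by (intro continuous_on_avg_integrand ce \<rho>(1) continuous_intros continuous_on_frechet_derivative[OF Ck_\<alpha>s] continuous_on_compose2[OF ch]) auto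
    have cI: "continuous_on (cbox c d) (I n)"
      unfolding I_def
    proof (rule integral_continuous_on_param)
      have "continuous_on (cbox c d \<times> ?B) (\<lambda>p. 1 * (e (\<beta>s n (\<alpha>s n (snd p) + fst p)) \<bullet> ?D (\<beta>s n) (\<alpha>s n (snd p) + fst p) (?D (\<alpha>s n) (snd p) (h (snd p)))))"
        by (intro continuous_on_avg_integrand[where \<rho>="\<lambda>_. 1"] ce continuous_intros continuous_on_frechet_derivative[OF Ck_\<alpha>s] continuous_on_compose2[OF ch]) auto
      then show "continuous_on (cbox c d \<times> ?B) (\<lambda>(t, x). e (\<beta>s n (\<alpha>s n x + t)) \<bullet> ?D (\<beta>s n) (\<alpha>s n x + t) (?D (\<alpha>s n) x (h x)))"
        by (simp add: split_beta)
    qed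
    have \<rho>c: "continuous_on (cbox c d) \<rho>" using \<rho>(1) by (rule continuous_on_subset) simp
    have "integral (cbox c d) (\<lambda>t. \<rho> t * I n t)
        = integral (cbox c d) (\<lambda>t. integral ?B (\<lambda>x. \<rho> t * (e (\<beta>s n (\<alpha>s n x + t)) \<bullet> ?D (\<beta>s n) (\<alpha>s n x + t) (?D (\<alpha>s n) x (h x)))))"
      unfolding I_def by (simp only: integral_mult_right)
    \<comment> \<open>Fubini for a continuous integrand; for fixed \<open>x\<close> the inner
      integral is then linear in the transported field.\<close>
    also have "\<dots> = integral ?B (\<lambda>x. integral (cbox c d) (\<lambda>t. \<rho> t * (e (\<beta>s n (\<alpha>s n x + t)) \<bullet> ?D (\<beta>s n) (\<alpha>s n x + t) (?D (\<alpha>s n) x (h x)))))"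
      using cint by (intro integral_swap_continuous[symmetric]) (simp add: cbox_Pair_eq)
    also have "\<dots> = integral ?B (\<lambda>x. ?D (\<alpha>s n) x (h x) \<bullet> avg e \<rho> c d n x)"
      by (simp only: inner_avg[OF ce \<rho>(1)])
    finally have J: "integral (cbox c d) (\<lambda>t. \<rho> t * I n t) = integral ?B (\<lambda>x. ?D (\<alpha>s n) x (h x) \<bullet> avg e \<rho> c d n x)" .
    have Jle: "norm (integral ?B (\<lambda>x. ?D (\<alpha>s n) x (h x) \<bullet> avg e \<rho> c d n x)) \<le> integral ?B (\<lambda>x. L * (norm (h x) * norm (avg e \<rho> c d n x)))"
    proof (rule integral_norm_bound_integral)
      show "(\<lambda>x. ?D (\<alpha>s n) x (h x) \<bullet> avg e \<rho> c d n x) integrable_on ?B"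
        by (intro integrable_continuous continuous_on_inner cDh continuous_on_avg ce \<rho>(1))
      show "(\<lambda>x. L * (norm (h x) * norm (avg e \<rho> c d n x))) integrable_on ?B"
        by (intro integrable_continuous continuous_intros continuous_on_subset[OF ch] continuous_on_avg ce \<rho>(1)) auto
      show "norm (?D (\<alpha>s n) x (h x) \<bullet> avg e \<rho> c d n x) \<le> L * (norm (h x) * norm (avg e \<rho> c d n x))" for x
        using mult_right_mono[OF deriv_\<alpha>s[of n x "h x"] norm_ge_zero[of "avg e \<rho> c d n x"]]
          order_trans[OF Cauchy_Schwarz_ineq2[of "?D (\<alpha>s n) x (h x)" "avg e \<rho> c d n x"]]
        by (simp add: mult.assoc)
    qed
    have "I n 0 = integral (cbox c d) (\<lambda>t. \<rho> t * I n 0)"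
      using \<rho>(4) by (simp only: integral_mult_left mult_1)
    also have "\<dots> = integral (cbox c d) (\<lambda>t. \<rho> t * I n t) - integral (cbox c d) (\<lambda>t. \<rho> t * (I n t - I n 0))"
      by (subst integral_diff[symmetric])
        (auto intro!: integrable_continuous continuous_intros cI \<rho>c simp: algebra_simps)
    finally have "\<bar>I n 0\<bar> \<le> \<bar>integral (cbox c d) (\<lambda>t. \<rho> t * I n t)\<bar> + \<bar>integral (cbox c d) (\<lambda>t. \<rho> t * (I n t - I n 0))\<bar>"
      by linarith
    moreover have "\<bar>integral (cbox c d) (\<lambda>t. \<rho> t * (I n t - I n 0))\<bar> \<le> L ^ 3 * \<tau> * (M + \<eta> * S)"
    proof -
      have "norm (integral (cbox c d) (\<lambda>t. \<rho> t * (I n t - I n 0))) \<le> integral (cbox c d) (\<lambda>t. (L ^ 3 * \<tau> * (M + \<eta> * S)) * \<rho> t)"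
      proof (rule integral_norm_bound_integral)
        show "(\<lambda>t. \<rho> t * (I n t - I n 0)) integrable_on cbox c d"
          by (intro integrable_continuous continuous_intros cI \<rho>c)
        show "(\<lambda>t. (L ^ 3 * \<tau> * (M + \<eta> * S)) * \<rho> t) integrable_on cbox c d"
          by (intro integrable_continuous continuous_intros \<rho>c)
        show "norm (\<rho> t * (I n t - I n 0)) \<le> (L ^ 3 * \<tau> * (M + \<eta> * S)) * \<rho> t" if "t \<in> cbox c d" for t
          using mult_left_mono[OF step[OF that] \<rho>(3)[of t]] \<rho>(3)[of t] by (simp add: abs_mult mult.commute)
      qed
      also have "\<dots> = L ^ 3 * \<tau> * (M + \<eta> * S)" using \<rho>(4) by (simp only: integral_mult_right mult_1_right)
      finally show ?thesis by simp
    qed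
    moreover have "\<bar>integral (cbox c d) (\<lambda>t. \<rho> t * I n t)\<bar> \<le> L * integral ?B (\<lambda>x. norm (h x) * norm (avg e \<rho> c d n x))"
      unfolding J using Jle by (simp only: integral_mult_right real_norm_def)
    ultimately show ?thesis by linarith
  qed
  have dct: "(\<lambda>x. norm (h x) * norm (avg_limit e \<rho> x)) integrable_on ?B"
    "(\<lambda>n. integral ?B (\<lambda>x. norm (h x) * norm (avg e \<rho> c d n x))) \<longlonglongrightarrow> integral ?B (\<lambda>x. norm (h x) * norm (avg_limit e \<rho> x))"
  proof -
    have 1: "(\<lambda>x. norm (h x) * norm (avg e \<rho> c d n x)) integrable_on ?B" for n
      by (intro integrable_continuous continuous_intros continuous_on_subset[OF ch] continuous_on_avg ce \<rho>(1)) auto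
    have 2: "(\<lambda>x. norm (h x) * (3 * (M\<rho> * (Me * L) * measure lborel (cbox c d)))) integrable_on ?B"
      by (intro integrable_continuous continuous_intros continuous_on_subset[OF ch]) auto
    have 3: "norm (norm (h x) * norm (avg e \<rho> c d n x)) \<le> norm (h x) * (3 * (M\<rho> * (Me * L) * measure lborel (cbox c d)))" for n x
      using mult_left_mono[OF avg_bound[OF ce Me(2) \<rho>(1), of M\<rho> c d n x] norm_ge_zero[of "h x"]] M\<rho>(2) by simp
    have 4: "(\<lambda>n. norm (h x) * norm (avg e \<rho> c d n x)) \<longlonglongrightarrow> norm (h x) * norm (avg_limit e \<rho> x)" for x
    proof (cases "x \<in> supp h")
      case True
      show ?thesis
        by (intro tendsto_intros avg_tendsto[OF ce e(2) \<rho>(1,2)] range[OF True])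
    next
      case False
      then show ?thesis by (simp add: supp_zero)
    qed
    show "(\<lambda>x. norm (h x) * norm (avg_limit e \<rho> x)) integrable_on ?B"
      by (rule dominated_convergence(1)[OF 1 2 3 4])
    show "(\<lambda>n. integral ?B (\<lambda>x. norm (h x) * norm (avg e \<rho> c d n x))) \<longlonglongrightarrow> integral ?B (\<lambda>x. norm (h x) * norm (avg_limit e \<rho> x))"
      by (rule dominated_convergence(2)[OF 1 2 3 4])
  qed
  show "(\<lambda>x. norm (h x) * norm (avg_limit e \<rho> x)) integrable_on ?B" by (rule dct(1))
  have I0: "(\<lambda>n. I n 0) \<longlonglongrightarrow> integral ?B (\<lambda>x. e x \<bullet> h x)"
    unfolding I_def add_0_right by (rule pullback_tendsto[OF e h supp inv])
  have curl_supp: "bounded (supp (curl e))"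
  proof (rule bounded_subset[OF e(2)])
    show "supp (curl e) \<subseteq> supp e"
      using e(1) by (intro supp_subset closed_supp curl_zero_outside_supp) auto
  qed
  \<comment> \<open>With \<open>\<eta>\<close> fixed, \<open>n\<close> tends to infinity;
    \<open>\<eta>\<close> is sent to 0 only afterwards.\<close>
  have le: "\<bar>integral ?B (\<lambda>x. e x \<bullet> h x)\<bar> \<le> L ^ 3 * \<tau> * (M + \<eta> * S) + L * integral ?B (\<lambda>x. norm (h x) * norm (avg_limit e \<rho> x))"
    if \<eta>: "0 < \<eta>" for \<eta>
  proof (rule tendsto_le[OF sequentially_bot _ tendsto_rabs[OF I0]])
    show "(\<lambda>n. L ^ 3 * \<tau> * (M + \<eta> * S) + L * integral ?B (\<lambda>x. norm (h x) * norm (avg e \<rho> c d n x)))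
        \<longlonglongrightarrow> L ^ 3 * \<tau> * (M + \<eta> * S) + L * integral ?B (\<lambda>x. norm (h x) * norm (avg_limit e \<rho> x))"
      by (intro tendsto_intros dct(2))
    show "\<forall>\<^sub>F n in sequentially. \<bar>I n 0\<bar> \<le> L ^ 3 * \<tau> * (M + \<eta> * S) + L * integral ?B (\<lambda>x. norm (h x) * norm (avg e \<rho> c d n x))"
      using uniform_composition_eventually[OF ce e(2) \<eta>] uniform_composition_eventually[OF continuous_on_curl[OF e(1)] curl_supp \<eta>]
      by eventually_elim (intro main \<eta>; blast)
  qed
  show "\<bar>integral ?B (\<lambda>x. e x \<bullet> h x)\<bar> \<le> L ^ 3 * \<tau> * M + L * integral ?B (\<lambda>x. norm (h x) * norm (avg_limit e \<rho> x))"
  proof (rule field_le_epsilon)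
    fix \<epsilon> :: real assume \<epsilon>: "0 < \<epsilon>"
    define K where "K = L ^ 3 * \<tau> * S + 1"
    have K: "0 < K" using L \<tau>0 S by (simp add: K_def add_nonneg_pos)
    have "L ^ 3 * \<tau> * ((\<epsilon> / K) * S) = (\<epsilon> / K) * (K - 1)" by (simp add: K_def)
    also have "\<dots> \<le> (\<epsilon> / K) * K" using \<epsilon> K by (intro mult_left_mono) auto
    also have "\<dots> = \<epsilon>" using K by simp
    finally show "\<bar>integral ?B (\<lambda>x. e x \<bullet> h x)\<bar> \<le> L ^ 3 * \<tau> * M + L * integral ?B (\<lambda>x. norm (h x) * norm (avg_limit e \<rho> x)) + \<epsilon>"
      using le[of "\<epsilon> / K"] \<epsilon> K by (simp add: distrib_left)
  qed
qed

end

section \<open>Cutoff functions and Lipschitz extension\<close>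

text \<open>Its derivative \<open>2 * max 0 u\<close> is continuous: the profile for cutoff
  functions, for which continuous first derivatives suffice.\<close>

definition pos_square :: "real \<Rightarrow> real" where
  "pos_square u = (max 0 u)\<^sup>2"

lemma pos_square_has_derivative: "(pos_square has_real_derivative 2 * max 0 x) (at x)"
proof -
  have "((\<lambda>h. (pos_square (x + h) - pos_square x) / h) \<longlongrightarrow> 2 * max 0 x) (at 0)"
  proof (rule LIM_zero_cancel, rule Lim_null_comparison)
    have "\<bar>(pos_square (x + h) - pos_square x) / h - 2 * max 0 x\<bar> \<le> \<bar>h\<bar>" if "h \<noteq> 0" for h
    proof -
      have "\<bar>pos_square (x + h) - pos_square x - h * (2 * max 0 x)\<bar> \<le> h\<^sup>2"
      proof (cases "0 \<le> x"; cases "0 \<le> x + h")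
        assume "0 \<le> x" "0 \<le> x + h"
        then show ?thesis by (simp add: pos_square_def power2_eq_square algebra_simps)
      next
        assume "0 \<le> x" "\<not> 0 \<le> x + h"
        then have *: "x * x \<le> (- h) * x" "(- h) * x \<le> (- h) * (- h)" by (intro mult_right_mono mult_left_mono; simp)+
        have "0 \<le> (x + h) * (x + h)" by simp
        also have "\<dots> = x * x + 2 * (h * x) + h * h" by (simp add: algebra_simps)
        finally have "\<bar>- (x * x) - 2 * (h * x)\<bar> \<le> h * h"
          using * zero_le_square[of x] zero_le_square[of h] unfolding abs_le_iff mult_minus_left by linarith
        then have "\<bar>- (x * x) - h * (2 * x)\<bar> \<le> h * h" by (simp only: mult.left_commute[of h 2 x])
        then show ?thesis using \<open>0 \<le> x\<close> \<open>\<not> 0 \<le> x + h\<close> by (simp add: pos_square_def power2_eq_square)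
      next
        assume "\<not> 0 \<le> x" "0 \<le> x + h"
        then have "(x + h) * (x + h) \<le> h * h" by (intro mult_mono) auto
        then show ?thesis using \<open>\<not> 0 \<le> x\<close> \<open>0 \<le> x + h\<close> by (simp add: pos_square_def power2_eq_square)
      next
        assume "\<not> 0 \<le> x" "\<not> 0 \<le> x + h"
        then show ?thesis by (simp add: pos_square_def)
      qed
      then have "\<bar>pos_square (x + h) - pos_square x - h * (2 * max 0 x)\<bar> / \<bar>h\<bar> \<le> h\<^sup>2 / \<bar>h\<bar>"
        by (intro divide_right_mono) auto
      moreover have "(pos_square (x + h) - pos_square x) / h - 2 * max 0 x = (pos_square (x + h) - pos_square x - h * (2 * max 0 x)) / h"
        using that by (simp add: field_simps)
      moreover have "h\<^sup>2 / \<bar>h\<bar> = \<bar>h\<bar>" using that by (simp add: power2_eq_square abs_if)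
      ultimately show ?thesis by (simp only: abs_divide)
    qed
    then show "\<forall>\<^sub>F h in at 0. norm ((pos_square (x + h) - pos_square x) / h - 2 * max 0 x) \<le> \<bar>h\<bar>"
      by (simp add: eventually_at_filter)
    show "((\<lambda>h. \<bar>h\<bar>) \<longlongrightarrow> 0) (at (0::real))" using tendsto_rabs[OF tendsto_ident_at[of 0 UNIV]] by simp
  qed
  then show ?thesis by (simp add: DERIV_def)
qed

lemma Ck_pos_square: "Ck (Suc 0) pos_square"
proof (rule Ck_SucI)
  show "(pos_square has_derivative (*) (2 * max 0 x)) (at x)" for x
    using pos_square_has_derivative by (simp add: has_field_derivative_def)
  show "Ck 0 (\<lambda>x. 2 * max 0 x * v)" for v :: real by (simp add: continuous_intros)
qed

text \<open>The quotient is at least 1 for points at distance at most \<open>r\<close> from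
  \<open>p\<close> and at most 0 from distance \<open>2 * r\<close> on. Applying
  \<open>pos_square\<close> flattens the lower end, and applying it to 1 minus the result flattens
  the upper one.\<close>

definition plateau :: "real ^ 3 \<Rightarrow> real \<Rightarrow> real ^ 3 \<Rightarrow> real" where
  "plateau p r x = 1 - pos_square (1 - pos_square ((4 * r\<^sup>2 - (x - p) \<bullet> (x - p)) / (3 * r\<^sup>2)))"

lemma Ck_plateau: "Ck (Suc 0) (plateau p r)"
proof -
  have i: "Ck (Suc 0) (\<lambda>x :: real ^ 3. x - p)"
    by (intro Ck_diff Ck_const Ck_bounded_linear bounded_linear_ident)
  have "Ck (Suc 0) (\<lambda>x :: real ^ 3. (4 * r\<^sup>2 - (x - p) \<bullet> (x - p)) * (1 / (3 * r\<^sup>2)))"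
    by (intro Ck_mult Ck_diff Ck_const Ck_inner i)
  then have "Ck (Suc 0) (\<lambda>x :: real ^ 3. (4 * r\<^sup>2 - (x - p) \<bullet> (x - p)) / (3 * r\<^sup>2))" by simp
  then show ?thesis
    unfolding plateau_def[abs_def] by (intro Ck_diff Ck_const Ck_compose[OF Ck_pos_square])
qed

lemma plateau_bounds: "0 \<le> plateau p r x" "plateau p r x \<le> 1"
proof -
  have "pos_square (1 - pos_square u) \<le> 1" for u
    unfolding pos_square_def by (intro power_le_one) auto
  then show "0 \<le> plateau p r x" by (simp add: plateau_def)
  show "plateau p r x \<le> 1" by (simp add: plateau_def pos_square_def)
qed

lemma plateau_one: "0 < r \<Longrightarrow> dist p x \<le> r \<Longrightarrow> plateau p r x = 1"
proof -
  assume r: "0 < r" and d: "dist p x \<le> r"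
  have "(x - p) \<bullet> (x - p) \<le> r\<^sup>2"
    using power_mono[OF d, of 2] by (simp add: dist_norm norm_minus_commute[of p] power2_norm_eq_inner[symmetric])
  then have "1 \<le> (4 * r\<^sup>2 - (x - p) \<bullet> (x - p)) / (3 * r\<^sup>2)" using r by (simp add: field_simps)
  then have "1 \<le> pos_square ((4 * r\<^sup>2 - (x - p) \<bullet> (x - p)) / (3 * r\<^sup>2))"
    by (simp add: pos_square_def)
  then show ?thesis by (simp add: plateau_def pos_square_def)
qed

lemma plateau_zero: "0 < r \<Longrightarrow> 2 * r \<le> dist p x \<Longrightarrow> plateau p r x = 0"
proof -
  assume r: "0 < r" and d: "2 * r \<le> dist p x"
  have "(2 * r)\<^sup>2 \<le> (x - p) \<bullet> (x - p)"
    using power_mono[OF d, of 2] r by (simp add: dist_norm norm_minus_commute[of p] power2_norm_eq_inner[symmetric])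
  then have "(4 * r\<^sup>2 - (x - p) \<bullet> (x - p)) / (3 * r\<^sup>2) \<le> 0"
    using r by (simp add: divide_le_0_iff power_mult_distrib)
  then show ?thesis by (simp add: plateau_def pos_square_def)
qed

text \<open>One minus the product of the complementary plateaus over a finite subcover of
  \<open>P\<close>. The function is constant on neighbourhoods of \<open>P\<close> and
  \<open>Z\<close>, so derivatives of a product with it are controlled there as well.\<close>

lemma C1_Urysohn:
  fixes P Z :: "(real ^ 3) set"
  assumes P: "compact P" and Z: "closed Z" and PZ: "P \<inter> Z = {}"
  obtains \<theta> U V where "Ck (Suc 0) \<theta>" "open U" "P \<subseteq> U" "\<And>x. x \<in> U \<Longrightarrow> \<theta> x = (1 :: real)"
    "open V" "Z \<subseteq> V" "\<And>x. x \<in> V \<Longrightarrow> \<theta> x = 0" "\<And>x. 0 \<le> \<theta> x" "\<And>x. \<theta> x \<le> 1"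
proof -
  have "\<exists>r>0. ball p (3 * r) \<inter> Z = {}" if "p \<in> P" for p
  proof -
    have "p \<in> - Z" "open (- Z)" using that PZ Z by auto
    then obtain r where r: "0 < r" "ball p r \<subseteq> - Z" using openE by blast
    then show ?thesis by (intro exI[of _ "r / 3"]) auto
  qed
  \<comment> \<open>The plateaus end at radius \<open>2 * r p\<close> while \<open>Z\<close> stays
    outside \<open>3 * r p\<close>; the gap makes the neighbourhood \<open>V\<close> of
    \<open>Z\<close> open.\<close>
  then obtain r where r: "\<And>p. p \<in> P \<Longrightarrow> 0 < r p" "\<And>p. p \<in> P \<Longrightarrow> ball p (3 * r p) \<inter> Z = {}" by metis
  have "P \<subseteq> (\<Union>p\<in>P. ball p (r p))" using r(1) by auto
  then obtain F where F: "F \<subseteq> P" "finite F" "P \<subseteq> (\<Union>p\<in>F. ball p (r p))"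
    using compactE_image[OF P, of P "\<lambda>p. ball p (r p)"] by auto
  define \<theta> where "\<theta> x = 1 - (\<Prod>p\<in>F. 1 - plateau p (r p) x)" for x
  define V where "V = (\<Inter>p\<in>F. - cball p (2 * r p))"
  show ?thesis
  proof (rule that)
    show "Ck (Suc 0) \<theta>"
      unfolding \<theta>_def by (intro Ck_diff Ck_const Ck_prod Ck_plateau F(2))
    show "open (\<Union>p\<in>F. ball p (r p))" by auto
    show "P \<subseteq> (\<Union>p\<in>F. ball p (r p))" by (rule F(3))
    show "\<theta> x = 1" if "x \<in> (\<Union>p\<in>F. ball p (r p))" for x
    proof -
      from \<open>x \<in> (\<Union>p\<in>F. ball p (r p))\<close> obtain p where p: "p \<in> F" "dist p x < r p" by auto
      then have "1 - plateau p (r p) x = 0" using r(1) F(1) by (simp add: plateau_one less_imp_le subset_iff)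
      then have "(\<Prod>p\<in>F. 1 - plateau p (r p) x) = 0" using p(1) F(2) by (intro prod_zero) auto
      then show ?thesis by (simp add: \<theta>_def)
    qed
    show "open V" unfolding V_def using F(2) by (intro open_INT) auto
    show "Z \<subseteq> V"
    proof
      fix z assume z: "z \<in> Z"
      have "2 * r p < dist p z" if "p \<in> F" for p
      proof -
        have "z \<notin> ball p (3 * r p)" using r(2)[of p] z that F(1) by blast
        then show ?thesis using r(1)[of p] that F(1) by auto
      qed
      then show "z \<in> V" by (auto simp: V_def not_le)
    qed
    show "\<theta> x = 0" if "x \<in> V" for x
    proof -
      have "plateau p (r p) x = 0" if "p \<in> F" for p
        using \<open>x \<in> V\<close> that r(1)[of p] F(1) by (intro plateau_zero) (auto simp: V_def)
      then show ?thesis by (simp add: \<theta>_def)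
    qed
    have "0 \<le> (\<Prod>p\<in>F. 1 - plateau p (r p) x)" "(\<Prod>p\<in>F. 1 - plateau p (r p) x) \<le> 1" for x
      using plateau_bounds by (auto intro!: prod_nonneg prod_le_1)
    then show "0 \<le> \<theta> x" "\<theta> x \<le> 1" for x by (auto simp: \<theta>_def)
  qed
qed

text \<open>McShane's extension: the infimum of the cones of slope \<open>L\<close> over the
  graph.\<close>

lemma Lipschitz_extension_real:
  fixes f :: "'a::metric_space \<Rightarrow> real"
  assumes L: "0 \<le> L" and f: "\<And>x y. x \<in> W \<Longrightarrow> y \<in> W \<Longrightarrow> \<bar>f x - f y\<bar> \<le> L * dist x y"
  obtains g where "\<And>x. x \<in> W \<Longrightarrow> g x = f x" "\<And>x y. \<bar>g x - g y\<bar> \<le> L * dist x y"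
proof (cases "W = {}")
  case True
  then show ?thesis using L by (intro that[of "\<lambda>x. 0"]) auto
next
  case False
  then obtain w where w: "w \<in> W" by blast
  define g where "g x = (INF y\<in>W. f y + L * dist x y)" for x
  have bdd: "bdd_below ((\<lambda>y. f y + L * dist x y) ` W)" for x
  proof (rule bdd_belowI2)
    fix y assume y: "y \<in> W"
    have "f w - f y \<le> L * dist w y" using f[OF w y] by linarith
    also have "\<dots> \<le> L * (dist w x + dist x y)" using L dist_triangle by (intro mult_left_mono) auto
    finally show "f w - L * dist w x \<le> f y + L * dist x y" by (simp add: algebra_simps)
  qed
  have le: "g x \<le> g y + L * dist x y" for x y
  proof -
    have "g x - L * dist x y \<le> (INF u\<in>W. f u + L * dist y u)"
    proof (rule cINF_greatest[OF False])
      fix u assume u: "u \<in> W"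
      have "g x \<le> f u + L * dist x u" unfolding g_def by (rule cINF_lower[OF bdd u])
      also have "\<dots> \<le> f u + L * (dist x y + dist y u)" using L dist_triangle by (intro add_left_mono mult_left_mono) auto
      finally show "g x - L * dist x y \<le> f u + L * dist y u" by (simp add: algebra_simps)
    qed
    then show ?thesis by (simp add: g_def)
  qed
  show ?thesis
  proof (rule that)
    fix x assume x: "x \<in> W"
    have "g x \<le> f x + L * dist x x" unfolding g_def by (rule cINF_lower[OF bdd x])
    moreover have "f x \<le> g x" unfolding g_def
    proof (rule cINF_greatest[OF False])
      fix u assume "u \<in> W"
      then show "f x \<le> f u + L * dist x u" using f[OF x, of u] by linarith
    qed
    ultimately show "g x = f x" by simp
  next
    fix x y
    show "\<bar>g x - g y\<bar> \<le> L * dist x y" using le[of x y] le[of y x] by (simp add: dist_commute abs_le_iff)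
  qed
qed

text \<open>McShane's extension in each component; adding the three component bounds gives the
  factor 3.\<close>

lemma Lipschitz_extension:
  fixes f :: "'a::metric_space \<Rightarrow> real ^ 3"
  assumes L: "0 \<le> L" and f: "\<And>x y. x \<in> W \<Longrightarrow> y \<in> W \<Longrightarrow> norm (f x - f y) \<le> L * dist x y"
  obtains g where "\<And>x. x \<in> W \<Longrightarrow> g x = f x" "\<And>x y. norm (g x - g y) \<le> 3 * L * dist x y"
proof -
  have "\<exists>g. (\<forall>x\<in>W. g x = f x $ i) \<and> (\<forall>x y. \<bar>g x - g y\<bar> \<le> L * dist x y)" for i
  proof -
    have "\<bar>f x $ i - f y $ i\<bar> \<le> L * dist x y" if "x \<in> W" "y \<in> W" for x y
      using order_trans[OF component_le_norm_cart[of "f x - f y" i] f[OF that]] by simp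
    from Lipschitz_extension_real[OF L this] show ?thesis by metis
  qed
  then obtain g where g: "\<And>i x. x \<in> W \<Longrightarrow> g i x = f x $ i" "\<And>i x y. \<bar>g i x - g i y\<bar> \<le> L * dist x y" by metis
  show ?thesis
  proof (rule that[of "\<lambda>x. \<chi> i. g i x"])
    show "(\<chi> i. g i x) = f x" if "x \<in> W" for x using g(1)[OF that] by (simp add: vec_eq_iff)
    fix x y
    have "norm ((\<chi> i. g i x) - (\<chi> i. g i y) :: real ^ 3) \<le> (\<Sum>i\<in>UNIV. \<bar>((\<chi> i. g i x) - (\<chi> i. g i y)) $ i\<bar>)"
      by (rule norm_le_l1_cart)
    also have "\<dots> \<le> (\<Sum>i\<in>(UNIV :: 3 set). L * dist x y)" using g(2) by (intro sum_mono) simp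
    finally show "norm ((\<chi> i. g i x) - (\<chi> i. g i y) :: real ^ 3) \<le> 3 * L * dist x y" by simp
  qed
qed

lemma box_weight_exists:
  fixes c d :: "real ^ 3"
  assumes ne: "box c d \<noteq> {}"
  obtains \<rho> :: "real ^ 3 \<Rightarrow> real" where "continuous_on UNIV \<rho>" "\<And>t. t \<notin> cbox c d \<Longrightarrow> \<rho> t = 0" "\<And>t. 0 \<le> \<rho> t"
    "integral (cbox c d) \<rho> = 1"
proof -
  let ?f = "box_cutoff c d 0"
  have c: "continuous_on UNIV ?f" using smooth_box_cutoff[of c d 0] by (intro Ck_imp_continuous[of 0]) (simp only: smooth_def)
  have i: "?f integrable_on cbox c d" by (intro integrable_continuous continuous_on_subset[OF c]) simp
  have out: "?f t = 0" if "t \<notin> box c d" for t using box_cutoff_outside[OF that] .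
  have pos: "0 < ?f t" if "t \<in> box c d" for t
    unfolding box_cutoff_def using that by (intro prod_pos) (auto simp: mem_box_cart exp_inv_pos_iff)
  define I where "I = integral (cbox c d) ?f"
  have "0 \<le> I" unfolding I_def by (rule integral_nonneg[OF i]) (rule box_cutoff_bounds)
  moreover have "I \<noteq> 0"
  proof
    assume "I = 0"
    then have hi: "(?f has_integral 0) (cbox c d)" using integrable_integral[OF i] by (simp add: I_def)
    obtain t where t: "t \<in> box c d" using ne by blast
    then have t': "t \<in> cbox c d" using box_subset_cbox by blast
    have "?f t = 0"
      by (rule has_integral_0_cbox_imp_0[OF continuous_on_subset[OF c] _ hi ne t']) (simp_all add: box_cutoff_bounds)
    then show False using pos[OF t] by simp
  qed
  ultimately have I: "0 < I" by simp
  show ?thesis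
  proof (rule that[of "\<lambda>t. ?f t * (1 / I)"])
    show "continuous_on UNIV (\<lambda>t. ?f t * (1 / I))" by (intro continuous_intros c)
    show "?f t * (1 / I) = 0" if "t \<notin> cbox c d" for t
    proof -
      have "t \<notin> box c d" using that box_subset_cbox by blast
      then show ?thesis by (simp add: out)
    qed
    show "0 \<le> ?f t * (1 / I)" for t using I box_cutoff_bounds(1)[of c d 0 t] by simp
    show "integral (cbox c d) (\<lambda>t. ?f t * (1 / I)) = 1"
      using I by (simp only: integral_mult_left I_def[symmetric]) simp
  qed
qed

section \<open>Charts that flatten the two boundary parts to a wedge\<close>

text \<open>The bound for expanding maps in dimension 3, applied to the squared norm; this is the
  source of the square root and of the exponent 3.\<close>

lemma L2_norm_compose_le:
  fixes T :: "real ^ 3 \<Rightarrow> real ^ 3" and e :: "real ^ 3 \<Rightarrow> 'b::euclidean_space"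
  assumes A: "A \<in> lmeasurable" "bounded A" and \<Omega>: "\<Omega> \<in> sets borel" "\<Omega> \<in> lmeasurable" "bounded \<Omega>"
    and T: "continuous_on UNIV T" "T ` A \<subseteq> \<Omega>" and e: "continuous_on UNIV e"
    and l: "0 < l" "\<And>x y. x \<in> A \<Longrightarrow> y \<in> A \<Longrightarrow> dist x y \<le> l * dist (T x) (T y)"
  shows "L2_norm A (\<lambda>x. e (T x)) \<le> sqrt ((3 * l) ^ 3) * L2_norm \<Omega> e"
proof -
  have AS: "A \<in> sets lebesgue" using A(1) by (rule fmeasurableD)
  have \<Omega>S: "\<Omega> \<in> sets lebesgue" using \<Omega>(2) by (rule fmeasurableD)
  have eL: "e \<in> L2 \<Omega>" by (rule continuous_L2[OF \<Omega>(2,3) e])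
  have eTL: "(\<lambda>x. e (T x)) \<in> L2 A"
    by (rule continuous_L2[OF A]) (intro continuous_on_compose2[OF e T(1)], simp)
  define F where "F y = ennreal ((norm (e y))\<^sup>2) * indicator \<Omega> y" for y
  have em: "e \<in> borel_measurable borel" using e by (rule borel_measurable_continuous_onI)
  have Fm: "F \<in> borel_measurable borel"
    unfolding F_def[abs_def] using em \<Omega>(1) by measurable
  have "ennreal ((L2_norm A (\<lambda>x. e (T x)))\<^sup>2) = (\<integral>\<^sup>+x. ennreal ((norm (e (T x)))\<^sup>2) \<partial>lebesgue_on A)"
    by (rule L2_norm_nn_integral[OF eTL, symmetric])
  also have "\<dots> = (\<integral>\<^sup>+x. F (T x) \<partial>lebesgue_on A)"
    using T(2) AS by (intro nn_integral_cong) (auto simp: F_def image_subset_iff)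
  also have "\<dots> \<le> ennreal ((3 * l) ^ DIM(real ^ 3)) * (\<integral>\<^sup>+x. F x \<partial>lborel)"
    by (rule nn_integral_expanding_le[OF AS continuous_on_subset[OF T(1) subset_UNIV] l Fm])
  also have "(\<integral>\<^sup>+x. F x \<partial>lborel) = (\<integral>\<^sup>+x. F x \<partial>lebesgue)"
    using Fm by (intro nn_integral_completion[symmetric])
  also have "\<dots> = (\<integral>\<^sup>+x. ennreal ((norm (e x))\<^sup>2) \<partial>lebesgue_on \<Omega>)"
    unfolding F_def using \<Omega>S by (intro nn_integral_restrict_space[symmetric]) simp
  also have "\<dots> = ennreal ((L2_norm \<Omega> e)\<^sup>2)" by (rule L2_norm_nn_integral[OF eL])
  also have "ennreal ((3 * l) ^ DIM(real ^ 3)) * ennreal ((L2_norm \<Omega> e)\<^sup>2) = ennreal ((3 * l) ^ 3 * (L2_norm \<Omega> e)\<^sup>2)"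
    using l(1) by (simp add: ennreal_mult'[symmetric])
  finally have "(L2_norm A (\<lambda>x. e (T x)))\<^sup>2 \<le> (3 * l) ^ 3 * (L2_norm \<Omega> e)\<^sup>2"
    using l(1) by (simp add: ennreal_le_iff)
  then have "sqrt ((L2_norm A (\<lambda>x. e (T x)))\<^sup>2) \<le> sqrt ((3 * l) ^ 3 * (L2_norm \<Omega> e)\<^sup>2)"
    by (rule real_sqrt_le_mono)
  then show ?thesis by (simp add: real_sqrt_mult)
qed

lemma L2_subset:
  assumes f: "f \<in> L2 \<Omega>" and A: "A \<in> sets lebesgue" "\<Omega> \<in> sets lebesgue" "A \<subseteq> \<Omega>"
  shows "f \<in> L2 A" "L2_norm A f \<le> L2_norm \<Omega> f"
proof -
  have m: "f \<in> borel_measurable (lebesgue_on A)"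
    using measurable_restrict_mono[OF L2_measurable[OF f] A(3)] .
  have i: "integrable lebesgue (\<lambda>x. indicator \<Omega> x *\<^sub>R (norm (f x))\<^sup>2)"
    using L2_integrable_norm_square[OF f] A(2) by (simp add: integrable_restrict_space)
  then have i': "integrable lebesgue (\<lambda>x. indicator A x *\<^sub>R (indicator \<Omega> x *\<^sub>R (norm (f x))\<^sup>2))"
    by (rule integrable_mult_indicator[OF A(1)])
  have eq: "indicator A x *\<^sub>R (indicator \<Omega> x *\<^sub>R (norm (f x))\<^sup>2) = indicator A x *\<^sub>R (norm (f x))\<^sup>2" for x
    using A(3) by (auto simp: indicator_def)
  have i'': "integrable (lebesgue_on A) (\<lambda>x. (norm (f x))\<^sup>2)"
    using i' A(1) unfolding eq by (simp add: integrable_restrict_space)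
  with m show "f \<in> L2 A" by (simp add: L2_def)
  have "(LINT x|lebesgue_on A. (norm (f x))\<^sup>2) = (LINT x|lebesgue. indicator A x *\<^sub>R (norm (f x))\<^sup>2)"
    using A(1) by (simp add: integral_restrict_space)
  also have "\<dots> \<le> (LINT x|lebesgue. indicator \<Omega> x *\<^sub>R (norm (f x))\<^sup>2)"
    using i i' A(3) unfolding eq by (intro integral_mono) (auto simp: indicator_def)
  also have "\<dots> = (LINT x|lebesgue_on \<Omega>. (norm (f x))\<^sup>2)"
    using A(2) by (simp add: integral_restrict_space)
  finally show "L2_norm A f \<le> L2_norm \<Omega> f" by (simp add: L2_norm_def real_sqrt_le_mono)
qed

definition C1_away :: "(real ^ 3) set \<Rightarrow> (real ^ 3 \<Rightarrow> real ^ 3) set" where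
  "C1_away \<Sigma> = {f. Ck (Suc 0) f \<and> bounded (supp f) \<and> supp f \<inter> closure \<Sigma> = {}}"

lemma supp_add_subset: "supp (\<lambda>x. f x + g x) \<subseteq> supp f \<union> supp (g :: _ \<Rightarrow> 'b::real_normed_vector)"
  by (intro supp_subset closed_Un closed_supp) (auto simp: supp_zero)

lemma supp_scaleR_subset: "supp (\<lambda>x. c *\<^sub>R f x) \<subseteq> supp (f :: _ \<Rightarrow> 'b::real_normed_vector)"
  by (intro supp_subset closed_supp) (auto simp: supp_zero)

lemma C1_away_add: "f \<in> C1_away \<Sigma> \<Longrightarrow> g \<in> C1_away \<Sigma> \<Longrightarrow> (\<lambda>x. f x + g x) \<in> C1_away \<Sigma>"
  using supp_add_subset[of f g] unfolding C1_away_def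
  by (auto intro!: Ck_add simp del: Ck.simps intro: bounded_subset[of "supp f \<union> supp g"])

lemma C1_away_scaleR: "f \<in> C1_away \<Sigma> \<Longrightarrow> (\<lambda>x. c *\<^sub>R f x) \<in> C1_away \<Sigma>"
  using supp_scaleR_subset[of c f] unfolding C1_away_def
  by (auto intro!: Ck_scaleR Ck_const simp del: Ck.simps intro: bounded_subset[of "supp f"])

lemma C1_away_zero: "(\<lambda>x. 0) \<in> C1_away \<Sigma>"
  by (auto simp: C1_away_def supp_def Ck_const simp del: Ck.simps)

lemma C1_away_diff: "f \<in> C1_away \<Sigma> \<Longrightarrow> g \<in> C1_away \<Sigma> \<Longrightarrow> (\<lambda>x. f x - g x) \<in> C1_away \<Sigma>"
  using C1_away_add[OF _ C1_away_scaleR, of f \<Sigma> g "-1"] by simp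

lemma C1_away_Ck: "f \<in> C1_away \<Sigma> \<Longrightarrow> Ck (Suc 0) f"
  by (simp add: C1_away_def del: Ck.simps)

lemma C1_away_L2:
  assumes "open \<Omega>" "bounded \<Omega>" "f \<in> C1_away \<Sigma>"
  shows "f \<in> L2 \<Omega>" "curl f \<in> L2 \<Omega>" "divergence f \<in> L2 \<Omega>"
  using open_bounded_lmeasurable[OF assms(1,2)] assms(2)
  by (auto intro!: continuous_L2 continuous_on_curl continuous_on_divergence C1_away_Ck[OF assms(3)]
      Ck_imp_continuous[OF C1_away_Ck[OF assms(3)]])

lemma curl_divergence_cong_open:
  assumes "open U" "x \<in> U" "\<And>y. y \<in> U \<Longrightarrow> g y = f y" "Ck (Suc 0) f"
  shows "curl g x = curl f x" "divergence g x = divergence f x"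
proof -
  have d: "f differentiable (at x)" using assms(4) by simp
  have "frechet_derivative g (at x) = frechet_derivative f (at x)"
    using assms(3) by (intro frechet_derivative_cong_open[OF assms(1,2) _ d]) simp
  then show "divergence g x = divergence f x" by (simp add: divergence_def)
  have "(\<lambda>y. f y $ i) differentiable (at x)" for i
    using bounded_linear.has_derivative[OF bounded_linear_vec_nth has_frechet_derivative[OF d]]
    unfolding differentiable_def by blast
  then have "frechet_derivative (\<lambda>y. g y $ i) (at x) = frechet_derivative (\<lambda>y. f y $ i) (at x)" for i
    using assms(3) by (intro frechet_derivative_cong_open[OF assms(1,2)]) simp_all
  then show "curl g x = curl f x" by (simp add: curl_def partial_def)
qed

text \<open>Makes extension by zero across a face explicit: \<open>Z\<close> is the region beyond
  the face, and \<open>g\<close> agrees with \<open>f\<close> to first order on the part of \<Omega>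
  that matters. The condition \<open>disj\<close> says that within \<open>closure \<Omega>\<close>
  the support of \<open>f\<close> does not touch the face.\<close>

lemma local_cutoff:
  fixes f :: "real ^ 3 \<Rightarrow> real ^ 3"
  assumes f: "Ck (Suc 0) f" and N: "compact N" and Z: "closed Z" and disj: "closure \<Omega> \<inter> supp f \<inter> N \<inter> Z = {}"
  obtains g where "Ck (Suc 0) g" "supp g \<subseteq> supp f"
    "\<And>x. x \<in> N \<inter> \<Omega> \<Longrightarrow> g x = f x \<and> curl g x = curl f x \<and> divergence g x = divergence f x"
    "\<And>x. x \<in> Z \<Longrightarrow> g x = 0 \<and> curl g x = 0 \<and> divergence g x = 0"
proof -
  have "compact (N \<inter> (closure \<Omega> \<inter> supp f))" using N by (intro compact_Int_closed) (auto simp: closed_supp)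
  moreover have "N \<inter> (closure \<Omega> \<inter> supp f) \<inter> Z = {}" using disj by blast
  ultimately obtain \<theta> U V where \<theta>: "Ck (Suc 0) \<theta>" "open U" "N \<inter> (closure \<Omega> \<inter> supp f) \<subseteq> U"
    "\<And>x. x \<in> U \<Longrightarrow> \<theta> x = (1 :: real)" "open V" "Z \<subseteq> V" "\<And>x. x \<in> V \<Longrightarrow> \<theta> x = 0"
    using C1_Urysohn[of "N \<inter> (closure \<Omega> \<inter> supp f)" Z] Z by metis
  show ?thesis
  proof (rule that[of "\<lambda>x. \<theta> x *\<^sub>R f x"])
    show "Ck (Suc 0) (\<lambda>x. \<theta> x *\<^sub>R f x)" by (intro Ck_scaleR \<theta> f)
    show "supp (\<lambda>x. \<theta> x *\<^sub>R f x) \<subseteq> supp f" by (intro supp_subset closed_supp) (simp add: supp_zero)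
    fix x
    show "\<theta> x *\<^sub>R f x = f x \<and> curl (\<lambda>x. \<theta> x *\<^sub>R f x) x = curl f x \<and> divergence (\<lambda>x. \<theta> x *\<^sub>R f x) x = divergence f x"
      if x: "x \<in> N \<inter> \<Omega>"
    proof -
      \<comment> \<open>On \<open>U\<close> the cutoff is 1, and off the support of \<open>f\<close>
        both fields vanish. Every point of \<open>N \<inter> \<Omega>\<close> lies in one of these
        open sets, so the derivatives agree as well.\<close>
      have "open (U \<union> - supp f)" using \<theta>(2) by (intro open_Un) (auto simp: closed_supp)
      moreover have "x \<in> U \<union> - supp f" using x \<theta>(3) closure_subset[of \<Omega>] by blast
      moreover have *: "\<theta> y *\<^sub>R f y = f y" if "y \<in> U \<union> - supp f" for y
        using that \<theta>(4) by (auto simp: supp_zero)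
      ultimately show ?thesis
        using curl_divergence_cong_open[of "U \<union> - supp f" x "\<lambda>x. \<theta> x *\<^sub>R f x" f] f by blast
    qed
    show "\<theta> x *\<^sub>R f x = 0 \<and> curl (\<lambda>x. \<theta> x *\<^sub>R f x) x = 0 \<and> divergence (\<lambda>x. \<theta> x *\<^sub>R f x) x = 0" if x: "x \<in> Z"
    proof -
      have z: "curl (\<lambda>x. 0) x = 0" "divergence (\<lambda>x. 0) x = 0" for x
        using curl_zero_outside_supp[of "\<lambda>x. 0" x] frechet_derivative_zero_outside_supp[of x "\<lambda>x. 0"]
        by (auto simp: supp_def divergence_def)
      have "x \<in> V" using x \<theta>(6) by blast
      then show ?thesis
        using curl_divergence_cong_open[of V x "\<lambda>x. \<theta> x *\<^sub>R f x" "\<lambda>x. 0", OF \<theta>(5) _ _ Ck_const] \<theta>(7) z by simp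
    qed
  qed
qed

text \<open>A chart away from \<open>\<Gamma>t\<close>, from \<open>\<Gamma>n\<close> or from both is covered by an \<open>a\<close> or \<open>b\<close> beyond the range of the
  corresponding coordinate.\<close>

locale wedge_chart =
  fixes \<Omega> \<Gamma>t \<Gamma>n W :: "(real ^ 3) set" and \<alpha> \<beta> :: "real ^ 3 \<Rightarrow> real ^ 3" and L a b :: real
  assumes open_\<Omega>: "open \<Omega>" and bounded_\<Omega>: "bounded \<Omega>"
    and open_W: "open W" and open_image: "open (\<alpha> ` W)" and L: "1 \<le> L"
    and lip_\<alpha>: "\<And>x y. norm (\<alpha> x - \<alpha> y) \<le> L * norm (x - y)"
    and lip_\<beta>: "\<And>x y. norm (\<beta> x - \<beta> y) \<le> L * norm (x - y)"
    and inv: "\<And>x. x \<in> W \<Longrightarrow> \<beta> (\<alpha> x) = x"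
    and inside: "\<And>x. x \<in> W \<Longrightarrow> x \<in> \<Omega> \<longleftrightarrow> \<alpha> x $ 1 < a \<and> \<alpha> x $ 3 < b"
    and face_t: "\<And>x. x \<in> W \<Longrightarrow> \<alpha> x $ 1 = a \<Longrightarrow> \<alpha> x $ 3 \<le> b \<Longrightarrow> x \<in> closure \<Gamma>t"
    and face_n: "\<And>x. x \<in> W \<Longrightarrow> \<alpha> x $ 1 \<le> a \<Longrightarrow> \<alpha> x $ 3 = b \<Longrightarrow> x \<in> closure \<Gamma>n"
begin

lemma lmeasurable_\<Omega>: "\<Omega> \<in> lmeasurable"
  using open_\<Omega> bounded_\<Omega> by (rule open_bounded_lmeasurable)

lemma continuous_\<alpha>: "continuous_on S \<alpha>" and continuous_\<beta>: "continuous_on S \<beta>"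
  using lip_\<alpha> lip_\<beta> L
  by (auto intro!: lipschitz_on_continuous_on[of L] lipschitz_onI simp: dist_norm)

lemma image_inv: "z \<in> \<alpha> ` W \<Longrightarrow> \<beta> z \<in> W \<and> \<alpha> (\<beta> z) = z"
  using inv by auto

lemma closure_inside:
  assumes "x \<in> W" "x \<in> closure \<Omega>"
  shows "\<alpha> x $ 1 \<le> a \<and> \<alpha> x $ 3 \<le> b"
proof (rule ccontr)
  assume n: "\<not> (\<alpha> x $ 1 \<le> a \<and> \<alpha> x $ 3 \<le> b)"
  define U where "U = W \<inter> ({y. a < \<alpha> y $ 1} \<union> {y. b < \<alpha> y $ 3})"
  have "open U" unfolding U_def
    by (intro open_Int open_W open_Un open_Collect_less continuous_intros continuous_\<alpha>)
  moreover have "x \<in> U" using n assms(1) by (auto simp: U_def)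
  ultimately obtain y where "y \<in> U" "y \<in> \<Omega>"
    using assms(2) by (metis IntE disjoint_iff open_Int_closure_eq_empty)
  then show False using inside[of y] by (auto simp: U_def)
qed

lemma expand_\<beta>: "z \<in> \<alpha> ` W \<Longrightarrow> z' \<in> \<alpha> ` W \<Longrightarrow> dist z z' \<le> L * dist (\<beta> z) (\<beta> z')"
  using lip_\<alpha>[of "\<beta> z" "\<beta> z'"] image_inv by (simp add: dist_norm)

lemma expand_\<alpha>: "x \<in> W \<Longrightarrow> y \<in> W \<Longrightarrow> dist x y \<le> L * dist (\<alpha> x) (\<alpha> y)"
  using lip_\<beta>[of "\<alpha> x" "\<alpha> y"] inv by (simp add: dist_norm)

lemma compact_margin:
  assumes K: "compact K" "K \<subseteq> W"
  obtains \<delta> where "0 < \<delta>" "\<And>x t. x \<in> K \<Longrightarrow> norm t \<le> \<delta> \<Longrightarrow> \<alpha> x + t \<in> \<alpha> ` W"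
proof (cases "K = {}")
  case True
  then show ?thesis by (intro that[of 1]) auto
next
  case False
  have "compact (\<alpha> ` K)" using K(1) by (intro compact_continuous_image continuous_\<alpha>)
  then obtain \<delta> where \<delta>: "0 < \<delta>" "{x. infdist x (\<alpha> ` K) \<le> \<delta>} \<subseteq> \<alpha> ` W"
    using compact_in_open_separated[of "\<alpha> ` K" "\<alpha> ` W"] False K(2) open_image by blast
  show ?thesis
  proof (rule that[OF \<delta>(1)])
    fix x t :: "real ^ 3" assume "x \<in> K" "norm t \<le> \<delta>"
    then have "infdist (\<alpha> x + t) (\<alpha> ` K) \<le> \<delta>"
      using infdist_le[of "\<alpha> x" "\<alpha> ` K" "\<alpha> x + t"] by (auto simp: dist_norm intro: order_trans)
    then show "\<alpha> x + t \<in> \<alpha> ` W" using \<delta>(2) by blast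
  qed
qed

end

lemma bounded_measurable_L2:
  fixes f :: "real ^ 3 \<Rightarrow> 'b::euclidean_space"
  assumes A: "A \<in> lmeasurable" and m: "f \<in> borel_measurable (lebesgue_on A)" and C: "\<And>x. x \<in> A \<Longrightarrow> norm (f x) \<le> C"
  shows "f \<in> L2 A"
proof -
  interpret finite_measure "lebesgue_on A"
    using A by (rule finite_measure_lebesgue_on)
  have "integrable (lebesgue_on A) (\<lambda>x. (norm (f x))\<^sup>2)"
  proof (rule integrable_const_bound[where B="C\<^sup>2"])
    show "AE x in lebesgue_on A. norm ((norm (f x))\<^sup>2) \<le> C\<^sup>2"
      using C by (intro AE_I2) (simp add: power_mono)
    show "(\<lambda>x. (norm (f x))\<^sup>2) \<in> borel_measurable (lebesgue_on A)"
      using m by measurable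
  qed
  with m show ?thesis by (simp add: L2_def)
qed

lemma L2_norm_tendsto_zero_bounded:
  fixes f :: "nat \<Rightarrow> real ^ 3 \<Rightarrow> 'b::euclidean_space"
  assumes A: "A \<in> lmeasurable" and m: "\<And>n. f n \<in> borel_measurable (lebesgue_on A)"
    and C: "\<And>n x. x \<in> A \<Longrightarrow> norm (f n x) \<le> C" and lim: "\<And>x. x \<in> A \<Longrightarrow> (\<lambda>n. f n x) \<longlonglongrightarrow> g x"
  shows "g \<in> L2 A" "(\<lambda>n. L2_norm A (\<lambda>x. f n x - g x)) \<longlonglongrightarrow> 0"
proof -
  interpret finite_measure "lebesgue_on A"
    using A by (rule finite_measure_lebesgue_on)
  have S: "A \<in> sets lebesgue" using A by (rule fmeasurableD)
  have gm: "g \<in> borel_measurable (lebesgue_on A)"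
    by (rule borel_measurable_LIMSEQ_metric[OF m]) (use lim S in auto)
  have gC: "norm (g x) \<le> C" if "x \<in> A" for x
    by (rule LIMSEQ_le_const2[OF tendsto_norm[OF lim[OF that]]]) (use C[OF that] in auto)
  show gL: "g \<in> L2 A" by (rule bounded_measurable_L2[OF A gm gC])
  have "(\<lambda>n. LINT x|lebesgue_on A. (norm (f n x - g x))\<^sup>2) \<longlonglongrightarrow> (LINT x|lebesgue_on A. 0)"
  proof (rule integral_dominated_convergence[where w="\<lambda>x. (2 * C)\<^sup>2"])
    show "(\<lambda>x. (norm (f n x - g x))\<^sup>2) \<in> borel_measurable (lebesgue_on A)" for n
      using m[of n] gm by measurable
    show "AE x in lebesgue_on A. (\<lambda>n. (norm (f n x - g x))\<^sup>2) \<longlonglongrightarrow> 0"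
    proof (rule AE_I2)
      fix x assume "x \<in> space (lebesgue_on A)"
      then have "(\<lambda>n. f n x - g x) \<longlonglongrightarrow> 0" using lim[of x] S by (intro LIM_zero) auto
      then have "(\<lambda>n. (norm (f n x - g x))\<^sup>2) \<longlonglongrightarrow> 0\<^sup>2" by (intro tendsto_power tendsto_norm_zero)
      then show "(\<lambda>n. (norm (f n x - g x))\<^sup>2) \<longlonglongrightarrow> 0" by simp
    qed
    show "AE x in lebesgue_on A. norm ((norm (f n x - g x))\<^sup>2) \<le> (2 * C)\<^sup>2" for n
    proof (rule AE_I2)
      fix x assume "x \<in> space (lebesgue_on A)"
      then have x: "x \<in> A" using S by simp
      have "norm (f n x - g x) \<le> 2 * C"
        using norm_triangle_ineq4[of "f n x" "g x"] C[OF x, of n] gC[OF x] by linarith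
      then have "(norm (f n x - g x))\<^sup>2 \<le> (2 * C)\<^sup>2" by (rule power_mono) simp
      then show "norm ((norm (f n x - g x))\<^sup>2) \<le> (2 * C)\<^sup>2" by simp
    qed
  qed auto
  then have "(\<lambda>n. sqrt (LINT x|lebesgue_on A. (norm (f n x - g x))\<^sup>2)) \<longlonglongrightarrow> sqrt 0"
    by (intro tendsto_real_sqrt) simp
  then show "(\<lambda>n. L2_norm A (\<lambda>x. f n x - g x)) \<longlonglongrightarrow> 0" by (simp add: L2_norm_def)
qed

lemma L2_norm_norm: "L2_norm A (\<lambda>x. norm (f x)) = L2_norm A f"
  by (simp add: L2_norm_def)

lemma L2_norm_fun: "f \<in> L2 A \<Longrightarrow> (\<lambda>x. norm (f x)) \<in> L2 A"
  by (auto simp: L2_def)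

lemma integral_norm_mult_le:
  assumes "f \<in> L2 A" "g \<in> L2 A"
  shows "integrable (lebesgue_on A) (\<lambda>x. norm (f x) * norm (g x))"
    and "(LINT x|lebesgue_on A. norm (f x) * norm (g x)) \<le> L2_norm A f * L2_norm A g"
proof -
  show "integrable (lebesgue_on A) (\<lambda>x. norm (f x) * norm (g x))"
    using L2_integrable_inner[OF L2_norm_fun[OF assms(1)] L2_norm_fun[OF assms(2)]] by simp
  have "(LINT x|lebesgue_on A. norm (f x) * norm (g x)) = L2_inner A (\<lambda>x. norm (f x)) (\<lambda>x. norm (g x))"
    by (simp add: L2_inner_def)
  also have "\<dots> \<le> L2_norm A (\<lambda>x. norm (f x)) * L2_norm A (\<lambda>x. norm (g x))"
    using L2_Cauchy_Schwarz[OF L2_norm_fun[OF assms(1)] L2_norm_fun[OF assms(2)]] by linarith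
  finally show "(LINT x|lebesgue_on A. norm (f x) * norm (g x)) \<le> L2_norm A f * L2_norm A g"
    unfolding L2_norm_norm .
qed

lemma divergence_zero_outside_supp: "x \<notin> supp F \<Longrightarrow> divergence F x = 0"
  by (simp add: divergence_def frechet_derivative_zero_outside_supp)

lemma curl_diff:
  assumes "Ck (Suc 0) f" "Ck (Suc 0) g"
  shows "curl (\<lambda>x. f x - g x) = (\<lambda>x. curl f x - curl g x)"
proof
  fix x
  have d: "f differentiable (at x)" "g differentiable (at x)" using assms by auto
  have dd: "(\<lambda>x. f x - g x) differentiable (at x)" using d by simp
  have "frechet_derivative (\<lambda>x. f x - g x) (at x) = (\<lambda>v. frechet_derivative f (at x) v - frechet_derivative g (at x) v)"
    by (rule frechet_derivative_at[symmetric]) (intro has_derivative_diff has_frechet_derivative d)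
  then show "curl (\<lambda>x. f x - g x) x = curl f x - curl g x"
    unfolding curl_def partial_def frechet_derivative_component[OF d(1)] frechet_derivative_component[OF d(2)]
      frechet_derivative_component[OF dd]
    by (simp add: vec_eq_iff forall_3)
qed

section \<open>The local compactness estimate\<close>

text \<open>\<open>\<delta>\<close> keeps every displaced point of \<open>K\<close> in the chart,
  \<open>\<tau>\<close> bounds the displacements in \<open>cbox c d\<close>, and \<open>R\<close>
  leaves the room \<open>L\<close> that the regularized charts require. The signs in
  \<open>direction\<close> are those that let points leave \<Omega> only through the first
  face.\<close>

locale chart_weight = wedge_chart \<Omega> \<Gamma>t \<Gamma>n W \<alpha> \<beta> L a b + reg: regularized_pair_limit \<alpha> \<beta> L \<alpha>s \<beta>s J R
  for \<Omega> \<Gamma>t \<Gamma>n W :: "(real ^ 3) set" and \<alpha> \<beta> :: "real ^ 3 \<Rightarrow> real ^ 3" and L a b :: real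
    and \<alpha>s \<beta>s :: "nat \<Rightarrow> real ^ 3 \<Rightarrow> real ^ 3" and J :: "real ^ 3 \<Rightarrow> real ^ 3 ^ 3" and R :: real +
  fixes K :: "(real ^ 3) set" and \<delta> \<tau> :: real and c d :: "real ^ 3" and \<rho> :: "real ^ 3 \<Rightarrow> real"
  assumes K: "compact K" "K \<subseteq> W"
    and margin: "\<And>x t. x \<in> K \<Longrightarrow> norm t \<le> \<delta> \<Longrightarrow> \<alpha> x + t \<in> \<alpha> ` W"
    and \<tau>: "0 < \<tau>" "\<tau> \<le> \<delta>" and box: "\<And>t. t \<in> cbox c d \<Longrightarrow> norm t \<le> \<tau>"
    and direction: "\<And>t. t \<in> cbox c d \<Longrightarrow> 0 \<le> t $ 1 \<and> t $ 3 \<le> 0"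
    and \<rho>: "continuous_on UNIV \<rho>" "\<And>t. t \<notin> cbox c d \<Longrightarrow> \<rho> t = 0" "\<And>t. 0 \<le> \<rho> t" "integral (cbox c d) \<rho> = 1"
    and range: "\<And>x t. x \<in> K \<Longrightarrow> t \<in> cbox c d \<Longrightarrow> norm (\<alpha> x + t) + L \<le> R"
begin

text \<open>All points reached from \<open>K\<close> by displacements of length at most
  \<open>\<delta>\<close>. The displaced field \<open>e\<close> has to be controlled on
  \<open>N\<close>, the test field \<open>h\<close> only on \<open>K\<close>.\<close>

definition N :: "(real ^ 3) set" where
  "N = \<beta> ` ((\<lambda>p. \<alpha> (fst p) + snd p) ` (K \<times> cball 0 \<delta>))"

lemma N: "compact N" "N \<subseteq> W" "K \<subseteq> N"
proof -
  show "compact N" unfolding N_def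
    by (intro compact_continuous_image continuous_\<beta> continuous_intros continuous_on_compose2[OF continuous_\<alpha>[of UNIV]] compact_Times K(1)) auto
  show "N \<subseteq> W" using margin image_inv by (auto simp: N_def)
  show "K \<subseteq> N"
  proof
    fix x assume x: "x \<in> K"
    then have "\<alpha> x \<in> (\<lambda>p. \<alpha> (fst p) + snd p) ` (K \<times> cball 0 \<delta>)"
      using \<tau> by (intro image_eqI[of _ _ "(x, 0)"]) auto
    moreover have "x = \<beta> (\<alpha> x)" using inv[of x] x K(2) by auto
    ultimately show "x \<in> N" unfolding N_def by (rule image_eqI[rotated])
  qed
qed

lemma move:
  assumes "x \<in> K" "s \<in> {0..1}" "t \<in> cbox c d"
  shows "\<beta> (\<alpha> x + s *\<^sub>R t) \<in> N" "\<alpha> x + s *\<^sub>R t \<in> \<alpha> ` W" "\<beta> (\<alpha> x + s *\<^sub>R t) \<in> W" "\<alpha> (\<beta> (\<alpha> x + s *\<^sub>R t)) = \<alpha> x + s *\<^sub>R t"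
    "\<alpha> x $ 1 \<le> \<alpha> (\<beta> (\<alpha> x + s *\<^sub>R t)) $ 1" "\<alpha> (\<beta> (\<alpha> x + s *\<^sub>R t)) $ 3 \<le> \<alpha> x $ 3"
proof -
  have "norm (s *\<^sub>R t) \<le> norm t" using assms(2) by (simp add: mult_left_le_one_le)
  then have st: "norm (s *\<^sub>R t) \<le> \<delta>" using box[OF assms(3)] \<tau>(2) by linarith
  show im: "\<alpha> x + s *\<^sub>R t \<in> \<alpha> ` W" using margin[OF assms(1) st] .
  then show "\<beta> (\<alpha> x + s *\<^sub>R t) \<in> W" and eq: "\<alpha> (\<beta> (\<alpha> x + s *\<^sub>R t)) = \<alpha> x + s *\<^sub>R t" using image_inv by auto
  have "\<alpha> x + s *\<^sub>R t \<in> (\<lambda>p. \<alpha> (fst p) + snd p) ` (K \<times> cball 0 \<delta>)"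
    using assms(1) st by (intro image_eqI[of _ _ "(x, s *\<^sub>R t)"]) auto
  then show "\<beta> (\<alpha> x + s *\<^sub>R t) \<in> N" unfolding N_def by (rule imageI)
  show "\<alpha> x $ 1 \<le> \<alpha> (\<beta> (\<alpha> x + s *\<^sub>R t)) $ 1" "\<alpha> (\<beta> (\<alpha> x + s *\<^sub>R t)) $ 3 \<le> \<alpha> x $ 3"
    unfolding eq using direction[OF assms(3)] assms(2) by (auto simp: mult_nonneg_nonpos)
qed

text \<open>A point of \<open>closure \<Omega>\<close> in the chart with first coordinate at least
  \<open>a\<close> lies on the first face, hence in \<open>closure \<Gamma>t\<close>, which the
  support of \<open>e\<close> avoids. So \<open>e\<close> can be cut off to vanish beyond that
  face.\<close>

lemma cutoff_t:
  assumes e: "e \<in> C1_away \<Gamma>t"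
  obtains e' where "Ck (Suc 0) e'" "bounded (supp e')"
    "\<And>y. y \<in> N \<inter> \<Omega> \<Longrightarrow> e' y = e y \<and> curl e' y = curl e y"
    "\<And>y. y \<in> N \<Longrightarrow> a \<le> \<alpha> y $ 1 \<Longrightarrow> e' y = 0 \<and> curl e' y = 0"
proof -
  let ?Z = "N \<inter> {y. a \<le> \<alpha> y $ 1}"
  have Z: "closed ?Z"
    using compact_imp_closed[OF N(1)] by (intro closed_Int closed_Collect_le continuous_intros continuous_\<alpha>)
  have disj: "closure \<Omega> \<inter> supp e \<inter> N \<inter> ?Z = {}"
  proof (rule equals0I)
    fix y assume "y \<in> closure \<Omega> \<inter> supp e \<inter> N \<inter> ?Z"
    then have y: "y \<in> closure \<Omega>" "y \<in> supp e" "y \<in> W" "a \<le> \<alpha> y $ 1" using N(2) by auto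
    then have "y \<in> closure \<Gamma>t" using closure_inside[of y] by (intro face_t) auto
    then show False using e y(2) by (auto simp: C1_away_def)
  qed
  show ?thesis
  proof (rule local_cutoff[OF C1_away_Ck[OF e] N(1) Z disj])
    fix g assume g: "Ck (Suc 0) g" "supp g \<subseteq> supp e"
      "\<And>x. x \<in> N \<inter> \<Omega> \<Longrightarrow> g x = e x \<and> curl g x = curl e x \<and> divergence g x = divergence e x"
      "\<And>x. x \<in> ?Z \<Longrightarrow> g x = 0 \<and> curl g x = 0 \<and> divergence g x = 0"
    have "bounded (supp e)" using e by (simp add: C1_away_def del: Ck.simps)
    then have b: "bounded (supp g)" using g(2) by (rule bounded_subset)
    show thesis
    proof (rule that[OF g(1) b])
      show "g y = e y \<and> curl g y = curl e y" if "y \<in> N \<inter> \<Omega>" for y using g(3)[OF that] by blast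
      show "g y = 0 \<and> curl g y = 0" if "y \<in> N" "a \<le> \<alpha> y $ 1" for y using g(4)[of y] that by blast
    qed
  qed
qed

text \<open>The counterpart for the face in \<open>closure \<Gamma>n\<close>. As the support of
  \<open>h\<close> lies in \<open>K\<close>, the cut off field agrees with \<open>h\<close> on all
  of \<Omega>.\<close>

lemma cutoff_n:
  assumes h: "h \<in> C1_away \<Gamma>n" "supp h \<subseteq> K"
  obtains h' where "Ck (Suc 0) h'" "supp h' \<subseteq> K"
    "\<And>x. x \<in> \<Omega> \<Longrightarrow> h' x = h x \<and> divergence h' x = divergence h x"
    "\<And>x. x \<in> K \<Longrightarrow> b \<le> \<alpha> x $ 3 \<Longrightarrow> h' x = 0 \<and> divergence h' x = 0"
proof -
  let ?Z = "K \<inter> {y. b \<le> \<alpha> y $ 3}"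
  have Z: "closed ?Z"
    using compact_imp_closed[OF K(1)] by (intro closed_Int closed_Collect_le continuous_intros continuous_\<alpha>)
  have disj: "closure \<Omega> \<inter> supp h \<inter> K \<inter> ?Z = {}"
  proof (rule equals0I)
    fix y assume "y \<in> closure \<Omega> \<inter> supp h \<inter> K \<inter> ?Z"
    then have y: "y \<in> closure \<Omega>" "y \<in> supp h" "y \<in> W" "b \<le> \<alpha> y $ 3" using K(2) by auto
    then have "y \<in> closure \<Gamma>n" using closure_inside[of y] by (intro face_n) auto
    then show False using h y(2) by (auto simp: C1_away_def)
  qed
  show ?thesis
  proof (rule local_cutoff[OF C1_away_Ck[OF h(1)] K(1) Z disj])
    fix g assume g: "Ck (Suc 0) g" "supp g \<subseteq> supp h"
      "\<And>x. x \<in> K \<inter> \<Omega> \<Longrightarrow> g x = h x \<and> curl g x = curl h x \<and> divergence g x = divergence h x"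
      "\<And>x. x \<in> ?Z \<Longrightarrow> g x = 0 \<and> curl g x = 0 \<and> divergence g x = 0"
    have out: "g x = h x \<and> divergence g x = divergence h x" if "x \<notin> K" for x
    proof -
      have "x \<notin> supp h" "x \<notin> supp g" using that h(2) g(2) by auto
      then have "h x = 0" "g x = 0" "divergence h x = 0" "divergence g x = 0"
        using supp_zero[of x h] supp_zero[of x g] divergence_zero_outside_supp[of x h] divergence_zero_outside_supp[of x g]
        by blast+
      then show ?thesis by simp
    qed
    show thesis
    proof (rule that[OF g(1)])
      show "supp g \<subseteq> K" using g(2) h(2) by blast
      show "g x = h x \<and> divergence g x = divergence h x" if "x \<in> \<Omega>" for x
        using that g(3)[of x] out[of x] by blast
      show "g x = 0 \<and> divergence g x = 0" if "x \<in> K" "b \<le> \<alpha> x $ 3" for x using that g(4)[of x] by blast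
    qed
  qed
qed

text \<open>By the choice of direction the integrand vanishes unless both \<open>x\<close> and the
  displaced point lie in \<Omega>. There the cut off fields are the original ones, and
  Cauchy-Schwarz together with the bound for composition with an expanding map of constant
  \<open>L\<^sup>2\<close> gives the estimate.\<close>

lemma moved_product_le:
  assumes e: "e \<in> C1_away \<Gamma>t" and h: "h \<in> C1_away \<Gamma>n"
    and e': "Ck (Suc 0) e'" "\<And>y. y \<in> N \<inter> \<Omega> \<Longrightarrow> e' y = e y \<and> curl e' y = curl e y"
      "\<And>y. y \<in> N \<Longrightarrow> a \<le> \<alpha> y $ 1 \<Longrightarrow> e' y = 0 \<and> curl e' y = 0"
    and h': "Ck (Suc 0) h'" "supp h' \<subseteq> K" "\<And>x. x \<in> \<Omega> \<Longrightarrow> h' x = h x \<and> divergence h' x = divergence h x"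
      "\<And>x. x \<in> K \<Longrightarrow> b \<le> \<alpha> x $ 3 \<Longrightarrow> h' x = 0 \<and> divergence h' x = 0"
    and B: "K \<subseteq> cbox p q" and st: "s \<in> {0..1}" "t \<in> cbox c d"
  shows "integral (cbox p q) (\<lambda>x. norm (e' (\<beta> (\<alpha> x + s *\<^sub>R t))) * \<bar>divergence h' x\<bar>
      + norm (curl e' (\<beta> (\<alpha> x + s *\<^sub>R t))) * norm (h' x))
    \<le> sqrt ((3 * L\<^sup>2) ^ 3) * ((L2_norm \<Omega> e + L2_norm \<Omega> (curl e)) * (L2_norm \<Omega> h + L2_norm \<Omega> (divergence h)))"
proof -
  define T where "T x = \<beta> (\<alpha> x + s *\<^sub>R t)" for x
  define A where "A = K \<inter> \<Omega> \<inter> T -` \<Omega>"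
  let ?g = "\<lambda>x. norm (e' (T x)) * \<bar>divergence h' x\<bar> + norm (curl e' (T x)) * norm (h' x)"
  have T: "continuous_on UNIV T" unfolding T_def
    by (intro continuous_on_compose2[OF continuous_\<beta>[of UNIV]] continuous_intros continuous_\<alpha>) auto
  have "open (T -` \<Omega>)" using open_vimage[OF open_\<Omega>] T by blast
  then have AS: "A \<in> sets lebesgue" unfolding A_def
    using K(1) open_\<Omega> by (intro sets.Int) (auto simp: compact_imp_closed)
  have Ab: "bounded A" unfolding A_def by (intro bounded_Int disjI1 compact_imp_bounded K(1))
  have Al: "A \<in> lmeasurable" using Ab AS by (rule bounded_set_imp_lmeasurable)
  have A\<Omega>: "A \<subseteq> \<Omega>" by (auto simp: A_def)
  have zero: "?g x = 0" if x: "x \<notin> A" for x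
  proof (cases "x \<in> K")
    case False
    then have "x \<notin> supp h'" using h'(2) by blast
    then have "h' x = 0" "divergence h' x = 0"
      using supp_zero[of x h'] divergence_zero_outside_supp[of x h'] by blast+
    then show ?thesis by simp
  next
    case True
    show ?thesis
    proof (cases "b \<le> \<alpha> x $ 3")
      case True
      then show ?thesis using h'(4)[OF \<open>x \<in> K\<close>] by simp
    next
      case False
      note mv = move[OF \<open>x \<in> K\<close> st, folded T_def]
      have "x \<in> W" using \<open>x \<in> K\<close> K(2) by blast
      \<comment> \<open>The third coordinate of \<open>T x\<close> is still below \<open>b\<close>.
        If \<open>T x\<close> is outside \<Omega>, its first coordinate must be at least
        \<open>a\<close>; if already \<open>x\<close> is outside, its own first coordinate is at
        least \<open>a\<close> and can only have grown.\<close>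
      have "a \<le> \<alpha> (T x) $ 1"
        using x \<open>x \<in> K\<close> inside[OF \<open>x \<in> W\<close>] inside[OF mv(3)] mv(5,6) False by (fastforce simp: A_def)
      then show ?thesis using e'(3)[OF mv(1)] by simp
    qed
  qed
  have gA: "?g x = norm (e (T x)) * norm (divergence h x) + norm (curl e (T x)) * norm (h x)" if "x \<in> A" for x
  proof -
    have "T x \<in> N \<inter> \<Omega>" using that move(1)[OF _ st, of x, folded T_def] by (auto simp: A_def)
    then show ?thesis using e'(2)[of "T x"] h'(3)[of x] that by (simp add: A_def)
  qed
  have cg: "continuous_on UNIV ?g"
    by (intro continuous_intros continuous_on_divergence[OF h'(1)] Ck_imp_continuous[OF h'(1)]
        continuous_on_compose2[OF Ck_imp_continuous[OF e'(1)] T] continuous_on_compose2[OF continuous_on_curl[OF e'(1)] T]) auto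
  have "integral (cbox p q) ?g = integral UNIV ?g"
    by (rule integral_cbox_eq_UNIV) (use B zero in \<open>auto simp: A_def\<close>)
  also have "\<dots> = (LINT x|lebesgue_on A. ?g x)"
    by (rule integral_lebesgue_on_supp[OF AS cg Ab, symmetric]) (use zero in auto)
  also have "\<dots> = (LINT x|lebesgue_on A. norm (e (T x)) * norm (divergence h x) + norm (curl e (T x)) * norm (h x))"
    using gA AS by (intro Bochner_Integration.integral_cong) auto
  finally have eq: "integral (cbox p q) ?g = (LINT x|lebesgue_on A. norm (e (T x)) * norm (divergence h x) + norm (curl e (T x)) * norm (h x))" .
  have ec: "continuous_on UNIV e" "continuous_on UNIV (curl e)"
    using Ck_imp_continuous[OF C1_away_Ck[OF e]] continuous_on_curl[OF C1_away_Ck[OF e]] .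
  have expand: "dist x y \<le> L\<^sup>2 * dist (T x) (T y)" if "x \<in> A" "y \<in> A" for x y
  proof -
    have xy: "x \<in> K" "y \<in> K" using that by (auto simp: A_def)
    have "dist x y \<le> L * dist (\<alpha> x) (\<alpha> y)" using xy K(2) by (intro expand_\<alpha>) auto
    also have "dist (\<alpha> x) (\<alpha> y) = dist (\<alpha> x + s *\<^sub>R t) (\<alpha> y + s *\<^sub>R t)" by simp
    also have "L * \<dots> \<le> L * (L * dist (T x) (T y))"
      unfolding T_def using L move(2)[OF xy(1) st] move(2)[OF xy(2) st] by (intro mult_left_mono expand_\<beta>) auto
    finally show ?thesis by (simp add: power2_eq_square mult.assoc)
  qed
  have TA: "T ` A \<subseteq> \<Omega>" by (auto simp: A_def)
  have cmp: "L2_norm A (\<lambda>x. f (T x)) \<le> sqrt ((3 * L\<^sup>2) ^ 3) * L2_norm \<Omega> f" "(\<lambda>x. f (T x)) \<in> L2 A"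
    if "continuous_on UNIV f" for f :: "real ^ 3 \<Rightarrow> real ^ 3"
  proof -
    show "L2_norm A (\<lambda>x. f (T x)) \<le> sqrt ((3 * L\<^sup>2) ^ 3) * L2_norm \<Omega> f"
      using L expand by (intro L2_norm_compose_le[OF Al Ab _ lmeasurable_\<Omega> bounded_\<Omega> T TA that]) (auto simp: open_\<Omega>)
    show "(\<lambda>x. f (T x)) \<in> L2 A" by (intro continuous_L2 Al Ab continuous_on_compose2[OF that T]) auto
  qed
  have hL: "h \<in> L2 \<Omega>" "divergence h \<in> L2 \<Omega>" using C1_away_L2[OF open_\<Omega> bounded_\<Omega> h] by auto
  have \<Omega>S: "\<Omega> \<in> sets lebesgue" using lmeasurable_\<Omega> by (rule fmeasurableD)
  note hA = L2_subset[OF hL(1) AS \<Omega>S A\<Omega>] and dA = L2_subset[OF hL(2) AS \<Omega>S A\<Omega>]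
  define C where "C = sqrt ((3 * L\<^sup>2) ^ 3)"
  have C: "0 \<le> C" using L by (simp add: C_def)
  have "integral (cbox p q) ?g = (LINT x|lebesgue_on A. norm (e (T x)) * norm (divergence h x)) + (LINT x|lebesgue_on A. norm (curl e (T x)) * norm (h x))"
    unfolding eq by (intro Bochner_Integration.integral_add integral_norm_mult_le cmp ec hA dA)
  also have "\<dots> \<le> L2_norm A (\<lambda>x. e (T x)) * L2_norm A (divergence h) + L2_norm A (\<lambda>x. curl e (T x)) * L2_norm A h"
    by (intro add_mono integral_norm_mult_le cmp ec hA dA)
  also have "\<dots> \<le> (C * L2_norm \<Omega> e) * L2_norm \<Omega> (divergence h) + (C * L2_norm \<Omega> (curl e)) * L2_norm \<Omega> h"
    unfolding C_def using L by (intro add_mono mult_mono cmp ec hA dA) auto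
  also have "\<dots> \<le> C * ((L2_norm \<Omega> e + L2_norm \<Omega> (curl e)) * (L2_norm \<Omega> h + L2_norm \<Omega> (divergence h)))"
    using C by (simp add: algebra_simps)
  finally show ?thesis unfolding T_def C_def .
qed

end

lemma L2_dominated:
  assumes f: "f \<in> L2 A" and g: "g \<in> borel_measurable (lebesgue_on A)" and A: "A \<in> sets lebesgue"
    and C: "0 \<le> C" "\<And>x. x \<in> A \<Longrightarrow> norm (g x) \<le> C * norm (f x)"
  shows "g \<in> L2 A" "L2_norm A g \<le> C * L2_norm A f"
proof -
  have le: "(norm (g x))\<^sup>2 \<le> C\<^sup>2 * (norm (f x))\<^sup>2" if "x \<in> A" for x
    using power_mono[OF C(2)[OF that], of 2] by (simp add: power_mult_distrib)
  have i: "integrable (lebesgue_on A) (\<lambda>x. C\<^sup>2 * (norm (f x))\<^sup>2)"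
    by (intro integrable_mult_right L2_integrable_norm_square f)
  have ig: "integrable (lebesgue_on A) (\<lambda>x. (norm (g x))\<^sup>2)"
  proof (rule Bochner_Integration.integrable_bound[OF i])
    show "(\<lambda>x. (norm (g x))\<^sup>2) \<in> borel_measurable (lebesgue_on A)" using g by measurable
    show "AE x in lebesgue_on A. norm ((norm (g x))\<^sup>2) \<le> norm (C\<^sup>2 * (norm (f x))\<^sup>2)"
    proof (rule AE_I2)
      fix x assume "x \<in> space (lebesgue_on A)"
      then have "x \<in> A" using A by simp
      from le[OF this] show "norm ((norm (g x))\<^sup>2) \<le> norm (C\<^sup>2 * (norm (f x))\<^sup>2)" by simp
    qed
  qed
  with g show "g \<in> L2 A" by (simp add: L2_def)
  have "(LINT x|lebesgue_on A. (norm (g x))\<^sup>2) \<le> (LINT x|lebesgue_on A. C\<^sup>2 * (norm (f x))\<^sup>2)"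
    using le A by (intro integral_mono ig i) simp
  also have "\<dots> = C\<^sup>2 * (LINT x|lebesgue_on A. (norm (f x))\<^sup>2)" by simp
  finally have "L2_norm A g \<le> sqrt (C\<^sup>2 * (LINT x|lebesgue_on A. (norm (f x))\<^sup>2))"
    unfolding L2_norm_def by (rule real_sqrt_le_mono)
  then show "L2_norm A g \<le> C * L2_norm A f" using C(1) by (simp add: L2_norm_def real_sqrt_mult)
qed

lemma norm_vec_nth_le: "norm (x $ i) \<le> norm (x :: 'a::real_normed_vector ^ 'n)"
  unfolding norm_vec_def by (rule member_le_L2_set) simp_all

section \<open>The averaging operator and its continuity\<close>

context chart_weight
begin

definition reach :: "real ^ 3 \<Rightarrow> (real ^ 3) set" where
  "reach x = {z \<in> cball 0 R. z - \<alpha> x \<in> cbox c d \<and> \<beta> z \<in> \<Omega>}"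

text \<open>\<open>avg_limit\<close> written with \<open>e\<close> itself. The cut off field is
  chosen anew for each \<open>e\<close>, so linearity in \<open>e\<close> would be lost; restricting
  the integral to points whose image under \<open>\<beta>\<close> lies in \<Omega> has the same
  effect as the cutoff and keeps it.\<close>

definition Q :: "(real ^ 3 \<Rightarrow> real ^ 3) \<Rightarrow> real ^ 3 \<Rightarrow> real ^ 3" where
  "Q e x = (\<chi> j. L2_inner (reach x) (\<lambda>z. e (\<beta> z)) (\<lambda>z. \<rho> (z - \<alpha> x) *\<^sub>R J z $ j))"

lemma reach_measurable: "reach x \<in> sets lebesgue" "bounded (reach x)" "reach x \<in> lmeasurable"
proof -
  have "reach x = cball 0 R \<inter> (\<lambda>z. z - \<alpha> x) -` cbox c d \<inter> \<beta> -` \<Omega>" by (auto simp: reach_def)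
  moreover have "open (\<beta> -` \<Omega>)" using open_vimage[OF open_\<Omega>] continuous_\<beta> by blast
  moreover have "closed ((\<lambda>z. z - \<alpha> x) -` cbox c d)"
    by (intro closed_vimage continuous_intros closed_cbox)
  ultimately show S: "reach x \<in> sets lebesgue" by (auto intro!: sets.Int)
  show b: "bounded (reach x)" by (rule bounded_subset[OF bounded_cball[of 0 R]]) (auto simp: reach_def)
  show "reach x \<in> lmeasurable" using b S by (rule bounded_set_imp_lmeasurable)
qed

lemma move_to:
  assumes "x \<in> K" "z - \<alpha> x \<in> cbox c d"
  shows "\<beta> z \<in> N" "z \<in> \<alpha> ` W" "\<beta> z \<in> W" "\<alpha> (\<beta> z) = z" "\<alpha> x $ 1 \<le> z $ 1" "z $ 3 \<le> \<alpha> x $ 3"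
  using move[OF assms(1) _ assms(2), of 1] by simp_all

lemma L2_reach:
  assumes "continuous_on UNIV e" "x \<in> K"
  shows "(\<lambda>z. e (\<beta> z)) \<in> L2 (reach x)" "L2_norm (reach x) (\<lambda>z. e (\<beta> z)) \<le> sqrt ((3 * L) ^ 3) * L2_norm \<Omega> e"
proof -
  show "(\<lambda>z. e (\<beta> z)) \<in> L2 (reach x)"
    by (intro continuous_L2 reach_measurable continuous_on_compose2[OF assms(1) continuous_\<beta>]) auto
  have "dist z z' \<le> L * dist (\<beta> z) (\<beta> z')" if "z \<in> reach x" "z' \<in> reach x" for z z'
    using that move_to(2)[OF assms(2)] by (intro expand_\<beta>) (auto simp: reach_def)
  then show "L2_norm (reach x) (\<lambda>z. e (\<beta> z)) \<le> sqrt ((3 * L) ^ 3) * L2_norm \<Omega> e"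
    using L by (intro L2_norm_compose_le reach_measurable lmeasurable_\<Omega> bounded_\<Omega> continuous_\<beta> assms(1))
      (auto simp: open_\<Omega> reach_def)
qed

lemma J_L2: "J \<in> L2 (cball 0 R)"
  using reg.weak by (simp add: L2_weakly_converges_def)

lemma weight_bound: obtains M\<rho> where "0 < M\<rho>" "\<And>t. norm (\<rho> t) \<le> M\<rho>"
proof -
  have "bounded (supp \<rho>)"
    using supp_subset[OF closed_cbox \<rho>(2)] bounded_cbox by (rule bounded_subset[rotated])
  then show ?thesis using bounded_support_bound[OF \<rho>(1)] that by blast
qed

lemma weighted_row_L2:
  assumes M: "0 < M" "\<And>t. norm (\<rho> t) \<le> M"
  shows "(\<lambda>z. \<rho> (z - \<alpha> x) *\<^sub>R J z $ j) \<in> L2 (reach x)"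
    "L2_norm (reach x) (\<lambda>z. \<rho> (z - \<alpha> x) *\<^sub>R J z $ j) \<le> M * L2_norm (cball 0 R) J"
proof -
  have sub: "reach x \<subseteq> cball 0 R" by (auto simp: reach_def)
  note JD = L2_subset[OF J_L2 reach_measurable(1) _ sub]
  have m1: "(\<lambda>z. J z $ j) \<in> borel_measurable (lebesgue_on (reach x))"
    by (rule measurable_compose[OF L2_measurable[OF JD(1)]]) (auto intro!: borel_measurable_continuous_onI continuous_intros)
  have m2: "(\<lambda>z. \<rho> (z - \<alpha> x)) \<in> borel_measurable (lebesgue_on (reach x))"
    by (intro continuous_imp_measurable_on_sets_lebesgue reach_measurable continuous_on_compose2[OF \<rho>(1)] continuous_intros) auto
  have m: "(\<lambda>z. \<rho> (z - \<alpha> x) *\<^sub>R J z $ j) \<in> borel_measurable (lebesgue_on (reach x))"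
    using m1 m2 by (rule borel_measurable_scaleR[rotated])
  have le: "norm (\<rho> (z - \<alpha> x) *\<^sub>R J z $ j) \<le> M * norm (J z)" for z
    using M unfolding norm_scaleR by (intro mult_mono norm_vec_nth_le) auto
  show "(\<lambda>z. \<rho> (z - \<alpha> x) *\<^sub>R J z $ j) \<in> L2 (reach x)"
    using M by (intro L2_dominated(1)[OF JD(1) m reach_measurable(1) _ le]) auto
  have "L2_norm (reach x) (\<lambda>z. \<rho> (z - \<alpha> x) *\<^sub>R J z $ j) \<le> M * L2_norm (reach x) J"
    using M by (intro L2_dominated(2)[OF JD(1) m reach_measurable(1) _ le]) auto
  also have "\<dots> \<le> M * L2_norm (cball 0 R) J" using M JD(2) by (intro mult_left_mono) auto
  finally show "L2_norm (reach x) (\<lambda>z. \<rho> (z - \<alpha> x) *\<^sub>R J z $ j) \<le> M * L2_norm (cball 0 R) J" .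
qed

text \<open>Cauchy-Schwarz in \<open>z\<close> shows that every component of \<open>Q\<close> at a
  point of \<open>K\<close> is a bounded functional on L^2; one constant serves all these points,
  which later provides the dominating bound.\<close>

lemma Q_component_bound: "\<exists>C\<ge>0. \<forall>e x j. continuous_on UNIV e \<longrightarrow> x \<in> K \<longrightarrow> \<bar>Q e x $ j\<bar> \<le> C * L2_norm \<Omega> e"
proof -
  obtain M where M: "0 < M" "\<And>t. norm (\<rho> t) \<le> M" using weight_bound by blast
  define C where "C = sqrt ((3 * L) ^ 3) * (M * L2_norm (cball 0 R) J)"
  have "\<bar>Q e x $ j\<bar> \<le> C * L2_norm \<Omega> e" if e: "continuous_on UNIV e" "x \<in> K" for e x j
  proof -
    have "\<bar>Q e x $ j\<bar> \<le> L2_norm (reach x) (\<lambda>z. e (\<beta> z)) * L2_norm (reach x) (\<lambda>z. \<rho> (z - \<alpha> x) *\<^sub>R J z $ j)"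
      unfolding Q_def vec_lambda_beta by (rule L2_Cauchy_Schwarz[OF L2_reach(1)[OF e] weighted_row_L2(1)[OF M]])
    also have "\<dots> \<le> (sqrt ((3 * L) ^ 3) * L2_norm \<Omega> e) * (M * L2_norm (cball 0 R) J)"
      using L by (intro mult_mono L2_reach(2)[OF e] weighted_row_L2(2)[OF M]) auto
    finally show ?thesis by (simp add: C_def algebra_simps)
  qed
  moreover have "0 \<le> C" using L M(1) by (simp add: C_def)
  ultimately show ?thesis by blast
qed

lemma Q_add:
  assumes "continuous_on UNIV e" "continuous_on UNIV f" "x \<in> K"
  shows "Q (\<lambda>y. e y + f y) x = Q e x + Q f x"
proof -
  obtain M where M: "0 < M" "\<And>t. norm (\<rho> t) \<le> M" using weight_bound by blast
  show ?thesis
    unfolding Q_def vec_eq_iff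
    using L2_inner_add_left[OF L2_reach(1)[OF assms(1,3)] L2_reach(1)[OF assms(2,3)] weighted_row_L2(1)[OF M]] by simp
qed

lemma Q_scaleR: "Q (\<lambda>y. k *\<^sub>R e y) x = k *\<^sub>R Q e x"
  unfolding Q_def vec_eq_iff using L2_inner_scaleR_left[of "reach x" k "\<lambda>z. e (\<beta> z)"] by simp

lemma Q_diff:
  assumes "continuous_on UNIV e" "continuous_on UNIV f" "x \<in> K"
  shows "Q (\<lambda>y. e y - f y) x = Q e x - Q f x"
  using Q_add[OF assms(1) _ assms(3), of "\<lambda>y. (-1) *\<^sub>R f y"] Q_scaleR[of "-1" f x] assms(2)
  by (simp add: continuous_on_minus)

text \<open>Points \<open>z\<close> that carry weight but do not come from \<Omega> lie beyond the
  first face, where \<open>e'\<close> vanishes. If \<open>x\<close> itself is outside \<Omega>, then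
  it is beyond that face already, and no displacement leads back.\<close>

lemma avg_limit_eq_Q:
  assumes e': "\<And>y. y \<in> N \<inter> \<Omega> \<Longrightarrow> e' y = e y" "\<And>y. y \<in> N \<Longrightarrow> a \<le> \<alpha> y $ 1 \<Longrightarrow> e' y = 0"
    and x: "x \<in> K" "\<alpha> x $ 3 < b"
  shows "reg.avg_limit e' \<rho> x = (if x \<in> \<Omega> then Q e x else 0)"
proof -
  have xW: "x \<in> W" using x(1) K(2) by blast
  have out: "\<rho> (z - \<alpha> x) * (e' (\<beta> z) \<bullet> v) = 0" if "z \<in> cball 0 R" "z \<notin> reach x" for z v
  proof (cases "z - \<alpha> x \<in> cbox c d")
    case True
    note mv = move_to[OF x(1) True]
    have "\<beta> z \<notin> \<Omega>" using that True by (auto simp: reach_def)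
    then have "a \<le> \<alpha> (\<beta> z) $ 1" using inside[OF mv(3)] mv(4,6) x(2) by auto
    then show ?thesis using e'(2)[OF mv(1)] by simp
  qed (simp add: \<rho>(2))
  have sub: "reach x \<subseteq> cball 0 R" by (auto simp: reach_def)
  have "reg.avg_limit e' \<rho> x $ j = L2_inner (reach x) (\<lambda>z. e' (\<beta> z)) (\<lambda>z. \<rho> (z - \<alpha> x) *\<^sub>R J z $ j)" for j
  proof -
    have "reg.avg_limit e' \<rho> x $ j = (LINT z|lebesgue. indicator (cball 0 R) z *\<^sub>R (\<rho> (z - \<alpha> x) * (e' (\<beta> z) \<bullet> J z $ j)))"
      unfolding reg.avg_limit_def vec_lambda_beta by (simp add: integral_restrict_space)
    also have "\<dots> = (LINT z|lebesgue. indicator (reach x) z *\<^sub>R (\<rho> (z - \<alpha> x) * (e' (\<beta> z) \<bullet> J z $ j)))"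
    proof (rule Bochner_Integration.integral_cong[OF refl])
      fix z
      show "indicator (cball 0 R) z *\<^sub>R (\<rho> (z - \<alpha> x) * (e' (\<beta> z) \<bullet> J z $ j))
          = indicator (reach x) z *\<^sub>R (\<rho> (z - \<alpha> x) * (e' (\<beta> z) \<bullet> J z $ j))"
      proof (cases "z \<in> reach x")
        case True
        then show ?thesis using sub by (simp add: subset_iff)
      next
        case False
        then show ?thesis using out[of z] by (cases "z \<in> cball 0 R") simp_all
      qed
    qed
    also have "\<dots> = L2_inner (reach x) (\<lambda>z. e' (\<beta> z)) (\<lambda>z. \<rho> (z - \<alpha> x) *\<^sub>R J z $ j)"
      unfolding L2_inner_def using reach_measurable(1) by (simp add: integral_restrict_space)
    finally show ?thesis .
  qed
  moreover have "L2_inner (reach x) (\<lambda>z. e' (\<beta> z)) (\<lambda>z. \<rho> (z - \<alpha> x) *\<^sub>R J z $ j) = (if x \<in> \<Omega> then Q e x else 0) $ j" for j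
  proof (cases "x \<in> \<Omega>")
    case True
    have "e' (\<beta> z) = e (\<beta> z)" if "z \<in> reach x" for z
      using that move_to(1)[OF x(1), of z] by (intro e'(1)) (auto simp: reach_def)
    then have "L2_inner (reach x) (\<lambda>z. e' (\<beta> z)) (\<lambda>z. \<rho> (z - \<alpha> x) *\<^sub>R J z $ j) = Q e x $ j"
      unfolding L2_inner_def Q_def vec_lambda_beta
      using reach_measurable(1) by (intro Bochner_Integration.integral_cong) auto
    then show ?thesis using True by simp
  next
    case False
    then have a: "a \<le> \<alpha> x $ 1" using inside[OF xW] x(2) by auto
    have "z \<notin> reach x" for z
    proof
      assume z: "z \<in> reach x"
      then have zc: "z - \<alpha> x \<in> cbox c d" and "\<beta> z \<in> \<Omega>" by (auto simp: reach_def)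
      then have "z $ 1 < a" using inside[OF move_to(3)[OF x(1) zc]] move_to(4)[OF x(1) zc] by simp
      then show False using move_to(5)[OF x(1) zc] a by simp
    qed
    then have "reach x = {}" by blast
    then show ?thesis using False
      by (simp add: L2_inner_def integral_restrict_space)
  qed
  ultimately show ?thesis by (simp add: vec_eq_iff)
qed

lemma K\<Omega>_measurable: "K \<inter> \<Omega> \<in> sets lebesgue" "K \<inter> \<Omega> \<in> lmeasurable"
proof -
  show S: "K \<inter> \<Omega> \<in> sets lebesgue" using K(1) open_\<Omega> by (intro sets.Int) (auto simp: compact_imp_closed)
  show "K \<inter> \<Omega> \<in> lmeasurable"
    by (rule bounded_set_imp_lmeasurable[OF _ S]) (simp add: bounded_Int bounded_\<Omega>)
qed

text \<open>On \<open>K \<inter> \<Omega>\<close> the function is a pointwise limit of the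
  continuous regularized averages.\<close>

lemma Q_measurable:
  assumes e: "e \<in> C1_away \<Gamma>t"
  shows "Q e \<in> borel_measurable (lebesgue_on (K \<inter> \<Omega>))"
proof (rule cutoff_t[OF e])
  fix e' assume e': "Ck (Suc 0) e'" "bounded (supp e')"
    "\<And>y. y \<in> N \<inter> \<Omega> \<Longrightarrow> e' y = e y \<and> curl e' y = curl e y"
    "\<And>y. y \<in> N \<Longrightarrow> a \<le> \<alpha> y $ 1 \<Longrightarrow> e' y = 0 \<and> curl e' y = 0"
  note ce' = Ck_imp_continuous[OF e'(1)]
  show ?thesis
  proof (rule borel_measurable_LIMSEQ_metric)
    show "reg.avg e' \<rho> c d n \<in> borel_measurable (lebesgue_on (K \<inter> \<Omega>))" for n
      by (intro continuous_imp_measurable_on_sets_lebesgue K\<Omega>_measurable reg.continuous_on_avg ce' \<rho>(1))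
    fix x assume "x \<in> space (lebesgue_on (K \<inter> \<Omega>))"
    then have x: "x \<in> K" "x \<in> \<Omega>" using K\<Omega>_measurable(1) by auto
    then have b: "\<alpha> x $ 3 < b" using inside[of x] K(2) by auto
    have "(\<lambda>n. reg.avg e' \<rho> c d n x) \<longlonglongrightarrow> reg.avg_limit e' \<rho> x"
      by (rule reg.avg_tendsto[OF ce' e'(2) \<rho>(1,2) range[OF x(1)]])
    moreover have "reg.avg_limit e' \<rho> x = Q e x"
      using avg_limit_eq_Q[of e' e x] e'(3,4) x b by simp
    ultimately show "(\<lambda>n. reg.avg e' \<rho> c d n x) \<longlonglongrightarrow> Q e x" by simp
  qed
qed

lemma Q_bound: "\<exists>C\<ge>0. \<forall>e x. continuous_on UNIV e \<longrightarrow> x \<in> K \<longrightarrow> norm (Q e x) \<le> C * L2_norm \<Omega> e"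
proof -
  obtain C where C: "0 \<le> C" "\<And>e x j. continuous_on UNIV e \<Longrightarrow> x \<in> K \<Longrightarrow> \<bar>Q e x $ j\<bar> \<le> C * L2_norm \<Omega> e"
    using Q_component_bound by blast
  have "norm (Q e x) \<le> (3 * C) * L2_norm \<Omega> e" if "continuous_on UNIV e" "x \<in> K" for e x
  proof -
    have "norm (Q e x) \<le> (\<Sum>j\<in>UNIV. \<bar>Q e x $ j\<bar>)" by (rule norm_le_l1_cart)
    also have "\<dots> \<le> (\<Sum>j\<in>(UNIV :: 3 set). C * L2_norm \<Omega> e)" by (intro sum_mono C(2) that)
    finally show ?thesis by simp
  qed
  then show ?thesis using C(1) by (intro exI[of _ "3 * C"]) auto
qed

lemma Q_L2:
  assumes e: "e \<in> C1_away \<Gamma>t"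
  shows "Q e \<in> L2 (K \<inter> \<Omega>)"
proof -
  obtain C where "\<And>x. x \<in> K \<Longrightarrow> norm (Q e x) \<le> C * L2_norm \<Omega> e"
    using Q_bound Ck_imp_continuous[OF C1_away_Ck[OF e]] by blast
  then show ?thesis
    by (intro bounded_measurable_L2[OF K\<Omega>_measurable(2) Q_measurable[OF e], of "C * L2_norm \<Omega> e"]) auto
qed

text \<open>\<open>div_curl_estimate\<close> for the cut off fields. Off
  \<open>K \<inter> \<Omega>\<close> either \<open>h'\<close> vanishes or the point is beyond the
  first face, where \<open>e'\<close> and its average vanish; so all terms can be rewritten with
  \<open>e\<close> and \<open>h\<close> on \<Omega>.\<close>

lemma localized_estimate:
  assumes e: "e \<in> C1_away \<Gamma>t" and h: "h \<in> C1_away \<Gamma>n" "supp h \<subseteq> K"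
  shows "\<bar>L2_inner \<Omega> e h\<bar> \<le> L ^ 3 * \<tau> * (sqrt ((3 * L\<^sup>2) ^ 3) *
      ((L2_norm \<Omega> e + L2_norm \<Omega> (curl e)) * (L2_norm \<Omega> h + L2_norm \<Omega> (divergence h))))
    + L * (L2_norm \<Omega> h * L2_norm (K \<inter> \<Omega>) (Q e))"
proof (rule cutoff_t[OF e], rule cutoff_n[OF h])
  fix e' h'
  assume e': "Ck (Suc 0) e'" "bounded (supp e')"
    "\<And>y. y \<in> N \<inter> \<Omega> \<Longrightarrow> e' y = e y \<and> curl e' y = curl e y"
    "\<And>y. y \<in> N \<Longrightarrow> a \<le> \<alpha> y $ 1 \<Longrightarrow> e' y = 0 \<and> curl e' y = 0"
  assume h': "Ck (Suc 0) h'" "supp h' \<subseteq> K"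
    "\<And>x. x \<in> \<Omega> \<Longrightarrow> h' x = h x \<and> divergence h' x = divergence h x"
    "\<And>x. x \<in> K \<Longrightarrow> b \<le> \<alpha> x $ 3 \<Longrightarrow> h' x = 0 \<and> divergence h' x = 0"
  obtain q where q: "K \<subseteq> cbox (- q) q" using compact_imp_bounded[OF K(1)] by (rule bounded_subset_cbox_zero)
  let ?B = "cbox (- q) q"
  have supp_B: "supp h' \<subseteq> ?B" using h'(2) q by blast
  let ?M = "sqrt ((3 * L\<^sup>2) ^ 3) * ((L2_norm \<Omega> e + L2_norm \<Omega> (curl e)) * (L2_norm \<Omega> h + L2_norm \<Omega> (divergence h)))"
  have inv': "\<beta> (\<alpha> x) = x" if "x \<in> supp h'" for x using that h'(2) K(2) inv by blast
  have range': "norm (\<alpha> x + t) + L \<le> R" if "x \<in> supp h'" "t \<in> cbox c d" for x t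
    using that h'(2) by (intro range) auto
  have M': "integral ?B (\<lambda>x. norm (e' (\<beta> (\<alpha> x + s *\<^sub>R t))) * \<bar>divergence h' x\<bar> + norm (curl e' (\<beta> (\<alpha> x + s *\<^sub>R t))) * norm (h' x)) \<le> ?M"
    if "s \<in> {0..1}" "t \<in> cbox c d" for s t
    by (rule moved_product_le[OF e h(1) e'(1,3,4) h' q that])
  note est = reg.div_curl_estimate[OF e'(1,2) h'(1) supp_B inv' \<rho> range' box M']
  have zero: "h' x = 0 \<or> (x \<in> K \<and> \<alpha> x $ 3 < b)" for x
    using h'(2,4) supp_zero[of x h'] by fastforce
  have \<Omega>S: "\<Omega> \<in> sets lebesgue" using lmeasurable_\<Omega> by (rule fmeasurableD)
  have hL: "h \<in> L2 \<Omega>" using C1_away_L2[OF open_\<Omega> bounded_\<Omega> h(1)] by auto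
  have K\<Omega>: "K \<inter> \<Omega> \<subseteq> \<Omega>" by blast
  note hK = L2_subset[OF hL K\<Omega>_measurable(1) \<Omega>S K\<Omega>]
  have eh_zero: "e' x \<bullet> h' x = 0" if "x \<notin> K \<inter> \<Omega>" for x
  proof (cases "h' x = 0")
    case False
    then have x: "x \<in> K" "\<alpha> x $ 3 < b" using zero[of x] by auto
    then have "a \<le> \<alpha> x $ 1" using inside[of x] K(2) that by auto
    then show ?thesis using e'(4)[of x] x(1) N(3) by auto
  qed simp
  have "integral ?B (\<lambda>x. e' x \<bullet> h' x) = integral UNIV (\<lambda>x. e' x \<bullet> h' x)"
    by (rule integral_cbox_eq_UNIV) (use supp_B supp_zero[of _ h'] in fastforce)
  also have "\<dots> = (LINT x|lebesgue_on \<Omega>. e' x \<bullet> h' x)"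
  proof (rule integral_lebesgue_on_supp[OF \<Omega>S _ compact_imp_bounded[OF K(1)], symmetric])
    show "continuous_on UNIV (\<lambda>x. e' x \<bullet> h' x)"
      by (intro continuous_intros Ck_imp_continuous[OF e'(1)] Ck_imp_continuous[OF h'(1)])
  qed (rule eh_zero)
  also have "\<dots> = L2_inner \<Omega> e h"
    unfolding L2_inner_def
  proof (rule Bochner_Integration.integral_cong[OF refl])
    fix x assume "x \<in> space (lebesgue_on \<Omega>)"
    then have x: "x \<in> \<Omega>" using \<Omega>S by simp
    show "e' x \<bullet> h' x = e x \<bullet> h x"
    proof (cases "x \<in> K")
      case True
      then show ?thesis using e'(3)[of x] h'(3)[OF x] x N(3) by auto
    next
      case False
      then have "x \<notin> supp h" using h(2) by blast
      then have "h x = 0" using supp_zero[of x h] by blast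
      then show ?thesis using h'(3)[OF x] by simp
    qed
  qed
  finally have lhs: "integral ?B (\<lambda>x. e' x \<bullet> h' x) = L2_inner \<Omega> e h" .
  have av: "norm (h' x) * norm (reg.avg_limit e' \<rho> x) = (if x \<in> K \<inter> \<Omega> then norm (h x) * norm (Q e x) else 0)" for x
  proof (cases "h' x = 0")
    case True
    then show ?thesis using h'(3)[of x] by auto
  next
    case False
    then have x: "x \<in> K" "\<alpha> x $ 3 < b" using zero[of x] by auto
    have "reg.avg_limit e' \<rho> x = (if x \<in> \<Omega> then Q e x else 0)"
      by (rule avg_limit_eq_Q[OF _ _ x]) (use e'(3,4) in auto)
    then show ?thesis using x h'(3)[of x] by simp
  qed
  have av_out: "norm (h' x) * norm (reg.avg_limit e' \<rho> x) = 0" if "x \<notin> K \<inter> \<Omega>" for x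
    unfolding av using that by (simp only: if_False)
  have "integral ?B (\<lambda>x. norm (h' x) * norm (reg.avg_limit e' \<rho> x)) = integral UNIV (\<lambda>x. norm (h' x) * norm (reg.avg_limit e' \<rho> x))"
    by (rule integral_cbox_eq_UNIV) (use av_out q in blast)
  also have "\<dots> = integral (K \<inter> \<Omega>) (\<lambda>x. norm (h' x) * norm (reg.avg_limit e' \<rho> x))"
    by (rule integral_cbox_eq_UNIV[symmetric]) (rule av_out)
  also have "\<dots> = integral (K \<inter> \<Omega>) (\<lambda>x. norm (h x) * norm (Q e x))"
    unfolding av by (rule integral_cong) simp
  also have "\<dots> = (LINT x|lebesgue_on (K \<inter> \<Omega>). norm (h x) * norm (Q e x))"
    by (rule lebesgue_integral_eq_integral[OF integral_norm_mult_le(1)[OF hK(1) Q_L2[OF e]] K\<Omega>_measurable(1), symmetric])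
  also have "\<dots> \<le> L2_norm (K \<inter> \<Omega>) h * L2_norm (K \<inter> \<Omega>) (Q e)"
    by (rule integral_norm_mult_le(2)[OF hK(1) Q_L2[OF e]])
  also have "\<dots> \<le> L2_norm \<Omega> h * L2_norm (K \<inter> \<Omega>) (Q e)"
    by (intro mult_right_mono hK(2)) simp
  finally have "L * integral ?B (\<lambda>x. norm (h' x) * norm (reg.avg_limit e' \<rho> x)) \<le> L * (L2_norm \<Omega> h * L2_norm (K \<inter> \<Omega>) (Q e))"
    using L by (intro mult_left_mono) auto
  then show ?thesis using est(1) unfolding lhs by linarith
qed

end

lemma L2_subspace_C1_away:
  assumes "open \<Omega>" "bounded \<Omega>"
  shows "L2_subspace \<Omega> (C1_away \<Sigma>)"
  unfolding L2_subspace_def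
  using C1_away_L2(1)[OF assms] C1_away_zero C1_away_add C1_away_scaleR by blast

lemma L2_norm_cong:
  assumes "A \<in> sets lebesgue" "\<And>x. x \<in> A \<Longrightarrow> f x = g x"
  shows "L2_norm A f = L2_norm A g"
  unfolding L2_norm_def using assms by (intro arg_cong[where f=sqrt] Bochner_Integration.integral_cong) auto

context chart_weight
begin

text \<open>Each component of the average at \<open>x\<close> is a bounded functional on the
  subspace \<open>C1_away \<Gamma>t\<close>. The Riesz lemma represents it by an element of L^2,
  against which the sequence converges weakly by assumption.\<close>

lemma Q_converges:
  assumes \<phi>: "\<And>n. \<phi> n \<in> C1_away \<Gamma>t" and weak: "L2_weakly_converges \<Omega> \<phi> E" and x: "x \<in> K"
  shows "\<exists>l. (\<lambda>n. Q (\<phi> n) x) \<longlonglongrightarrow> l"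
proof -
  obtain C where C: "0 \<le> C" "\<And>e x j. continuous_on UNIV e \<Longrightarrow> x \<in> K \<Longrightarrow> \<bar>Q e x $ j\<bar> \<le> C * L2_norm \<Omega> e"
    using Q_component_bound by blast
  have "\<exists>l. (\<lambda>n. Q (\<phi> n) x $ j) \<longlonglongrightarrow> l" for j
  proof (rule L2_Riesz[OF lmeasurable_\<Omega> L2_subspace_C1_away[OF open_\<Omega> bounded_\<Omega>, of \<Gamma>t], of "\<lambda>e. Q e x $ j" C])
    fix f g assume fg: "f \<in> C1_away \<Gamma>t" "g \<in> C1_away \<Gamma>t"
    show "Q (\<lambda>x. f x + g x) x $ j = Q f x $ j + Q g x $ j"
      by (subst Q_add[OF Ck_imp_continuous[OF C1_away_Ck[OF fg(1)]] Ck_imp_continuous[OF C1_away_Ck[OF fg(2)]] x]) simp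
  next
    show "Q (\<lambda>x. k *\<^sub>R f x) x $ j = k * Q f x $ j" for k f by (simp add: Q_scaleR)
  next
    show "\<bar>Q f x $ j\<bar> \<le> C * L2_norm \<Omega> f" if "f \<in> C1_away \<Gamma>t" for f
      by (rule C(2)[OF Ck_imp_continuous[OF C1_away_Ck[OF that]] x])
  next
    fix g s assume g: "g \<in> L2 \<Omega>" "\<And>f. f \<in> C1_away \<Gamma>t \<Longrightarrow> Q f x $ j = L2_inner \<Omega> g f"
    have "(\<lambda>n. L2_inner \<Omega> (\<phi> n) g) \<longlonglongrightarrow> L2_inner \<Omega> E g"
      using weak g(1) by (simp add: L2_weakly_converges_def)
    then have "(\<lambda>n. Q (\<phi> n) x $ j) \<longlonglongrightarrow> L2_inner \<Omega> E g"
      using g(2)[OF \<phi>] by (simp add: L2_inner_commute)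
    then show ?thesis by blast
  qed
  then obtain l where "\<And>j. (\<lambda>n. Q (\<phi> n) x $ j) \<longlonglongrightarrow> l j" by metis
  then have "(\<lambda>n. Q (\<phi> n) x) \<longlonglongrightarrow> (\<chi> j. l j)" by (intro vec_tendstoI) simp
  then show ?thesis by blast
qed

text \<open>The averages converge pointwise and are uniformly bounded, hence they converge in L^2 on
  \<open>K \<inter> \<Omega>\<close>. The factor \<open>4 * C\<close> bounds the norms of a
  difference and of its curl together, \<open>2 * C\<close> each.\<close>

lemma sequence_estimate:
  assumes \<phi>: "\<And>n. \<phi> n \<in> C1_away \<Gamma>t" and weak: "L2_weakly_converges \<Omega> \<phi> E"
    and C: "\<And>n. L2_norm \<Omega> (\<phi> n) \<le> C" "\<And>n. L2_norm \<Omega> (curl (\<phi> n)) \<le> C" and \<eta>: "0 < \<eta>"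
  shows "\<exists>n0. \<forall>n\<ge>n0. \<forall>m\<ge>n0. \<forall>h\<in>C1_away \<Gamma>n. supp h \<subseteq> K \<longrightarrow>
    \<bar>L2_inner \<Omega> (\<lambda>x. \<phi> n x - \<phi> m x) h\<bar>
      \<le> (L ^ 3 * \<tau> * (sqrt ((3 * L\<^sup>2) ^ 3) * (4 * C)) + \<eta>) * (L2_norm \<Omega> h + L2_norm \<Omega> (divergence h))"
proof -
  let ?A = "K \<inter> \<Omega>"
  obtain B where B: "0 \<le> B" "\<And>e x. continuous_on UNIV e \<Longrightarrow> x \<in> K \<Longrightarrow> norm (Q e x) \<le> B * L2_norm \<Omega> e"
    using Q_bound by blast
  have c\<phi>: "continuous_on UNIV (\<phi> n)" for n by (rule Ck_imp_continuous[OF C1_away_Ck[OF \<phi>]])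
  have "\<forall>x. \<exists>l. x \<in> K \<longrightarrow> (\<lambda>n. Q (\<phi> n) x) \<longlonglongrightarrow> l" using Q_converges[OF \<phi> weak] by blast
  then obtain l where l: "\<And>x. x \<in> K \<Longrightarrow> (\<lambda>n. Q (\<phi> n) x) \<longlonglongrightarrow> l x" by metis
  have bd: "norm (Q (\<phi> n) x) \<le> B * C" if "x \<in> ?A" for n x
  proof -
    have "norm (Q (\<phi> n) x) \<le> B * L2_norm \<Omega> (\<phi> n)" using that by (intro B(2) c\<phi>) auto
    also have "\<dots> \<le> B * C" using B(1) C(1) by (intro mult_left_mono)
    finally show ?thesis .
  qed
  have lim: "(\<lambda>n. Q (\<phi> n) x) \<longlonglongrightarrow> l x" if "x \<in> ?A" for x using that l by blast
  note zero = L2_norm_tendsto_zero_bounded[OF K\<Omega>_measurable(2) Q_measurable[OF \<phi>] bd lim]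
  have "0 < \<eta> / (2 * L)" using \<eta> L by simp
  then obtain n0 where n0: "\<And>n. n0 \<le> n \<Longrightarrow> L2_norm ?A (\<lambda>x. Q (\<phi> n) x - l x) < \<eta> / (2 * L)"
    using order_tendstoD(2)[OF zero(2)] unfolding eventually_sequentially by blast
  show ?thesis
  proof (intro exI[of _ n0] allI ballI impI)
    fix n m h assume nm: "n0 \<le> n" "n0 \<le> m" and h: "h \<in> C1_away \<Gamma>n" "supp h \<subseteq> K"
    let ?e = "\<lambda>x. \<phi> n x - \<phi> m x"
    have e: "?e \<in> C1_away \<Gamma>t" by (intro C1_away_diff \<phi>)
    note L2\<phi> = C1_away_L2[OF open_\<Omega> bounded_\<Omega> \<phi>]
    have ne: "L2_norm \<Omega> ?e \<le> 2 * C"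
      using L2_norm_triangle_diff[OF L2\<phi>(1) L2\<phi>(1), of n m] C(1)[of n] C(1)[of m] by linarith
    have nc: "L2_norm \<Omega> (curl ?e) \<le> 2 * C"
      using L2_norm_triangle_diff[OF L2\<phi>(2) L2\<phi>(2), of n m] C(2)[of n] C(2)[of m]
        curl_diff[OF C1_away_Ck[OF \<phi>] C1_away_Ck[OF \<phi>], of n m] by simp
    have nQ: "L2_norm ?A (Q ?e) \<le> \<eta> / L"
    proof -
      have "L2_norm ?A (Q ?e) = L2_norm ?A (\<lambda>x. Q (\<phi> n) x - Q (\<phi> m) x)"
        by (rule L2_norm_cong[OF K\<Omega>_measurable(1)]) (rule Q_diff[OF c\<phi> c\<phi>], simp)
      also have "\<dots> \<le> L2_norm ?A (\<lambda>x. Q (\<phi> n) x - l x) + L2_norm ?A (\<lambda>x. l x - Q (\<phi> m) x)"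
        by (rule L2_norm_triangle_between[OF Q_L2[OF \<phi>] zero(1) Q_L2[OF \<phi>]])
      also have "\<dots> \<le> \<eta> / (2 * L) + \<eta> / (2 * L)"
        using n0[OF nm(1)] n0[OF nm(2)] L2_norm_minus_commute[of ?A l "Q (\<phi> m)"] by linarith
      finally show ?thesis using L by simp
    qed
    define H where "H = L2_norm \<Omega> h + L2_norm \<Omega> (divergence h)"
    have H: "0 \<le> H" "L2_norm \<Omega> h \<le> H" by (simp_all add: H_def)
    have "\<bar>L2_inner \<Omega> ?e h\<bar> \<le> L ^ 3 * \<tau> * (sqrt ((3 * L\<^sup>2) ^ 3) * ((L2_norm \<Omega> ?e + L2_norm \<Omega> (curl ?e)) * H))
        + L * (L2_norm \<Omega> h * L2_norm ?A (Q ?e))"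
      unfolding H_def by (rule localized_estimate[OF e h])
    also have "\<dots> \<le> L ^ 3 * \<tau> * (sqrt ((3 * L\<^sup>2) ^ 3) * ((4 * C) * H)) + L * (H * (\<eta> / L))"
      using L \<tau> H ne nc nQ by (intro add_mono mult_left_mono mult_right_mono mult_mono) auto
    also have "\<dots> = (L ^ 3 * \<tau> * (sqrt ((3 * L\<^sup>2) ^ 3) * (4 * C)) + \<eta>) * H"
      using L by (simp add: algebra_simps)
    finally show "\<bar>L2_inner \<Omega> ?e h\<bar> \<le> (L ^ 3 * \<tau> * (sqrt ((3 * L\<^sup>2) ^ 3) * (4 * C)) + \<eta>) * (L2_norm \<Omega> h + L2_norm \<Omega> (divergence h))"
      unfolding H_def .
  qed
qed

end

text \<open>Half of \<open>\<epsilon>\<close> is spent on the displacement, by the choice of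
  \<open>\<tau>\<close>, and half on the convergence of the averages, by the choice of
  \<open>n0\<close>.\<close>

lemma (in wedge_chart) chart_compactness:
  assumes \<phi>: "\<And>n. \<phi> n \<in> C1_away \<Gamma>t" and weak: "L2_weakly_converges \<Omega> \<phi> E"
    and C: "\<And>n. L2_norm \<Omega> (\<phi> n) \<le> C" "\<And>n. L2_norm \<Omega> (curl (\<phi> n)) \<le> C"
    and K: "compact K" "K \<subseteq> W" and \<epsilon>: "0 < \<epsilon>"
  shows "\<exists>n0. \<forall>n\<ge>n0. \<forall>m\<ge>n0. \<forall>h\<in>C1_away \<Gamma>n. supp h \<subseteq> K \<longrightarrow>
    \<bar>L2_inner \<Omega> (\<lambda>x. \<phi> n x - \<phi> m x) h\<bar> \<le> \<epsilon> * (L2_norm \<Omega> h + L2_norm \<Omega> (divergence h))"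
proof -
  have C0: "0 \<le> C" using C(1)[of 0] L2_norm_nonneg[of \<Omega> "\<phi> 0"] by linarith
  obtain \<delta> where \<delta>: "0 < \<delta>" "\<And>x t. x \<in> K \<Longrightarrow> norm t \<le> \<delta> \<Longrightarrow> \<alpha> x + t \<in> \<alpha> ` W"
    using compact_margin[OF K] by blast
  define D where "D = L ^ 3 * (sqrt ((3 * L\<^sup>2) ^ 3) * (4 * C))"
  have D: "0 \<le> D" using L C0 by (simp add: D_def)
  \<comment> \<open>\<open>D\<close> is the factor of \<open>\<tau>\<close> in
    \<open>sequence_estimate\<close>; adding 1 avoids division by 0.\<close>
  define \<tau> where "\<tau> = min \<delta> (\<epsilon> / (2 * (D + 1)))"
  have \<tau>: "0 < \<tau>" "\<tau> \<le> \<delta>" "\<tau> * D \<le> \<epsilon> / 2"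
  proof -
    show "0 < \<tau>" "\<tau> \<le> \<delta>" using \<delta>(1) \<epsilon> D by (auto simp: \<tau>_def)
    have "\<tau> * D \<le> \<epsilon> / (2 * (D + 1)) * (D + 1)"
      using D \<epsilon> by (intro mult_mono) (auto simp: \<tau>_def)
    also have "\<dots> = \<epsilon> / 2"
    proof -
      have "D + 1 \<noteq> 0" using D by linarith
      then show ?thesis by (metis nonzero_mult_divide_mult_cancel_right times_divide_eq_left)
    qed
    finally show "\<tau> * D \<le> \<epsilon> / 2" .
  qed
  \<comment> \<open>A box of displacements with the required signs in coordinates 1 and 3. The sides
    \<open>\<tau> / 3\<close> keep the norm below \<open>\<tau>\<close>, and the interior is
    nonempty so that the box carries a weight.\<close>
  define c d :: "real ^ 3" where "c = vector [0, 0, - (\<tau> / 3)]" and "d = vector [\<tau> / 3, \<tau> / 3, 0]"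
  have t: "\<bar>t $ 1\<bar> \<le> \<tau> / 3 \<and> \<bar>t $ 2\<bar> \<le> \<tau> / 3 \<and> \<bar>t $ 3\<bar> \<le> \<tau> / 3 \<and> 0 \<le> t $ 1 \<and> t $ 3 \<le> 0" if "t \<in> cbox c d" for t
    using that \<tau>(1) by (auto simp: mem_box_cart forall_3 c_def d_def)
  have box: "norm t \<le> \<tau>" if "t \<in> cbox c d" for t
    using norm_le_l1_cart[of t] t[OF that] unfolding sum_3 by linarith
  have "vector [\<tau> / 6, \<tau> / 6, - (\<tau> / 6)] \<in> box c d"
    using \<tau>(1) by (simp add: mem_box_cart forall_3 c_def d_def)
  then have "box c d \<noteq> {}" by blast
  then obtain \<rho> :: "real ^ 3 \<Rightarrow> real" where \<rho>: "continuous_on UNIV \<rho>" "\<And>t. t \<notin> cbox c d \<Longrightarrow> \<rho> t = 0" "\<And>t. 0 \<le> \<rho> t"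
    "integral (cbox c d) \<rho> = 1"
    using box_weight_exists by blast
  have "bounded (\<alpha> ` K)"
    using K(1) by (intro compact_imp_bounded compact_continuous_image continuous_\<alpha>)
  then obtain B where B: "\<forall>y\<in>\<alpha> ` K. norm y \<le> B" unfolding bounded_iff by blast
  \<comment> \<open>The radius of the ball on which the Jacobians are taken: the size of
    \<open>\<alpha>\<close> on \<open>K\<close>, the displacement, and the margin \<open>L\<close>
    for the regularization.\<close>
  have range: "norm (\<alpha> x + t) + L \<le> B + \<tau> + L" if "x \<in> K" "t \<in> cbox c d" for x t
    using norm_triangle_ineq[of "\<alpha> x" t] B that(1) box[OF that(2)] by fastforce
  show ?thesis
  proof (rule regularization_exists[OF L lip_\<alpha> lip_\<beta>, of "B + \<tau> + L"])
    fix \<alpha>s \<beta>s J assume reg: "regularized_pair_limit \<alpha> \<beta> L \<alpha>s \<beta>s J (B + \<tau> + L)"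
    have "chart_weight \<Omega> \<Gamma>t \<Gamma>n W \<alpha> \<beta> L a b \<alpha>s \<beta>s J (B + \<tau> + L) K \<delta> \<tau> c d \<rho>"
      by (intro chart_weight.intro wedge_chart_axioms reg chart_weight_axioms.intro K \<delta>(2) \<tau>(1,2) box \<rho> range)
        (use t in blast)+
    then interpret cw: chart_weight \<Omega> \<Gamma>t \<Gamma>n W \<alpha> \<beta> L a b \<alpha>s \<beta>s J "B + \<tau> + L" K \<delta> \<tau> c d \<rho> .
    note estimate = cw.sequence_estimate[OF \<phi> weak C half_gt_zero[OF \<epsilon>]]
    have le: "L ^ 3 * \<tau> * (sqrt ((3 * L\<^sup>2) ^ 3) * (4 * C)) + \<epsilon> / 2 \<le> \<epsilon>"
    proof -
      have "L ^ 3 * \<tau> * (sqrt ((3 * L\<^sup>2) ^ 3) * (4 * C)) = \<tau> * D" by (simp add: D_def)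
      then show ?thesis using \<tau>(3) by linarith
    qed
    from estimate show ?thesis
    proof (elim exE, intro exI allI ballI impI)
      fix n0 n m h
      assume n0: "\<forall>n\<ge>n0. \<forall>m\<ge>n0. \<forall>h\<in>C1_away \<Gamma>n. supp h \<subseteq> K \<longrightarrow> \<bar>L2_inner \<Omega> (\<lambda>x. \<phi> n x - \<phi> m x) h\<bar>
        \<le> (L ^ 3 * \<tau> * (sqrt ((3 * L\<^sup>2) ^ 3) * (4 * C)) + \<epsilon> / 2) * (L2_norm \<Omega> h + L2_norm \<Omega> (divergence h))"
      assume *: "n0 \<le> n" "n0 \<le> m" "h \<in> C1_away \<Gamma>n" "supp h \<subseteq> K"
      show "\<bar>L2_inner \<Omega> (\<lambda>x. \<phi> n x - \<phi> m x) h\<bar> \<le> \<epsilon> * (L2_norm \<Omega> h + L2_norm \<Omega> (divergence h))"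
        by (rule order_trans[OF n0[rule_format, OF *] mult_right_mono[OF le]]) simp
    qed
  qed
qed

section \<open>Existence of wedge charts\<close>

definition lipschitz :: "'a::metric_space set \<Rightarrow> ('a \<Rightarrow> 'b::metric_space) \<Rightarrow> bool" where
  "lipschitz S f \<longleftrightarrow> (\<exists>L. L-lipschitz_on S f)"

lemma lipschitz_subset: "lipschitz S f \<Longrightarrow> T \<subseteq> S \<Longrightarrow> lipschitz T f"
  unfolding lipschitz_def by (elim exE) (rule exI, erule (1) lipschitz_on_subset)

lemma lipschitz_continuous_on: "lipschitz S f \<Longrightarrow> continuous_on S f"
  unfolding lipschitz_def by (elim exE) (erule lipschitz_on_continuous_on)

lemma lipschitz_compose:
  assumes "lipschitz T g" "lipschitz S f" "\<And>x. x \<in> S \<Longrightarrow> f x \<in> T"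
  shows "lipschitz S (\<lambda>x. g (f x))"
proof -
  have "lipschitz (f ` S) g" using assms(3) by (intro lipschitz_subset[OF assms(1)]) auto
  then show ?thesis
    using assms(2) unfolding lipschitz_def by (elim exE) (rule exI, erule (1) lipschitz_on_compose2)
qed

lemma lipschitz_id: "lipschitz S (\<lambda>x. x)"
  unfolding lipschitz_def by (rule exI, rule lipschitz_on_id)

lemma lipschitz_const: "lipschitz S (\<lambda>x. c)"
  unfolding lipschitz_def by (rule exI, rule lipschitz_on_constant)

lemma lipschitz_add: "lipschitz S f \<Longrightarrow> lipschitz S g \<Longrightarrow> lipschitz S (\<lambda>x. f x + g x)"
  for f g :: "'a::metric_space \<Rightarrow> 'b::real_normed_vector"
  unfolding lipschitz_def by (elim exE) (rule exI, erule (1) lipschitz_on_add)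

lemma lipschitz_diff: "lipschitz S f \<Longrightarrow> lipschitz S g \<Longrightarrow> lipschitz S (\<lambda>x. f x - g x)"
  for f g :: "'a::metric_space \<Rightarrow> 'b::real_normed_vector"
  unfolding lipschitz_def by (elim exE) (rule exI, erule (1) lipschitz_on_diff)

lemma lipschitz_dist_le:
  assumes "lipschitz S f" and le: "\<And>x y. dist (g x) (g y) \<le> dist (f x) (f y)"
  shows "lipschitz S g"
proof -
  obtain L where L: "L-lipschitz_on S f" using assms(1) unfolding lipschitz_def by blast
  have "L-lipschitz_on S g"
    by (rule lipschitz_onI[OF order_trans[OF le lipschitz_onD[OF L]] lipschitz_on_nonneg[OF L]])
  then show ?thesis unfolding lipschitz_def by blast
qed

lemma lipschitz_nth: "lipschitz S f \<Longrightarrow> lipschitz S (\<lambda>x. f x $ i)"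
  for f :: "'a::metric_space \<Rightarrow> real ^ 'n"
  by (erule lipschitz_dist_le) (rule dist_vec_nth_le)

lemma lipschitz_max_0: "lipschitz S f \<Longrightarrow> lipschitz S (\<lambda>x. max (f x) 0)"
  and lipschitz_min_0: "lipschitz S f \<Longrightarrow> lipschitz S (\<lambda>x. min (f x) 0)"
  for f :: "'a::metric_space \<Rightarrow> real"
  by (erule lipschitz_dist_le, unfold dist_real_def, arith)+

lemma lipschitz_max: "lipschitz S f \<Longrightarrow> lipschitz S g \<Longrightarrow> lipschitz S (\<lambda>x. max (f x) (g x))"
  for f g :: "'a::metric_space \<Rightarrow> real"
proof -
  assume fg: "lipschitz S f" "lipschitz S g"
  have "max (f x) (g x) = g x + max (f x - g x) 0" for x by auto
  then show ?thesis
    using lipschitz_add[OF fg(2) lipschitz_max_0[OF lipschitz_diff[OF fg]]] by simp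
qed

lemma lipschitz_vec:
  fixes f :: "'a::metric_space \<Rightarrow> real ^ 'n"
  assumes "\<And>i. lipschitz S (\<lambda>x. f x $ i)"
  shows "lipschitz S f"
proof -
  obtain L where L: "\<And>i. (L i)-lipschitz_on S (\<lambda>x. f x $ i)"
    using assms unfolding lipschitz_def by metis
  have "(\<Sum>i\<in>UNIV. L i)-lipschitz_on S f"
  proof (rule lipschitz_onI)
    show "0 \<le> (\<Sum>i\<in>UNIV. L i)" by (rule sum_nonneg) (rule lipschitz_on_nonneg[OF L])
    fix x y assume xy: "x \<in> S" "y \<in> S"
    have "dist (f x) (f y) \<le> (\<Sum>i\<in>UNIV. \<bar>(f x - f y) $ i\<bar>)"
      unfolding dist_norm by (rule norm_le_l1_cart)
    also have "\<dots> \<le> (\<Sum>i\<in>UNIV. L i * dist x y)"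
      using lipschitz_onD[OF L xy] by (intro sum_mono) (simp add: dist_real_def)
    finally show "dist (f x) (f y) \<le> (\<Sum>i\<in>UNIV. L i) * dist x y" by (simp add: sum_distrib_right)
  qed
  then show ?thesis unfolding lipschitz_def by blast
qed

lemma lipschitz_vector_3:
  assumes "lipschitz S f" "lipschitz S g" "lipschitz S h"
  shows "lipschitz S (\<lambda>x. vector [f x, g x, h x] :: real ^ 3)"
proof (rule lipschitz_vec)
  fix i :: 3
  show "lipschitz S (\<lambda>x. vector [f x, g x, h x] $ i)"
    using assms exhaust_3[of i] by auto
qed

lemma lipschitz_vector_2:
  assumes "lipschitz S f" "lipschitz S g"
  shows "lipschitz S (\<lambda>x. vector [f x, g x] :: real ^ 2)"
proof (rule lipschitz_vec)
  fix i :: 2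
  show "lipschitz S (\<lambda>x. vector [f x, g x] $ i)"
    using assms exhaust_2[of i] by auto
qed

lemmas lipschitz_rules = lipschitz_id lipschitz_const lipschitz_add lipschitz_diff lipschitz_nth
  lipschitz_max_0 lipschitz_min_0 lipschitz_max lipschitz_vector_3 lipschitz_vector_2

text \<open>A chart and its inverse are given only on \<open>W\<close> and on its image, whereas
  mollification requires maps on the whole space. Extension multiplies the Lipschitz constants by 3,
  and \<open>L\<close> is chosen above both results and above 1.\<close>

lemma wedge_chart_exists:
  fixes \<kappa> :: "real ^ 3 \<Rightarrow> real ^ 3"
  assumes "open \<Omega>" "bounded \<Omega>" "open W" "open (\<kappa> ` W)" and \<kappa>: "lipschitz W \<kappa>" and \<mu>: "lipschitz (\<kappa> ` W) \<mu>"
    and inv: "\<And>x. x \<in> W \<Longrightarrow> \<mu> (\<kappa> x) = x"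
    and inside: "\<And>x. x \<in> W \<Longrightarrow> x \<in> \<Omega> \<longleftrightarrow> \<kappa> x $ 1 < a \<and> \<kappa> x $ 3 < b"
    and face_t: "\<And>x. x \<in> W \<Longrightarrow> \<kappa> x $ 1 = a \<Longrightarrow> \<kappa> x $ 3 \<le> b \<Longrightarrow> x \<in> closure \<Gamma>t"
    and face_n: "\<And>x. x \<in> W \<Longrightarrow> \<kappa> x $ 1 \<le> a \<Longrightarrow> \<kappa> x $ 3 = b \<Longrightarrow> x \<in> closure \<Gamma>n"
  shows "\<exists>\<alpha> \<beta> L a b. wedge_chart \<Omega> \<Gamma>t \<Gamma>n W \<alpha> \<beta> L a b"
proof -
  obtain M where M: "M-lipschitz_on W \<kappa>" using \<kappa> unfolding lipschitz_def by blast
  obtain N where N: "N-lipschitz_on (\<kappa> ` W) \<mu>" using \<mu> unfolding lipschitz_def by blast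
  have nonneg: "0 \<le> M" "0 \<le> N" using M N lipschitz_on_nonneg by blast+
  have M': "norm (\<kappa> x - \<kappa> y) \<le> M * dist x y" if "x \<in> W" "y \<in> W" for x y
    using lipschitz_onD[OF M that(1,2)] unfolding dist_norm .
  have N': "norm (\<mu> x - \<mu> y) \<le> N * dist x y" if "x \<in> \<kappa> ` W" "y \<in> \<kappa> ` W" for x y
    using lipschitz_onD[OF N that(1,2)] unfolding dist_norm .
  obtain \<alpha> where \<alpha>: "\<And>x. x \<in> W \<Longrightarrow> \<alpha> x = \<kappa> x" "\<And>x y. norm (\<alpha> x - \<alpha> y) \<le> 3 * M * dist x y"
    using Lipschitz_extension[OF nonneg(1) M'] by blast
  obtain \<beta> where \<beta>: "\<And>x. x \<in> \<kappa> ` W \<Longrightarrow> \<beta> x = \<mu> x" "\<And>x y. norm (\<beta> x - \<beta> y) \<le> 3 * N * dist x y"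
    using Lipschitz_extension[OF nonneg(2) N'] by blast
  have image: "\<alpha> ` W = \<kappa> ` W" by (rule image_cong[OF refl \<alpha>(1)])
  define L where "L = 1 + 3 * M + 3 * N"
  have L: "1 \<le> L" "3 * M \<le> L" "3 * N \<le> L" using nonneg by (auto simp: L_def)
  have "wedge_chart \<Omega> \<Gamma>t \<Gamma>n W \<alpha> \<beta> L a b"
  proof (unfold_locales)
    show "norm (\<alpha> x - \<alpha> y) \<le> L * norm (x - y)" for x y
      using order_trans[OF \<alpha>(2)[of x y] mult_right_mono[OF L(2) zero_le_dist]] unfolding dist_norm .
    show "norm (\<beta> x - \<beta> y) \<le> L * norm (x - y)" for x y
      using order_trans[OF \<beta>(2)[of x y] mult_right_mono[OF L(3) zero_le_dist]] unfolding dist_norm .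
    show "open (\<alpha> ` W)" using assms(4) image by simp
  qed (use assms \<alpha>(1) \<beta>(1) L(1) in auto)
  then show ?thesis by blast
qed

lemma bi_lipschitz_bij_inverse:
  assumes "bi_lipschitz_bij f U V"
  obtains g where "lipschitz U f" "lipschitz V g" "\<And>x. x \<in> U \<Longrightarrow> f x \<in> V \<and> g (f x) = x" "\<And>y. y \<in> V \<Longrightarrow> g y \<in> U \<and> f (g y) = y"
proof
  have f: "bij_betw f U V" "lipschitz U f" "lipschitz V (inv_into U f)"
    using assms unfolding bi_lipschitz_bij_def lipschitz_def by blast+
  show "lipschitz U f" "lipschitz V (inv_into U f)" by fact+
  show "f x \<in> V \<and> inv_into U f (f x) = x" if "x \<in> U" for x
    using f(1) that by (auto simp: bij_betw_def)
  show "inv_into U f y \<in> U \<and> f (inv_into U f y) = y" if "y \<in> V" for y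
    using f(1) that by (auto simp: bij_betw_def inv_into_into f_inv_into_f)
qed

lemma image_characterization:
  assumes "\<And>x. x \<in> U \<Longrightarrow> f x \<in> V \<and> g (f x) = x" "f ` (U \<inter> A) = {y \<in> V. P y}" "x \<in> U"
  shows "x \<in> A \<longleftrightarrow> P (f x)"
proof
  assume "x \<in> A"
  then have "f x \<in> f ` (U \<inter> A)" using assms(3) by simp
  then show "P (f x)" unfolding assms(2) by simp
next
  assume "P (f x)"
  then have "f x \<in> f ` (U \<inter> A)" unfolding assms(2) using assms(1)[OF assms(3)] by simp
  then show "x \<in> A"
  proof (rule imageE)
    fix x' assume x': "f x = f x'" "x' \<in> U \<inter> A"
    then have "x = x'" using assms(1)[of x'] assms(1)[OF assms(3)] by simp
    then show "x \<in> A" using x' by simp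
  qed
qed

lemma open_open_cube: "open (open_cube :: (real ^ 'n) set)"
proof -
  have "open_cube = (\<Inter>i\<in>UNIV. {y :: real ^ 'n. y $ i > -1} \<inter> {y. y $ i < 1})"
    unfolding open_cube_def by blast
  also have "open \<dots>"
    by (rule open_INT) (simp_all add: open_Int open_halfspace_component_gt_cart open_halfspace_component_lt_cart)
  finally show ?thesis .
qed

lemma boundary_chart:
  assumes "weak_lipschitz_domain \<Omega>" "p \<in> frontier \<Omega>"
  obtains U \<phi> \<theta> where "open U" "p \<in> U" "\<phi> p = (0 :: real ^ 3)" "lipschitz U \<phi>" "lipschitz open_cube \<theta>"
    "\<And>x. x \<in> U \<Longrightarrow> \<phi> x \<in> open_cube \<and> \<theta> (\<phi> x) = x" "\<And>y. y \<in> open_cube \<Longrightarrow> \<theta> y \<in> U \<and> \<phi> (\<theta> y) = y"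
    "\<And>x. x \<in> U \<Longrightarrow> x \<in> \<Omega> \<longleftrightarrow> \<phi> x $ 3 < 0" "\<And>x. x \<in> U \<Longrightarrow> x \<in> frontier \<Omega> \<longleftrightarrow> \<phi> x $ 3 = 0"
proof -
  obtain U and \<phi> :: "real ^ 3 \<Rightarrow> real ^ 3" where U: "open U" "p \<in> U" "bi_lipschitz_bij \<phi> U open_cube" "\<phi> p = 0"
    "\<phi> ` (U \<inter> \<Omega>) = {y \<in> open_cube. y $ 3 < 0}" "\<phi> ` (U \<inter> frontier \<Omega>) = {y \<in> open_cube. y $ 3 = 0}"
    using assms unfolding weak_lipschitz_domain_def by blast
  show ?thesis
  proof (rule bi_lipschitz_bij_inverse[OF U(3)])
    fix \<theta> assume \<theta>: "lipschitz U \<phi>" "lipschitz open_cube \<theta>" "\<And>x. x \<in> U \<Longrightarrow> \<phi> x \<in> open_cube \<and> \<theta> (\<phi> x) = x"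
      "\<And>y. y \<in> open_cube \<Longrightarrow> \<theta> y \<in> U \<and> \<phi> (\<theta> y) = y"
    show ?thesis
      by (rule that[OF U(1,2,4) \<theta> image_characterization[OF \<theta>(3) U(5)] image_characterization[OF \<theta>(3) U(6)]])
  qed
qed

lemma interface_chart:
  assumes "weak_lipschitz_part \<Gamma> \<Gamma>t" "p \<in> top_of_set \<Gamma> frontier_of \<Gamma>t"
  obtains V \<psi> \<omega> where "openin (top_of_set \<Gamma>) V" "p \<in> V" "lipschitz V \<psi>" "lipschitz (open_cube :: (real ^ 2) set) \<omega>"
    "\<And>x. x \<in> V \<Longrightarrow> \<psi> x \<in> open_cube \<and> \<omega> (\<psi> x) = x" "\<And>y. y \<in> open_cube \<Longrightarrow> \<omega> y \<in> V \<and> \<psi> (\<omega> y) = y"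
    "\<And>x. x \<in> V \<Longrightarrow> x \<in> \<Gamma>t \<longleftrightarrow> \<psi> x $ 1 < 0" "\<And>x. x \<in> V \<Longrightarrow> x \<in> top_of_set \<Gamma> frontier_of \<Gamma>t \<longleftrightarrow> \<psi> x $ 1 = 0"
    "\<And>x. x \<in> V \<Longrightarrow> x \<in> - closure \<Gamma>t \<longleftrightarrow> \<psi> x $ 1 > 0"
proof -
  obtain V and \<psi> :: "real ^ 3 \<Rightarrow> real ^ 2" where V: "openin (top_of_set \<Gamma>) V" "p \<in> V" "bi_lipschitz_bij \<psi> V open_cube"
    "\<psi> ` (V \<inter> \<Gamma>t) = {y \<in> open_cube. y $ 1 < 0}" "\<psi> ` (V \<inter> (top_of_set \<Gamma> frontier_of \<Gamma>t)) = {y \<in> open_cube. y $ 1 = 0}"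
    "\<psi> ` (V \<inter> - closure \<Gamma>t) = {y \<in> open_cube. y $ 1 > 0}"
    using assms unfolding weak_lipschitz_part_def Diff_eq by blast
  show ?thesis
  proof (rule bi_lipschitz_bij_inverse[OF V(3)])
    fix \<omega> assume \<omega>: "lipschitz V \<psi>" "lipschitz open_cube \<omega>" "\<And>x. x \<in> V \<Longrightarrow> \<psi> x \<in> open_cube \<and> \<omega> (\<psi> x) = x"
      "\<And>y. y \<in> open_cube \<Longrightarrow> \<omega> y \<in> V \<and> \<psi> (\<omega> y) = y"
    show ?thesis
      by (rule that[OF V(1,2) \<omega> image_characterization[OF \<omega>(3) V(4)]
        image_characterization[OF \<omega>(3) V(5)] image_characterization[OF \<omega>(3) V(6)]])
  qed
qed

text \<open>Openness of the image is deduced from the explicit inverse: the image of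
  \<open>S\<close> is its preimage under the continuous map \<open>g\<close>.\<close>

lemma open_image_homeomorphism:
  assumes "open S" "continuous_on T g" "open T" "\<And>x. x \<in> S \<Longrightarrow> f x \<in> T \<and> g (f x) = x" "\<And>y. y \<in> T \<Longrightarrow> g y \<in> S \<Longrightarrow> f (g y) = y"
  shows "open (f ` S)"
proof -
  have "f ` S = T \<inter> g -` S"
  proof (intro equalityI subsetI)
    fix y assume "y \<in> T \<inter> g -` S"
    then show "y \<in> f ` S" using assms(5)[of y] by (metis IntD1 IntD2 imageI vimageD)
  qed (use assms(4) in auto)
  then show ?thesis using continuous_open_preimage[OF assms(2,3,1)] by simp
qed

text \<open>Folds the half space \<open>y\<^sub>3 < 0\<close> to the wedge \<open>k\<^sub>1 < 0, k\<^sub>3 < 0\<close>: the half plane \<open>y\<^sub>3 = 0 \<ge> y\<^sub>1\<close> becomes the face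
  \<open>k\<^sub>1 = 0\<close> and \<open>y\<^sub>3 = 0 \<le> y\<^sub>1\<close> the face \<open>k\<^sub>3 = 0\<close>.\<close>

definition wedge_map :: "real ^ 3 \<Rightarrow> real ^ 3" where
  "wedge_map y = vector [y $ 3 - max (y $ 1) 0, y $ 2, y $ 3 + min (y $ 1) 0]"

definition wedge_inv :: "real ^ 3 \<Rightarrow> real ^ 3" where
  "wedge_inv k = vector [k $ 3 - k $ 1, k $ 2, max (k $ 1) (k $ 3)]"

lemma wedge_inv_map [simp]: "wedge_inv (wedge_map y) = y"
  unfolding wedge_inv_def wedge_map_def vec_eq_iff forall_3 vector_3 by linarith

lemma wedge_map_inv [simp]: "wedge_map (wedge_inv k) = k"
  unfolding wedge_inv_def wedge_map_def vec_eq_iff forall_3 vector_3 by linarith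

lemma lipschitz_wedge: "lipschitz S wedge_map" "lipschitz S wedge_inv"
  unfolding wedge_map_def[abs_def] wedge_inv_def[abs_def] by (intro lipschitz_rules)+

lemma interior_wedge_chart:
  assumes "open \<Omega>" "bounded \<Omega>"
  shows "\<exists>\<alpha> \<beta> L a b. wedge_chart \<Omega> \<Gamma>t \<Gamma>n \<Omega> \<alpha> \<beta> L a b"
proof -
  obtain B where B: "\<And>x. x \<in> \<Omega> \<Longrightarrow> norm x \<le> B" using assms(2) unfolding bounded_iff by blast
  have less: "x $ i < B + 1" if "x \<in> \<Omega>" for x i
    using B[OF that] component_le_norm_cart[of x i] by linarith
  show ?thesis
  proof (rule wedge_chart_exists[where \<kappa> = "\<lambda>x. x" and \<mu> = "\<lambda>x. x" and a = "B + 1" and b = "B + 1"])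
    show "open ((\<lambda>x. x) ` \<Omega>)" using assms(1) by simp
    fix x assume x: "x \<in> \<Omega>"
    show "x \<in> \<Omega> \<longleftrightarrow> x $ 1 < B + 1 \<and> x $ 3 < B + 1" using less[OF x] x by simp
    show "x \<in> closure \<Gamma>t" if "x $ 1 = B + 1" using less[OF x, of 1] that by simp
    show "x \<in> closure \<Gamma>n" if "x $ 3 = B + 1" using less[OF x, of 3] that by simp
  qed (use assms in \<open>simp_all add: lipschitz_id\<close>)
qed

definition swap_13 :: "real ^ 3 \<Rightarrow> real ^ 3" where
  "swap_13 y = vector [y $ 3, y $ 2, y $ 1]"

lemma swap_13_swap_13 [simp]: "swap_13 (swap_13 y) = y"
  unfolding swap_13_def vec_eq_iff forall_3 vector_3 by simp

lemma swap_13_nth [simp]: "swap_13 y $ 1 = y $ 3" "swap_13 y $ 3 = y $ 1"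
  by (simp_all add: swap_13_def)

lemma lipschitz_swap_13: "lipschitz S swap_13"
  unfolding swap_13_def[abs_def] by (intro lipschitz_rules)

lemma open_cube_nth: "y \<in> open_cube \<Longrightarrow> -1 < y $ i \<and> y $ i < 1"
  by (simp add: open_cube_def)

text \<open>\<open>swap_13\<close> makes the flattened boundary the first face, and \<open>W\<close>
  is shrunk until all its boundary points lie in \<Gamma>t. The other coordinate stays below 1, so
  with \<open>b = 1\<close> the second face never occurs.\<close>

lemma face_t_wedge_chart:
  assumes \<Omega>: "weak_lipschitz_domain \<Omega>" and part: "openin (top_of_set (frontier \<Omega>)) \<Gamma>t" and p: "p \<in> \<Gamma>t"
  shows "\<exists>W. p \<in> W \<and> (\<exists>\<alpha> \<beta> L a b. wedge_chart \<Omega> \<Gamma>t \<Gamma>n W \<alpha> \<beta> L a b)"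
proof -
  obtain U' where U': "open U'" "\<Gamma>t = frontier \<Omega> \<inter> U'" using part by (auto simp: openin_open)
  have "p \<in> frontier \<Omega>" using p U'(2) by blast
  from \<Omega> this show ?thesis
  proof (rule boundary_chart)
    fix U and \<phi> \<theta> :: "real ^ 3 \<Rightarrow> real ^ 3"
    assume U: "open U" "p \<in> U" and lip: "lipschitz U \<phi>" "lipschitz open_cube \<theta>"
      and \<phi>: "\<And>x. x \<in> U \<Longrightarrow> \<phi> x \<in> open_cube \<and> \<theta> (\<phi> x) = x" and \<theta>: "\<And>y. y \<in> open_cube \<Longrightarrow> \<theta> y \<in> U \<and> \<phi> (\<theta> y) = y"
      and inside: "\<And>x. x \<in> U \<Longrightarrow> x \<in> \<Omega> \<longleftrightarrow> \<phi> x $ 3 < 0" and boundary: "\<And>x. x \<in> U \<Longrightarrow> x \<in> frontier \<Omega> \<longleftrightarrow> \<phi> x $ 3 = 0"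
    let ?\<kappa> = "\<lambda>x. swap_13 (\<phi> x)" and ?\<mu> = "\<lambda>k. \<theta> (swap_13 k)" and ?W = "U \<inter> U'"
    have W: "open ?W" using U U' by blast
    have "open (\<phi> ` ?W)"
    proof (rule open_image_homeomorphism[OF W lipschitz_continuous_on[OF lip(2)] open_open_cube])
      show "\<phi> x \<in> open_cube \<and> \<theta> (\<phi> x) = x" if "x \<in> ?W" for x using \<phi> that by blast
      show "\<phi> (\<theta> y) = y" if "y \<in> open_cube" for y using \<theta> that by blast
    qed
    then have "open (swap_13 ` \<phi> ` ?W)"
      by (rule open_image_homeomorphism[where T = UNIV and g = swap_13])
        (simp_all add: lipschitz_continuous_on lipschitz_swap_13)
    then have image: "open (?\<kappa> ` ?W)" by (simp add: image_image)
    have small: "\<phi> x $ 1 < 1" if "x \<in> ?W" for x using \<phi>[of x] that open_cube_nth[of "\<phi> x" 1] by blast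
    have "\<exists>\<alpha> \<beta> L a b. wedge_chart \<Omega> \<Gamma>t \<Gamma>n ?W \<alpha> \<beta> L a b"
    proof (rule wedge_chart_exists[OF _ _ W image, where \<mu> = ?\<mu> and a = 0 and b = 1])
      show "open \<Omega>" "bounded \<Omega>" using \<Omega> by (auto simp: weak_lipschitz_domain_def bounded_domain_def)
      show "lipschitz ?W ?\<kappa>"
        by (rule lipschitz_compose[OF lipschitz_swap_13 lipschitz_subset[OF lip(1)]]) auto
      show "lipschitz (?\<kappa> ` ?W) ?\<mu>"
        by (rule lipschitz_compose[OF lip(2) lipschitz_swap_13]) (use \<phi> in auto)
      fix x assume x: "x \<in> ?W"
      show "?\<mu> (?\<kappa> x) = x" using \<phi> x by simp
      show "x \<in> \<Omega> \<longleftrightarrow> ?\<kappa> x $ 1 < 0 \<and> ?\<kappa> x $ 3 < 1" using inside[of x] small[OF x] x by simp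
      show "x \<in> closure \<Gamma>t" if "?\<kappa> x $ 1 = 0"
        using boundary[of x] that x U'(2) closure_subset[of \<Gamma>t] by auto
      show "x \<in> closure \<Gamma>n" if "?\<kappa> x $ 3 = 1" using small[OF x] that by simp
    qed
    then show ?thesis using U(2) p U'(2) by blast
  qed
qed

text \<open>Here the boundary is the second face. Removing \<open>closure \<Gamma>t\<close> from the
  chart leaves only boundary points of the complementary part.\<close>

lemma face_n_wedge_chart:
  assumes \<Omega>: "weak_lipschitz_domain \<Omega>" and p: "p \<in> frontier \<Omega> - closure \<Gamma>t"
  shows "\<exists>W. p \<in> W \<and> (\<exists>\<alpha> \<beta> L a b. wedge_chart \<Omega> \<Gamma>t (frontier \<Omega> - closure \<Gamma>t) W \<alpha> \<beta> L a b)"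
proof -
  have "p \<in> frontier \<Omega>" using p by blast
  from \<Omega> this show ?thesis
  proof (rule boundary_chart)
    fix U and \<phi> \<theta> :: "real ^ 3 \<Rightarrow> real ^ 3"
    assume U: "open U" "p \<in> U" and lip: "lipschitz U \<phi>" "lipschitz open_cube \<theta>"
      and \<phi>: "\<And>x. x \<in> U \<Longrightarrow> \<phi> x \<in> open_cube \<and> \<theta> (\<phi> x) = x" and \<theta>: "\<And>y. y \<in> open_cube \<Longrightarrow> \<theta> y \<in> U \<and> \<phi> (\<theta> y) = y"
      and inside: "\<And>x. x \<in> U \<Longrightarrow> x \<in> \<Omega> \<longleftrightarrow> \<phi> x $ 3 < 0" and boundary: "\<And>x. x \<in> U \<Longrightarrow> x \<in> frontier \<Omega> \<longleftrightarrow> \<phi> x $ 3 = 0"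
    let ?W = "U - closure \<Gamma>t"
    have W: "open ?W" using U by (simp add: open_Diff)
    have image: "open (\<phi> ` ?W)"
    proof (rule open_image_homeomorphism[OF W lipschitz_continuous_on[OF lip(2)] open_open_cube])
      show "\<phi> x \<in> open_cube \<and> \<theta> (\<phi> x) = x" if "x \<in> ?W" for x using \<phi> that by blast
      show "\<phi> (\<theta> y) = y" if "y \<in> open_cube" for y using \<theta> that by blast
    qed
    have small: "\<phi> x $ 1 < 1" if "x \<in> ?W" for x using \<phi>[of x] that open_cube_nth[of "\<phi> x" 1] by blast
    have "\<exists>\<alpha> \<beta> L a b. wedge_chart \<Omega> \<Gamma>t (frontier \<Omega> - closure \<Gamma>t) ?W \<alpha> \<beta> L a b"
    proof (rule wedge_chart_exists[OF _ _ W image, where \<mu> = \<theta> and a = 1 and b = 0])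
      show "open \<Omega>" "bounded \<Omega>" using \<Omega> by (auto simp: weak_lipschitz_domain_def bounded_domain_def)
      show "lipschitz ?W \<phi>" by (rule lipschitz_subset[OF lip(1)]) auto
      show "lipschitz (\<phi> ` ?W) \<theta>" by (rule lipschitz_subset[OF lip(2)]) (use \<phi> in auto)
      fix x assume x: "x \<in> ?W"
      show "\<theta> (\<phi> x) = x" using \<phi> x by simp
      show "x \<in> \<Omega> \<longleftrightarrow> \<phi> x $ 1 < 1 \<and> \<phi> x $ 3 < 0" using inside[of x] small[OF x] x by simp
      show "x \<in> closure \<Gamma>t" if "\<phi> x $ 1 = 1" using small[OF x] that by simp
      show "x \<in> closure (frontier \<Omega> - closure \<Gamma>t)" if "\<phi> x $ 3 = 0"
        using boundary[of x] that x closure_subset[of "frontier \<Omega> - closure \<Gamma>t"] by auto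
    qed
    then show ?thesis using U(2) p by blast
  qed
qed

text \<open>The chart \<open>\<phi>\<close> flattens the boundary but knows nothing of the
  interface, while \<open>\<psi>\<close> straightens the interface but lives only on the boundary.
  Extending \<open>\<psi>\<close> constantly along the third coordinate of \<open>\<phi>\<close>
  combines the two, and \<open>wedge_map\<close> then folds the flat boundary along the
  interface.\<close>

lemma edge_wedge_chart:
  assumes \<Omega>: "weak_lipschitz_domain \<Omega>" and part: "weak_lipschitz_part (frontier \<Omega>) \<Gamma>t"
    and p: "p \<in> top_of_set (frontier \<Omega>) frontier_of \<Gamma>t"
  shows "\<exists>W. p \<in> W \<and> (\<exists>\<alpha> \<beta> L a b. wedge_chart \<Omega> \<Gamma>t (frontier \<Omega> - closure \<Gamma>t) W \<alpha> \<beta> L a b)"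
proof -
  let ?\<Gamma> = "frontier \<Omega>" and ?\<Gamma>n = "frontier \<Omega> - closure \<Gamma>t"
  have frontier_of: "top_of_set ?\<Gamma> frontier_of \<Gamma>t \<subseteq> ?\<Gamma> \<inter> closure \<Gamma>t"
    unfolding frontier_of_def closure_of_subtopology by (auto intro: closure_mono[THEN subsetD])
  have "p \<in> frontier \<Omega>" using p frontier_of by blast
  from \<Omega> this show ?thesis
  proof (rule boundary_chart)
    fix U and \<phi> \<theta> :: "real ^ 3 \<Rightarrow> real ^ 3"
    assume U: "open U" "p \<in> U" and \<phi>p: "\<phi> p = 0" and lip: "lipschitz U \<phi>" "lipschitz open_cube \<theta>"
      and \<phi>: "\<And>x. x \<in> U \<Longrightarrow> \<phi> x \<in> open_cube \<and> \<theta> (\<phi> x) = x" and \<theta>: "\<And>y. y \<in> open_cube \<Longrightarrow> \<theta> y \<in> U \<and> \<phi> (\<theta> y) = y"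
      and inside: "\<And>x. x \<in> U \<Longrightarrow> x \<in> \<Omega> \<longleftrightarrow> \<phi> x $ 3 < 0" and boundary: "\<And>x. x \<in> U \<Longrightarrow> x \<in> frontier \<Omega> \<longleftrightarrow> \<phi> x $ 3 = 0"
    from part p show ?thesis
    proof (rule interface_chart)
      fix V and \<psi> :: "real ^ 3 \<Rightarrow> real ^ 2" and \<omega>
      assume V: "openin (top_of_set ?\<Gamma>) V" "p \<in> V" and lip2: "lipschitz V \<psi>" "lipschitz open_cube \<omega>"
        and \<psi>: "\<And>x. x \<in> V \<Longrightarrow> \<psi> x \<in> open_cube \<and> \<omega> (\<psi> x) = x" and \<omega>: "\<And>y. y \<in> open_cube \<Longrightarrow> \<omega> y \<in> V \<and> \<psi> (\<omega> y) = y"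
        and part_t: "\<And>x. x \<in> V \<Longrightarrow> x \<in> \<Gamma>t \<longleftrightarrow> \<psi> x $ 1 < 0"
        and interface: "\<And>x. x \<in> V \<Longrightarrow> x \<in> top_of_set ?\<Gamma> frontier_of \<Gamma>t \<longleftrightarrow> \<psi> x $ 1 = 0"
        and part_n: "\<And>x. x \<in> V \<Longrightarrow> x \<in> - closure \<Gamma>t \<longleftrightarrow> \<psi> x $ 1 > 0"
      obtain V' where V': "open V'" "V = ?\<Gamma> \<inter> V'" using V(1) by (auto simp: openin_open)

      txt \<open>\<open>q\<close> projects onto \<open>frontier \<Omega>\<close> along the third chart coordinate; \<open>Y\<close> replaces the first two chart
        coordinates by those that \<open>\<psi>\<close> gives to \<open>q x\<close>, and \<open>X\<close> is its inverse.\<close>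
      define \<pi> where "\<pi> y = (vector [y $ 1, y $ 2, 0] :: real ^ 3)" for y :: "real ^ 3"
      define q where "q x = \<theta> (\<pi> (\<phi> x))" for x
      define W where "W = {x \<in> U. q x \<in> V}"
      define Y where "Y x = (vector [\<psi> (q x) $ 1, \<psi> (q x) $ 2, \<phi> x $ 3] :: real ^ 3)" for x
      define flat where "flat z = (vector [z $ 1, z $ 2] :: real ^ 2)" for z :: "real ^ 3"
      define X where "X z = \<theta> (vector [\<phi> (\<omega> (flat z)) $ 1, \<phi> (\<omega> (flat z)) $ 2, z $ 3])" for z

      have \<pi>_cube: "\<pi> y \<in> open_cube" if "y \<in> open_cube" for y
        using that by (simp add: open_cube_def forall_3 \<pi>_def)
      have lip_\<pi>: "lipschitz S \<pi>" for S unfolding \<pi>_def by (intro lipschitz_rules)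
      have lip_flat: "lipschitz S flat" for S unfolding flat_def by (intro lipschitz_rules)
      have flat_cube: "flat z \<in> open_cube" if "z \<in> open_cube" for z
        using that by (simp add: open_cube_def forall_3 forall_2 flat_def)
      have q_U: "q x \<in> U" and \<phi>_q: "\<phi> (q x) = \<pi> (\<phi> x)" if "x \<in> U" for x
        using \<theta>[OF \<pi>_cube] \<phi>[OF that] by (auto simp: q_def)
      have q_\<Gamma>: "q x \<in> ?\<Gamma>" if "x \<in> U" for x
        using boundary[OF q_U[OF that]] \<phi>_q[OF that] by (simp add: \<pi>_def)
      have lip_q: "lipschitz U q"
        unfolding q_def by (intro lipschitz_compose[OF lip(2)] lipschitz_compose[OF lip_\<pi> lip(1)] UNIV_I \<pi>_cube) (use \<phi> in auto)

      have "W = U \<inter> q -` V'" using q_\<Gamma> by (auto simp: W_def V'(2))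
      then have W: "open W"
        using continuous_open_preimage[OF lipschitz_continuous_on[OF lip_q] U(1) V'(1)] by simp
      have W_sub: "W \<subseteq> U" "\<And>x. x \<in> W \<Longrightarrow> q x \<in> V" by (auto simp: W_def)
      have flat_Y: "flat (Y x) = \<psi> (q x)" for x
        by (simp add: flat_def Y_def vec_eq_iff forall_2)
      have Y_cube: "Y x \<in> open_cube" if "x \<in> W" for x
      proof -
        have "\<psi> (q x) \<in> open_cube" "\<phi> x \<in> open_cube" using that W_sub \<psi> \<phi> by auto
        then show ?thesis by (simp add: open_cube_def forall_3 forall_2 Y_def)
      qed
      have X_Y: "X (Y x) = x" and \<omega>_Y: "\<omega> (flat (Y x)) = q x" if "x \<in> W" for x
      proof -
        show *: "\<omega> (flat (Y x)) = q x" using \<psi> W_sub(2)[OF that] by (simp add: flat_Y)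
        have xU: "x \<in> U" using that W_sub(1) by blast
        have "vector [\<pi> (\<phi> x) $ 1, \<pi> (\<phi> x) $ 2, Y x $ 3] = \<phi> x"
          by (simp add: \<pi>_def Y_def vec_eq_iff forall_3)
        then show "X (Y x) = x" using \<phi>[OF xU] by (simp add: X_def * \<phi>_q[OF xU])
      qed
      \<comment> \<open>The image of \<open>W\<close> under \<open>Y\<close>. The condition makes
        the boundary point with interface coordinates \<open>flat z\<close> visible to the chart
        \<open>\<phi>\<close>.\<close>
      define T where "T = {z \<in> open_cube. \<omega> (flat z) \<in> U}"
      have lip_\<omega>: "lipschitz open_cube (\<lambda>z. \<omega> (flat z))"
        by (rule lipschitz_compose[OF lip2(2) lip_flat flat_cube])
      have "T = open_cube \<inter> (\<lambda>z. \<omega> (flat z)) -` U" by (auto simp: T_def)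
      then have open_T: "open T"
        using continuous_open_preimage[OF lipschitz_continuous_on[OF lip_\<omega>] open_open_cube U(1)] by simp
      have arg: "vector [\<phi> (\<omega> (flat z)) $ 1, \<phi> (\<omega> (flat z)) $ 2, z $ 3] \<in> (open_cube :: (real ^ 3) set)" if "z \<in> T" for z
      proof -
        have "\<phi> (\<omega> (flat z)) \<in> open_cube" "z \<in> open_cube" using that \<phi> by (auto simp: T_def)
        then show ?thesis by (simp add: open_cube_def forall_3)
      qed
      have lip_\<phi>\<omega>: "lipschitz T (\<lambda>z. \<phi> (\<omega> (flat z)))"
        by (rule lipschitz_compose[OF lip(1) lipschitz_subset[OF lip_\<omega>]]) (auto simp: T_def)
      have lip_X: "lipschitz T X"
        unfolding X_def by (rule lipschitz_compose[OF lip(2) _ arg]) (intro lipschitz_rules lip_\<phi>\<omega>)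
      have Y_X: "X z \<in> W \<and> Y (X z) = z" if z: "z \<in> T" for z
      proof -
        have zc: "z \<in> open_cube" and \<omega>U: "\<omega> (flat z) \<in> U" using z by (auto simp: T_def)
        have \<omega>V: "\<omega> (flat z) \<in> V" "\<psi> (\<omega> (flat z)) = flat z" using \<omega>[OF flat_cube[OF zc]] by auto
        then have "\<omega> (flat z) \<in> ?\<Gamma>" using V'(2) by blast
        then have third: "\<phi> (\<omega> (flat z)) $ 3 = 0" using boundary[OF \<omega>U] by simp
        have XU: "X z \<in> U" and \<phi>X: "\<phi> (X z) = vector [\<phi> (\<omega> (flat z)) $ 1, \<phi> (\<omega> (flat z)) $ 2, z $ 3]"
          using \<theta>[OF arg[OF z]] by (auto simp: X_def)
        have "\<pi> (\<phi> (X z)) = \<phi> (\<omega> (flat z))" using third by (simp add: \<pi>_def \<phi>X vec_eq_iff forall_3)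
        then have qX: "q (X z) = \<omega> (flat z)" using \<phi>[OF \<omega>U] by (simp add: q_def)
        have "Y (X z) = vector [flat z $ 1, flat z $ 2, z $ 3]" by (simp add: Y_def \<phi>X qX \<omega>V(2))
        also have "\<dots> = z" by (simp add: vec_eq_iff forall_3 flat_def)
        finally show ?thesis using XU \<omega>V(1) by (simp add: W_def qX)
      qed
      have Y_T: "Y x \<in> T" if "x \<in> W" for x
        using Y_cube[OF that] \<omega>_Y[OF that] q_U[of x] that W_sub(1) by (auto simp: T_def)
      have "open (Y ` W)"
      proof (rule open_image_homeomorphism[OF W lipschitz_continuous_on[OF lip_X] open_T])
        show "Y x \<in> T \<and> X (Y x) = x" if "x \<in> W" for x using that Y_T X_Y by blast
        show "Y (X z) = z" if "z \<in> T" for z using Y_X[OF that] by blast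
      qed
      then have "open (wedge_map ` Y ` W)"
        by (rule open_image_homeomorphism[where T = UNIV and g = wedge_inv])
          (simp_all add: lipschitz_continuous_on lipschitz_wedge)
      then have image: "open ((\<lambda>x. wedge_map (Y x)) ` W)" by (simp add: image_image)
      have lip_Y: "lipschitz W Y"
      proof -
        have "lipschitz W (\<lambda>x. \<psi> (q x))"
          by (rule lipschitz_compose[OF lip2(1) lipschitz_subset[OF lip_q W_sub(1)] W_sub(2)])
        then show ?thesis unfolding Y_def by (intro lipschitz_rules lipschitz_subset[OF lip(1) W_sub(1)])
      qed
      \<comment> \<open>On the boundary the projection \<open>q\<close> is the identity, so the
        first two coordinates of \<open>Y\<close> are those of \<open>\<psi>\<close> itself.\<close>
      have on_\<Gamma>: "x \<in> V \<and> Y x = vector [\<psi> x $ 1, \<psi> x $ 2, 0]" if "x \<in> W" "Y x $ 3 = 0" for x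
      proof -
        have xU: "x \<in> U" using that W_sub by blast
        have "\<phi> x $ 3 = 0" using that(2) by (simp add: Y_def)
        then have "\<pi> (\<phi> x) = \<phi> x" by (simp add: \<pi>_def vec_eq_iff forall_3)
        then have "q x = x" using \<phi>[OF xU] by (simp add: q_def)
        then show ?thesis using W_sub(2)[OF that(1)] \<open>\<phi> x $ 3 = 0\<close> by (simp add: Y_def)
      qed
      have "\<exists>\<alpha> \<beta> L a b. wedge_chart \<Omega> \<Gamma>t ?\<Gamma>n W \<alpha> \<beta> L a b"
      proof (rule wedge_chart_exists[OF _ _ W image, where \<mu> = "\<lambda>k. X (wedge_inv k)" and a = 0 and b = 0])
        show "open \<Omega>" "bounded \<Omega>" using \<Omega> by (auto simp: weak_lipschitz_domain_def bounded_domain_def)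
        show "lipschitz W (\<lambda>x. wedge_map (Y x))"
          by (rule lipschitz_compose[OF lipschitz_wedge(1) lip_Y UNIV_I])
        show "lipschitz ((\<lambda>x. wedge_map (Y x)) ` W) (\<lambda>k. X (wedge_inv k))"
          by (rule lipschitz_compose[OF lip_X lipschitz_wedge(2)]) (use Y_T in auto)
        fix x assume x: "x \<in> W"
        show "X (wedge_inv (wedge_map (Y x))) = x" using X_Y[OF x] by simp
        have "x \<in> \<Omega> \<longleftrightarrow> Y x $ 3 < 0" using inside[of x] W_sub x by (auto simp: Y_def)
        \<comment> \<open>One of the two folded coordinates is the third coordinate of
          \<open>Y x\<close> itself, and the other is that coordinate minus the modulus of the
          first.\<close>
        also have "\<dots> \<longleftrightarrow> Y x $ 3 - max (Y x $ 1) 0 < 0 \<and> Y x $ 3 + min (Y x $ 1) 0 < 0" by arith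
        finally show "x \<in> \<Omega> \<longleftrightarrow> wedge_map (Y x) $ 1 < 0 \<and> wedge_map (Y x) $ 3 < 0" by (simp add: wedge_map_def)
        show "x \<in> closure \<Gamma>t" if "wedge_map (Y x) $ 1 = 0" "wedge_map (Y x) $ 3 \<le> 0"
        proof -
          have "Y x $ 3 - max (Y x $ 1) 0 = 0" "Y x $ 3 + min (Y x $ 1) 0 \<le> 0"
            using that unfolding wedge_map_def vector_3 by auto
          then have *: "Y x $ 3 = 0" "Y x $ 1 \<le> 0" by arith+
          then have "x \<in> V" "\<psi> x $ 1 \<le> 0" using on_\<Gamma>[OF x *(1)] by auto
          then have "x \<in> \<Gamma>t \<or> x \<in> top_of_set ?\<Gamma> frontier_of \<Gamma>t" using part_t interface by force
          then show ?thesis using frontier_of closure_subset by blast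
        qed
        show "x \<in> closure ?\<Gamma>n" if "wedge_map (Y x) $ 1 \<le> 0" "wedge_map (Y x) $ 3 = 0"
        proof -
          have "Y x $ 3 - max (Y x $ 1) 0 \<le> 0" "Y x $ 3 + min (Y x $ 1) 0 = 0"
            using that unfolding wedge_map_def vector_3 by auto
          then have *: "Y x $ 3 = 0" "Y x $ 1 \<ge> 0" by arith+
          then have xV: "x \<in> V" and nonneg: "\<psi> x $ 1 \<ge> 0" using on_\<Gamma>[OF x *(1)] by auto
          have cube: "\<psi> x \<in> open_cube" "\<omega> (\<psi> x) = x" using \<psi>[OF xV] by auto
          have isCont: "isCont \<omega> (\<psi> x)"
            using lipschitz_continuous_on[OF lip2(2)] continuous_on_eq_continuous_at[OF open_open_cube] cube(1) by blast
          \<comment> \<open>Points of the interface are limits of points of the complementary part,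
            obtained by moving slightly in the direction in which the first coordinate of
            \<open>\<psi>\<close> increases.\<close>
          define y where "y n = \<psi> x + inverse (real (Suc n)) *\<^sub>R axis 1 1" for n
          have "y \<longlonglongrightarrow> \<psi> x + 0 *\<^sub>R axis 1 1"
            unfolding y_def by (intro tendsto_intros LIMSEQ_inverse_real_of_nat)
          then have lim: "y \<longlonglongrightarrow> \<psi> x" by simp
          have "(\<lambda>n. \<omega> (y n)) \<longlonglongrightarrow> x"
            using isCont_tendsto_compose[OF isCont lim] cube(2) by simp
          moreover have "\<forall>\<^sub>F n in sequentially. \<omega> (y n) \<in> closure ?\<Gamma>n"
            using topological_tendstoD[OF lim open_open_cube cube(1)]
          proof eventually_elim
            case (elim n)
            have "\<omega> (y n) \<in> V" "\<psi> (\<omega> (y n)) = y n" using \<omega>[OF elim] by auto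
            moreover have "y n $ 1 > 0" using nonneg by (simp add: y_def axis_def add_nonneg_pos)
            ultimately have "\<omega> (y n) \<in> ?\<Gamma>n" using part_n[of "\<omega> (y n)"] V'(2) by auto
            then show ?case using closure_subset by (rule rev_subsetD)
          qed
          ultimately show ?thesis
            by (intro Lim_in_closed_set[OF closed_closure _ trivial_limit_sequentially, of "\<lambda>n. \<omega> (y n)"])
        qed
      qed
      moreover have "p \<in> W"
      proof -
        have "\<pi> 0 = 0" by (simp add: \<pi>_def vec_eq_iff forall_3)
        then have "q p = p" using \<phi>[OF U(2)] by (simp add: q_def \<phi>p)
        then show ?thesis using U(2) V(2) by (simp add: W_def)
      qed
      ultimately show ?thesis by blast
    qed
  qed
qed

lemma wedge_chart_cover:
  assumes \<Omega>: "weak_lipschitz_domain \<Omega>" and part: "weak_lipschitz_part (frontier \<Omega>) \<Gamma>t" and p: "p \<in> closure \<Omega>"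
  shows "\<exists>W. p \<in> W \<and> (\<exists>\<alpha> \<beta> L a b. wedge_chart \<Omega> \<Gamma>t (frontier \<Omega> - closure \<Gamma>t) W \<alpha> \<beta> L a b)"
proof -
  have open_part: "openin (top_of_set (frontier \<Omega>)) \<Gamma>t" using part by (simp add: weak_lipschitz_part_def)
  have "open \<Omega>" "bounded \<Omega>" using \<Omega> by (auto simp: weak_lipschitz_domain_def bounded_domain_def)
  consider "p \<in> \<Omega>" | "p \<in> \<Gamma>t" | "p \<in> frontier \<Omega> - closure \<Gamma>t" | "p \<in> frontier \<Omega>" "p \<in> closure \<Gamma>t" "p \<notin> \<Gamma>t"
    using p \<open>open \<Omega>\<close> by (auto simp: frontier_def interior_open)
  then show ?thesis
  proof cases
    case 1
    from conjI[OF this interior_wedge_chart[OF \<open>open \<Omega>\<close> \<open>bounded \<Omega>\<close>]] show ?thesis by (rule exI)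
  next
    case 2
    from face_t_wedge_chart[OF \<Omega> open_part this] show ?thesis .
  next
    case 3
    from face_n_wedge_chart[OF \<Omega> this] show ?thesis .
  next
    case 4
    have "\<Gamma>t \<subseteq> frontier \<Omega>" using openin_imp_subset[OF open_part] .
    then have "frontier \<Omega> \<inter> \<Gamma>t = \<Gamma>t" by blast
    then have "top_of_set (frontier \<Omega>) closure_of \<Gamma>t = frontier \<Omega> \<inter> closure \<Gamma>t"
      unfolding closure_of_subtopology euclidean_closure_of by simp
    then have "p \<in> top_of_set (frontier \<Omega>) frontier_of \<Gamma>t"
      unfolding frontier_of_def using 4 interior_of_subset[of "top_of_set (frontier \<Omega>)" \<Gamma>t] by blast
    from edge_wedge_chart[OF \<Omega> part this] show ?thesis .
  qed
qed

section \<open>The div-curl lemma\<close>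

lemma L2_norm_mono:
  assumes f: "f \<in> L2 \<Omega>" and g: "g \<in> L2 \<Omega>" and \<Omega>: "\<Omega> \<in> sets lebesgue" and le: "\<And>x. x \<in> \<Omega> \<Longrightarrow> norm (f x) \<le> norm (g x)"
  shows "L2_norm \<Omega> f \<le> L2_norm \<Omega> g"
  unfolding L2_norm_def
proof (intro real_sqrt_le_mono integral_mono)
  show "integrable (lebesgue_on \<Omega>) (\<lambda>x. (norm (f x))\<^sup>2)" "integrable (lebesgue_on \<Omega>) (\<lambda>x. (norm (g x))\<^sup>2)"
    using f g by (simp_all add: L2_def)
  fix x assume "x \<in> space (lebesgue_on \<Omega>)"
  then have "x \<in> \<Omega>" using \<Omega> by (simp add: space_restrict_space)
  from le[OF this] show "(norm (f x))\<^sup>2 \<le> (norm (g x))\<^sup>2" by (rule power_mono) simp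
qed

lemma C1_away_mult:
  fixes \<omega> :: "real ^ 3 \<Rightarrow> real"
  assumes "Ck (Suc 0) \<omega>" "h \<in> C1_away \<Sigma>"
  shows "(\<lambda>x. \<omega> x *\<^sub>R h x) \<in> C1_away \<Sigma>" "supp (\<lambda>x. \<omega> x *\<^sub>R h x) \<subseteq> supp h"
proof -
  show *: "supp (\<lambda>x. \<omega> x *\<^sub>R h x) \<subseteq> supp h"
    by (rule supp_subset[OF closed_supp]) (simp add: supp_zero[of _ h])
  have h: "Ck (Suc 0) h" "bounded (supp h)" "supp h \<inter> closure \<Sigma> = {}"
    using assms(2) unfolding C1_away_def by blast+
  show "(\<lambda>x. \<omega> x *\<^sub>R h x) \<in> C1_away \<Sigma>"
    unfolding C1_away_def using bounded_subset[OF h(2) *] * h(3) Ck_scaleR[OF assms(1) h(1)] by blast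
qed

lemma frechet_derivative_bound_on_compact:
  fixes f :: "'a::euclidean_space \<Rightarrow> 'b::real_normed_vector"
  assumes f: "Ck (Suc 0) f" and K: "compact K"
  obtains M where "0 \<le> M" "\<And>x v. x \<in> K \<Longrightarrow> norm (frechet_derivative f (at x) v) \<le> M * norm v"
proof -
  have "continuous_on (K \<times> cball 0 1) (\<lambda>z. frechet_derivative f (at (fst z)) (snd z))"
    by (intro continuous_on_frechet_derivative[OF f] continuous_intros)
  then have "compact ((\<lambda>z. frechet_derivative f (at (fst z)) (snd z)) ` (K \<times> cball 0 1))"
    by (rule compact_continuous_image) (intro compact_Times K compact_cball)
  from compact_imp_bounded[OF this]
  obtain M where M: "0 < M" "\<forall>w\<in>(\<lambda>z. frechet_derivative f (at (fst z)) (snd z)) ` (K \<times> cball 0 1). norm w \<le> M"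
    unfolding bounded_pos by (elim exE conjE) (rule that)
  have "norm (frechet_derivative f (at x) v) \<le> M * norm v" if "x \<in> K" for x v
  proof -
    have lin: "linear (frechet_derivative f (at x))"
      using has_derivative_linear[OF Ck_Suc_has_derivative[OF f]] .
    let ?u = "inverse (norm v) *\<^sub>R v"
    have "(x, ?u) \<in> K \<times> cball 0 1" using that by (cases "v = 0") simp_all
    from bspec[OF M(2) imageI[OF this]] have u: "norm (frechet_derivative f (at x) ?u) \<le> M" by simp
    have "frechet_derivative f (at x) v = norm v *\<^sub>R frechet_derivative f (at x) ?u"
      by (cases "v = 0") (simp_all only: linear_cmul[OF lin] linear_0[OF lin], simp_all)
    then have "norm (frechet_derivative f (at x) v) = norm v * norm (frechet_derivative f (at x) ?u)" by simp
    also have "\<dots> \<le> norm v * M" by (rule mult_left_mono[OF u]) simp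
    finally show ?thesis by (simp add: mult.commute)
  qed
  with M(1) that[of M] show ?thesis by simp
qed

text \<open>The product rule for the divergence, with the cutoff and its derivative bounded on the
  compact closure of \<Omega>. It keeps the norm of test fields under control when they are
  localized.\<close>

lemma multiplier_bound:
  fixes \<omega> :: "real ^ 3 \<Rightarrow> real"
  assumes \<Omega>: "open \<Omega>" "bounded \<Omega>" and \<omega>: "Ck (Suc 0) \<omega>"
  obtains C where "0 < C" "\<And>h. h \<in> C1_away \<Sigma> \<Longrightarrow>
    L2_norm \<Omega> (\<lambda>x. \<omega> x *\<^sub>R h x) + L2_norm \<Omega> (divergence (\<lambda>x. \<omega> x *\<^sub>R h x))
      \<le> C * (L2_norm \<Omega> h + L2_norm \<Omega> (divergence h))"
proof -
  have K: "compact (closure \<Omega>)" using \<Omega>(2) by (simp add: compact_closure)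
  have "compact (\<omega> ` closure \<Omega>)"
    using K by (intro compact_continuous_image continuous_on_subset[OF Ck_imp_continuous[OF \<omega>]]) auto
  then obtain A where A: "0 < A" "\<And>x. x \<in> closure \<Omega> \<Longrightarrow> \<bar>\<omega> x\<bar> \<le> A"
    using compact_imp_bounded[of "\<omega> ` closure \<Omega>"] unfolding bounded_pos by auto
  obtain M where M: "0 \<le> M" "\<And>x v. x \<in> closure \<Omega> \<Longrightarrow> norm (frechet_derivative \<omega> (at x) v) \<le> M * norm v"
    using frechet_derivative_bound_on_compact[OF \<omega> K] by blast
  have meas: "\<Omega> \<in> lmeasurable" using \<Omega> by (rule open_bounded_lmeasurable)
  then have sets: "\<Omega> \<in> sets lebesgue" by (rule fmeasurableD)
  show ?thesis
  proof (rule that[of "A + M"])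
    show "0 < A + M" using A(1) M(1) by simp
    fix h assume h: "h \<in> C1_away \<Sigma>"
    have Ckh: "Ck (Suc 0) h" using h by (rule C1_away_Ck)
    have L2h: "h \<in> L2 \<Omega>" "divergence h \<in> L2 \<Omega>" using C1_away_L2[OF \<Omega> h] by auto
    have mult: "(\<lambda>x. \<omega> x *\<^sub>R h x) \<in> L2 \<Omega>" using C1_away_L2(1)[OF \<Omega> C1_away_mult(1)[OF \<omega> h]] .
    let ?d = "\<lambda>x. frechet_derivative \<omega> (at x) (h x)" and ?e = "\<lambda>x. \<omega> x * divergence h x"
    have d: "?d \<in> L2 \<Omega>"
      by (intro continuous_L2[OF meas \<Omega>(2)] continuous_on_frechet_derivative[OF \<omega>] continuous_on_id Ck_imp_continuous[OF Ckh])
    have e: "?e \<in> L2 \<Omega>"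
      by (intro continuous_L2[OF meas \<Omega>(2)] continuous_intros Ck_imp_continuous[OF \<omega>] continuous_on_divergence[OF Ckh])
    have x: "x \<in> closure \<Omega>" if "x \<in> \<Omega>" for x using that closure_subset by blast
    have "L2_norm \<Omega> (\<lambda>x. \<omega> x *\<^sub>R h x) \<le> L2_norm \<Omega> (\<lambda>x. A *\<^sub>R h x)"
      by (intro L2_norm_mono mult L2_scaleR L2h sets) (simp add: mult_right_mono[OF order_trans[OF A(2) abs_ge_self]] x)
    also have "\<dots> = A * L2_norm \<Omega> h" using A(1) by (simp add: L2_norm_scaleR)
    finally have 1: "L2_norm \<Omega> (\<lambda>x. \<omega> x *\<^sub>R h x) \<le> A * L2_norm \<Omega> h" .
    have "L2_norm \<Omega> ?d \<le> L2_norm \<Omega> (\<lambda>x. M *\<^sub>R h x)"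
      by (intro L2_norm_mono d L2_scaleR L2h sets) (use M x in auto)
    then have 2: "L2_norm \<Omega> ?d \<le> M * L2_norm \<Omega> h" using M(1) by (simp add: L2_norm_scaleR)
    have "L2_norm \<Omega> ?e \<le> L2_norm \<Omega> (\<lambda>x. A *\<^sub>R divergence h x)"
      by (intro L2_norm_mono e L2_scaleR L2h sets) (simp add: abs_mult mult_right_mono[OF order_trans[OF A(2) abs_ge_self]] x)
    then have 3: "L2_norm \<Omega> ?e \<le> A * L2_norm \<Omega> (divergence h)" using A(1) by (simp only: L2_norm_scaleR abs_of_pos)
    have "divergence (\<lambda>x. \<omega> x *\<^sub>R h x) = (\<lambda>x. ?d x + ?e x)"
      using \<omega> Ckh by (intro ext divergence_scaleR) simp_all
    then have "L2_norm \<Omega> (divergence (\<lambda>x. \<omega> x *\<^sub>R h x)) \<le> L2_norm \<Omega> ?d + L2_norm \<Omega> ?e"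
      using L2_norm_triangle[OF d e] by simp
    then have "L2_norm \<Omega> (\<lambda>x. \<omega> x *\<^sub>R h x) + L2_norm \<Omega> (divergence (\<lambda>x. \<omega> x *\<^sub>R h x))
      \<le> A * L2_norm \<Omega> h + (M * L2_norm \<Omega> h + A * L2_norm \<Omega> (divergence h))"
      using 1 2 3 by linarith
    also have "\<dots> \<le> A * L2_norm \<Omega> h + (M * L2_norm \<Omega> h + A * L2_norm \<Omega> (divergence h)) + M * L2_norm \<Omega> (divergence h)"
      using M(1) by simp
    also have "\<dots> = (A + M) * (L2_norm \<Omega> h + L2_norm \<Omega> (divergence h))" by (simp add: algebra_simps)
    finally show "L2_norm \<Omega> (\<lambda>x. \<omega> x *\<^sub>R h x) + L2_norm \<Omega> (divergence (\<lambda>x. \<omega> x *\<^sub>R h x))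
      \<le> (A + M) * (L2_norm \<Omega> h + L2_norm \<Omega> (divergence h))" .
  qed
qed

text \<open>Induction over the balls in place of a partition of unity: a test field is split by one
  plateau function, the first piece is supported in the double ball, and the second vanishes on the
  ball and falls under the induction hypothesis. \<open>\<epsilon>\<close> is generalized because
  each splitting costs a constant.\<close>

lemma ball_cover_compactness:
  fixes P :: "(real ^ 3) set" and r :: "real ^ 3 \<Rightarrow> real" and \<phi> :: "nat \<Rightarrow> real ^ 3 \<Rightarrow> real ^ 3"
  assumes \<Omega>: "open \<Omega>" "bounded \<Omega>" and \<phi>: "\<And>n. \<phi> n \<in> L2 \<Omega>"
    and P: "finite P" "\<And>p. p \<in> P \<Longrightarrow> 0 < r p"
    and "local": "\<And>p \<epsilon>. p \<in> P \<Longrightarrow> 0 < \<epsilon> \<Longrightarrow> \<exists>n0. \<forall>n\<ge>n0. \<forall>m\<ge>n0. \<forall>h\<in>C1_away \<Sigma>. supp h \<subseteq> cball p (2 * r p) \<longrightarrow>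
      \<bar>L2_inner \<Omega> (\<lambda>x. \<phi> n x - \<phi> m x) h\<bar> \<le> \<epsilon> * (L2_norm \<Omega> h + L2_norm \<Omega> (divergence h))"
    and \<epsilon>: "0 < \<epsilon>"
  shows "\<exists>n0. \<forall>n\<ge>n0. \<forall>m\<ge>n0. \<forall>h\<in>C1_away \<Sigma>. (\<forall>x\<in>\<Omega>. (\<forall>p\<in>P. x \<notin> ball p (r p)) \<longrightarrow> h x = 0) \<longrightarrow>
      \<bar>L2_inner \<Omega> (\<lambda>x. \<phi> n x - \<phi> m x) h\<bar> \<le> \<epsilon> * (L2_norm \<Omega> h + L2_norm \<Omega> (divergence h))"
  using P "local" \<epsilon>
proof (induction P arbitrary: \<epsilon> rule: finite_induct)
  case empty
  have sets: "\<Omega> \<in> sets lebesgue" using open_bounded_lmeasurable[OF \<Omega>] by (rule fmeasurableD)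
  have "L2_inner \<Omega> (\<lambda>x. \<phi> n x - \<phi> m x) h = 0" if "\<forall>x\<in>\<Omega>. h x = 0" for n m h
  proof -
    have "L2_inner \<Omega> (\<lambda>x. \<phi> n x - \<phi> m x) h = (LINT x|lebesgue_on \<Omega>. 0)"
      unfolding L2_inner_def by (rule Bochner_Integration.integral_cong) (use that sets in \<open>auto simp: space_restrict_space\<close>)
    then show ?thesis by simp
  qed
  then show ?case using empty.prems(3) by simp
next
  case (insert p P)
  let ?\<omega> = "plateau p (r p)"
  let ?N = "\<lambda>h. L2_norm \<Omega> h + L2_norm \<Omega> (divergence h)"
  have rp: "0 < r p" using insert.prems(1) by simp
  have \<omega>: "Ck (Suc 0) ?\<omega>" "Ck (Suc 0) (\<lambda>x. 1 - ?\<omega> x)"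
    by (intro Ck_plateau Ck_diff Ck_const)+
  obtain C where C: "0 < C" "\<And>h. h \<in> C1_away \<Sigma> \<Longrightarrow> ?N (\<lambda>x. ?\<omega> x *\<^sub>R h x) \<le> C * ?N h"
    using multiplier_bound[OF \<Omega> \<omega>(1), of \<Sigma>] by blast
  obtain D where D: "0 < D" "\<And>h. h \<in> C1_away \<Sigma> \<Longrightarrow> ?N (\<lambda>x. (1 - ?\<omega> x) *\<^sub>R h x) \<le> D * ?N h"
    using multiplier_bound[OF \<Omega> \<omega>(2), of \<Sigma>] by blast
  have "0 < \<epsilon> / (2 * C)" "0 < \<epsilon> / (2 * D)" using insert.prems(3) C(1) D(1) by auto
  obtain n1 where n1: "\<forall>n\<ge>n1. \<forall>m\<ge>n1. \<forall>h\<in>C1_away \<Sigma>. supp h \<subseteq> cball p (2 * r p) \<longrightarrow>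
      \<bar>L2_inner \<Omega> (\<lambda>x. \<phi> n x - \<phi> m x) h\<bar> \<le> \<epsilon> / (2 * C) * ?N h"
    using insert.prems(2)[OF insertI1 \<open>0 < \<epsilon> / (2 * C)\<close>] by (elim exE) (rule that)
  have "\<exists>n2. \<forall>n\<ge>n2. \<forall>m\<ge>n2. \<forall>h\<in>C1_away \<Sigma>. (\<forall>x\<in>\<Omega>. (\<forall>p\<in>P. x \<notin> ball p (r p)) \<longrightarrow> h x = 0) \<longrightarrow>
      \<bar>L2_inner \<Omega> (\<lambda>x. \<phi> n x - \<phi> m x) h\<bar> \<le> \<epsilon> / (2 * D) * ?N h"
    by (rule insert.IH[OF _ _ \<open>0 < \<epsilon> / (2 * D)\<close>]) (use insert.prems(1,2) in \<open>simp_all only: insertI2\<close>)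
  then obtain n2 where n2: "\<forall>n\<ge>n2. \<forall>m\<ge>n2. \<forall>h\<in>C1_away \<Sigma>. (\<forall>x\<in>\<Omega>. (\<forall>p\<in>P. x \<notin> ball p (r p)) \<longrightarrow> h x = 0) \<longrightarrow>
      \<bar>L2_inner \<Omega> (\<lambda>x. \<phi> n x - \<phi> m x) h\<bar> \<le> \<epsilon> / (2 * D) * ?N h"
    by (elim exE) (rule that)
  show ?case
  proof (intro exI[of _ "max n1 n2"] allI ballI impI)
    fix n m h assume nm: "max n1 n2 \<le> n" "max n1 n2 \<le> m" and h: "h \<in> C1_away \<Sigma>"
      and vanish: "\<forall>x\<in>\<Omega>. (\<forall>p\<in>insert p P. x \<notin> ball p (r p)) \<longrightarrow> h x = 0"
    have nm: "n1 \<le> n" "n1 \<le> m" "n2 \<le> n" "n2 \<le> m" using nm by linarith+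
    let ?f = "\<lambda>x. ?\<omega> x *\<^sub>R h x" and ?g = "\<lambda>x. (1 - ?\<omega> x) *\<^sub>R h x" and ?u = "\<lambda>x. \<phi> n x - \<phi> m x"
    have f: "?f \<in> C1_away \<Sigma>" and g: "?g \<in> C1_away \<Sigma>" using C1_away_mult(1)[OF _ h] \<omega> by blast+
    have "supp ?f \<subseteq> cball p (2 * r p)"
    proof (rule supp_subset[OF closed_cball])
      fix x assume "x \<notin> cball p (2 * r p)"
      then have "2 * r p \<le> dist p x" by simp
      from plateau_zero[OF rp this] show "?f x = 0" by simp
    qed
    then have "\<bar>L2_inner \<Omega> ?u ?f\<bar> \<le> \<epsilon> / (2 * C) * ?N ?f"
      by (rule n1[rule_format, OF nm(1,2) f])
    also have "\<dots> \<le> \<epsilon> / (2 * C) * (C * ?N h)"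
      using C(2)[OF h] \<open>0 < \<epsilon> / (2 * C)\<close> by (intro mult_left_mono) auto
    also have "\<dots> = \<epsilon> / 2 * ?N h" using C(1) by simp
    finally have 1: "\<bar>L2_inner \<Omega> ?u ?f\<bar> \<le> \<epsilon> / 2 * ?N h" .
    have vanish_g: "\<forall>x\<in>\<Omega>. (\<forall>p\<in>P. x \<notin> ball p (r p)) \<longrightarrow> ?g x = 0"
    proof (intro ballI impI)
      fix x assume x: "x \<in> \<Omega>" "\<forall>p\<in>P. x \<notin> ball p (r p)"
      show "?g x = 0"
      proof (cases "x \<in> ball p (r p)")
        case True
        then have "dist p x \<le> r p" by simp
        from plateau_one[OF rp this] show ?thesis by simp
      next
        case False
        then have "h x = 0" using vanish x by simp
        then show ?thesis by simp
      qed
    qed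
    have "\<bar>L2_inner \<Omega> ?u ?g\<bar> \<le> \<epsilon> / (2 * D) * ?N ?g"
      by (rule bspec[OF n2[THEN spec, THEN mp, OF nm(3), THEN spec, THEN mp, OF nm(4)] g, THEN mp, OF vanish_g])
    also have "\<dots> \<le> \<epsilon> / (2 * D) * (D * ?N h)"
      using D(2)[OF h] \<open>0 < \<epsilon> / (2 * D)\<close> by (intro mult_left_mono) auto
    also have "\<dots> = \<epsilon> / 2 * ?N h" using D(1) by simp
    finally have 2: "\<bar>L2_inner \<Omega> ?u ?g\<bar> \<le> \<epsilon> / 2 * ?N h" .
    have "h = (\<lambda>x. ?f x + ?g x)" by (simp add: scaleR_left_diff_distrib)
    then have "L2_inner \<Omega> ?u h = L2_inner \<Omega> ?u (\<lambda>x. ?f x + ?g x)" by (rule arg_cong)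
    also have "\<dots> = L2_inner \<Omega> ?u ?f + L2_inner \<Omega> ?u ?g"
      by (rule L2_inner_add_right[OF C1_away_L2(1)[OF \<Omega> f] C1_away_L2(1)[OF \<Omega> g] L2_diff[OF \<phi> \<phi>]])
    finally have "\<bar>L2_inner \<Omega> ?u h\<bar> \<le> \<epsilon> / 2 * ?N h + \<epsilon> / 2 * ?N h" using 1 2 by linarith
    then show "\<bar>L2_inner \<Omega> ?u h\<bar> \<le> \<epsilon> * ?N h" by (simp add: algebra_simps)
  qed
qed

lemma global_compactness:
  assumes \<Omega>: "weak_lipschitz_domain \<Omega>" and part: "weak_lipschitz_part (frontier \<Omega>) \<Gamma>t"
    and \<phi>: "\<And>n. \<phi> n \<in> C1_away \<Gamma>t" and weak: "L2_weakly_converges \<Omega> \<phi> E"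
    and C: "\<And>n. L2_norm \<Omega> (\<phi> n) \<le> C" "\<And>n. L2_norm \<Omega> (curl (\<phi> n)) \<le> C" and \<epsilon>: "0 < \<epsilon>"
  shows "\<exists>n0. \<forall>n\<ge>n0. \<forall>m\<ge>n0. \<forall>h\<in>C1_away (frontier \<Omega> - closure \<Gamma>t).
    \<bar>L2_inner \<Omega> (\<lambda>x. \<phi> n x - \<phi> m x) h\<bar> \<le> \<epsilon> * (L2_norm \<Omega> h + L2_norm \<Omega> (divergence h))"
proof -
  let ?\<Gamma>n = "frontier \<Omega> - closure \<Gamma>t"
  have op: "open \<Omega>" "bounded \<Omega>" using \<Omega> by (auto simp: weak_lipschitz_domain_def bounded_domain_def)
  define Q where "Q p r \<longleftrightarrow> (\<forall>\<epsilon>>0. \<exists>n0. \<forall>n\<ge>n0. \<forall>m\<ge>n0. \<forall>h\<in>C1_away ?\<Gamma>n. supp h \<subseteq> cball p (2 * r) \<longrightarrow>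
      \<bar>L2_inner \<Omega> (\<lambda>x. \<phi> n x - \<phi> m x) h\<bar> \<le> \<epsilon> * (L2_norm \<Omega> h + L2_norm \<Omega> (divergence h)))" for p r
  have "\<exists>r>0. Q p r" if p: "p \<in> closure \<Omega>" for p
  proof -
    from wedge_chart_cover[OF \<Omega> part p] show ?thesis
    proof (elim exE conjE)
      fix W \<alpha> \<beta> L a b assume W: "p \<in> W" and "wedge_chart \<Omega> \<Gamma>t ?\<Gamma>n W \<alpha> \<beta> L a b"
      then interpret wedge_chart \<Omega> \<Gamma>t ?\<Gamma>n W \<alpha> \<beta> L a b by simp
      \<comment> \<open>The covering ball gets radius \<open>s / 2\<close>, because the plateau of
        radius \<open>r\<close> extends to \<open>2 * r\<close>.\<close>
      obtain s where s: "0 < s" "cball p s \<subseteq> W" using open_W W by (meson open_contains_cball)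
      show ?thesis
        unfolding Q_def
      proof (intro exI[of _ "s / 2"] conjI allI impI)
        show "0 < s / 2" using s by simp
        fix \<epsilon> :: real assume "0 < \<epsilon>"
        have "cball p (2 * (s / 2)) \<subseteq> W" using s(2) by simp
        from chart_compactness[OF \<phi> weak C compact_cball this \<open>0 < \<epsilon>\<close>]
        show "\<exists>n0. \<forall>n\<ge>n0. \<forall>m\<ge>n0. \<forall>h\<in>C1_away ?\<Gamma>n. supp h \<subseteq> cball p (2 * (s / 2)) \<longrightarrow>
          \<bar>L2_inner \<Omega> (\<lambda>x. \<phi> n x - \<phi> m x) h\<bar> \<le> \<epsilon> * (L2_norm \<Omega> h + L2_norm \<Omega> (divergence h))" .
      qed
    qed
  qed
  then obtain r where r: "\<And>p. p \<in> closure \<Omega> \<Longrightarrow> 0 < r p" and Q: "\<And>p. p \<in> closure \<Omega> \<Longrightarrow> Q p (r p)"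
    by metis
  have cpt: "compact (closure \<Omega>)" using op(2) by (simp add: compact_closure)
  have cover: "closure \<Omega> \<subseteq> (\<Union>p\<in>closure \<Omega>. ball p (r p))" using r by auto
  obtain P where P: "P \<subseteq> closure \<Omega>" "finite P" "closure \<Omega> \<subseteq> (\<Union>p\<in>P. ball p (r p))"
    by (rule compactE_image[OF cpt open_ball cover])
  have "\<exists>n0. \<forall>n\<ge>n0. \<forall>m\<ge>n0. \<forall>h\<in>C1_away ?\<Gamma>n. (\<forall>x\<in>\<Omega>. (\<forall>p\<in>P. x \<notin> ball p (r p)) \<longrightarrow> h x = 0) \<longrightarrow>
      \<bar>L2_inner \<Omega> (\<lambda>x. \<phi> n x - \<phi> m x) h\<bar> \<le> \<epsilon> * (L2_norm \<Omega> h + L2_norm \<Omega> (divergence h))"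
  proof (rule ball_cover_compactness[OF op C1_away_L2(1)[OF op \<phi>] P(2) _ _ \<epsilon>])
    show "0 < r p" if "p \<in> P" for p using r that P(1) by blast
    show "\<exists>n0. \<forall>n\<ge>n0. \<forall>m\<ge>n0. \<forall>h\<in>C1_away ?\<Gamma>n. supp h \<subseteq> cball p (2 * r p) \<longrightarrow>
      \<bar>L2_inner \<Omega> (\<lambda>x. \<phi> n x - \<phi> m x) h\<bar> \<le> \<epsilon> * (L2_norm \<Omega> h + L2_norm \<Omega> (divergence h))" if "p \<in> P" "0 < \<epsilon>" for p \<epsilon>
      using Q[OF subsetD[OF P(1) that(1)]] that(2) unfolding Q_def by simp
  qed
  moreover have "\<forall>x\<in>\<Omega>. (\<forall>p\<in>P. x \<notin> ball p (r p)) \<longrightarrow> h x = 0" for h :: "real ^ 3 \<Rightarrow> real ^ 3"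
    using P(3) closure_subset[of \<Omega>] by blast
  ultimately show ?thesis by simp
qed

section \<open>Approximation of the given fields and passage to the limit\<close>

lemma C_inf_bd_C1_away: "\<phi> \<in> C_inf_bd \<Sigma> \<Longrightarrow> \<phi> \<in> C1_away \<Sigma>"
proof -
  assume \<phi>: "\<phi> \<in> C_inf_bd \<Sigma>"
  then have c: "\<phi> \<in> C_c_inf UNIV" by (simp add: C_inf_bd_def)
  obtain \<delta> where \<delta>: "0 < \<delta>" "\<forall>x\<in>supp \<phi>. \<forall>y\<in>\<Sigma>. \<delta> \<le> dist x y"
    using \<phi> unfolding C_inf_bd_def by blast
  have "supp \<phi> \<inter> closure \<Sigma> = {}"
  proof (intro equals0I)
    fix x assume x: "x \<in> supp \<phi> \<inter> closure \<Sigma>"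
    then obtain y where "y \<in> \<Sigma>" "dist y x < \<delta>" using \<delta>(1) closure_approachable by blast
    then show False using \<delta>(2) x by (force simp: dist_commute)
  qed
  then show ?thesis
    unfolding C1_away_def using C_c_inf_Ck[OF c, of "Suc 0"] C_c_inf_supp(2)[OF c] by blast
qed

text \<open>\<open>R_norm\<close> of the difference involves an arbitrary representative of the weak
  curl of the difference. Uniqueness identifies it almost everywhere with the difference of the
  curls, so both norms are bounded separately.\<close>

lemma R_bd_approximation:
  assumes \<Omega>: "open \<Omega>" "bounded \<Omega>" and E: "E \<in> R_bd \<Omega> \<Sigma>" and \<epsilon>: "0 < \<epsilon>"
  shows "\<exists>\<phi>\<in>C1_away \<Sigma>. L2_norm \<Omega> (\<lambda>x. E x - \<phi> x) < \<epsilon> \<and> L2_norm \<Omega> (\<lambda>x. weak_curl \<Omega> E x - curl \<phi> x) < \<epsilon>"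
proof -
  obtain \<phi> where \<phi>: "\<phi> \<in> C_inf_bd \<Sigma>" and less: "R_norm \<Omega> (\<lambda>x. E x - \<phi> x) < \<epsilon>"
    using E \<epsilon> unfolding R_bd_def by blast
  have \<phi>1: "\<phi> \<in> C1_away \<Sigma>" using \<phi> by (rule C_inf_bd_C1_away)
  have R: "E \<in> R_space \<Omega>" using E by (simp add: R_bd_def)
  then have L: "E \<in> L2 \<Omega>" by (simp add: R_space_def)
  have c: "is_weak_curl \<Omega> (\<lambda>x. E x - \<phi> x) (\<lambda>x. weak_curl \<Omega> E x - curl \<phi> x)"
    by (intro is_weak_curl_diff[OF \<Omega> L] C1_away_L2[OF \<Omega> \<phi>1] is_weak_curl_weak_curl[OF R] is_weak_curl_curl[OF \<Omega> C1_away_Ck[OF \<phi>1]])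
  then have "(\<lambda>x. E x - \<phi> x) \<in> R_space \<Omega>"
    using L2_diff[OF L C1_away_L2(1)[OF \<Omega> \<phi>1]] unfolding R_space_def by blast
  from is_weak_curl_weak_curl[OF this] have w: "is_weak_curl \<Omega> (\<lambda>x. E x - \<phi> x) (weak_curl \<Omega> (\<lambda>x. E x - \<phi> x))" .
  have "L2_norm \<Omega> (weak_curl \<Omega> (\<lambda>x. E x - \<phi> x)) = L2_norm \<Omega> (\<lambda>x. weak_curl \<Omega> E x - curl \<phi> x)"
    by (rule L2_norm_cong_AE[OF _ _ is_weak_curl_unique[OF \<Omega> w c]]) (use c w in \<open>simp_all add: is_weak_curl_def\<close>)
  then have "L2_norm \<Omega> (\<lambda>x. E x - \<phi> x) < \<epsilon>" "L2_norm \<Omega> (\<lambda>x. weak_curl \<Omega> E x - curl \<phi> x) < \<epsilon>"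
    using le_less_trans[OF real_sqrt_sum_squares_ge1 less[unfolded R_norm_def]]
      le_less_trans[OF real_sqrt_sum_squares_ge2 less[unfolded R_norm_def]] by simp_all
  with \<phi>1 show ?thesis by blast
qed

lemma D_bd_approximation:
  assumes \<Omega>: "open \<Omega>" "bounded \<Omega>" and H: "H \<in> D_bd \<Omega> \<Sigma>" and \<epsilon>: "0 < \<epsilon>"
  shows "\<exists>\<eta>\<in>C1_away \<Sigma>. L2_norm \<Omega> (\<lambda>x. H x - \<eta> x) < \<epsilon> \<and> L2_norm \<Omega> (\<lambda>x. weak_div \<Omega> H x - divergence \<eta> x) < \<epsilon>"
proof -
  obtain \<eta> where \<eta>: "\<eta> \<in> C_inf_bd \<Sigma>" and less: "D_norm \<Omega> (\<lambda>x. H x - \<eta> x) < \<epsilon>"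
    using H \<epsilon> unfolding D_bd_def by blast
  have \<eta>1: "\<eta> \<in> C1_away \<Sigma>" using \<eta> by (rule C_inf_bd_C1_away)
  have D: "H \<in> D_space \<Omega>" using H by (simp add: D_bd_def)
  then have L: "H \<in> L2 \<Omega>" by (simp add: D_space_def)
  have c: "is_weak_div \<Omega> (\<lambda>x. H x - \<eta> x) (\<lambda>x. weak_div \<Omega> H x - divergence \<eta> x)"
    by (intro is_weak_div_diff[OF \<Omega> L] C1_away_L2[OF \<Omega> \<eta>1] is_weak_div_weak_div[OF D] is_weak_div_divergence[OF \<Omega> C1_away_Ck[OF \<eta>1]])
  then have "(\<lambda>x. H x - \<eta> x) \<in> D_space \<Omega>"
    using L2_diff[OF L C1_away_L2(1)[OF \<Omega> \<eta>1]] unfolding D_space_def by blast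
  from is_weak_div_weak_div[OF this] have w: "is_weak_div \<Omega> (\<lambda>x. H x - \<eta> x) (weak_div \<Omega> (\<lambda>x. H x - \<eta> x))" .
  have "L2_norm \<Omega> (weak_div \<Omega> (\<lambda>x. H x - \<eta> x)) = L2_norm \<Omega> (\<lambda>x. weak_div \<Omega> H x - divergence \<eta> x)"
    by (rule L2_norm_cong_AE[OF _ _ is_weak_div_unique[OF \<Omega> w c]]) (use c w in \<open>simp_all add: is_weak_div_def\<close>)
  then have "L2_norm \<Omega> (\<lambda>x. H x - \<eta> x) < \<epsilon>" "L2_norm \<Omega> (\<lambda>x. weak_div \<Omega> H x - divergence \<eta> x) < \<epsilon>"
    using le_less_trans[OF real_sqrt_sum_squares_ge1 less[unfolded D_norm_def]]
      le_less_trans[OF real_sqrt_sum_squares_ge2 less[unfolded D_norm_def]] by simp_all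
  with \<eta>1 show ?thesis by blast
qed

lemma L2_weakly_converges_cong_AE:
  assumes "L2_weakly_converges \<Omega> f g" "g' \<in> L2 \<Omega>" "AE x in lebesgue_on \<Omega>. g x = g' x"
  shows "L2_weakly_converges \<Omega> f g'"
proof -
  have g: "g \<in> L2 \<Omega>" using assms(1) by (simp add: L2_weakly_converges_def)
  have "L2_inner \<Omega> g h = L2_inner \<Omega> g' h" if "h \<in> L2 \<Omega>" for h
    using L2_inner_cong_AE[OF g assms(2) that assms(3)] .
  then show ?thesis using assms(1,2) by (simp add: L2_weakly_converges_def)
qed

lemma L2_inner_tendsto_0:
  assumes f: "\<And>n. f n \<in> L2 \<Omega>" "\<And>n. L2_norm \<Omega> (f n) \<le> M" and g: "\<And>n. g n \<in> L2 \<Omega>" "(\<lambda>n. L2_norm \<Omega> (g n)) \<longlonglongrightarrow> 0"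
  shows "(\<lambda>n. L2_inner \<Omega> (f n) (g n)) \<longlonglongrightarrow> 0"
proof (rule Lim_null_comparison)
  have "norm (L2_inner \<Omega> (f n) (g n)) \<le> M * L2_norm \<Omega> (g n)" for n
    unfolding real_norm_def
    by (rule order_trans[OF L2_Cauchy_Schwarz[OF f(1) g(1)] mult_right_mono[OF f(2) L2_norm_nonneg]])
  then show "\<forall>\<^sub>F n in sequentially. norm (L2_inner \<Omega> (f n) (g n)) \<le> M * L2_norm \<Omega> (g n)" by simp
  show "(\<lambda>n. M * L2_norm \<Omega> (g n)) \<longlonglongrightarrow> 0" using tendsto_mult_right_zero[OF g(2)] .
qed

lemma L2_weakly_converges_perturbation:
  assumes f: "L2_weakly_converges \<Omega> f f'" and g: "\<And>n. g n \<in> L2 \<Omega>" and diff: "(\<lambda>n. L2_norm \<Omega> (\<lambda>x. f n x - g n x)) \<longlonglongrightarrow> 0"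
  shows "L2_weakly_converges \<Omega> g f'"
proof -
  have fL: "\<And>n. f n \<in> L2 \<Omega>" and f'L: "f' \<in> L2 \<Omega>" using f by (simp_all add: L2_weakly_converges_def)
  have "(\<lambda>n. L2_inner \<Omega> (g n) h) \<longlonglongrightarrow> L2_inner \<Omega> f' h" if h: "h \<in> L2 \<Omega>" for h
  proof -
    have "(\<lambda>n. L2_inner \<Omega> h (\<lambda>x. f n x - g n x)) \<longlonglongrightarrow> 0"
      by (rule L2_inner_tendsto_0[OF h order_refl L2_diff[OF fL g] diff])
    then have "(\<lambda>n. L2_inner \<Omega> (f n) h - L2_inner \<Omega> (g n) h) \<longlonglongrightarrow> 0"
      by (simp add: L2_inner_commute[of \<Omega> h] L2_inner_diff_left[OF fL g h])
    moreover have "(\<lambda>n. L2_inner \<Omega> (f n) h) \<longlonglongrightarrow> L2_inner \<Omega> f' h"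
      using f h by (simp add: L2_weakly_converges_def)
    ultimately have "(\<lambda>n. L2_inner \<Omega> (f n) h - (L2_inner \<Omega> (f n) h - L2_inner \<Omega> (g n) h)) \<longlonglongrightarrow> L2_inner \<Omega> f' h - 0"
      by (intro tendsto_diff)
    then show ?thesis by simp
  qed
  then show ?thesis using g f'L by (simp add: L2_weakly_converges_def)
qed

lemma L2_norm_le_of_near:
  assumes "f \<in> L2 \<Omega>" "g \<in> L2 \<Omega>" "L2_norm \<Omega> f \<le> M" "L2_norm \<Omega> (\<lambda>x. f x - g x) < \<epsilon>" "\<epsilon> \<le> \<delta>"
  shows "L2_norm \<Omega> g \<le> M + \<delta>"
proof -
  have "L2_norm \<Omega> g \<le> L2_norm \<Omega> f + L2_norm \<Omega> (\<lambda>x. f x - g x)"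
    using L2_norm_triangle_diff[OF assms(1) L2_diff[OF assms(1,2)]] by simp
  then show ?thesis using assms(3-5) by linarith
qed

text \<open>Subsequences are extracted first for the fields, then for the curls. Testing with fixed
  smooth fields shows that the weak limit of the curls is a weak curl of the limit, and it is then
  exchanged for the representative \<open>weak_curl \<Omega> E'\<close>.\<close>

lemma R_space_weakly_compact:
  assumes \<Omega>: "open \<Omega>" "bounded \<Omega>" and E: "\<And>n. E n \<in> R_space \<Omega>"
    and M: "\<And>n. L2_norm \<Omega> (E n) \<le> M" "\<And>n. L2_norm \<Omega> (weak_curl \<Omega> (E n)) \<le> M"
  obtains r E' where "strict_mono (r :: nat \<Rightarrow> nat)" "E' \<in> R_space \<Omega>" "L2_weakly_converges \<Omega> (\<lambda>n. E (r n)) E'"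
    "L2_weakly_converges \<Omega> (\<lambda>n. weak_curl \<Omega> (E (r n))) (weak_curl \<Omega> E')"
proof -
  have meas: "\<Omega> \<in> lmeasurable" using \<Omega> by (rule open_bounded_lmeasurable)
  have c: "is_weak_curl \<Omega> (E n) (weak_curl \<Omega> (E n))" for n using is_weak_curl_weak_curl[OF E] .
  have L: "E n \<in> L2 \<Omega>" "weak_curl \<Omega> (E n) \<in> L2 \<Omega>" for n
    using E c by (simp_all add: R_space_def is_weak_curl_def)
  show ?thesis
  proof (rule L2_weakly_compact[OF meas L(1) M(1)])
    fix r1 E' assume r1: "strict_mono (r1 :: nat \<Rightarrow> nat)" and E': "L2_weakly_converges \<Omega> (\<lambda>n. E (r1 n)) E'"
    show ?thesis
    proof (rule L2_weakly_compact[OF meas L(2)[of "r1 _"] M(2)[of "r1 _"]])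
      fix r2 G assume r2: "strict_mono (r2 :: nat \<Rightarrow> nat)" and G: "L2_weakly_converges \<Omega> (\<lambda>n. weak_curl \<Omega> (E (r1 (r2 n)))) G"
      have conv: "L2_weakly_converges \<Omega> (\<lambda>n. E (r1 (r2 n))) E'"
        using L2_weakly_converges_subseq[OF E' r2] .
      have G': "is_weak_curl \<Omega> E' G" by (rule is_weak_curl_limit[OF \<Omega> conv G c])
      have R: "E' \<in> R_space \<Omega>" using E' G' unfolding R_space_def L2_weakly_converges_def by blast
      have w: "is_weak_curl \<Omega> E' (weak_curl \<Omega> E')" using is_weak_curl_weak_curl[OF R] .
      then have "weak_curl \<Omega> E' \<in> L2 \<Omega>" by (simp add: is_weak_curl_def)
      from L2_weakly_converges_cong_AE[OF G this is_weak_curl_unique[OF \<Omega> G' w]]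
      show ?thesis
        using that[of "r1 \<circ> r2", OF strict_mono_o[OF r1 r2] R] conv by simp
    qed
  qed
qed

lemma D_space_weakly_compact:
  assumes \<Omega>: "open \<Omega>" "bounded \<Omega>" and H: "\<And>n. H n \<in> D_space \<Omega>"
    and M: "\<And>n. L2_norm \<Omega> (H n) \<le> M" "\<And>n. L2_norm \<Omega> (weak_div \<Omega> (H n)) \<le> M"
  obtains r H' where "strict_mono (r :: nat \<Rightarrow> nat)" "H' \<in> D_space \<Omega>" "L2_weakly_converges \<Omega> (\<lambda>n. H (r n)) H'"
    "L2_weakly_converges \<Omega> (\<lambda>n. weak_div \<Omega> (H (r n))) (weak_div \<Omega> H')"
proof -
  have meas: "\<Omega> \<in> lmeasurable" using \<Omega> by (rule open_bounded_lmeasurable)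
  have c: "is_weak_div \<Omega> (H n) (weak_div \<Omega> (H n))" for n using is_weak_div_weak_div[OF H] .
  have L: "H n \<in> L2 \<Omega>" "weak_div \<Omega> (H n) \<in> L2 \<Omega>" for n
    using H c by (simp_all add: D_space_def is_weak_div_def)
  show ?thesis
  proof (rule L2_weakly_compact[OF meas L(1) M(1)])
    fix r1 H' assume r1: "strict_mono (r1 :: nat \<Rightarrow> nat)" and H': "L2_weakly_converges \<Omega> (\<lambda>n. H (r1 n)) H'"
    show ?thesis
    proof (rule L2_weakly_compact[OF meas L(2)[of "r1 _"] M(2)[of "r1 _"]])
      fix r2 g assume r2: "strict_mono (r2 :: nat \<Rightarrow> nat)" and g: "L2_weakly_converges \<Omega> (\<lambda>n. weak_div \<Omega> (H (r1 (r2 n)))) g"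
      have conv: "L2_weakly_converges \<Omega> (\<lambda>n. H (r1 (r2 n))) H'"
        using L2_weakly_converges_subseq[OF H' r2] .
      have g': "is_weak_div \<Omega> H' g" by (rule is_weak_div_limit[OF \<Omega> conv g c])
      have D: "H' \<in> D_space \<Omega>" using H' g' unfolding D_space_def L2_weakly_converges_def by blast
      have w: "is_weak_div \<Omega> H' (weak_div \<Omega> H')" using is_weak_div_weak_div[OF D] .
      then have "weak_div \<Omega> H' \<in> L2 \<Omega>" by (simp add: is_weak_div_def)
      from L2_weakly_converges_cong_AE[OF g this is_weak_div_unique[OF \<Omega> g' w]]
      show ?thesis
        using that[of "r1 \<circ> r2", OF strict_mono_o[OF r1 r2] D] conv by simp
    qed
  qed
qed

text \<open>As the estimate is uniform in the test field, \<open>m\<close> can tend to infinity in \<open>L2_inner \<Omega> (\<phi> m) (\<eta> n)\<close>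
  before \<open>n\<close> does.\<close>

lemma div_curl_smooth:
  assumes \<Omega>: "weak_lipschitz_domain \<Omega>" and part: "weak_lipschitz_part (frontier \<Omega>) \<Gamma>t"
    and \<phi>: "\<And>n. \<phi> n \<in> C1_away \<Gamma>t" "L2_weakly_converges \<Omega> \<phi> E"
    and \<eta>: "\<And>n. \<eta> n \<in> C1_away (frontier \<Omega> - closure \<Gamma>t)" "L2_weakly_converges \<Omega> \<eta> H"
    and C: "\<And>n. L2_norm \<Omega> (\<phi> n) \<le> C" "\<And>n. L2_norm \<Omega> (curl (\<phi> n)) \<le> C"
    and D: "\<And>n. L2_norm \<Omega> (\<eta> n) \<le> D" "\<And>n. L2_norm \<Omega> (divergence (\<eta> n)) \<le> D"
  shows "(\<lambda>n. L2_inner \<Omega> (\<phi> n) (\<eta> n)) \<longlonglongrightarrow> L2_inner \<Omega> E H"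
proof -
  have D0: "0 \<le> D" using D(1)[of 0] L2_norm_nonneg[of \<Omega> "\<eta> 0"] by linarith
  have L: "\<phi> n \<in> L2 \<Omega>" "\<eta> n \<in> L2 \<Omega>" "E \<in> L2 \<Omega>" for n
    using \<phi>(2) \<eta>(2) by (simp_all add: L2_weakly_converges_def)
  have "(\<lambda>n. L2_inner \<Omega> (\<phi> n) (\<eta> n) - L2_inner \<Omega> E (\<eta> n)) \<longlonglongrightarrow> 0"
  proof (rule LIMSEQ_I)
    fix \<epsilon> :: real assume \<epsilon>: "0 < \<epsilon>"
    \<comment> \<open>The two norms of the test field add up to at most \<open>2 * D\<close>; adding
      1 covers \<open>D = 0\<close> and makes the final inequality strict.\<close>
    define \<tau> where "\<tau> = \<epsilon> / (2 * (D + 1))"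
    have \<tau>: "0 < \<tau>" using \<epsilon> D0 by (simp add: \<tau>_def)
    have \<tau>_less: "\<tau> * (2 * D) < \<epsilon>"
    proof -
      have "\<tau> * (2 * D) < \<tau> * (2 * (D + 1))" using \<tau> by simp
      also have "\<dots> = \<epsilon>" using D0 unfolding \<tau>_def by (intro nonzero_eq_divide_eq[THEN iffD1] refl) simp
      finally show ?thesis .
    qed
    obtain n0 where n0: "\<forall>n\<ge>n0. \<forall>m\<ge>n0. \<forall>h\<in>C1_away (frontier \<Omega> - closure \<Gamma>t).
      \<bar>L2_inner \<Omega> (\<lambda>x. \<phi> n x - \<phi> m x) h\<bar> \<le> \<tau> * (L2_norm \<Omega> h + L2_norm \<Omega> (divergence h))"
      using global_compactness[OF \<Omega> part \<phi> C \<tau>] by (elim exE) (rule that)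
    have "norm (L2_inner \<Omega> (\<phi> n) (\<eta> n) - L2_inner \<Omega> E (\<eta> n) - 0) < \<epsilon>" if n: "n0 \<le> n" for n
    proof -
      have "(\<lambda>m. \<bar>L2_inner \<Omega> (\<phi> n) (\<eta> n) - L2_inner \<Omega> (\<phi> m) (\<eta> n)\<bar>) \<longlonglongrightarrow> \<bar>L2_inner \<Omega> (\<phi> n) (\<eta> n) - L2_inner \<Omega> E (\<eta> n)\<bar>"
        using \<phi>(2) L(2) by (intro tendsto_rabs tendsto_diff tendsto_const) (simp add: L2_weakly_converges_def)
      moreover have "\<bar>L2_inner \<Omega> (\<phi> n) (\<eta> n) - L2_inner \<Omega> (\<phi> m) (\<eta> n)\<bar> \<le> \<tau> * (2 * D)" if m: "n0 \<le> m" for m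
      proof -
        have "\<bar>L2_inner \<Omega> (\<phi> n) (\<eta> n) - L2_inner \<Omega> (\<phi> m) (\<eta> n)\<bar> = \<bar>L2_inner \<Omega> (\<lambda>x. \<phi> n x - \<phi> m x) (\<eta> n)\<bar>"
          using L2_inner_diff_left[OF L(1) L(1) L(2), of n m n] by simp
        also have "\<dots> \<le> \<tau> * (L2_norm \<Omega> (\<eta> n) + L2_norm \<Omega> (divergence (\<eta> n)))"
          by (rule n0[rule_format, OF n m \<eta>(1)])
        also have "\<dots> \<le> \<tau> * (2 * D)"
          using add_mono[OF D(1) D(2), of n n] \<tau> by (intro mult_left_mono) simp_all
        finally show ?thesis .
      qed
      ultimately have "\<bar>L2_inner \<Omega> (\<phi> n) (\<eta> n) - L2_inner \<Omega> E (\<eta> n)\<bar> \<le> \<tau> * (2 * D)"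
        by (intro LIMSEQ_le_const2) blast+
      then show ?thesis using \<tau>_less by simp
    qed
    then show "\<exists>no. \<forall>n\<ge>no. norm (L2_inner \<Omega> (\<phi> n) (\<eta> n) - L2_inner \<Omega> E (\<eta> n) - 0) < \<epsilon>" by blast
  qed
  moreover have "(\<lambda>n. L2_inner \<Omega> E (\<eta> n)) \<longlonglongrightarrow> L2_inner \<Omega> E H"
    using \<eta>(2) L(3) unfolding L2_weakly_converges_def L2_inner_commute[of \<Omega> E] by blast
  ultimately have "(\<lambda>n. L2_inner \<Omega> (\<phi> n) (\<eta> n) - L2_inner \<Omega> E (\<eta> n) + L2_inner \<Omega> E (\<eta> n)) \<longlonglongrightarrow> 0 + L2_inner \<Omega> E H"
    by (rule tendsto_add)
  then show ?thesis by simp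
qed

lemma bounded_range_le: "bounded (range f) \<Longrightarrow> \<exists>M. \<forall>n. f n \<le> M" for f :: "nat \<Rightarrow> real"
  unfolding bounded_iff by (metis abs_le_D1 rangeI real_norm_def)

theorem theorem2:
  fixes \<Omega> \<Gamma> \<Gamma>t \<Gamma>n :: "(real ^ 3) set"
    and E H :: "nat \<Rightarrow> real ^ 3 \<Rightarrow> real ^ 3"
  assumes "weak_lipschitz_domain \<Omega>"
    and "\<Gamma> = frontier \<Omega>"
    and "weak_lipschitz_part \<Gamma> \<Gamma>t"
    and "\<Gamma>n = \<Gamma> - closure \<Gamma>t"
    and "\<And>n. E n \<in> R_bd \<Omega> \<Gamma>t"
    and "\<And>n. H n \<in> D_bd \<Omega> \<Gamma>n"
    and "bounded (range (\<lambda>n. L2_norm \<Omega> (E n)))"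
    and "bounded (range (\<lambda>n. L2_norm \<Omega> (H n)))"
    and "bounded (range (\<lambda>n. L2_norm \<Omega> (weak_curl \<Omega> (E n))))"
    and "bounded (range (\<lambda>n. L2_norm \<Omega> (weak_div \<Omega> (H n))))"
  shows "\<exists>E' H' r. strict_mono (r :: nat \<Rightarrow> nat) \<and>
           E' \<in> R_space \<Omega> \<and> H' \<in> D_space \<Omega> \<and>
           L2_weakly_converges \<Omega> (\<lambda>n. E (r n)) E' \<and>
           L2_weakly_converges \<Omega> (\<lambda>n. weak_curl \<Omega> (E (r n))) (weak_curl \<Omega> E') \<and>
           L2_weakly_converges \<Omega> (\<lambda>n. H (r n)) H' \<and>
           L2_weakly_converges \<Omega> (\<lambda>n. weak_div \<Omega> (H (r n))) (weak_div \<Omega> H') \<and>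
           (\<lambda>n. LINT x|lebesgue_on \<Omega>. E (r n) x \<bullet> H (r n) x)
             \<longlonglongrightarrow> (LINT x|lebesgue_on \<Omega>. E' x \<bullet> H' x)"
proof -
  have \<Omega>: "open \<Omega>" "bounded \<Omega>" using assms(1) by (auto simp: weak_lipschitz_domain_def bounded_domain_def)
  have part: "weak_lipschitz_part (frontier \<Omega>) \<Gamma>t" and \<Gamma>n: "\<Gamma>n = frontier \<Omega> - closure \<Gamma>t" using assms(2-4) by auto
  have RD: "E n \<in> R_space \<Omega>" "H n \<in> D_space \<Omega>" for n using assms(5,6) by (simp_all add: R_bd_def D_bd_def)
  obtain M1 where M1: "\<And>n. L2_norm \<Omega> (E n) \<le> M1" using bounded_range_le[OF assms(7)] by blast
  obtain M2 where M2: "\<And>n. L2_norm \<Omega> (H n) \<le> M2" using bounded_range_le[OF assms(8)] by blast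
  obtain M3 where M3: "\<And>n. L2_norm \<Omega> (weak_curl \<Omega> (E n)) \<le> M3" using bounded_range_le[OF assms(9)] by blast
  obtain M4 where M4: "\<And>n. L2_norm \<Omega> (weak_div \<Omega> (H n)) \<le> M4" using bounded_range_le[OF assms(10)] by blast
  define M where "M = max (max M1 M2) (max M3 M4)"
  have M: "L2_norm \<Omega> (E n) \<le> M" "L2_norm \<Omega> (H n) \<le> M" "L2_norm \<Omega> (weak_curl \<Omega> (E n)) \<le> M" "L2_norm \<Omega> (weak_div \<Omega> (H n)) \<le> M" for n
    using M1[of n] M2[of n] M3[of n] M4[of n] unfolding M_def by linarith+
  \<comment> \<open>The approximation improves with \<open>n\<close>, so the approximating fields
    have the same weak limits; the errors never exceed 1, hence the common bound
    \<open>M + 1\<close>.\<close>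
  let ?\<epsilon> = "\<lambda>n. inverse (real (Suc n))"
  have "\<exists>\<phi>. \<forall>n. \<phi> n \<in> C1_away \<Gamma>t \<and> L2_norm \<Omega> (\<lambda>x. E n x - \<phi> n x) < ?\<epsilon> n \<and> L2_norm \<Omega> (\<lambda>x. weak_curl \<Omega> (E n) x - curl (\<phi> n) x) < ?\<epsilon> n"
    using R_bd_approximation[OF \<Omega> assms(5), of "?\<epsilon> _"] by (intro choice allI) auto
  then obtain \<phi> where \<phi>: "\<And>n. \<phi> n \<in> C1_away \<Gamma>t" "\<And>n. L2_norm \<Omega> (\<lambda>x. E n x - \<phi> n x) < ?\<epsilon> n"
    "\<And>n. L2_norm \<Omega> (\<lambda>x. weak_curl \<Omega> (E n) x - curl (\<phi> n) x) < ?\<epsilon> n" by blast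
  have "\<exists>\<eta>. \<forall>n. \<eta> n \<in> C1_away \<Gamma>n \<and> L2_norm \<Omega> (\<lambda>x. H n x - \<eta> n x) < ?\<epsilon> n \<and> L2_norm \<Omega> (\<lambda>x. weak_div \<Omega> (H n) x - divergence (\<eta> n) x) < ?\<epsilon> n"
    using D_bd_approximation[OF \<Omega> assms(6), of "?\<epsilon> _"] by (intro choice allI) auto
  then obtain \<eta> where \<eta>: "\<And>n. \<eta> n \<in> C1_away \<Gamma>n" "\<And>n. L2_norm \<Omega> (\<lambda>x. H n x - \<eta> n x) < ?\<epsilon> n"
    "\<And>n. L2_norm \<Omega> (\<lambda>x. weak_div \<Omega> (H n) x - divergence (\<eta> n) x) < ?\<epsilon> n" by blast
  have L: "E n \<in> L2 \<Omega>" "H n \<in> L2 \<Omega>" "weak_curl \<Omega> (E n) \<in> L2 \<Omega>" "weak_div \<Omega> (H n) \<in> L2 \<Omega>" for n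
    using RD[of n] is_weak_curl_weak_curl[OF RD(1)] is_weak_div_weak_div[OF RD(2)]
    by (simp_all add: R_space_def D_space_def is_weak_curl_def is_weak_div_def)
  have \<phi>L: "\<phi> n \<in> L2 \<Omega>" "curl (\<phi> n) \<in> L2 \<Omega>" and \<eta>L: "\<eta> n \<in> L2 \<Omega>" "divergence (\<eta> n) \<in> L2 \<Omega>" for n
    using C1_away_L2[OF \<Omega> \<phi>(1)] C1_away_L2[OF \<Omega> \<eta>(1)] by blast+
  have e: "?\<epsilon> n \<le> 1" for n by (simp add: inverse_le_1_iff)
  have bound: "L2_norm \<Omega> (\<phi> n) \<le> M + 1" "L2_norm \<Omega> (curl (\<phi> n)) \<le> M + 1"
    "L2_norm \<Omega> (\<eta> n) \<le> M + 1" for n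
    using L2_norm_le_of_near[OF L(1) \<phi>L(1) M(1) \<phi>(2) e] L2_norm_le_of_near[OF L(3) \<phi>L(2) M(3) \<phi>(3) e] L2_norm_le_of_near[OF L(2) \<eta>L(1) M(2) \<eta>(2) e] by blast+
  have bound_div: "L2_norm \<Omega> (divergence (\<eta> n)) \<le> M + 1" for n
    using L2_norm_le_of_near[OF L(4) \<eta>L(2) M(4) \<eta>(3) e] .
  have \<phi>_lim: "(\<lambda>n. L2_norm \<Omega> (\<lambda>x. E n x - \<phi> n x)) \<longlonglongrightarrow> 0"
    by (rule tendsto_sandwich[OF always_eventually always_eventually tendsto_const LIMSEQ_inverse_real_of_nat])
      (intro allI L2_norm_nonneg less_imp_le \<phi>(2))+
  have \<eta>_lim: "(\<lambda>n. L2_norm \<Omega> (\<lambda>x. H n x - \<eta> n x)) \<longlonglongrightarrow> 0"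
    by (rule tendsto_sandwich[OF always_eventually always_eventually tendsto_const LIMSEQ_inverse_real_of_nat])
      (intro allI L2_norm_nonneg less_imp_le \<eta>(2))+
  show ?thesis
  proof (rule R_space_weakly_compact[OF \<Omega> RD(1) M(1,3)])
    fix r1 E' assume r1: "strict_mono (r1 :: nat \<Rightarrow> nat)" and E': "E' \<in> R_space \<Omega>" "L2_weakly_converges \<Omega> (\<lambda>n. E (r1 n)) E'"
      "L2_weakly_converges \<Omega> (\<lambda>n. weak_curl \<Omega> (E (r1 n))) (weak_curl \<Omega> E')"
    show ?thesis
    proof (rule D_space_weakly_compact[OF \<Omega> RD(2)[of "r1 _"] M(2)[of "r1 _"] M(4)[of "r1 _"]])
      fix r2 H' assume r2: "strict_mono (r2 :: nat \<Rightarrow> nat)" and H': "H' \<in> D_space \<Omega>" "L2_weakly_converges \<Omega> (\<lambda>n. H (r1 (r2 n))) H'"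
        "L2_weakly_converges \<Omega> (\<lambda>n. weak_div \<Omega> (H (r1 (r2 n)))) (weak_div \<Omega> H')"
      define r where "r n = r1 (r2 n)" for n
      have r: "strict_mono r" using strict_mono_o[OF r1 r2] by (simp add: r_def[abs_def] o_def)
      have E_r: "L2_weakly_converges \<Omega> (\<lambda>n. E (r n)) E'" "L2_weakly_converges \<Omega> (\<lambda>n. weak_curl \<Omega> (E (r n))) (weak_curl \<Omega> E')"
        using L2_weakly_converges_subseq[OF E'(2) r2] L2_weakly_converges_subseq[OF E'(3) r2] by (simp_all add: r_def)
      have H_r: "L2_weakly_converges \<Omega> (\<lambda>n. H (r n)) H'" "L2_weakly_converges \<Omega> (\<lambda>n. weak_div \<Omega> (H (r n))) (weak_div \<Omega> H')"
        using H' by (simp_all add: r_def)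
      have \<phi>_r: "(\<lambda>n. L2_norm \<Omega> (\<lambda>x. E (r n) x - \<phi> (r n) x)) \<longlonglongrightarrow> 0"
        and \<eta>_r: "(\<lambda>n. L2_norm \<Omega> (\<lambda>x. H (r n) x - \<eta> (r n) x)) \<longlonglongrightarrow> 0"
        using LIMSEQ_subseq_LIMSEQ[OF \<phi>_lim r] LIMSEQ_subseq_LIMSEQ[OF \<eta>_lim r] by (simp_all add: o_def)
      have smooth: "(\<lambda>n. L2_inner \<Omega> (\<phi> (r n)) (\<eta> (r n))) \<longlonglongrightarrow> L2_inner \<Omega> E' H'"
        by (rule div_curl_smooth[OF assms(1) part \<phi>(1) L2_weakly_converges_perturbation[OF E_r(1) \<phi>L(1) \<phi>_r]
          \<eta>(1)[unfolded \<Gamma>n] L2_weakly_converges_perturbation[OF H_r(1) \<eta>L(1) \<eta>_r] bound(1,2,3) bound_div])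
      have 1: "(\<lambda>n. L2_inner \<Omega> (H (r n)) (\<lambda>x. E (r n) x - \<phi> (r n) x)) \<longlonglongrightarrow> 0"
        by (rule L2_inner_tendsto_0[OF L(2) M(2) L2_diff[OF L(1) \<phi>L(1)] \<phi>_r])
      have 2: "(\<lambda>n. L2_inner \<Omega> (\<phi> (r n)) (\<lambda>x. H (r n) x - \<eta> (r n) x)) \<longlonglongrightarrow> 0"
        by (rule L2_inner_tendsto_0[OF \<phi>L(1) bound(1) L2_diff[OF L(2) \<eta>L(1)] \<eta>_r])
      \<comment> \<open>The two error terms pair a bounded sequence with one that tends to 0 in
        norm; the last term is the smooth case.\<close>
      have split: "L2_inner \<Omega> (H n) (\<lambda>x. E n x - \<phi> n x) + L2_inner \<Omega> (\<phi> n) (\<lambda>x. H n x - \<eta> n x) + L2_inner \<Omega> (\<phi> n) (\<eta> n)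
        = L2_inner \<Omega> (E n) (H n)" for n
        using L2_inner_diff_right[OF L(1) \<phi>L(1) L(2), of n n n] L2_inner_diff_right[OF L(2) \<eta>L(1) \<phi>L(1), of n n n]
        by (simp add: L2_inner_commute[of \<Omega> "H n"])
      have "(\<lambda>n. L2_inner \<Omega> (E (r n)) (H (r n))) \<longlonglongrightarrow> L2_inner \<Omega> E' H'"
        using tendsto_add[OF tendsto_add[OF 1 2] smooth] by (simp add: split)
      then show ?thesis
        using r E'(1) H'(1) E_r H_r unfolding L2_inner_def
        by (intro exI[of _ E'] exI[of _ H'] exI[of _ r] conjI)
    qed
  qed
qed

end
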